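(* There is a randomized one-sided-error Monte Carlo algorithm that, given a directed graph $G=(V,E,c,t)$ with $n$ vertices and $m$ edges in which every edge $e$ has a real cost $c(e)$ and a real transit time $t(e)$, computes a minimum ratio cycle of $G$ with running time $O(n^{3/2} m^{3/4} \log^2 n)$.
   Context: A minimum ratio (minimum cost-to-time ratio) cycle of $G$ is a directed cycle $C$ minimizing $\sum_{e\in C} c(e) / \sum_{e\in C} t(e)$. Running time is measured in the strongly polynomial sense: the number of arithmetic operations and comparisons on the real input values, independent of their encoding size.
   Formalization: It is assumed that every directed cycle has positive total transit time; for arbitrary real transit times the ratio is undefined on cycles of total time zero, and with totals of mixed sign the problem is NP-hard. *)

theory Defs
  imports
    "Graph_Theory.Graph_Theory"
    "HOL-Probability.Probability_Mass_Function"
    "HOL-Analysis.Analysis"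
begin

section \<open>Minimum ratio cycles\<close>

text \<open>
  A cycle is a nonempty closed arc walk without repeated vertices, as in \<^theory>\<open>Graph_Theory.Arc_Walk\<close>;
  it is given by its list of arcs, and a self-loop is a cycle of length one.
\<close>

definition cycle_ratio :: "('e \<Rightarrow> real) \<Rightarrow> ('e \<Rightarrow> real) \<Rightarrow> 'e list \<Rightarrow> real" where
  "cycle_ratio c t p = (\<Sum>e\<leftarrow>p. c e) / (\<Sum>e\<leftarrow>p. t e)"

definition min_ratio_cycle ::
  "('v, 'e) pre_digraph \<Rightarrow> ('e \<Rightarrow> real) \<Rightarrow> ('e \<Rightarrow> real) \<Rightarrow> 'e list \<Rightarrow> bool" where
  "min_ratio_cycle G c t p \<longleftrightarrow>
     pre_digraph.cycle G p \<and>
     (\<forall>q. pre_digraph.cycle G q \<longrightarrow> cycle_ratio c t p \<le> cycle_ratio c t q)"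


section \<open>A randomized real RAM\<close>

text \<open>
  The machine has two sorts of data, words and reals, each with a register file and a randomly
  accessible memory that is addressed by words. Every instruction costs one time step. Words are
  natural numbers modulo a number \<open>W\<close> that will be polynomial in the size of the input, so
  that words have logarithmically many bits and word arithmetic cannot be used to compute with huge
  integers at unit cost. Reals are exact; they can only be combined by field operations and
  compared. There are no real constants other than converted words, and no rounding.
\<close>

datatype aop = Add | Sub | Mul | Div

datatype instr =
    WConst nat nat
  | WOp aop nat nat nat
  | WLoad nat nat
  | WStore nat nat
  | WRandom nat nat
  | ROfWord nat nat
  | ROp aop nat nat nat
  | RLoad nat nat
  | RStore nat nat
  | Jump nat
  | JumpWLess nat nat nat
  | JumpRLess nat nat nat

type_synonym program = "instr list"

record config =
  pc :: nat
  wreg :: "nat \<Rightarrow> nat"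
  rreg :: "nat \<Rightarrow> real"
  wmem :: "nat \<Rightarrow> nat"
  rmem :: "nat \<Rightarrow> real"

text \<open>Subtraction of words is truncated at zero, and division by zero yields zero.\<close>

fun word_aop :: "nat \<Rightarrow> aop \<Rightarrow> nat \<Rightarrow> nat \<Rightarrow> nat" where
  "word_aop W Add x y = (x + y) mod W"
| "word_aop W Sub x y = (x - y) mod W"
| "word_aop W Mul x y = (x * y) mod W"
| "word_aop W Div x y = (x div y) mod W"

fun real_aop :: "aop \<Rightarrow> real \<Rightarrow> real \<Rightarrow> real" where
  "real_aop Add x y = x + y"
| "real_aop Sub x y = x - y"
| "real_aop Mul x y = x * y"
| "real_aop Div x y = x / y"

abbreviation next_pc :: "config \<Rightarrow> config" where
  "next_pc s \<equiv> s\<lparr>pc := Suc (pc s)\<rparr>"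

text \<open>
  The only randomized instruction is \<open>WRandom i j\<close>, which draws a uniformly distributed word
  between zero and the contents of register \<open>j\<close>, inclusive.
\<close>

fun exec_instr :: "nat \<Rightarrow> instr \<Rightarrow> config \<Rightarrow> config pmf" where
  "exec_instr W (WConst i a) s =
     return_pmf (next_pc (s\<lparr>wreg := (wreg s)(i := a mod W)\<rparr>))"
| "exec_instr W (WOp f i j k) s =
     return_pmf (next_pc (s\<lparr>wreg := (wreg s)(i := word_aop W f (wreg s j) (wreg s k))\<rparr>))"
| "exec_instr W (WLoad i j) s =
     return_pmf (next_pc (s\<lparr>wreg := (wreg s)(i := wmem s (wreg s j))\<rparr>))"
| "exec_instr W (WStore i j) s =
     return_pmf (next_pc (s\<lparr>wmem := (wmem s)(wreg s i := wreg s j)\<rparr>))"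
| "exec_instr W (WRandom i j) s =
     map_pmf (\<lambda>x. next_pc (s\<lparr>wreg := (wreg s)(i := x)\<rparr>)) (pmf_of_set {..wreg s j})"
| "exec_instr W (ROfWord i j) s =
     return_pmf (next_pc (s\<lparr>rreg := (rreg s)(i := real (wreg s j))\<rparr>))"
| "exec_instr W (ROp f i j k) s =
     return_pmf (next_pc (s\<lparr>rreg := (rreg s)(i := real_aop f (rreg s j) (rreg s k))\<rparr>))"
| "exec_instr W (RLoad i j) s =
     return_pmf (next_pc (s\<lparr>rreg := (rreg s)(i := rmem s (wreg s j))\<rparr>))"
| "exec_instr W (RStore i j) s =
     return_pmf (next_pc (s\<lparr>rmem := (rmem s)(wreg s i := rreg s j)\<rparr>))"
| "exec_instr W (Jump l) s =
     return_pmf (s\<lparr>pc := l\<rparr>)"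
| "exec_instr W (JumpWLess i j l) s =
     return_pmf (if wreg s i < wreg s j then s\<lparr>pc := l\<rparr> else next_pc s)"
| "exec_instr W (JumpRLess i j l) s =
     return_pmf (if rreg s i < rreg s j then s\<lparr>pc := l\<rparr> else next_pc s)"

definition halted :: "program \<Rightarrow> config \<Rightarrow> bool" where
  "halted P s \<longleftrightarrow> length P \<le> pc s"

definition step :: "nat \<Rightarrow> program \<Rightarrow> config \<Rightarrow> config pmf" where
  "step W P s = (if halted P s then return_pmf s else exec_instr W (P ! pc s) s)"

text \<open>The distribution of the configuration after a given number of time steps.\<close>

primrec run :: "nat \<Rightarrow> program \<Rightarrow> nat \<Rightarrow> config \<Rightarrow> config pmf" where
  "run W P 0 s = return_pmf s"
| "run W P (Suc T) s = bind_pmf (step W P s) (run W P T)"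


section \<open>Solving the minimum ratio cycle problem\<close>

text \<open>
  An input is a finite directed graph without parallel arcs whose vertices and arcs are numbered
  consecutively from zero. Initially word registers 0 and 1 contain the numbers of vertices and arcs,
  the word memory contains the tails and heads of the arcs, and the real memory contains their
  costs and transit times. Everything else is zero.
\<close>

definition numbered_digraph :: "nat \<Rightarrow> nat \<Rightarrow> (nat, nat) pre_digraph \<Rightarrow> bool" where
  "numbered_digraph n m G \<longleftrightarrow> nomulti_digraph G \<and> verts G = {..<n} \<and> arcs G = {..<m}"

definition initial ::
  "nat \<Rightarrow> nat \<Rightarrow> (nat, nat) pre_digraph \<Rightarrow> (nat \<Rightarrow> real) \<Rightarrow> (nat \<Rightarrow> real) \<Rightarrow> config" where
  "initial n m G c t = \<lparr>
     pc = 0,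
     wreg = (\<lambda>_. 0)(0 := n, 1 := m),
     rreg = (\<lambda>_. 0),
     wmem = (\<lambda>a. if a < 2 * m then (if even a then tail G (a div 2) else head G (a div 2)) else 0),
     rmem = (\<lambda>a. if a < 2 * m then (if even a then c (a div 2) else t (a div 2)) else 0)\<rparr>"

text \<open>
  The output is a list of arcs, with its length in word register 0 and its entries at the beginning
  of the word memory. The empty list, which is not a cycle, means that the graph has no cycle.
\<close>

definition result :: "config \<Rightarrow> nat list" where
  "result s = map (wmem s) [0..<wreg s 0]"

text \<open>
  On a given input, \<open>P\<close> is a one-sided-error Monte Carlo algorithm with running time at
  most \<open>T\<close>: whatever the random choices, it halts within \<open>T\<close> steps and outputs
  a cycle if there is one (so the ratio of the output is never below the optimum) and the empty list
  otherwise; with probability at least 1/2 an output cycle has minimum ratio.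
\<close>

definition solves_min_ratio_cycle_within ::
  "nat \<Rightarrow> program \<Rightarrow> nat \<Rightarrow> nat \<Rightarrow> nat \<Rightarrow> (nat, nat) pre_digraph
     \<Rightarrow> (nat \<Rightarrow> real) \<Rightarrow> (nat \<Rightarrow> real) \<Rightarrow> bool" where
  "solves_min_ratio_cycle_within W P T n m G c t \<longleftrightarrow>
     (let D = run W P T (initial n m G c t) in
       (\<forall>s \<in> set_pmf D. halted P s) \<and>
       (if \<exists>q. pre_digraph.cycle G q
        then (\<forall>s \<in> set_pmf D. pre_digraph.cycle G (result s)) \<and>
             measure_pmf.prob D {s. min_ratio_cycle G c t (result s)} \<ge> 1 / 2
        else (\<forall>s \<in> set_pmf D. result s = [])))"

end

(*
  Let lam be the minimum ratio and consider the weights c - lam t, for which no cycle is negative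
  and exactly the optimal cycles have weight zero. For a given x, Bellman-Ford with c - x t
  decides in time O(n m) whether lam < x; this is the only access to lam.

  Shortest walks for c - lam t are computed without knowing lam: a candidate walk with cost a and
  time b is the line x |-> a - x b, and which of two lines is smaller at lam depends only on the
  side of lam on which they cross. Candidates for the same table entry are paired, and one
  Bellman-Ford run at the median crossing point of all pairs, over all entries together, eliminates
  half of the pairs. A logarithmic number of passes leaves one candidate per entry, and as the number
  of candidates decays geometrically, sorting the crossing points is affordable.

  The first phase computes in h rounds the shortest walks with at most h arcs between all pairs of
  vertices, in time about h n m. The second one extends them by repeated squaring to long walks that
  visit a random sample of about (n/h) log n vertices, in time about ((n/h) log n)^3. With
  probability at least 1/2 the sample meets every h consecutive arcs of a fixed optimal cycle,
  and then the best ratio on the diagonal of the table is lam. The choice h^4 m = n^2 log^4 n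
  balances both phases.

  The table only contains real walks, so the best ratio x is never below lam. If x = lam, every arc
  of an optimal cycle is tight for the Bellman-Ford potentials and every cycle of tight arcs is
  optimal. Otherwise, which Bellman-Ford notices, any cycle is output.
*)
theory Submission
  imports Defs "HOL-Probability.Product_PMF"
begin

section \<open>A structured language and its compiler\<close>

text \<open>Logarithms accumulate in two places. Resolving the candidates of one table update takes
  a logarithmic number of Bellman-Ford runs, which is one factor. Sorting adds no further one: a
  pass with p pairs drops at least p/2 candidates, so all its sorts together cost no more than one
  sort of the initial list, up to a constant. The second factor is the number of squarings in the
  second phase and the log n inside h in the first one. This surplus in h pays for the oversampling:
  with u = n^(1/2) / m^(1/4) and v = n / u, h is about u log n, and (n/h) log n samples are only
  about v many. As u n m = v^3, both phases cost n^(3/2) m^(3/4) log^2 n. Words must not overflow,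
  and the time bound must hold for all random choices. So all randomness sits in one loop that draws
  the sample before the tables are filled, in a time that does not depend on the drawn values.
  Everything else is deterministic, written in a structured language with an exact clock, and padded
  to a common time by idling in the halted state.\<close>

datatype wexp = WV nat | WC nat | WB aop wexp wexp | WL nat wexp
datatype rexp = RV nat | RW wexp | RB aop rexp rexp | RL nat wexp
datatype bexp = WLess wexp wexp | RLess rexp rexp

datatype cmd =
    SKIP
  | WSet nat wexp
  | RSet nat rexp
  | WSt nat wexp wexp
  | RSt nat wexp rexp
  | Seq cmd cmd (infixr ";;" 61)
  | If bexp cmd cmd
  | While bexp cmd

record st =
  wv :: "nat \<Rightarrow> nat"
  rv :: "nat \<Rightarrow> real"
  wa :: "nat \<Rightarrow> nat \<Rightarrow> nat"
  ra :: "nat \<Rightarrow> nat \<Rightarrow> real"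
  clk :: nat

fun nat_aop :: "aop \<Rightarrow> nat \<Rightarrow> nat \<Rightarrow> nat" where
  "nat_aop Add x y = x + y"
| "nat_aop Sub x y = x - y"
| "nat_aop Mul x y = x * y"
| "nat_aop Div x y = x div y"

primrec evW :: "st \<Rightarrow> wexp \<Rightarrow> nat" where
  "evW s (WV i) = wv s i"
| "evW s (WC a) = a"
| "evW s (WB f a b) = nat_aop f (evW s a) (evW s b)"
| "evW s (WL a e) = wa s a (evW s e)"

primrec evR :: "st \<Rightarrow> rexp \<Rightarrow> real" where
  "evR s (RV i) = rv s i"
| "evR s (RW e) = real (evW s e)"
| "evR s (RB f a b) = real_aop f (evR s a) (evR s b)"
| "evR s (RL a e) = ra s a (evW s e)"

primrec evB :: "st \<Rightarrow> bexp \<Rightarrow> bool" where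
  "evB s (WLess a b) = (evW s a < evW s b)"
| "evB s (RLess a b) = (evR s a < evR s b)"

text \<open>
  There are 32 arrays, interleaved in memory behind the input, whose \<open>off\<close> cells
  form array number 32. Programs that make a word overflow have no semantics.
\<close>

locale ram =
  fixes W off IM :: nat
  assumes fits: "off + 32 * IM + 32 \<le> W"
begin

definition okA :: "nat \<Rightarrow> nat \<Rightarrow> bool" where
  "okA a i \<longleftrightarrow> (if a < 32 then i < IM else a = 32 \<and> i < off)"

text \<open>Truncated subtraction and division never exceed their first operand, so only sums and
  products can overflow.\<close>

primrec okW :: "st \<Rightarrow> wexp \<Rightarrow> bool" where
  "okW s (WV i) = True"
| "okW s (WC a) = (a < W)"
| "okW s (WB f a b) = (okW s a \<and> okW s b \<and> (f = Add \<or> f = Mul \<longrightarrow> nat_aop f (evW s a) (evW s b) < W))"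
| "okW s (WL a e) = (okW s e \<and> okA a (evW s e))"

primrec okR :: "st \<Rightarrow> rexp \<Rightarrow> bool" where
  "okR s (RV i) = True"
| "okR s (RW e) = okW s e"
| "okR s (RB f a b) = (okR s a \<and> okR s b)"
| "okR s (RL a e) = (okW s e \<and> okA a (evW s e))"

primrec okB :: "st \<Rightarrow> bexp \<Rightarrow> bool" where
  "okB s (WLess a b) = (okW s a \<and> okW s b)"
| "okB s (RLess a b) = (okR s a \<and> okR s b)"

end

text \<open>Five instructions turn a cell number into an address. Interleaving the arrays lets them
  use only the constant 32 and \<open>off\<close>, so the program never has to know the array length
  \<open>IM\<close>.\<close>

abbreviation costA :: "nat \<Rightarrow> nat" where "costA a \<equiv> if a < 32 then 5 else 0"

primrec costW :: "wexp \<Rightarrow> nat" where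
  "costW (WV i) = 2"
| "costW (WC a) = 1"
| "costW (WB f a b) = costW a + costW b + 1"
| "costW (WL a e) = costW e + costA a + 1"

primrec costR :: "rexp \<Rightarrow> nat" where
  "costR (RV i) = 3"
| "costR (RW e) = costW e + 1"
| "costR (RB f a b) = costR a + costR b + 1"
| "costR (RL a e) = costW e + costA a + 1"

primrec costB :: "bexp \<Rightarrow> nat" where
  "costB (WLess a b) = costW a + costW b + 1"
| "costB (RLess a b) = costR a + costR b + 1"

text \<open>
  Word variable \<open>i\<close> lives in register \<open>ur i\<close>, so that variables 0 and 1 start as the
  numbers of vertices and arcs; register 2 holds \<open>off\<close> and the other odd registers are temporaries.
\<close>

abbreviation ur :: "nat \<Rightarrow> nat" where "ur i \<equiv> if i < 2 then i else 2 * i"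
abbreviation td :: "nat \<Rightarrow> nat" where "td d \<equiv> 2 * d + 3"
abbreviation rt :: "nat \<Rightarrow> nat" where "rt d \<equiv> 2 * d + 1"

definition addr :: "nat \<Rightarrow> nat \<Rightarrow> instr list" where
  "addr d a = (if a < 32 then
     [WConst (td (Suc d)) 32, WOp Mul (td d) (td d) (td (Suc d)), WOp Add (td d) (td d) 2,
      WConst (td (Suc d)) a, WOp Add (td d) (td d) (td (Suc d))] else [])"

text \<open>The machine has no move instruction, so a register is copied by adding zero to
  it.\<close>

primrec compW :: "nat \<Rightarrow> wexp \<Rightarrow> instr list" where
  "compW d (WV i) = [WConst (td d) 0, WOp Add (td d) (ur i) (td d)]"
| "compW d (WC a) = [WConst (td d) a]"
| "compW d (WB f a b) = compW d a @ compW (Suc d) b @ [WOp f (td d) (td d) (td (Suc d))]"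
| "compW d (WL a e) = compW d e @ addr d a @ [WLoad (td d) (td d)]"

text \<open>Word subexpressions are always evaluated at depth 0, since no word temporary is live
  inside a real expression. The zero used for copying a real register is a converted word, there
  being no real constants.\<close>

primrec compR :: "nat \<Rightarrow> rexp \<Rightarrow> instr list" where
  "compR d (RV i) = [WConst (td 0) 0, ROfWord (rt d) (td 0), ROp Add (rt d) (2 * i) (rt d)]"
| "compR d (RW e) = compW 0 e @ [ROfWord (rt d) (td 0)]"
| "compR d (RB f a b) = compR d a @ compR (Suc d) b @ [ROp f (rt d) (rt d) (rt (Suc d))]"
| "compR d (RL a e) = compW 0 e @ addr 0 a @ [RLoad (rt d) (td 0)]"

primrec compB :: "nat \<Rightarrow> bexp \<Rightarrow> instr list" where
  "compB l (WLess a b) = compW 0 a @ compW 1 b @ [JumpWLess (td 0) (td 1) l]"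
| "compB l (RLess a b) = compR 0 a @ compR 1 b @ [JumpRLess (rt 0) (rt 1) l]"

primrec len :: "cmd \<Rightarrow> nat" where
  "len SKIP = 0"
| "len (WSet i e) = costW e + 2"
| "len (RSet i e) = costR e + 3"
| "len (WSt a e f) = costW f + costW e + costA a + 1"
| "len (RSt a e f) = costR f + costW e + costA a + 1"
| "len (c ;; d) = len c + len d"
| "len (If b c d) = costB b + len d + 1 + len c"
| "len (While b c) = costB b + 1 + len c + 1"

text \<open>The branch taken on success is placed last, so that only the other branch needs a jump.
  \<open>RSt\<close> evaluates its real value first: this destroys word temporaries, whereas the
  word code for the index leaves all real registers intact.\<close>

primrec comp :: "nat \<Rightarrow> cmd \<Rightarrow> instr list" where
  "comp l SKIP = []"
| "comp l (WSet i e) = compW 0 e @ [WConst (td 1) 0, WOp Add (ur i) (td 0) (td 1)]"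
| "comp l (RSet i e) = compR 0 e @ [WConst (td 0) 0, ROfWord (rt 1) (td 0), ROp Add (2 * i) (rt 0) (rt 1)]"
| "comp l (WSt a e f) = compW 0 f @ compW 1 e @ addr 1 a @ [WStore (td 1) (td 0)]"
| "comp l (RSt a e f) = compR 0 f @ compW 0 e @ addr 0 a @ [RStore (td 0) (rt 0)]"
| "comp l (c ;; d) = comp l c @ comp (l + len c) d"
| "comp l (If b c d) =
     (let l1 = l + costB b; l2 = l1 + len d + 1 in
      compB l2 b @ comp l1 d @ [Jump (l2 + len c)] @ comp l2 c)"
| "comp l (While b c) =
     (let l1 = l + costB b + 1 in
      compB l1 b @ [Jump (l1 + len c + 1)] @ comp l1 c @ [Jump l])"

lemma length_addr: "length (addr d a) = costA a" by (simp add: addr_def)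

lemma length_compW: "length (compW d e) = costW e"
  by (induction e arbitrary: d) (auto simp: length_addr)

lemma length_compR: "length (compR d e) = costR e"
  by (induction e arbitrary: d) (auto simp: length_addr length_compW)

lemma length_compB: "length (compB l b) = costB b"
  by (cases b) (auto simp: length_compW length_compR)

lemma length_comp: "length (comp l c) = len c"
  by (induction c arbitrary: l)
    (auto simp: length_compW length_compR length_addr length_compB Let_def)

context ram
begin

text \<open>The clock counts executed instructions of the compiled code; each extra 1 in the rules
  for conditionals and loops is an unconditional jump. A program that overflows has no
  derivation.\<close>

inductive big :: "cmd \<Rightarrow> st \<Rightarrow> st \<Rightarrow> bool" where
  big_SKIP: "big SKIP s s"
| big_WSet: "okW s e \<Longrightarrow> big (WSet i e) s (s\<lparr>wv := (wv s)(i := evW s e), clk := clk s + costW e + 2\<rparr>)"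
| big_RSet: "okR s e \<Longrightarrow> big (RSet i e) s (s\<lparr>rv := (rv s)(i := evR s e), clk := clk s + costR e + 3\<rparr>)"
| big_WSt: "okW s e \<Longrightarrow> okW s f \<Longrightarrow> okA a (evW s e) \<Longrightarrow>
    big (WSt a e f) s (s\<lparr>wa := (wa s)(a := (wa s a)(evW s e := evW s f)),
      clk := clk s + costW f + costW e + costA a + 1\<rparr>)"
| big_RSt: "okW s e \<Longrightarrow> okR s f \<Longrightarrow> okA a (evW s e) \<Longrightarrow>
    big (RSt a e f) s (s\<lparr>ra := (ra s)(a := (ra s a)(evW s e := evR s f)),
      clk := clk s + costR f + costW e + costA a + 1\<rparr>)"
| big_Seq: "big c s s1 \<Longrightarrow> big d s1 s2 \<Longrightarrow> big (c ;; d) s s2"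
| big_IfT: "okB s b \<Longrightarrow> evB s b \<Longrightarrow> big c (s\<lparr>clk := clk s + costB b\<rparr>) s1 \<Longrightarrow> big (If b c d) s s1"
| big_IfF: "okB s b \<Longrightarrow> \<not> evB s b \<Longrightarrow> big d (s\<lparr>clk := clk s + costB b\<rparr>) s1 \<Longrightarrow>
    big (If b c d) s (s1\<lparr>clk := clk s1 + 1\<rparr>)"
| big_WhileF: "okB s b \<Longrightarrow> \<not> evB s b \<Longrightarrow> big (While b c) s (s\<lparr>clk := clk s + costB b + 1\<rparr>)"
| big_WhileT: "okB s b \<Longrightarrow> evB s b \<Longrightarrow> big c (s\<lparr>clk := clk s + costB b\<rparr>) s1 \<Longrightarrow>
    big (While b c) (s1\<lparr>clk := clk s1 + 1\<rparr>) s2 \<Longrightarrow> big (While b c) s s2"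

text \<open>The final two clauses bound the value of any subexpression: it has been computed into
  some register, and registers hold words below \<open>W\<close>.\<close>

definition rel :: "st \<Rightarrow> config \<Rightarrow> bool" where
  "rel s \<sigma> \<longleftrightarrow> (\<forall>i. wreg \<sigma> (ur i) = wv s i) \<and> (\<forall>i. rreg \<sigma> (2 * i) = rv s i) \<and> wreg \<sigma> 2 = off \<and>
     (\<forall>a<32. \<forall>i<IM. wmem \<sigma> (off + 32 * i + a) = wa s a i) \<and>
     (\<forall>a<32. \<forall>i<IM. rmem \<sigma> (off + 32 * i + a) = ra s a i) \<and>
     (\<forall>i<off. wmem \<sigma> i = wa s 32 i) \<and> (\<forall>i<off. rmem \<sigma> i = ra s 32 i) \<and>
     (\<forall>r. wreg \<sigma> r < W) \<and> (\<forall>a. wmem \<sigma> a < W)"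

end

section \<open>Code positions, deterministic runs and the correctness of the compiler\<close>

primrec codeat :: "program \<Rightarrow> nat \<Rightarrow> instr list \<Rightarrow> bool" where
  "codeat P l [] = True"
| "codeat P l (x # xs) = (l < length P \<and> P ! l = x \<and> codeat P (Suc l) xs)"

lemma codeat_append: "codeat P l (xs @ ys) \<longleftrightarrow> codeat P l xs \<and> codeat P (l + length xs) ys"
  by (induction xs arbitrary: l) auto

lemma codeat_nth: "codeat P l xs \<Longrightarrow> k < length xs \<Longrightarrow> l + k < length P \<and> P ! (l + k) = xs ! k"
  by (induction xs arbitrary: l k) (auto simp: less_Suc_eq_0_disj, force+)

lemma codeat_middle: "codeat (xs @ ys @ zs) (length xs) ys"
proof (induction ys arbitrary: xs)
  case (Cons y ys)
  from Cons[of "xs @ [y]"] show ?case by simp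
qed simp

definition reach :: "nat \<Rightarrow> program \<Rightarrow> nat \<Rightarrow> config \<Rightarrow> config \<Rightarrow> bool" where
  "reach W P k \<sigma> \<sigma>' \<longleftrightarrow> run W P k \<sigma> = return_pmf \<sigma>'"

lemma run_add: "run W P (a + b) \<sigma> = bind_pmf (run W P a \<sigma>) (run W P b)"
proof (induction a arbitrary: \<sigma>)
  case (Suc a)
  then have "run W P (a + b) = (\<lambda>\<sigma>. bind_pmf (run W P a \<sigma>) (run W P b))" by auto
  then show ?case by (simp add: bind_assoc_pmf)
qed (simp add: bind_return_pmf)

lemma reach_trans: "reach W P a s s1 \<Longrightarrow> reach W P b s1 s2 \<Longrightarrow> reach W P (a + b) s s2"
  by (simp add: reach_def run_add bind_return_pmf)

lemma Suc_numerals: "(2::nat) = Suc (Suc 0)" "(3::nat) = Suc (Suc (Suc 0))" "(5::nat) = Suc (Suc (Suc (Suc (Suc 0))))"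
  by simp_all

lemmas exec_simps = reach_def step_def halted_def bind_return_pmf

context ram
begin

lemma addr_bound: "i < IM \<Longrightarrow> a < 32 \<Longrightarrow> off + 32 * i + a < W"
  using fits by linarith

lemma addr_inj:
  assumes "a < 32" "b < 32"
  shows "off + 32 * i + a = off + 32 * j + b \<longleftrightarrow> i = j \<and> a = b"
proof -
  have "(32 * i + a) div 32 = i" "(32 * j + b) div 32 = j" using assms by simp_all
  then show ?thesis by (metis add.assoc add_left_cancel)
qed

lemma reg_distinct: "ur i \<noteq> td d" "td d \<noteq> ur i" "td d \<noteq> 2" "2 \<noteq> td d" "2 * i \<noteq> rt d" "rt d \<noteq> 2 * i"
proof -
  have "2 * i \<noteq> Suc (2 * Suc d)" by (rule double_not_eq_Suc_double)
  then show "ur i \<noteq> td d" "td d \<noteq> ur i" by (auto split: if_splits)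
  have "2 * i \<noteq> Suc (2 * d)" by (rule double_not_eq_Suc_double)
  then show "2 * i \<noteq> rt d" "rt d \<noteq> 2 * i" by simp_all
qed simp_all

lemma rel_cong:
  assumes "rel s \<sigma>" "\<And>i. wreg \<sigma>' (ur i) = wreg \<sigma> (ur i)" "\<And>i. rreg \<sigma>' (2 * i) = rreg \<sigma> (2 * i)"
    "wreg \<sigma>' 2 = wreg \<sigma> 2" "wmem \<sigma>' = wmem \<sigma>" "rmem \<sigma>' = rmem \<sigma>" "\<And>r. wreg \<sigma>' r < W"
  shows "rel s \<sigma>'"
  using assms(1) unfolding rel_def assms(2-6) using assms(7) by blast

lemma rel_temp: "rel s \<sigma> \<Longrightarrow> x < W \<Longrightarrow> rel s (\<sigma>\<lparr>wreg := (wreg \<sigma>)(td d := x), pc := k\<rparr>)"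
  by (rule rel_cong, assumption) (auto simp: reg_distinct rel_def simp del: split_paired_All)

lemma rel_temp': "rel s \<sigma> \<Longrightarrow> rel s (\<sigma>\<lparr>rreg := (rreg \<sigma>)(rt d := x), pc := k\<rparr>)"
  by (rule rel_cong, assumption) (auto simp: reg_distinct rel_def double_not_eq_Suc_double)

definition loc :: "nat \<Rightarrow> nat \<Rightarrow> nat" where
  "loc a i = (if a < 32 then off + 32 * i + a else i)"

lemma reach_addr:
  assumes code: "codeat P (pc \<sigma>) (addr d a)" and rl: "rel s \<sigma>"
    and v: "wreg \<sigma> (td d) = i" and ok: "okA a i"
  shows "\<exists>\<sigma>'. reach W P (costA a) \<sigma> \<sigma>' \<and> pc \<sigma>' = pc \<sigma> + costA a \<and> wreg \<sigma>' (td d) = loc a i \<and>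
    rel s \<sigma>' \<and> (\<forall>j<d. wreg \<sigma>' (td j) = wreg \<sigma> (td j)) \<and> rreg \<sigma>' = rreg \<sigma>"
proof (cases "a < 32")
  case True
  with ok have i: "i < IM" by (simp add: okA_def)
  have b: "off + 32 * i + a < W" using addr_bound[OF i True] .
  have o: "wreg \<sigma> 2 = off" and w: "\<forall>r. wreg \<sigma> r < W" using rl by (auto simp: rel_def)
  define \<sigma>' where "\<sigma>' = \<sigma>\<lparr>wreg := (wreg \<sigma>)(td d := off + 32 * i + a, td (Suc d) := a), pc := pc \<sigma> + 5\<rparr>"
  have m: "32 mod W = 32" "a mod W = a" "(i * 32) mod W = i * 32" "(i * 32 + off) mod W = i * 32 + off"
    "(i * 32 + off + a) mod W = i * 32 + off + a" using b fits True i by (auto intro!: mod_less)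
  define E where "E k r = \<sigma>\<lparr>wreg := r, pc := pc \<sigma> + k\<rparr>" for k r
  define r1 where "r1 = (wreg \<sigma>)(td (Suc d) := 32)"
  define r2 where "r2 = r1(td d := i * 32)"
  define r3 where "r3 = r2(td d := i * 32 + off)"
  define r4 where "r4 = r3(td (Suc d) := a)"
  have r: "r1 (td d) = i" "r1 (td (Suc d)) = 32" "r2 (td d) = i * 32" "r2 2 = off" "r3 (td d) = i * 32 + off"
      "r4 (td d) = i * 32 + off" "r4 (td (Suc d)) = a"
    using v o by (simp_all add: r1_def r2_def r3_def r4_def)
  have c: "pc \<sigma> + k < length P \<and> P ! (pc \<sigma> + k) = addr d a ! k" if "k < 5" for k
    using codeat_nth[OF code, of k] that True by (simp add: addr_def)
  have "reach W P 1 \<sigma> (E 1 r1)"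
    using c[of 0] m True by (simp add: exec_simps addr_def E_def r1_def)
  moreover have "reach W P 1 (E 1 r1) (E 2 r2)"
    using c[of 1] m r True by (simp add: exec_simps addr_def E_def r2_def)
  moreover have "reach W P 1 (E 2 r2) (E 3 r3)"
    using c[of 2] m r True by (simp add: exec_simps addr_def E_def r3_def)
  moreover have "reach W P 1 (E 3 r3) (E 4 r4)"
    using c[of 3] m r True by (simp add: exec_simps addr_def E_def r4_def)
  moreover have "reach W P 1 (E 4 r4) (E 5 (r4(td d := i * 32 + off + a)))"
    using c[of 4] m r True by (simp add: exec_simps addr_def E_def)
  ultimately have "reach W P (1 + 1 + 1 + 1 + 1) \<sigma> (E 5 (r4(td d := i * 32 + off + a)))"
    by (blast intro: reach_trans)
  moreover have "E 5 (r4(td d := i * 32 + off + a)) = \<sigma>'"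
    by (auto simp: E_def r1_def r2_def r3_def r4_def \<sigma>'_def fun_eq_iff)
  ultimately have "reach W P 5 \<sigma> \<sigma>'" by (simp add: Suc_numerals)
  moreover have "rel s \<sigma>'"
    using rel_temp[OF rel_temp[OF rl b, where d = d and k = 0], where d = "Suc d" and x = a and k = "pc \<sigma> + 5"] True fits by (simp add: \<sigma>'_def)
  ultimately show ?thesis using True by (auto simp: \<sigma>'_def loc_def)
next
  case False
  then show ?thesis using assms by (intro exI[of _ \<sigma>]) (auto simp: reach_def loc_def)
qed

lemma rel_pc: "rel s \<sigma> \<Longrightarrow> rel s (\<sigma>\<lparr>pc := k\<rparr>)"
  unfolding rel_def by auto

lemma rel_clk: "rel (s\<lparr>clk := k\<rparr>) \<sigma> = rel s \<sigma>"
  unfolding rel_def by auto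

lemma rel_wload: "rel s \<sigma> \<Longrightarrow> okA a i \<Longrightarrow> wmem \<sigma> (loc a i) = wa s a i"
  unfolding rel_def okA_def loc_def by (auto split: if_splits)

lemma rel_rload: "rel s \<sigma> \<Longrightarrow> okA a i \<Longrightarrow> rmem \<sigma> (loc a i) = ra s a i"
  unfolding rel_def okA_def loc_def by (auto split: if_splits)

lemma rel_bounds: "rel s \<sigma> \<Longrightarrow> wreg \<sigma> r < W" "rel s \<sigma> \<Longrightarrow> wmem \<sigma> x < W" "rel s \<sigma> \<Longrightarrow> wreg \<sigma> (ur i) = wv s i"
  "rel s \<sigma> \<Longrightarrow> rreg \<sigma> (2 * i) = rv s i"
  unfolding rel_def by blast+

lemma word_aop_ok:
  assumes "x < W" "y < W" "f = Add \<or> f = Mul \<longrightarrow> nat_aop f x y < W"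
  shows "word_aop W f x y = nat_aop f x y" "nat_aop f x y < W"
proof -
  have "x div y < W" using assms(1) div_le_dividend[of x y] by linarith
  then show "word_aop W f x y = nat_aop f x y" "nat_aop f x y < W" using assms by (cases f; simp)+
qed

lemma reach_compW:
  assumes "codeat P (pc \<sigma>) (compW d e)" "okW s e" "rel s \<sigma>"
  shows "\<exists>\<sigma>'. reach W P (costW e) \<sigma> \<sigma>' \<and> pc \<sigma>' = pc \<sigma> + costW e \<and> wreg \<sigma>' (td d) = evW s e \<and>
    rel s \<sigma>' \<and> (\<forall>j<d. wreg \<sigma>' (td j) = wreg \<sigma> (td j)) \<and> rreg \<sigma>' = rreg \<sigma>"
  using assms
proof (induction e arbitrary: d \<sigma>)
  case (WV i)
  let ?s = "\<sigma>\<lparr>wreg := (wreg \<sigma>)(td d := wv s i), pc := pc \<sigma> + 2\<rparr>"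
  have w: "wv s i < W" "wreg \<sigma> (ur i) = wv s i" using rel_bounds[OF WV(3)] by metis+
  note n = reg_distinct(1)[of i d]
  have "reach W P (Suc (Suc 0)) \<sigma> ?s" using WV(1) w n by (auto simp: exec_simps simp del: fun_upd_apply) (auto simp: fun_eq_iff)
  then have "reach W P 2 \<sigma> ?s" by (simp only: Suc_numerals)
  then show ?case using rel_temp[OF WV(3) w(1)] by (intro exI[of _ ?s]) auto
next
  case (WC a)
  let ?s = "\<sigma>\<lparr>wreg := (wreg \<sigma>)(td d := a), pc := pc \<sigma> + 1\<rparr>"
  have w: "a < W" using WC by simp
  have "reach W P 1 \<sigma> ?s" using WC(1) w by (auto simp: exec_simps simp del: fun_upd_apply)
  then show ?case using rel_temp[OF WC(3) w] by (intro exI[of _ ?s]) auto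
next
  case (WB f a b)
  from WB.IH(1)[of \<sigma> d] WB.prems obtain s1 where s1: "reach W P (costW a) \<sigma> s1" "pc s1 = pc \<sigma> + costW a"
    "wreg s1 (td d) = evW s a" "rel s s1" "\<forall>j<d. wreg s1 (td j) = wreg \<sigma> (td j)" "rreg s1 = rreg \<sigma>"
    by (auto simp: codeat_append length_compW)
  from WB.IH(2)[of s1 "Suc d"] WB.prems s1 obtain s2 where s2: "reach W P (costW b) s1 s2" "pc s2 = pc s1 + costW b"
    "wreg s2 (td (Suc d)) = evW s b" "rel s s2" "\<forall>j<Suc d. wreg s2 (td j) = wreg s1 (td j)" "rreg s2 = rreg s1"
    by (auto simp: codeat_append length_compW)
  have v: "wreg s2 (td d) = evW s a" using s2(5) s1(3) by auto
  have bd: "evW s a < W" "evW s b < W" using rel_bounds(1)[OF s2(4)] v s2(3) by metis+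
  note f = word_aop_ok[OF bd, of f]
  let ?s = "s2\<lparr>wreg := (wreg s2)(td d := evW s (WB f a b)), pc := pc s2 + 1\<rparr>"
  have "reach W P 1 s2 ?s" using WB.prems s1 s2 v f by (auto simp: exec_simps codeat_append length_compW simp del: fun_upd_apply)
  from reach_trans[OF reach_trans[OF s1(1) s2(1)] this]
  have "reach W P (costW (WB f a b)) \<sigma> ?s" by simp
  moreover have "rel s ?s" using rel_temp[OF s2(4), of "evW s (WB f a b)"] f(2) WB.prems by simp
  ultimately show ?case using s1 s2 by (intro exI[of _ ?s]) auto
next
  case (WL a e)
  from WL.IH[of \<sigma> d] WL.prems obtain s1 where s1: "reach W P (costW e) \<sigma> s1" "pc s1 = pc \<sigma> + costW e"
    "wreg s1 (td d) = evW s e" "rel s s1" "\<forall>j<d. wreg s1 (td j) = wreg \<sigma> (td j)" "rreg s1 = rreg \<sigma>"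
    by (auto simp: codeat_append length_compW)
  from WL.prems s1(2) have c: "codeat P (pc s1) (addr d a)" "okA a (evW s e)"
    by (auto simp: codeat_append length_compW)
  from reach_addr[OF c(1) s1(4) s1(3) c(2)] obtain s2 where s2: "reach W P (costA a) s1 s2" "pc s2 = pc s1 + costA a"
    "wreg s2 (td d) = loc a (evW s e)" "rel s s2" "\<forall>j<d. wreg s2 (td j) = wreg s1 (td j)" "rreg s2 = rreg s1"
    by blast
  have l: "wmem s2 (loc a (evW s e)) = wa s a (evW s e)" using rel_wload[OF s2(4) c(2)] .
  then have bd: "wa s a (evW s e) < W" using rel_bounds(2)[OF s2(4)] by metis
  let ?s = "s2\<lparr>wreg := (wreg s2)(td d := wa s a (evW s e)), pc := pc s2 + 1\<rparr>"
  have "P ! pc s2 = WLoad (td d) (td d)" "pc s2 < length P" using WL.prems s1 s2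
    by (auto simp: codeat_append length_compW length_addr)
  then have "reach W P 1 s2 ?s" using s2(3) l by (auto simp: exec_simps simp del: fun_upd_apply)
  from reach_trans[OF reach_trans[OF s1(1) s2(1)] this]
  have "reach W P (costW (WL a e)) \<sigma> ?s" by simp
  moreover have "rel s ?s" using rel_temp[OF s2(4) bd] by simp
  ultimately show ?case using s1 s2 by (intro exI[of _ ?s]) auto
qed

lemma reach_compR:
  assumes "codeat P (pc \<sigma>) (compR d e)" "okR s e" "rel s \<sigma>"
  shows "\<exists>\<sigma>'. reach W P (costR e) \<sigma> \<sigma>' \<and> pc \<sigma>' = pc \<sigma> + costR e \<and> rreg \<sigma>' (rt d) = evR s e \<and>
    rel s \<sigma>' \<and> (\<forall>j<d. rreg \<sigma>' (rt j) = rreg \<sigma> (rt j))"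
  using assms
proof (induction e arbitrary: d \<sigma>)
  case (RV i)
  let ?s1 = "\<sigma>\<lparr>wreg := (wreg \<sigma>)(td 0 := 0), pc := pc \<sigma>\<rparr>"
  let ?s = "?s1\<lparr>rreg := (rreg \<sigma>)(rt d := rv s i), pc := pc \<sigma> + 3\<rparr>"
  have w: "rreg \<sigma> (2 * i) = rv s i" using rel_bounds[OF RV(3)] by metis
  note n = double_not_eq_Suc_double[of i d]
  have "reach W P (Suc (Suc (Suc 0))) \<sigma> ?s" using RV(1) w n by (auto simp: exec_simps simp del: fun_upd_apply) (auto simp: fun_eq_iff)
  then have "reach W P 3 \<sigma> ?s" by (simp only: Suc_numerals)
  moreover have "rel s ?s1" using rel_temp[OF RV(3), where x = 0 and d = 0 and k = "pc \<sigma>"] fits by simp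
  then have "rel s ?s" using rel_temp'[of s ?s1, where d = d] by simp
  ultimately show ?case by (intro exI[of _ ?s]) auto
next
  case (RW e)
  from reach_compW[of P \<sigma> 0 e s] RW.prems obtain s1 where s1: "reach W P (costW e) \<sigma> s1" "pc s1 = pc \<sigma> + costW e"
    "wreg s1 (td 0) = evW s e" "rel s s1" "rreg s1 = rreg \<sigma>"
    by (auto simp: codeat_append length_compW)
  let ?s = "s1\<lparr>rreg := (rreg s1)(rt d := real (evW s e)), pc := pc s1 + 1\<rparr>"
  have "reach W P 1 s1 ?s" using RW.prems s1 by (auto simp: exec_simps codeat_append length_compW simp del: fun_upd_apply)
  from reach_trans[OF s1(1) this]
  have "reach W P (costR (RW e)) \<sigma> ?s" by simp
  moreover have "rel s ?s" using rel_temp'[OF s1(4)] by simp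
  ultimately show ?case using s1 by (intro exI[of _ ?s]) auto
next
  case (RB f a b)
  from RB.IH(1)[of \<sigma> d] RB.prems obtain s1 where s1: "reach W P (costR a) \<sigma> s1" "pc s1 = pc \<sigma> + costR a"
    "rreg s1 (rt d) = evR s a" "rel s s1" "\<forall>j<d. rreg s1 (rt j) = rreg \<sigma> (rt j)"
    by (auto simp: codeat_append length_compR)
  from RB.IH(2)[of s1 "Suc d"] RB.prems s1 obtain s2 where s2: "reach W P (costR b) s1 s2" "pc s2 = pc s1 + costR b"
    "rreg s2 (rt (Suc d)) = evR s b" "rel s s2" "\<forall>j<Suc d. rreg s2 (rt j) = rreg s1 (rt j)"
    by (auto simp: codeat_append length_compR)
  have v: "rreg s2 (rt d) = evR s a" using s2(5) s1(3) by auto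
  let ?s = "s2\<lparr>rreg := (rreg s2)(rt d := evR s (RB f a b)), pc := pc s2 + 1\<rparr>"
  have "reach W P 1 s2 ?s" using RB.prems s1 s2 v by (auto simp: exec_simps codeat_append length_compR simp del: fun_upd_apply)
  from reach_trans[OF reach_trans[OF s1(1) s2(1)] this]
  have "reach W P (costR (RB f a b)) \<sigma> ?s" by simp
  moreover have "rel s ?s" using rel_temp'[OF s2(4)] by simp
  ultimately show ?case using s1 s2 by (intro exI[of _ ?s]) auto
next
  case (RL a e)
  from reach_compW[of P \<sigma> 0 e s] RL.prems obtain s1 where s1: "reach W P (costW e) \<sigma> s1" "pc s1 = pc \<sigma> + costW e"
    "wreg s1 (td 0) = evW s e" "rel s s1" "rreg s1 = rreg \<sigma>"
    by (auto simp: codeat_append length_compW)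
  from RL.prems s1(2) have c: "codeat P (pc s1) (addr 0 a)" "okA a (evW s e)"
    by (auto simp: codeat_append length_compW)
  from reach_addr[OF c(1) s1(4) s1(3) c(2)] obtain s2 where s2: "reach W P (costA a) s1 s2" "pc s2 = pc s1 + costA a"
    "wreg s2 (td 0) = loc a (evW s e)" "rel s s2" "rreg s2 = rreg s1"
    by blast
  have l: "rmem s2 (loc a (evW s e)) = ra s a (evW s e)" using rel_rload[OF s2(4) c(2)] .
  let ?s = "s2\<lparr>rreg := (rreg s2)(rt d := ra s a (evW s e)), pc := pc s2 + 1\<rparr>"
  have "P ! pc s2 = RLoad (rt d) (td 0)" "pc s2 < length P" using RL.prems s1 s2
    by (auto simp: codeat_append length_compW length_addr)
  then have "reach W P 1 s2 ?s" using s2(3) l by (auto simp: exec_simps simp del: fun_upd_apply)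
  from reach_trans[OF reach_trans[OF s1(1) s2(1)] this]
  have "reach W P (costR (RL a e)) \<sigma> ?s" by simp
  moreover have "rel s ?s" using rel_temp'[OF s2(4)] by simp
  ultimately show ?case using s1 s2 by (intro exI[of _ ?s]) auto
qed

lemma reach_compB:
  assumes code: "codeat P (pc \<sigma>) (compB l b)" and ok: "okB s b" and r: "rel s \<sigma>"
  shows "\<exists>\<sigma>'. reach W P (costB b) \<sigma> \<sigma>' \<and> pc \<sigma>' = (if evB s b then l else pc \<sigma> + costB b) \<and> rel s \<sigma>'"
proof (cases b)
  case (WLess a b')
  from reach_compW[of P \<sigma> 0 a s] assms WLess obtain s1 where s1: "reach W P (costW a) \<sigma> s1" "pc s1 = pc \<sigma> + costW a"
    "wreg s1 (td 0) = evW s a" "rel s s1"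
    by (auto simp: codeat_append length_compW)
  from reach_compW[of P s1 "Suc 0" b' s] assms WLess s1 obtain s2 where s2: "reach W P (costW b') s1 s2" "pc s2 = pc s1 + costW b'"
    "wreg s2 (td (Suc 0)) = evW s b'" "rel s s2" "\<forall>j<Suc 0. wreg s2 (td j) = wreg s1 (td j)"
    by (auto simp: codeat_append length_compW)
  have v: "wreg s2 (td 0) = evW s a" using s2(5) s1(3) by auto
  let ?s = "s2\<lparr>pc := if evB s b then l else pc s2 + 1\<rparr>"
  have "reach W P 1 s2 ?s" using code WLess s1 s2(1-4) v by (auto simp: exec_simps codeat_append length_compW)
  from reach_trans[OF reach_trans[OF s1(1) s2(1)] this]
  have "reach W P (costB b) \<sigma> ?s" using WLess by simp
  then show ?thesis using rel_pc[OF s2(4)] s1 s2 WLess by (intro exI[of _ ?s]) auto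
next
  case (RLess a b')
  from reach_compR[of P \<sigma> 0 a s] assms RLess obtain s1 where s1: "reach W P (costR a) \<sigma> s1" "pc s1 = pc \<sigma> + costR a"
    "rreg s1 (rt 0) = evR s a" "rel s s1"
    by (auto simp: codeat_append length_compR)
  from reach_compR[of P s1 "Suc 0" b' s] assms RLess s1 obtain s2 where s2: "reach W P (costR b') s1 s2" "pc s2 = pc s1 + costR b'"
    "rreg s2 (rt (Suc 0)) = evR s b'" "rel s s2" "\<forall>j<Suc 0. rreg s2 (rt j) = rreg s1 (rt j)"
    by (auto simp: codeat_append length_compR)
  have v: "rreg s2 (rt 0) = evR s a" using s2(5) s1(3) by auto
  let ?s = "s2\<lparr>pc := if evB s b then l else pc s2 + 1\<rparr>"
  have "reach W P 1 s2 ?s" using code RLess s1 s2(1-4) v by (auto simp: exec_simps codeat_append length_compR)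
  from reach_trans[OF reach_trans[OF s1(1) s2(1)] this]
  have "reach W P (costB b) \<sigma> ?s" using RLess by simp
  then show ?thesis using rel_pc[OF s2(4)] s1 s2 RLess by (intro exI[of _ ?s]) auto
qed

lemma rel_WSet:
  assumes r: "rel s \<sigma>" and x: "x < W"
  shows "rel (s\<lparr>wv := (wv s)(i := x), clk := t\<rparr>) (\<sigma>\<lparr>wreg := (wreg \<sigma>)(ur i := x), pc := k\<rparr>)"
proof -
  have "ur j = ur i \<longleftrightarrow> j = i" for j by auto
  moreover have "ur i \<noteq> 2" by auto
  ultimately show ?thesis using r x unfolding rel_def by auto
qed

lemma rel_RSet:
  assumes r: "rel s \<sigma>"
  shows "rel (s\<lparr>rv := (rv s)(i := x), clk := t\<rparr>) (\<sigma>\<lparr>rreg := (rreg \<sigma>)(2 * i := x), pc := k\<rparr>)"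
  using r unfolding rel_def by auto

lemma rel_WSt:
  assumes r: "rel s \<sigma>" and x: "x < W" and ok: "okA a i"
  shows "rel (s\<lparr>wa := (wa s)(a := (wa s a)(i := x)), clk := t\<rparr>) (\<sigma>\<lparr>wmem := (wmem \<sigma>)(loc a i := x), pc := k\<rparr>)"
proof (cases "a < 32")
  case True
  have "off + 32 * j + b \<noteq> loc a i \<or> (a = b \<and> i = j)" if "b < 32" for b j
    using addr_inj[OF that True, of j i] True by (auto simp: loc_def)
  moreover have "loc a i = off + 32 * i + a" using True by (simp add: loc_def)
  ultimately show ?thesis using r x True unfolding rel_def by auto
next
  case False
  then show ?thesis using ok r x unfolding rel_def okA_def loc_def by auto
qed

lemma rel_RSt:
  assumes r: "rel s \<sigma>" and ok: "okA a i"
  shows "rel (s\<lparr>ra := (ra s)(a := (ra s a)(i := x)), clk := t\<rparr>) (\<sigma>\<lparr>rmem := (rmem \<sigma>)(loc a i := x), pc := k\<rparr>)"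
proof (cases "a < 32")
  case True
  have "off + 32 * j + b \<noteq> loc a i \<or> (a = b \<and> i = j)" if "b < 32" for b j
    using addr_inj[OF that True, of j i] True by (auto simp: loc_def)
  moreover have "loc a i = off + 32 * i + a" using True by (simp add: loc_def)
  ultimately show ?thesis using r True unfolding rel_def by auto
next
  case False
  then show ?thesis using ok r unfolding rel_def okA_def loc_def by auto
qed

lemma reach_instr:
  "pc \<sigma> < length P \<Longrightarrow> P ! pc \<sigma> = x \<Longrightarrow> exec_instr W x \<sigma> = return_pmf \<sigma>' \<Longrightarrow> reach W P 1 \<sigma> \<sigma>'"
  by (simp add: exec_simps)

text \<open>The clock is an exact step count and not just an upper bound. The sampling loop depends
  on this: its compiled body must take the same number of steps for every drawn value.\<close>

theorem comp_correct:
  assumes "big c s s'" "codeat P (pc \<sigma>) (comp (pc \<sigma>) c)" "rel s \<sigma>"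
  shows "\<exists>k \<sigma>'. clk s' = clk s + k \<and> reach W P k \<sigma> \<sigma>' \<and> pc \<sigma>' = pc \<sigma> + len c \<and> rel s' \<sigma>'"
  using assms
proof (induction arbitrary: \<sigma> rule: big.induct)
  case (big_SKIP s)
  then show ?case by (intro exI[of _ 0] exI[of _ \<sigma>]) (auto simp: reach_def)
next
  case (big_WSet s e i)
  from reach_compW[of P \<sigma> 0 e s] big_WSet obtain s1 where s1: "reach W P (costW e) \<sigma> s1" "pc s1 = pc \<sigma> + costW e"
    "wreg s1 (td 0) = evW s e" "rel s s1"
    by (auto simp: codeat_append length_compW)
  have ev: "evW s e < W" using rel_bounds(1)[OF s1(4)] s1(3) by metis
  let ?s2 = "s1\<lparr>wreg := (wreg s1)(td 1 := 0), pc := pc s1 + 1\<rparr>"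
  let ?s3 = "?s2\<lparr>wreg := (wreg ?s2)(ur i := evW s e), pc := pc s1 + 2\<rparr>"
  have p: "pc s1 < length P" "P ! pc s1 = WConst (td 1) 0" "pc ?s2 < length P" "P ! pc ?s2 = WOp Add (ur i) (td 0) (td 1)"
    using big_WSet.prems(1) s1(2) by (auto simp: codeat_append length_compW)
  have "reach W P 1 s1 ?s2" by (rule reach_instr[OF p(1,2)]) simp
  moreover have "reach W P 1 ?s2 ?s3" by (rule reach_instr[OF p(3,4)]) (use s1 ev in simp)
  ultimately have "reach W P (costW e + (1 + 1)) \<sigma> ?s3" using s1(1) reach_trans by blast
  moreover have "rel s ?s2" using rel_temp[OF s1(4), where x = 0 and d = 1 and k = "pc s1 + 1"] fits by simp
  from rel_WSet[OF this ev] have "rel (s\<lparr>wv := (wv s)(i := evW s e), clk := clk s + costW e + 2\<rparr>) ?s3" by blast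
  ultimately show ?case using s1(2) by (intro exI[of _ "costW e + (1 + 1)"] exI[of _ ?s3]) auto
next
  case (big_RSet s e i)
  from reach_compR[of P \<sigma> 0 e s] big_RSet obtain s1 where s1: "reach W P (costR e) \<sigma> s1" "pc s1 = pc \<sigma> + costR e"
    "rreg s1 (rt 0) = evR s e" "rel s s1"
    by (auto simp: codeat_append length_compR)
  let ?s2 = "s1\<lparr>wreg := (wreg s1)(td 0 := 0), pc := pc s1 + 1\<rparr>"
  let ?s3 = "?s2\<lparr>rreg := (rreg ?s2)(rt 1 := 0), pc := pc s1 + 2\<rparr>"
  let ?s4 = "?s3\<lparr>rreg := (rreg ?s3)(2 * i := evR s e), pc := pc s1 + 3\<rparr>"
  have p: "pc s1 < length P" "P ! pc s1 = WConst (td 0) 0" "pc ?s2 < length P" "P ! pc ?s2 = ROfWord (rt 1) (td 0)"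
    "pc ?s3 < length P" "P ! pc ?s3 = ROp Add (2 * i) (rt 0) (rt 1)"
    using big_RSet.prems(1) s1(2) by (auto simp: codeat_append length_compR)
  have "reach W P 1 s1 ?s2" by (rule reach_instr[OF p(1,2)]) simp
  moreover have "reach W P 1 ?s2 ?s3" by (rule reach_instr[OF p(3,4)]) simp
  moreover have "reach W P 1 ?s3 ?s4" by (rule reach_instr[OF p(5,6)]) (use s1 in simp)
  ultimately have "reach W P (costR e + (1 + (1 + 1))) \<sigma> ?s4" using s1(1) reach_trans by blast
  moreover have "rel s ?s2" using rel_temp[OF s1(4), where x = 0 and d = 0 and k = "pc s1 + 1"] fits by simp
  from rel_RSet[OF rel_temp'[OF this]]
  have "rel (s\<lparr>rv := (rv s)(i := evR s e), clk := clk s + costR e + 3\<rparr>) ?s4" by blast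
  ultimately show ?case using s1(2) by (intro exI[of _ "costR e + (1 + (1 + 1))"] exI[of _ ?s4]) auto
next
  case (big_WSt s e f a)
  from reach_compW[of P \<sigma> 0 f s] big_WSt obtain s1 where s1: "reach W P (costW f) \<sigma> s1" "pc s1 = pc \<sigma> + costW f"
    "wreg s1 (td 0) = evW s f" "rel s s1"
    by (auto simp: codeat_append length_compW)
  from reach_compW[of P s1 1 e s] big_WSt s1 obtain s2 where s2: "reach W P (costW e) s1 s2" "pc s2 = pc s1 + costW e"
    "wreg s2 (td 1) = evW s e" "rel s s2" "\<forall>j<1. wreg s2 (td j) = wreg s1 (td j)"
    by (auto simp: codeat_append length_compW)
  have "codeat P (pc s2) (addr 1 a)" using big_WSt.prems(1) s1(2) s2(2)
    by (auto simp: codeat_append length_compW)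
  from reach_addr[OF this s2(4,3) big_WSt.hyps(3)] obtain s3 where s3: "reach W P (costA a) s2 s3" "pc s3 = pc s2 + costA a"
    "wreg s3 (td 1) = loc a (evW s e)" "rel s s3" "\<forall>j<1. wreg s3 (td j) = wreg s2 (td j)" by auto
  have v: "wreg s3 (td 0) = evW s f" using s1(3) s2(5) s3(5) by auto
  then have ev: "evW s f < W" using rel_bounds(1)[OF s3(4)] by metis
  let ?s4 = "s3\<lparr>wmem := (wmem s3)(loc a (evW s e) := evW s f), pc := pc s3 + 1\<rparr>"
  have p: "pc s3 < length P" "P ! pc s3 = WStore (td 1) (td 0)"
    using big_WSt.prems(1) s1(2) s2(2) s3(2) by (auto simp: codeat_append length_compW length_addr)
  have "reach W P 1 s3 ?s4" by (rule reach_instr[OF p(1,2)]) (use s3(3) v in simp)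
  then have "reach W P (costW f + (costW e + (costA a + 1))) \<sigma> ?s4" using s1(1) s2(1) s3(1) reach_trans by blast
  moreover have "rel (s\<lparr>wa := (wa s)(a := (wa s a)(evW s e := evW s f)), clk := clk s + costW f + costW e + costA a + 1\<rparr>) ?s4"
    by (rule rel_WSt[OF s3(4) ev big_WSt.hyps(3)])
  ultimately show ?case using s1(2) s2(2) s3(2)
    by (intro exI[of _ "costW f + (costW e + (costA a + 1))"] exI[of _ ?s4]) auto
next
  case (big_RSt s e f a)
  from reach_compR[of P \<sigma> 0 f s] big_RSt obtain s1 where s1: "reach W P (costR f) \<sigma> s1" "pc s1 = pc \<sigma> + costR f"
    "rreg s1 (rt 0) = evR s f" "rel s s1"
    by (auto simp: codeat_append length_compR)
  from reach_compW[of P s1 0 e s] big_RSt s1 obtain s2 where s2: "reach W P (costW e) s1 s2" "pc s2 = pc s1 + costW e"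
    "wreg s2 (td 0) = evW s e" "rel s s2" "rreg s2 = rreg s1"
    by (auto simp: codeat_append length_compR length_compW)
  have "codeat P (pc s2) (addr 0 a)" using big_RSt.prems(1) s1(2) s2(2)
    by (auto simp: codeat_append length_compW length_compR)
  from reach_addr[OF this s2(4,3) big_RSt.hyps(3)] obtain s3 where s3: "reach W P (costA a) s2 s3" "pc s3 = pc s2 + costA a"
    "wreg s3 (td 0) = loc a (evW s e)" "rel s s3" "rreg s3 = rreg s2" by auto
  have v: "rreg s3 (rt 0) = evR s f" using s1(3) s2(5) s3(5) by auto
  let ?s4 = "s3\<lparr>rmem := (rmem s3)(loc a (evW s e) := evR s f), pc := pc s3 + 1\<rparr>"
  have p: "pc s3 < length P" "P ! pc s3 = RStore (td 0) (rt 0)"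
    using big_RSt.prems(1) s1(2) s2(2) s3(2) by (auto simp: codeat_append length_compW length_compR length_addr)
  have "reach W P 1 s3 ?s4" by (rule reach_instr[OF p(1,2)]) (use s3(3) v in simp)
  then have "reach W P (costR f + (costW e + (costA a + 1))) \<sigma> ?s4" using s1(1) s2(1) s3(1) reach_trans by blast
  moreover have "rel (s\<lparr>ra := (ra s)(a := (ra s a)(evW s e := evR s f)), clk := clk s + costR f + costW e + costA a + 1\<rparr>) ?s4"
    by (rule rel_RSt[OF s3(4) big_RSt.hyps(3)])
  ultimately show ?case using s1(2) s2(2) s3(2)
    by (intro exI[of _ "costR f + (costW e + (costA a + 1))"] exI[of _ ?s4]) auto
next
  case (big_Seq c s s1 d s2)
  from big_Seq.IH(1)[of \<sigma>] big_Seq.prems obtain k1 \<sigma>1 where 1: "clk s1 = clk s + k1" "reach W P k1 \<sigma> \<sigma>1"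
    "pc \<sigma>1 = pc \<sigma> + len c" "rel s1 \<sigma>1" by (auto simp: codeat_append length_comp)
  from big_Seq.IH(2)[of \<sigma>1] big_Seq.prems 1 obtain k2 \<sigma>2 where 2: "clk s2 = clk s1 + k2" "reach W P k2 \<sigma>1 \<sigma>2"
    "pc \<sigma>2 = pc \<sigma>1 + len d" "rel s2 \<sigma>2" by (auto simp: codeat_append length_comp)
  show ?case using reach_trans[OF 1(2) 2(2)] 1 2 by (intro exI[of _ "k1 + k2"] exI[of _ \<sigma>2]) auto
next
  case (big_IfT s b c s1 d)
  let ?l2 = "pc \<sigma> + costB b + len d + 1"
  from reach_compB[of P \<sigma> ?l2 b s] big_IfT.prems big_IfT.hyps obtain \<sigma>1 where 1: "reach W P (costB b) \<sigma> \<sigma>1"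
    "pc \<sigma>1 = ?l2" "rel s \<sigma>1" by (auto simp: codeat_append Let_def)
  have "codeat P (pc \<sigma>1) (comp (pc \<sigma>1) c)" using big_IfT.prems(1) 1(2)
    by (simp add: codeat_append Let_def length_compB length_comp add.commute add.left_commute)
  from big_IfT.IH[OF this] 1(3) obtain k2 \<sigma>2 where 2: "clk s1 = clk s + costB b + k2" "reach W P k2 \<sigma>1 \<sigma>2"
    "pc \<sigma>2 = pc \<sigma>1 + len c" "rel s1 \<sigma>2" by (auto simp: rel_clk)
  show ?case using reach_trans[OF 1(1) 2(2)] 1(2) 2 by (intro exI[of _ "costB b + k2"] exI[of _ \<sigma>2]) auto
next
  case (big_IfF s b d s1 c)
  let ?l2 = "pc \<sigma> + costB b + len d + 1"
  from reach_compB[of P \<sigma> ?l2 b s] big_IfF.prems big_IfF.hyps obtain \<sigma>1 where 1: "reach W P (costB b) \<sigma> \<sigma>1"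
    "pc \<sigma>1 = pc \<sigma> + costB b" "rel s \<sigma>1" by (auto simp: codeat_append Let_def)
  have "codeat P (pc \<sigma>1) (comp (pc \<sigma>1) d)" using big_IfF.prems(1) 1(2)
    by (simp add: codeat_append Let_def length_compB length_comp)
  from big_IfF.IH[OF this] 1(3) obtain k2 \<sigma>2 where 2: "clk s1 = clk s + costB b + k2" "reach W P k2 \<sigma>1 \<sigma>2"
    "pc \<sigma>2 = pc \<sigma>1 + len d" "rel s1 \<sigma>2" by (auto simp: rel_clk)
  let ?s = "\<sigma>2\<lparr>pc := ?l2 + len c\<rparr>"
  have p: "pc \<sigma>2 < length P" "P ! pc \<sigma>2 = Jump (?l2 + len c)"
    using big_IfF.prems(1) 1(2) 2(3) by (auto simp: codeat_append Let_def length_compB length_comp)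
  have "reach W P 1 \<sigma>2 ?s" by (rule reach_instr[OF p]) simp
  from reach_trans[OF 1(1) reach_trans[OF 2(2) this]] show ?case
    using 2 rel_pc[OF 2(4)] by (intro exI[of _ "costB b + (k2 + 1)"] exI[of _ ?s]) (auto simp: rel_clk)
next
  case (big_WhileF s b c)
  let ?l = "pc \<sigma> + costB b + 1"
  from reach_compB[of P \<sigma> ?l b s] big_WhileF.prems big_WhileF.hyps obtain \<sigma>1 where 1: "reach W P (costB b) \<sigma> \<sigma>1"
    "pc \<sigma>1 = pc \<sigma> + costB b" "rel s \<sigma>1" by (auto simp: codeat_append Let_def)
  let ?s = "\<sigma>1\<lparr>pc := ?l + len c + 1\<rparr>"
  have p: "pc \<sigma>1 < length P" "P ! pc \<sigma>1 = Jump (?l + len c + 1)"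
    using big_WhileF.prems(1) 1(2) by (auto simp: codeat_append Let_def length_compB length_comp)
  have "reach W P 1 \<sigma>1 ?s" by (rule reach_instr[OF p]) simp
  from reach_trans[OF 1(1) this] show ?case
    using rel_pc[OF 1(3)] by (intro exI[of _ "costB b + 1"] exI[of _ ?s]) (auto simp: rel_clk)
next
  case (big_WhileT s b c s1 s2)
  let ?l = "pc \<sigma> + costB b + 1"
  from reach_compB[of P \<sigma> ?l b s] big_WhileT.prems big_WhileT.hyps obtain \<sigma>1 where 1: "reach W P (costB b) \<sigma> \<sigma>1"
    "pc \<sigma>1 = ?l" "rel s \<sigma>1" by (auto simp: codeat_append Let_def)
  have "codeat P (pc \<sigma>1) (comp (pc \<sigma>1) c)" using big_WhileT.prems(1) 1(2)
    by (simp add: codeat_append Let_def length_compB)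
  from big_WhileT.IH(1)[OF this] 1(3) obtain k2 \<sigma>2 where 2: "clk s1 = clk s + costB b + k2" "reach W P k2 \<sigma>1 \<sigma>2"
    "pc \<sigma>2 = pc \<sigma>1 + len c" "rel s1 \<sigma>2" by (auto simp: rel_clk)
  let ?s = "\<sigma>2\<lparr>pc := pc \<sigma>\<rparr>"
  have p: "pc \<sigma>2 < length P" "P ! pc \<sigma>2 = Jump (pc \<sigma>)"
    using big_WhileT.prems(1) 1(2) 2(3) by (auto simp: codeat_append Let_def length_compB length_comp)
  have 3: "reach W P 1 \<sigma>2 ?s" by (rule reach_instr[OF p]) simp
  have "codeat P (pc ?s) (comp (pc ?s) (While b c))" using big_WhileT.prems(1) by simp
  from big_WhileT.IH(2)[OF this] rel_pc[OF 2(4)] obtain k4 \<sigma>4 where 4: "clk s2 = clk s1 + 1 + k4"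
    "reach W P k4 ?s \<sigma>4" "pc \<sigma>4 = pc ?s + len (While b c)" "rel s2 \<sigma>4" by (auto simp: rel_clk)
  from reach_trans[OF 1(1) reach_trans[OF 2(2) reach_trans[OF 3 4(2)]]] show ?case
    using 2 4 by (intro exI[of _ "costB b + (k2 + (1 + k4))"] exI[of _ \<sigma>4]) auto
qed

end

section \<open>Weakest preconditions\<close>

primrec modW :: "cmd \<Rightarrow> nat set" where
  "modW SKIP = {}"
| "modW (WSet i e) = {i}"
| "modW (RSet i e) = {}"
| "modW (WSt a e f) = {}"
| "modW (RSt a e f) = {}"
| "modW (c ;; d) = modW c \<union> modW d"
| "modW (If b c d) = modW c \<union> modW d"
| "modW (While b c) = modW c"

primrec modR :: "cmd \<Rightarrow> nat set" where
  "modR SKIP = {}"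
| "modR (WSet i e) = {}"
| "modR (RSet i e) = {i}"
| "modR (WSt a e f) = {}"
| "modR (RSt a e f) = {}"
| "modR (c ;; d) = modR c \<union> modR d"
| "modR (If b c d) = modR c \<union> modR d"
| "modR (While b c) = modR c"

primrec modWA :: "cmd \<Rightarrow> nat set" where
  "modWA SKIP = {}"
| "modWA (WSet i e) = {}"
| "modWA (RSet i e) = {}"
| "modWA (WSt a e f) = {a}"
| "modWA (RSt a e f) = {}"
| "modWA (c ;; d) = modWA c \<union> modWA d"
| "modWA (If b c d) = modWA c \<union> modWA d"
| "modWA (While b c) = modWA c"

primrec modRA :: "cmd \<Rightarrow> nat set" where
  "modRA SKIP = {}"
| "modRA (WSet i e) = {}"
| "modRA (RSet i e) = {}"
| "modRA (WSt a e f) = {}"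
| "modRA (RSt a e f) = {a}"
| "modRA (c ;; d) = modRA c \<union> modRA d"
| "modRA (If b c d) = modRA c \<union> modRA d"
| "modRA (While b c) = modRA c"

definition frame :: "cmd \<Rightarrow> st \<Rightarrow> st \<Rightarrow> bool" where
  "frame c s s' \<longleftrightarrow> (\<forall>i. i \<notin> modW c \<longrightarrow> wv s' i = wv s i) \<and> (\<forall>i. i \<notin> modR c \<longrightarrow> rv s' i = rv s i) \<and>
     (\<forall>a. a \<notin> modWA c \<longrightarrow> wa s' a = wa s a) \<and> (\<forall>a. a \<notin> modRA c \<longrightarrow> ra s' a = ra s a)"

lemma frame_refl: "frame c s s" "frame c s (s\<lparr>clk := t\<rparr>)" by (simp_all add: frame_def)

lemma frame_trans: "frame c s1 s2 \<Longrightarrow> frame c s2 s3 \<Longrightarrow> frame c s1 s3"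
  by (simp add: frame_def)

lemma frame_clk: "frame c (s\<lparr>clk := t\<rparr>) s' = frame c s s'" "frame c s (s'\<lparr>clk := t\<rparr>) = frame c s s'"
  by (simp_all add: frame_def)

definition For :: "nat \<Rightarrow> nat \<Rightarrow> cmd \<Rightarrow> cmd" where
  "For i j c = (WSet i (WC 0) ;; While (WLess (WV i) (WV j)) (c ;; WSet i (WB Add (WV i) (WC 1))))"

lemma mod_For [simp]: "modW (For i j c) = insert i (modW c)" "modR (For i j c) = modR c"
    "modWA (For i j c) = modWA c" "modRA (For i j c) = modRA c"
  by (auto simp: For_def)

context ram
begin

lemma big_frame: "big c s s' \<Longrightarrow> frame c s s'"
  by (induction rule: big.induct) (auto simp: frame_def)

text \<open>This is total correctness, because runs that diverge or overflow have no
  derivation.\<close>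

definition wp :: "cmd \<Rightarrow> (st \<Rightarrow> bool) \<Rightarrow> st \<Rightarrow> bool" where
  "wp c Q s \<longleftrightarrow> (\<exists>s'. big c s s' \<and> Q s')"

lemma wp_SKIP: "wp SKIP Q s = Q s"
  by (auto simp: wp_def intro: big.intros elim: big.cases)

lemma wp_WSet: "wp (WSet i e) Q s =
    (okW s e \<and> Q (s\<lparr>wv := (wv s)(i := evW s e), clk := clk s + costW e + 2\<rparr>))"
  by (auto simp: wp_def intro: big.intros elim: big.cases)

lemma wp_RSet: "wp (RSet i e) Q s =
    (okR s e \<and> Q (s\<lparr>rv := (rv s)(i := evR s e), clk := clk s + costR e + 3\<rparr>))"
  by (auto simp: wp_def intro: big.intros elim: big.cases)

lemma wp_WSt: "wp (WSt a e f) Q s =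
    (okW s e \<and> okW s f \<and> okA a (evW s e) \<and> Q (s\<lparr>wa := (wa s)(a := (wa s a)(evW s e := evW s f)),
      clk := clk s + costW f + costW e + costA a + 1\<rparr>))"
  by (auto simp: wp_def intro: big.intros elim: big.cases)

lemma wp_RSt: "wp (RSt a e f) Q s =
    (okW s e \<and> okR s f \<and> okA a (evW s e) \<and> Q (s\<lparr>ra := (ra s)(a := (ra s a)(evW s e := evR s f)),
      clk := clk s + costR f + costW e + costA a + 1\<rparr>))"
  by (auto simp: wp_def intro: big.intros elim: big.cases)

lemma wp_Seq: "wp (c ;; d) Q s = wp c (wp d Q) s"
  unfolding wp_def by (blast intro: big_Seq elim: big.cases[of "c ;; d" s for c d s, simplified])

lemma wp_If: "wp (If b c d) Q s = (okB s b \<and>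
    (if evB s b then wp c Q (s\<lparr>clk := clk s + costB b\<rparr>)
     else wp d (\<lambda>s'. Q (s'\<lparr>clk := clk s' + 1\<rparr>)) (s\<lparr>clk := clk s + costB b\<rparr>)))"
proof
  assume "wp (If b c d) Q s"
  then obtain s' where "big (If b c d) s s'" "Q s'" by (auto simp: wp_def)
  then show "okB s b \<and> (if evB s b then wp c Q (s\<lparr>clk := clk s + costB b\<rparr>)
     else wp d (\<lambda>s'. Q (s'\<lparr>clk := clk s' + 1\<rparr>)) (s\<lparr>clk := clk s + costB b\<rparr>))"
    by (cases rule: big.cases) (auto simp: wp_def)
qed (auto simp: wp_def intro: big.intros split: if_splits)

lemmas wp_simps = wp_SKIP wp_WSet wp_RSet wp_WSt wp_RSt wp_Seq wp_If okA_def

lemma wp_conseq: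
  assumes "wp c Q s" "\<And>s'. Q s' \<Longrightarrow> frame c s s' \<Longrightarrow> R s'"
  shows "wp c R s"
  using assms big_frame unfolding wp_def by blast

text \<open>The number of iterations is fixed in advance by \<open>N\<close>. The function
  \<open>ph\<close> is a potential: an iteration may exceed its budget \<tau> by the amount by which
  it lowers \<open>ph\<close>. The invariant must not mention the clock, since guards and jumps
  advance it between iterations.\<close>

lemma wp_While_aux:
  assumes "I k s" "k \<le> N"
    and guard: "\<And>k s'. k \<le> N \<Longrightarrow> I k s' \<Longrightarrow> okB s' b \<and> (evB s' b \<longleftrightarrow> k < N)"
    and step: "\<And>k s'. k < N \<Longrightarrow> I k s' \<Longrightarrow> wp c (\<lambda>s''. I (Suc k) s'' \<and> clk s'' + ph (Suc k) s'' \<le> clk s' + ph k s' + \<tau>) s'"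
    and stab: "\<And>k s t. I k s \<Longrightarrow> I k (s\<lparr>clk := t\<rparr>)" "\<And>k s t. ph k (s\<lparr>clk := t\<rparr>) = (ph k s :: nat)"
  shows "wp (While b c) (\<lambda>s'. I N s' \<and>
    clk s' + ph N s' \<le> clk s + ph k s + (N - k) * (\<tau> + costB b + 1) + costB b + 1) s"
  using assms(1,2)
proof (induction "N - k" arbitrary: k s)
  case 0
  then show ?case using guard[of k s] stab big_WhileF[of s b c] unfolding wp_def
    by (intro exI[of _ "s\<lparr>clk := clk s + costB b + 1\<rparr>"]) auto
next
  case (Suc d)
  then have k: "k < N" by simp
  let ?s = "s\<lparr>clk := clk s + costB b\<rparr>"
  obtain s1 where s1: "big c ?s s1" "I (Suc k) s1" "clk s1 + ph (Suc k) s1 \<le> clk s + costB b + ph k s + \<tau>"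
    using step[OF k stab(1)[OF Suc.prems(1)], of "clk s + costB b"] stab(2) by (auto simp: wp_def)
  let ?s1 = "s1\<lparr>clk := clk s1 + 1\<rparr>"
  have d: "d = N - Suc k" using Suc.hyps(2) by simp
  have "Suc k \<le> N" using k by simp
  from Suc.hyps(1)[OF d stab(1)[OF s1(2)] this, of "clk s1 + 1"]
  obtain s2 where s2: "big (While b c) ?s1 s2" "I N s2"
      "clk s2 + ph N s2 \<le> clk s1 + 1 + ph (Suc k) s1 + (N - Suc k) * (\<tau> + costB b + 1) + costB b + 1"
    by (auto simp: wp_def stab(2))
  have "N - k = Suc (N - Suc k)" using k by simp
  then have "(N - k) * (\<tau> + costB b + 1) = (N - Suc k) * (\<tau> + costB b + 1) + (\<tau> + costB b + 1)" by simp
  then have "clk s2 + ph N s2 \<le> clk s + ph k s + (N - k) * (\<tau> + costB b + 1) + costB b + 1"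
    using s2(3) s1(3) by linarith
  moreover have "big (While b c) s s2"
    using big_WhileT[OF _ _ s1(1) s2(1)] guard[OF Suc.prems(2,1)] k by blast
  ultimately show ?case using s2(2) unfolding wp_def by blast
qed

lemma wp_WhileP:
  assumes "I 0 s"
    and guard: "\<And>k s'. k \<le> N \<Longrightarrow> I k s' \<Longrightarrow> frame c s s' \<Longrightarrow> okB s' b \<and> (evB s' b \<longleftrightarrow> k < N)"
    and step: "\<And>k s'. k < N \<Longrightarrow> I k s' \<Longrightarrow> frame c s s' \<Longrightarrow>
      wp c (\<lambda>s''. I (Suc k) s'' \<and> clk s'' + ph (Suc k) s'' \<le> clk s' + ph k s' + \<tau>) s'"
    and stab: "\<And>k s t. I k s \<Longrightarrow> I k (s\<lparr>clk := t\<rparr>)" "\<And>k s t. ph k (s\<lparr>clk := t\<rparr>) = (ph k s :: nat)"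
    and post: "\<And>s'. I N s' \<Longrightarrow> frame c s s' \<Longrightarrow>
      clk s' + ph N s' \<le> clk s + ph 0 s + N * (\<tau> + costB b + 1) + costB b + 1 \<Longrightarrow> R s'"
  shows "wp (While b c) R s"
proof (rule wp_conseq[OF wp_While_aux[where I = "\<lambda>k s'. I k s' \<and> frame c s s'" and k = 0 and N = N and ph = ph and \<tau> = \<tau>]])
  fix k s' assume k: "k < N" and I: "I k s' \<and> frame c s s'"
  show "wp c (\<lambda>s''. (I (Suc k) s'' \<and> frame c s s'') \<and> clk s'' + ph (Suc k) s'' \<le> clk s' + ph k s' + \<tau>) s'"
    by (rule wp_conseq[OF step[OF k]]) (use I frame_trans in blast)+
qed (use assms frame_refl in \<open>auto simp: frame_clk\<close>)

text \<open>In each iteration the guard costs 5, the increment 6 and the jump back 1, which makes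
  12. The initialisation costs 3 and leaving the loop 6, which makes 9.\<close>

lemma wp_ForP:
  assumes N: "wv s j = N" "N < W" "i \<noteq> j" "i \<notin> modW c" "j \<notin> modW c"
    and init: "I 0 s"
    and step: "\<And>k s'. k < N \<Longrightarrow> I k s' \<Longrightarrow> wv s' i = k \<Longrightarrow> frame (For i j c) s s' \<Longrightarrow>
      wp c (\<lambda>s''. I (Suc k) s'' \<and> clk s'' + ph (Suc k) s'' \<le> clk s' + ph k s' + \<tau>) s'"
    and stab: "\<And>k s x t. I k s \<Longrightarrow> I k (s\<lparr>wv := (wv s)(i := x), clk := t\<rparr>)"
      "\<And>k s x t. ph k (s\<lparr>wv := (wv s)(i := x), clk := t\<rparr>) = (ph k s :: nat)"
    and post: "\<And>s'. I N s' \<Longrightarrow> frame (For i j c) s s' \<Longrightarrow>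
      clk s' + ph N s' \<le> clk s + ph 0 s + N * (\<tau> + 12) + 9 \<Longrightarrow> R s'"
  shows "wp (For i j c) R s"
proof -
  let ?F = "frame (For i j c)" and ?c = "c ;; WSet i (WB Add (WV i) (WC 1))"
  let ?s0 = "s\<lparr>wv := (wv s)(i := 0), clk := clk s + costW (WC 0) + 2\<rparr>"
  have F: "?F = frame ?c" by (intro ext) (auto simp: frame_def)
  have cl: "I k (t\<lparr>clk := x\<rparr>)" if "I k t" for k t x using stab(1)[OF that, where x = "wv t i" and t = x] by simp
  have cp: "ph k (t\<lparr>clk := x\<rparr>) = ph k t" for k t x using stab(2)[where k = k and s = t and x = "wv t i" and t = x] by simp
  have "wp (While (WLess (WV i) (WV j)) ?c) R ?s0"
  proof (rule wp_WhileP[where I = "\<lambda>k s'. I k s' \<and> wv s' i = k \<and> frame ?c s s'" and N = N and ph = ph and \<tau> = "\<tau> + 6"])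
    show "I 0 ?s0 \<and> wv ?s0 i = 0 \<and> frame ?c s ?s0" using stab(1)[OF init] by (auto simp: frame_def)
  next
    fix k s' assume k: "k < N" and I: "I k s' \<and> wv s' i = k \<and> frame ?c s s'"
    have "wp c (\<lambda>s''. I (Suc k) s'' \<and> clk s'' + ph (Suc k) s'' \<le> clk s' + ph k s' + \<tau>) s'"
      using step[OF k] I unfolding F by blast
    then have "wp c (\<lambda>s''. I (Suc k) s'' \<and> clk s'' + ph (Suc k) s'' \<le> clk s' + ph k s' + \<tau> \<and> frame c s' s'') s'"
      by (rule wp_conseq) blast
    then have "wp ?c (\<lambda>s''. (I (Suc k) s'' \<and> wv s'' i = Suc k) \<and>
        clk s'' + ph (Suc k) s'' \<le> clk s' + ph k s' + (\<tau> + 6)) s'"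
      unfolding wp_Seq
      by (rule wp_conseq) (use I N k stab in \<open>auto simp: wp_WSet frame_def\<close>)
    then show "wp ?c (\<lambda>s''. (I (Suc k) s'' \<and> wv s'' i = Suc k \<and> frame ?c s s'') \<and>
        clk s'' + ph (Suc k) s'' \<le> clk s' + ph k s' + (\<tau> + 6)) s'"
      by (rule wp_conseq) (use I frame_trans in blast)
  next
    fix k s' assume k: "k \<le> N" and I: "I k s' \<and> wv s' i = k \<and> frame ?c s s'"
    have "wv s' j = N" using I N unfolding frame_def by auto
    then show "okB s' (WLess (WV i) (WV j)) \<and> (evB s' (WLess (WV i) (WV j)) \<longleftrightarrow> k < N)" using I k by auto
  next
    fix s' assume I: "I N s' \<and> wv s' i = N \<and> frame ?c s s'"
      and t: "clk s' + ph N s' \<le> clk ?s0 + ph 0 ?s0 + N * (\<tau> + 6 + costB (WLess (WV i) (WV j)) + 1) + costB (WLess (WV i) (WV j)) + 1"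
    show "R s'" using post[of s'] I t unfolding F by (simp add: stab(2) add.commute add.left_commute)
  qed (use cl cp in \<open>auto simp: frame_clk\<close>)
  then show ?thesis using fits by (simp add: For_def wp_Seq wp_WSet)
qed

lemma wp_For:
  assumes N: "wv s j = N" "N < W" "i \<noteq> j" "i \<notin> modW c" "j \<notin> modW c"
    and init: "I 0 s"
    and step: "\<And>k s'. k < N \<Longrightarrow> I k s' \<Longrightarrow> wv s' i = k \<Longrightarrow> frame (For i j c) s s' \<Longrightarrow>
      wp c (\<lambda>s''. I (Suc k) s'' \<and> clk s'' \<le> clk s' + \<tau>) s'"
    and stab: "\<And>k s x t. I k s \<Longrightarrow> I k (s\<lparr>wv := (wv s)(i := x), clk := t\<rparr>)"
    and post: "\<And>s'. I N s' \<Longrightarrow> frame (For i j c) s s' \<Longrightarrow> clk s' \<le> clk s + N * (\<tau> + 12) + 9 \<Longrightarrow> R s'"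
  shows "wp (For i j c) R s"
  by (rule wp_ForP[where I = I and ph = "\<lambda>_ _. 0", OF N init _ stab]) (use step post in auto)

end

section \<open>Walks and cycles\<close>

definition wt :: "(nat \<Rightarrow> real) \<Rightarrow> nat list \<Rightarrow> real" where
  "wt w es = (\<Sum>e\<leftarrow>es. w e)"

lemma wt_simps [simp]: "wt w [] = 0" "wt w (e # es) = w e + wt w es" "wt w (es @ fs) = wt w es + wt w fs"
  by (simp_all add: wt_def)

lemma wt_diff: "wt (\<lambda>e. c e - x * t e) es = wt c es - x * wt t es"
  by (induction es) (auto simp: algebra_simps)

locale arc_graph =
  fixes n m :: nat and src dst :: "nat \<Rightarrow> nat"
  assumes src: "e < m \<Longrightarrow> src e < n" and dst: "e < m \<Longrightarrow> dst e < n"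
begin

fun walk :: "nat \<Rightarrow> nat list \<Rightarrow> nat \<Rightarrow> bool" where
  "walk u [] v = (u = v)"
| "walk u (e # es) v = (e < m \<and> src e = u \<and> walk (dst e) es v)"

lemma walk_append: "walk u (es @ fs) v \<longleftrightarrow> (\<exists>x. walk u es x \<and> walk x fs v)"
  by (induction es arbitrary: u) auto

lemma walk_last: "walk u es v \<Longrightarrow> es \<noteq> [] \<Longrightarrow> dst (last es) = v"
  by (induction es arbitrary: u) (auto split: if_splits)

lemma walk_set: "walk u es v \<Longrightarrow> set es \<subseteq> {..<m}"
  by (induction es arbitrary: u) auto

lemma walk_ends: "walk u es v \<Longrightarrow> es \<noteq> [] \<Longrightarrow> u < n \<and> v < n"
proof -
  assume a: "walk u es v" "es \<noteq> []"
  have "last es < m" using walk_set[OF a(1)] last_in_set[OF a(2)] by auto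
  then show ?thesis using walk_last[OF a] dst src a by (cases es) auto
qed

definition closed :: "nat list \<Rightarrow> bool" where
  "closed es \<longleftrightarrow> es \<noteq> [] \<and> (\<exists>u. walk u es u)"

definition cyc :: "nat list \<Rightarrow> bool" where
  "cyc es \<longleftrightarrow> closed es \<and> distinct (map dst es)"

text \<open>Two arcs with the same head enclose a closed piece. It is cut out behind the first of
  them, which stays and keeps the remaining walk nonempty.\<close>

lemma walk_split:
  assumes "walk u es v" "\<not> distinct (map dst es)"
  obtains as bs cs x where "es = as @ bs @ cs" "bs \<noteq> []" "as @ cs \<noteq> []" "walk u (as @ cs) v" "walk x bs x"
proof -
  from not_distinct_decomp[OF assms(2)] obtain xs ys zs y where
    d: "map dst es = xs @ [y] @ ys @ [y] @ zs" by blast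
  obtain as r0 where 0: "es = as @ r0" "map dst r0 = y # ys @ y # zs"
    using d by (auto simp: map_eq_append_conv)
  obtain e r where r: "r0 = e # r" "dst e = y" "map dst r = ys @ y # zs" using 0(2) by (cases r0) auto
  obtain bs r1 where r1: "r = bs @ r1" "map dst r1 = y # zs" using r(3) by (auto simp: map_eq_append_conv)
  obtain f cs where "r1 = f # cs" "dst f = y" using r1(2) by (cases r1) auto
  note 1 = 0(1) r(1,2) and 2 = r1(1) this
  show thesis
    by (rule that[of "as @ [e]" "bs @ [f]" cs y]) (use assms(1) 1 2 in \<open>auto simp: walk_append\<close>)
qed

text \<open>A closed walk decomposes into cycles, so a sign condition preserved by addition passes
  from cycles to closed walks.\<close>

lemma closed_induct_wt:
  assumes cyc: "\<And>q. cyc q \<Longrightarrow> P (wt w q)" and add: "\<And>x y. P x \<Longrightarrow> P y \<Longrightarrow> P (x + y)"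
  shows "closed es \<Longrightarrow> P (wt w es)"
proof (induction "length es" arbitrary: es rule: less_induct)
  case less
  show ?case
  proof (cases "distinct (map dst es)")
    case True
    then show ?thesis using cyc less.prems by (simp add: cyc_def)
  next
    case False
    obtain u where "walk u es u" using less.prems by (auto simp: closed_def)
    from walk_split[OF this False] obtain as bs cs x where
      d: "es = as @ bs @ cs" "bs \<noteq> []" "as @ cs \<noteq> []" "walk u (as @ cs) u" "walk x bs x" .
    have "P (wt w (as @ cs))" by (rule less.hyps) (use d in \<open>auto simp: closed_def\<close>)
    moreover have "P (wt w bs)" by (rule less.hyps) (use d in \<open>auto simp: closed_def\<close>)
    ultimately have "P (wt w (as @ cs) + wt w bs)" by (rule add)
    then show ?thesis using d(1) by (simp add: algebra_simps)
  qed
qed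

lemma distinct_length:
  assumes "walk u es v" "distinct (map dst es)" shows "length es \<le> n"
proof -
  have "set (map dst es) \<subseteq> {..<n}" using walk_set[OF assms(1)] dst by auto
  then show ?thesis using card_mono[of "{..<n}" "set (map dst es)"] distinct_card[OF assms(2)] by simp
qed

text \<open>Cutting out closed pieces never increases the weight. The bound is \<open>n\<close> and
  not \<open>n - 1\<close> because only the heads become distinct and the start vertex may recur;
  hence Bellman-Ford makes \<open>n\<close> rounds.\<close>

lemma shorten_walk:
  assumes nn: "\<And>q. closed q \<Longrightarrow> 0 \<le> wt w q"
  shows "walk u es v \<Longrightarrow> \<exists>fs. walk u fs v \<and> length fs \<le> n \<and> wt w fs \<le> wt w es"
proof (induction "length es" arbitrary: es rule: less_induct)
  case less
  show ?case
  proof (cases "distinct (map dst es)")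
    case True
    then show ?thesis using distinct_length[OF less.prems] less.prems by blast
  next
    case False
    from walk_split[OF less.prems False] obtain as bs cs x where
      d: "es = as @ bs @ cs" "bs \<noteq> []" "walk u (as @ cs) v" "walk x bs x" .
    from less.hyps[OF _ d(3)] d obtain fs where "walk u fs v" "length fs \<le> n" "wt w fs \<le> wt w (as @ cs)"
      by auto
    moreover have "0 \<le> wt w bs" using d nn by (auto simp: closed_def)
    ultimately show ?thesis using d(1) by (intro exI[of _ fs]) auto
  qed
qed

lemma finite_cyc: "finite {q. cyc q}"
proof (rule finite_subset)
  show "{q. cyc q} \<subseteq> {es. set es \<subseteq> {..<m} \<and> length es \<le> n}"
    using walk_set distinct_length unfolding cyc_def closed_def by blast
qed (simp add: finite_lists_length_le)

subsection \<open>Bellman-Ford\<close>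

definition relax :: "(nat \<Rightarrow> real) \<Rightarrow> nat \<Rightarrow> (nat \<Rightarrow> real) \<Rightarrow> nat \<Rightarrow> real" where
  "relax w e d = (if d (src e) + w e < d (dst e) then d(dst e := d (src e) + w e) else d)"

text \<open>All distances start at zero, as if from a source joined to every vertex, so walks may
  begin anywhere. Arcs are relaxed in place, so a distance may already belong to a longer walk;
  \<open>k\<close> therefore occurs only in upper bounds. The last clause records the progress
  \<open>j\<close> within the current round.\<close>

definition bf_inv :: "(nat \<Rightarrow> real) \<Rightarrow> nat \<Rightarrow> nat \<Rightarrow> (nat \<Rightarrow> real) \<Rightarrow> bool" where
  "bf_inv w k j d \<longleftrightarrow> (\<forall>v<n. \<exists>u es. walk u es v \<and> d v = wt w es) \<and>
     (\<forall>v<n. \<forall>u es. walk u es v \<longrightarrow> length es \<le> k \<longrightarrow> d v \<le> wt w es) \<and>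
     (\<forall>e<j. \<forall>u es. walk u es (src e) \<longrightarrow> length es \<le> k \<longrightarrow> d (dst e) \<le> wt w es + w e)"

lemma bf_inv_init:
  assumes "\<And>v. v < n \<Longrightarrow> d v = 0" shows "bf_inv w 0 0 d"
proof -
  have "\<exists>u es. walk u es v \<and> wt w es = 0" for v by (rule exI[of _ v], rule exI[of _ "[]"]) simp
  then show ?thesis using assms unfolding bf_inv_def by auto
qed

lemma bf_inv_relax:
  assumes i: "bf_inv w k j d" and j: "j < m"
  shows "bf_inv w k (Suc j) (relax w j d)"
proof -
  have le: "relax w j d v \<le> d v" for v by (simp add: relax_def)
  have new: "relax w j d (dst j) \<le> d (src j) + w j" by (simp add: relax_def)
  have r: "\<exists>u es. walk u es v \<and> relax w j d v = wt w es" if v: "v < n" for v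
  proof (cases "relax w j d v = d v")
    case True
    then show ?thesis using i v unfolding bf_inv_def by simp
  next
    case False
    then have v': "v = dst j" "relax w j d v = d (src j) + w j" by (auto simp: relax_def split: if_splits)
    obtain u es where "walk u es (src j)" "d (src j) = wt w es" using i src[OF j] unfolding bf_inv_def by blast
    then show ?thesis using v' j by (intro exI[of _ u] exI[of _ "es @ [j]"]) (auto simp: walk_append)
  qed
  have "relax w j d (dst e) \<le> wt w es + w e"
    if "e < Suc j" "walk u es (src e)" "length es \<le> k" for e u es
  proof (cases "e = j")
    case True
    then show ?thesis using new i that src[OF j] unfolding bf_inv_def by fastforce
  next
    case False
    then have "e < j" using that by simp
    then have "d (dst e) \<le> wt w es + w e" using i that unfolding bf_inv_def by blast
    then show ?thesis using le[of "dst e"] by linarith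
  qed
  then show ?thesis using r le i unfolding bf_inv_def by (meson order_trans)
qed

lemma bf_inv_round:
  assumes i: "bf_inv w k m d"
  shows "bf_inv w (Suc k) 0 d"
proof -
  have "d v \<le> wt w es" if v: "v < n" "walk u es v" "length es \<le> Suc k" for v u es
  proof (cases es rule: rev_cases)
    case Nil
    then show ?thesis using i v unfolding bf_inv_def by fastforce
  next
    case (snoc fs e)
    then have "walk u fs (src e)" "e < m" "dst e = v" "length fs \<le> k" using v by (auto simp: walk_append)
    then show ?thesis using i snoc unfolding bf_inv_def by fastforce
  qed
  then show ?thesis using i unfolding bf_inv_def by blast
qed

lemma potential_walk:
  assumes "\<And>e. e < m \<Longrightarrow> d (dst e) \<le> d (src e) + w e"
  shows "walk u es v \<Longrightarrow> d v \<le> d u + wt w es"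
proof (induction es arbitrary: u)
  case (Cons e es)
  then show ?case using assms[of e] by fastforce
qed simp

text \<open>Without negative closed walks, the walk behind a distance, extended by one arc, can be
  shortened to at most \<open>n\<close> arcs and has thus been taken into account. Conversely, if no
  arc is violated, the potential differences around a closed walk cancel and its weight is
  nonnegative.\<close>

lemma bf_inv_final:
  assumes i: "bf_inv w n 0 d"
  shows "(\<exists>e<m. d (src e) + w e < d (dst e)) \<longleftrightarrow> (\<exists>q. closed q \<and> wt w q < 0)"
proof
  show "\<exists>q. closed q \<and> wt w q < 0" if "\<exists>e<m. d (src e) + w e < d (dst e)"
  proof (rule ccontr)
    assume "\<not> ?thesis"
    then have nn: "\<And>q. closed q \<Longrightarrow> 0 \<le> wt w q" by force
    from that obtain e where e: "e < m" "d (src e) + w e < d (dst e)" by blast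
    obtain u es where es: "walk u es (src e)" "d (src e) = wt w es" using i src[OF e(1)] unfolding bf_inv_def by blast
    then have "walk u (es @ [e]) (dst e)" using e by (auto simp: walk_append)
    from shorten_walk[OF nn this] obtain fs where "walk u fs (dst e)" "length fs \<le> n" "wt w fs \<le> wt w (es @ [e])"
      by blast
    then show False using i dst[OF e(1)] e(2) es(2) unfolding bf_inv_def by fastforce
  qed
  show "\<exists>e<m. d (src e) + w e < d (dst e)" if "\<exists>q. closed q \<and> wt w q < 0"
  proof (rule ccontr)
    assume "\<not> ?thesis"
    then have p: "\<And>e. e < m \<Longrightarrow> d (dst e) \<le> d (src e) + w e" by force
    from that obtain q u where "walk u q u" "wt w q < 0" by (auto simp: closed_def)
    then show False using potential_walk[of d w, OF p] by fastforce
  qed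
qed

text \<open>The inequalities for the arc and for the pieces before and after it add up to an
  equality, so none of them is strict.\<close>

lemma potential_tight:
  assumes p: "\<And>e. e < m \<Longrightarrow> d (dst e) \<le> d (src e) + w e"
    and q: "walk u q v" "d v = d u + wt w q" and e: "e \<in> set q"
  shows "d (dst e) = d (src e) + w e"
proof -
  obtain as bs where s: "q = as @ e # bs" using e by (meson split_list)
  with q have 1: "walk u as (src e)" "walk (dst e) bs v" "e < m" by (auto simp: walk_append)
  have "d (src e) \<le> d u + wt w as" "d v \<le> d (dst e) + wt w bs"
    using potential_walk[of d w, OF p] 1 by blast+
  then show ?thesis using q(2) s p[OF 1(3)] by simp
qed

lemma walk_tight:
  "walk u q v \<Longrightarrow> (\<And>e. e \<in> set q \<Longrightarrow> d (dst e) = d (src e) + w e) \<Longrightarrow> d v = d u + wt w q"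
  by (induction q arbitrary: u) (auto simp: algebra_simps)

subsection \<open>Finding a cycle\<close>

text \<open>After \<open>k\<close> rounds the mark of a vertex is \<open>k\<close> iff an allowed walk of length \<open>k\<close> starts there.\<close>

definition mk_inv :: "(nat \<Rightarrow> bool) \<Rightarrow> nat \<Rightarrow> nat \<Rightarrow> (nat \<Rightarrow> nat) \<Rightarrow> (nat \<Rightarrow> nat) \<Rightarrow> bool" where
  "mk_inv al k j mk nx \<longleftrightarrow> (\<forall>u<n. mk u \<le> Suc k) \<and>
     (\<forall>u<n. 0 < mk u \<longrightarrow> nx u < m \<and> al (nx u) \<and> src (nx u) = u \<and> mk u \<le> Suc (mk (dst (nx u)))) \<and>
     (\<forall>q. closed q \<longrightarrow> (\<forall>e\<in>set q. al e) \<longrightarrow> (\<forall>e\<in>set q. k \<le> mk (src e) \<and> (e < j \<longrightarrow> Suc k \<le> mk (src e))))"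

lemma mk_inv_init: "(\<And>u. u < n \<Longrightarrow> mk u = 0) \<Longrightarrow> mk_inv al 0 0 mk nx"
  unfolding mk_inv_def by auto

lemma closed_next: "closed q \<Longrightarrow> e \<in> set q \<Longrightarrow> \<exists>f\<in>set q. src f = dst e"
proof -
  assume q: "closed q" "e \<in> set q"
  then obtain u where "walk u q u" by (auto simp: closed_def)
  moreover obtain as bs where "q = as @ e # bs" using split_list[OF q(2)] by blast
  ultimately have "walk u (as @ e # bs) u" by simp
  then have "walk (dst e) bs u" "walk u as (src e)" by (auto simp: walk_append)
  then show ?thesis using \<open>q = _\<close> by (cases bs; cases as) auto
qed

lemma mk_inv_step:
  assumes i: "mk_inv al k j mk nx" and j: "j < m" and c: "al j" "k \<le> mk (dst j)"
  shows "mk_inv al k (Suc j) (mk(src j := Suc k)) (nx(src j := j))"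
proof -
  have le: "mk u \<le> (mk(src j := Suc k)) u" if "u < n" for u using i that unfolding mk_inv_def by auto
  have 2: "(nx(src j := j)) u < m \<and> al ((nx(src j := j)) u) \<and> src ((nx(src j := j)) u) = u \<and>
      (mk(src j := Suc k)) u \<le> Suc ((mk(src j := Suc k)) (dst ((nx(src j := j)) u)))"
    if "u < n" "0 < (mk(src j := Suc k)) u" for u
  proof (cases "u = src j")
    case True
    then show ?thesis using j c by auto
  next
    case False
    then have a: "nx u < m" "al (nx u)" "src (nx u) = u" "mk u \<le> Suc (mk (dst (nx u)))"
      using i that unfolding mk_inv_def by auto
    then show ?thesis using False le[OF dst[OF a(1)]] by auto
  qed
  have "k \<le> (mk(src j := Suc k)) (src e) \<and> (e < Suc j \<longrightarrow> Suc k \<le> (mk(src j := Suc k)) (src e))"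
    if "closed q" "\<forall>e\<in>set q. al e" "e \<in> set q" for q e
    using i that unfolding mk_inv_def by (auto simp: less_Suc_eq)
  then show ?thesis using i 2 unfolding mk_inv_def by auto
qed

text \<open>An arc of an allowed closed walk is never skipped: its head is the tail of another arc
  of the walk and therefore has a mark of at least \<open>k\<close>.\<close>

lemma mk_inv_skip:
  assumes i: "mk_inv al k j mk nx" and j: "j < m" and c: "\<not> (al j \<and> k \<le> mk (dst j))"
  shows "mk_inv al k (Suc j) mk nx"
proof -
  have "e < j" if h: "closed q" "\<forall>e\<in>set q. al e" "e \<in> set q" "e < Suc j" for q e
  proof (rule ccontr)
    assume "\<not> e < j"
    then have "e = j" using that by simp
    moreover obtain f where "f \<in> set q" "src f = dst e" using closed_next[OF h(1,3)] by blast
    ultimately show False using c i that unfolding mk_inv_def by metis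
  qed
  then show ?thesis using i unfolding mk_inv_def by blast
qed

lemma mk_inv_round:
  assumes i: "mk_inv al k m mk nx" shows "mk_inv al (Suc k) 0 mk nx"
proof -
  have "e < m" if "closed q" "e \<in> set q" for q e using that walk_set unfolding closed_def by blast
  then show ?thesis using i unfolding mk_inv_def by (auto simp: le_SucI)
qed

lemma mk_inv_complete:
  assumes i: "mk_inv al n 0 mk nx" and q: "closed q" "\<forall>e\<in>set q. al e"
  shows "\<exists>u<n. n \<le> mk u"
proof -
  define e where "e = hd q"
  have "e \<in> set q" using q by (auto simp: closed_def e_def)
  moreover from this have "e < m" using q(1) walk_set unfolding closed_def by blast
  ultimately show ?thesis using i q src unfolding mk_inv_def by blast
qed

text \<open>Along successors the mark drops by at most one per step, so \<open>n\<close> steps from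
  \<open>u\<close> are possible and some vertex recurs. From there on the path is periodic, and
  after \<open>n\<close> steps it is certainly on the cycle. This finds a vertex of the cycle
  without recording which vertices were visited.\<close>

lemma mk_inv_cycle:
  fixes mk nx u
  defines "f \<equiv> \<lambda>v. dst (nx v)"
  defines "x \<equiv> (f ^^ n) u"
  assumes i: "mk_inv al k 0 mk nx" and u: "u < n" "n \<le> mk u"
  shows "\<exists>p>0. p \<le> n \<and> (f ^^ p) x = x \<and> (\<forall>i<p. 0 < i \<longrightarrow> (f ^^ i) x \<noteq> x) \<and>
    (\<forall>i. (f ^^ i) x < n \<and> nx ((f ^^ i) x) < m) \<and> cyc (map (\<lambda>i. nx ((f ^^ i) x)) [0..<p]) \<and>
    (\<forall>e\<in>set (map (\<lambda>i. nx ((f ^^ i) x)) [0..<p]). al e)"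
proof -
  have v: "(f ^^ i) u < n \<and> n - i \<le> mk ((f ^^ i) u)" if "i \<le> n" for i
    using that
  proof (induction i)
    case (Suc i)
    then have 1: "(f ^^ i) u < n" "n - i \<le> mk ((f ^^ i) u)" "0 < n - i" by auto
    then have "nx ((f ^^ i) u) < m" "mk ((f ^^ i) u) \<le> Suc (mk (f ((f ^^ i) u)))"
      using i unfolding mk_inv_def f_def by (meson less_le_trans)+
    then show ?case using 1 dst unfolding f_def by auto
  qed (use u in auto)
  have "\<not> inj_on (\<lambda>i. (f ^^ i) u) {..n}"
  proof
    assume "inj_on (\<lambda>i. (f ^^ i) u) {..n}"
    moreover have "(\<lambda>i. (f ^^ i) u) ` {..n} \<subseteq> {..<n}" using v by auto
    ultimately show False using card_inj_on_le[of _ "{..n}" "{..<n}"] by fastforce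
  qed
  then obtain a b where ab: "a < b" "b \<le> n" "(f ^^ a) u = (f ^^ b) u"
    unfolding inj_on_def by (metis atMost_iff linorder_neqE_nat)
  have per: "(f ^^ (l + (b - a))) u = (f ^^ l) u" if "a \<le> l" for l
  proof -
    have "(f ^^ (l - a)) ((f ^^ b) u) = (f ^^ (l - a)) ((f ^^ a) u)" using ab by simp
    then have "(f ^^ (l - a + b)) u = (f ^^ (l - a + a)) u" unfolding funpow_add o_def .
    moreover have e: "l - a + b = l + (b - a)" "l - a + a = l" using that ab by auto
    ultimately show ?thesis by (simp only: e)
  qed
  \<comment> \<open>By periodicity every later vertex equals one of the first \<open>b\<close>,
    whose marks are known to be positive.\<close>
  have red: "\<exists>l'<b. a \<le> l' \<and> (f ^^ l) u = (f ^^ l') u" if "a \<le> l" for l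
    using that
  proof (induction l rule: less_induct)
    case (less l)
    show ?case
    proof (cases "l < b")
      case False
      then have "a \<le> l - (b - a)" "l - (b - a) < l" using ab by auto
      with less.IH[of "l - (b - a)"] per[of "l - (b - a)"] show ?thesis using False ab by auto
    qed (use less in auto)
  qed
  have xi: "(f ^^ i) x = (f ^^ (i + n)) u" for i by (simp add: x_def funpow_add)
  have val: "(f ^^ i) x < n \<and> 0 < mk ((f ^^ i) x)" for i
  proof -
    obtain l where "l < b" "(f ^^ i) x = (f ^^ l) u" using red[of "i + n"] ab by (auto simp: xi)
    then show ?thesis using v[of l] ab by auto
  qed
  have N: "nx ((f ^^ i) x) < m \<and> al (nx ((f ^^ i) x)) \<and> src (nx ((f ^^ i) x)) = (f ^^ i) x" for i
    using val[of i] i unfolding mk_inv_def by blast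
  have px: "(f ^^ (b - a)) x = x" using per[of n] ab xi[of "b - a"] by (simp add: x_def add.commute)
  \<comment> \<open>The number \<open>b - a\<close> is merely some period; taking the least one
    makes the heads distinct.\<close>
  define p where "p = (LEAST p. 0 < p \<and> (f ^^ p) x = x)"
  have p: "0 < p" "(f ^^ p) x = x" using LeastI[of "\<lambda>p. 0 < p \<and> (f ^^ p) x = x" "b - a"] px ab unfolding p_def by auto
  have pm: "(f ^^ i) x \<noteq> x" if "i < p" "0 < i" for i using not_less_Least[of i "\<lambda>p. 0 < p \<and> (f ^^ p) x = x"] that unfolding p_def by auto
  have pn: "p \<le> n" using Least_le[of "\<lambda>p. 0 < p \<and> (f ^^ p) x = x" "b - a"] px ab unfolding p_def by auto
  let ?q = "\<lambda>p. map (\<lambda>i. nx ((f ^^ i) x)) [0..<p]"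
  have "walk x (?q l) ((f ^^ l) x)" for l
  proof (induction l)
    case (Suc l)
    then show ?case using N[of l] by (auto simp: walk_append f_def)
  qed simp
  from this[of p] have cl: "closed (?q p)" using p by (auto simp: closed_def)
  have inj: "inj_on (\<lambda>i. (f ^^ Suc i) x) {0..<p}"
  proof (rule linorder_inj_onI)
    fix i j assume ij: "i < j" "i \<in> {0..<p}" "j \<in> {0..<p}"
    show "(f ^^ Suc i) x \<noteq> (f ^^ Suc j) x"
    proof
      assume "(f ^^ Suc i) x = (f ^^ Suc j) x"
      then have "(f ^^ (p - Suc j)) ((f ^^ Suc i) x) = (f ^^ (p - Suc j)) ((f ^^ Suc j) x)" by simp
      then have "(f ^^ (p - Suc j + Suc i)) x = (f ^^ (p - Suc j + Suc j)) x"
        unfolding funpow_add o_def .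
      moreover have e: "p - Suc j + Suc j = p" using ij by auto
      ultimately have "(f ^^ (p - Suc j + Suc i)) x = x" using p(2) by (simp only: e)
      moreover have "p - Suc j + Suc i < p" "0 < p - Suc j + Suc i" using ij by auto
      ultimately show False using pm by blast
    qed
  qed auto
  have "map dst (?q p) = map (\<lambda>i. (f ^^ Suc i) x) [0..<p]" by (simp add: f_def o_def)
  then have "distinct (map dst (?q p))" using inj by (simp only: distinct_map) auto
  then have "cyc (?q p)" using cl by (simp add: cyc_def)
  then show ?thesis using p pm pn val N by (intro exI[of _ p]) auto
qed

end

section \<open>Parametric weights and tables of walks\<close>

type_synonym line = "real \<times> real"

locale ratio = arc_graph +
  fixes c t :: "nat \<Rightarrow> real"
  assumes cyc_ex: "\<exists>q. cyc q" and cyc_pos: "cyc q \<Longrightarrow> 0 < wt t q"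
begin

definition lam :: real where
  "lam = Min ((\<lambda>q. wt c q / wt t q) ` {q. cyc q})"

lemma lam_attained: "\<exists>q. cyc q \<and> wt c q = lam * wt t q"
proof -
  have "lam \<in> (\<lambda>q. wt c q / wt t q) ` {q. cyc q}"
    unfolding lam_def by (rule Min_in) (use finite_cyc cyc_ex in auto)
  then obtain q where q: "cyc q" "lam = wt c q / wt t q" by auto
  then show ?thesis using cyc_pos[OF q(1)] by (intro exI[of _ q]) auto
qed

lemma cyc_lam: assumes "cyc q" shows "lam * wt t q \<le> wt c q"
proof -
  have "lam \<le> wt c q / wt t q"
    unfolding lam_def by (rule Min_le) (use finite_cyc assms in auto)
  then show ?thesis using cyc_pos[OF assms] by (simp add: pos_le_divide_eq)
qed

lemma closed_pos: "closed q \<Longrightarrow> 0 < wt t q"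
  using closed_induct_wt[where P = "\<lambda>x. 0 < x" and w = t] cyc_pos by simp

lemma closed_lam: "closed q \<Longrightarrow> 0 \<le> wt (\<lambda>e. c e - lam * t e) q"
  using closed_induct_wt[where P = "\<lambda>x. 0 \<le> x" and w = "\<lambda>e. c e - lam * t e"] cyc_lam by (simp add: wt_diff)

lemma neg_iff: "(\<exists>q. closed q \<and> wt (\<lambda>e. c e - x * t e) q < 0) \<longleftrightarrow> lam < x"
proof
  assume "\<exists>q. closed q \<and> wt (\<lambda>e. c e - x * t e) q < 0"
  then obtain q where q: "closed q" "wt c q < x * wt t q" by (auto simp: wt_diff)
  then have "lam * wt t q < x * wt t q" using closed_lam[OF q(1)] by (simp add: wt_diff)
  then show "lam < x" using closed_pos[OF q(1)] by simp
next
  assume x: "lam < x"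
  obtain q where q: "cyc q" "wt c q = lam * wt t q" using lam_attained by blast
  then have "wt c q < x * wt t q" using cyc_pos[OF q(1)] x by simp
  then show "\<exists>q. closed q \<and> wt (\<lambda>e. c e - x * t e) q < 0" using q by (auto simp: wt_diff cyc_def)
qed

section \<open>Lines, table invariants and updates\<close>

definition val :: "line \<Rightarrow> real" where "val l = fst l - lam * snd l"

definition line :: "nat list \<Rightarrow> line" where "line es = (wt c es, wt t es)"

definition plus_line :: "line \<Rightarrow> line \<Rightarrow> line" where
  "plus_line k l = (fst k + fst l, snd k + snd l)"

lemma val_plus: "val (plus_line k l) = val k + val l"
  by (simp add: val_def plus_line_def algebra_simps)

lemma line_append: "line (es @ fs) = plus_line (line es) (line fs)"
  by (simp add: line_def plus_line_def)

lemma val_line: "val (line es) = wt (\<lambda>e. c e - lam * t e) es"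
  by (simp add: val_def line_def wt_diff)

definition sound :: "(nat \<Rightarrow> line option) \<Rightarrow> bool" where
  "sound D \<longleftrightarrow> (\<forall>u<n. \<forall>v<n. \<forall>l. D (u * n + v) = Some l \<longrightarrow> (\<exists>es. es \<noteq> [] \<and> walk u es v \<and> l = line es))"

definition below :: "(nat \<Rightarrow> line option) \<Rightarrow> nat \<Rightarrow> real \<Rightarrow> bool" where
  "below D g x \<longleftrightarrow> (\<exists>l. D g = Some l \<and> val l \<le> x)"

definition opt1 :: "nat \<Rightarrow> (nat \<Rightarrow> line option) \<Rightarrow> bool" where
  "opt1 k D \<longleftrightarrow> (\<forall>u v es. walk u es v \<longrightarrow> es \<noteq> [] \<longrightarrow> length es \<le> k \<longrightarrow> below D (u * n + v) (val (line es)))"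

text \<open>\<open>cs\<close> is a set of candidate lines for table entries; \<open>D'\<close> arises from \<open>D\<close> by entering the best ones.\<close>

definition upd_spec :: "(nat \<Rightarrow> line option) \<Rightarrow> (nat \<times> line) set \<Rightarrow> (nat \<Rightarrow> line option) \<Rightarrow> bool" where
  "upd_spec D cs D' \<longleftrightarrow> (\<forall>g. if \<exists>l. (g, l) \<in> cs then
      \<exists>l. D' g = Some l \<and> (g, l) \<in> cs \<and> (\<forall>l'. (g, l') \<in> cs \<longrightarrow> val l \<le> val l') else D' g = D g)"

lemma upd_spec_cand: "upd_spec D cs D' \<Longrightarrow> (g, l) \<in> cs \<Longrightarrow> below D' g (val l)"
  unfolding upd_spec_def below_def by (metis (no_types))

lemma upd_spec_some: "upd_spec D cs D' \<Longrightarrow> D' g = Some l \<Longrightarrow> (g, l) \<in> cs \<or> D g = Some l"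
  unfolding upd_spec_def by (metis (no_types) option.inject)

text \<open>If the old line takes part whenever its index has candidates, then the minimum that
  replaces it is no larger.\<close>

lemma upd_spec_old:
  assumes "upd_spec D cs D'" "\<And>l l'. D g = Some l \<Longrightarrow> (g, l') \<in> cs \<Longrightarrow> (g, l) \<in> cs" "below D g x"
  shows "below D' g x"
proof (cases "\<exists>l. (g, l) \<in> cs")
  case True
  obtain l where "D g = Some l" "val l \<le> x" using assms(3) by (auto simp: below_def)
  then have "below D' g (val l)" using upd_spec_cand[OF assms(1)] True assms(2) by blast
  then show ?thesis using \<open>val l \<le> x\<close> by (auto simp: below_def)
next
  case False
  then have "D' g = D g" using assms(1) unfolding upd_spec_def by meson
  then show ?thesis using assms(3) by (simp add: below_def)
qed

lemma idx_inj: "v < n \<Longrightarrow> y < n \<Longrightarrow> u * n + v = x * n + y \<Longrightarrow> u = x \<and> v = (y :: nat)"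
  by (metis add_cancel_right_left div_less div_mult_self3 less_nat_zero_code mod_less mod_mult_self3 add.commute)

text \<open>The old entry of the target is offered again together with each extension, so that an
  update cannot worsen it.\<close>

definition cand1 :: "(nat \<Rightarrow> line option) \<Rightarrow> nat \<Rightarrow> nat \<Rightarrow> (nat \<times> line) set" where
  "cand1 D u e = (\<lambda>l. (u * n + dst e, l)) ` set_option (D (u * n + dst e)) \<union>
     (\<lambda>l. (u * n + dst e, plus_line l (c e, t e))) ` set_option (D (u * n + src e))"

text \<open>These are the candidates of all pairs that precede (\<open>u\<close>, \<open>e\<close>)
  in loop order, which makes the set an invariant of the two nested loops that generate
  candidates.\<close>

definition cands1 :: "(nat \<Rightarrow> line option) \<Rightarrow> nat \<Rightarrow> nat \<Rightarrow> (nat \<times> line) set" where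
  "cands1 D u e = (\<Union>u'<u. \<Union>e'<m. cand1 D u' e') \<union> (\<Union>e'<e. cand1 D u e')"

lemma cands1_0: "cands1 D 0 0 = {}" by (simp add: cands1_def)
lemma cands1_Suc: "cands1 D u (Suc e) = cands1 D u e \<union> cand1 D u e"
  by (auto simp: cands1_def lessThan_Suc)
lemma cands1_round: "cands1 D u m = cands1 D (Suc u) 0"
  by (auto simp: cands1_def lessThan_Suc)

lemma phase1_sound:
  assumes s: "sound D" and u: "upd_spec D (cands1 D n 0) D'"
  shows "sound D'"
  unfolding sound_def
proof (intro allI impI)
  fix x v l assume x: "x < n" "v < n" "D' (x * n + v) = Some l"
  from upd_spec_some[OF u x(3)]
  consider "D (x * n + v) = Some l" | "(x * n + v, l) \<in> cands1 D n 0" by blast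
  then show "\<exists>es. es \<noteq> [] \<and> walk x es v \<and> l = line es"
  proof cases
    case 1
    then show ?thesis using s x unfolding sound_def by blast
  next
    case 2
    then obtain u' e where ue: "u' < n" "e < m" "(x * n + v, l) \<in> cand1 D u' e" by (auto simp: cands1_def)
    then have g: "x * n + v = u' * n + dst e" by (auto simp: cand1_def)
    from idx_inj[OF x(2) dst[OF ue(2)] g] have eq: "u' = x" "dst e = v" by auto
    from ue(3) consider "D (x * n + v) = Some l" |
        l0 where "D (x * n + src e) = Some l0" "l = plus_line l0 (c e, t e)"
      unfolding cand1_def eq by auto
    then show ?thesis
    proof cases
      case 1
      then show ?thesis using s x unfolding sound_def by blast
    next
      case 2
      then obtain es where "walk x es (src e)" "l0 = line es" using s x src[OF ue(2)] unfolding sound_def by blast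
      then show ?thesis using 2(2) ue(2) eq
        by (intro exI[of _ "es @ [e]"]) (auto simp: walk_append line_append, simp add: line_def)
    qed
  qed
qed

text \<open>Split off the last arc. The table has no entries for empty walks, so a walk of a single
  arc is not an extension; it must be covered by the old table, which is the reason for
  \<open>0 < k\<close>.\<close>

lemma phase1_opt:
  assumes o: "opt1 k D" and k: "0 < k" and u: "upd_spec D (cands1 D n 0) D'"
  shows "opt1 (Suc k) D'"
  unfolding opt1_def
proof (intro allI impI)
  fix x v es assume w: "walk x es v" "es \<noteq> []" "length es \<le> Suc k"
  have xv: "x < n" "v < n" using walk_ends[OF w(1,2)] by auto
  define fs e where "fs = butlast es" and "e = last es"
  have es: "es = fs @ [e]" using w(2) by (simp add: fs_def e_def)
  then have fe: "walk x fs (src e)" "e < m" "dst e = v" "length fs \<le> k" using w by (auto simp: walk_append)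
  show "below D' (x * n + v) (val (line es))"
  proof (cases "fs = []")
    case True
    have "below D (x * n + v) (val (line es))" using o w k es True unfolding opt1_def by auto
    then obtain l where l: "D (x * n + v) = Some l" "val l \<le> val (line es)" by (auto simp: below_def)
    then have "(x * n + v, l) \<in> cand1 D x e" using fe by (auto simp: cand1_def)
    then have "(x * n + v, l) \<in> cands1 D n 0" using xv fe by (auto simp: cands1_def)
    from upd_spec_cand[OF u this] l show ?thesis by (auto simp: below_def)
  next
    case False
    have "below D (x * n + src e) (val (line fs))" using o fe False unfolding opt1_def by auto
    then obtain l where l: "D (x * n + src e) = Some l" "val l \<le> val (line fs)" by (auto simp: below_def)
    then have "(x * n + v, plus_line l (c e, t e)) \<in> cand1 D x e" using fe by (auto simp: cand1_def)
    then have "(x * n + v, plus_line l (c e, t e)) \<in> cands1 D n 0" using xv fe by (auto simp: cands1_def)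
    from upd_spec_cand[OF u this] l show ?thesis
      unfolding es below_def line_append val_plus by (auto simp: line_def)
  qed
qed

lemma opt1_mono: "opt1 k D \<Longrightarrow> j \<le> k \<Longrightarrow> opt1 j D"
  unfolding opt1_def by simp

subsection \<open>Long walks through sampled vertices\<close>

text \<open>Concatenations of at most \<open>2 ^ k\<close> nonempty pieces with at most
  \<open>h\<close> arcs each and with all junctions in \<open>S\<close>: the walks that
  \<open>k\<close> squarings of the table take into account.\<close>

primrec hops :: "nat set \<Rightarrow> nat \<Rightarrow> nat \<Rightarrow> nat \<Rightarrow> nat list \<Rightarrow> nat \<Rightarrow> bool" where
  "hops S h 0 u es v = (walk u es v \<and> es \<noteq> [] \<and> length es \<le> h)"
| "hops S h (Suc k) u es v = (hops S h k u es v \<or>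
     (\<exists>x as bs. x \<in> S \<and> es = as @ bs \<and> hops S h k u as x \<and> hops S h k x bs v))"

definition opt2 :: "nat set \<Rightarrow> nat \<Rightarrow> nat \<Rightarrow> (nat \<Rightarrow> line option) \<Rightarrow> bool" where
  "opt2 S h k D \<longleftrightarrow> (\<forall>u\<in>S. \<forall>v\<in>S. \<forall>es. hops S h k u es v \<longrightarrow> below D (u * n + v) (val (line es)))"

lemma opt2_0: "opt1 h D \<Longrightarrow> opt2 S h 0 D"
  unfolding opt1_def opt2_def by auto

definition cand2 :: "(nat \<Rightarrow> line option) \<Rightarrow> nat \<Rightarrow> nat \<Rightarrow> nat \<Rightarrow> (nat \<times> line) set" where
  "cand2 D u v x = (\<lambda>l. (u * n + v, l)) ` set_option (D (u * n + v)) \<union>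
     (\<lambda>(k, l). (u * n + v, plus_line k l)) ` (set_option (D (u * n + x)) \<times> set_option (D (x * n + v)))"

definition cands2 :: "(nat \<Rightarrow> line option) \<Rightarrow> (nat \<Rightarrow> nat) \<Rightarrow> nat \<Rightarrow> nat \<Rightarrow> nat \<Rightarrow> nat \<Rightarrow> (nat \<times> line) set" where
  "cands2 D S N i j k = (\<Union>i'<i. \<Union>j'<N. \<Union>k'<N. cand2 D (S i') (S j') (S k')) \<union>
     (\<Union>j'<j. \<Union>k'<N. cand2 D (S i) (S j') (S k')) \<union> (\<Union>k'<k. cand2 D (S i) (S j) (S k'))"

lemma cands2_0: "cands2 D S N 0 0 0 = {}" by (simp add: cands2_def)
lemma cands2_Suc: "cands2 D S N i j (Suc k) = cands2 D S N i j k \<union> cand2 D (S i) (S j) (S k)"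
  by (auto simp: cands2_def lessThan_Suc)
lemma cands2_round: "cands2 D S N i j N = cands2 D S N i (Suc j) 0" "cands2 D S N i N 0 = cands2 D S N (Suc i) 0 0"
  by (auto simp: cands2_def lessThan_Suc)

lemma phase2_sound:
  assumes s: "sound D" and S: "\<And>i. i < N \<Longrightarrow> S i < n" and u: "upd_spec D (cands2 D S N N 0 0) D'"
  shows "sound D'"
  unfolding sound_def
proof (intro allI impI)
  fix x v l assume x: "x < n" "v < n" "D' (x * n + v) = Some l"
  from upd_spec_some[OF u x(3)]
  consider "D (x * n + v) = Some l" | "(x * n + v, l) \<in> cands2 D S N N 0 0" by blast
  then show "\<exists>es. es \<noteq> [] \<and> walk x es v \<and> l = line es"
  proof cases
    case 1
    then show ?thesis using s x unfolding sound_def by blast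
  next
    case 2
    then obtain i j k where ijk: "i < N" "j < N" "k < N" "(x * n + v, l) \<in> cand2 D (S i) (S j) (S k)"
      by (auto simp: cands2_def)
    then have g: "x * n + v = S i * n + S j" by (auto simp: cand2_def)
    from idx_inj[OF x(2) S[OF ijk(2)] g] have eq: "S i = x" "S j = v" by auto
    from ijk(4) consider "D (x * n + v) = Some l" |
        l1 l2 where "D (x * n + S k) = Some l1" "D (S k * n + v) = Some l2" "l = plus_line l1 l2"
      unfolding cand2_def eq by auto
    then show ?thesis
    proof cases
      case 1
      then show ?thesis using s x unfolding sound_def by blast
    next
      case 2
      then obtain es fs where "es \<noteq> []" "walk x es (S k)" "l1 = line es" "walk (S k) fs v" "l2 = line fs"
        using s x S[OF ijk(3)] unfolding sound_def by meson
      then show ?thesis using 2(3) by (intro exI[of _ "es @ fs"]) (auto simp: walk_append line_append)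
    qed
  qed
qed

lemma phase2_below:
  assumes S: "\<And>i. i < N \<Longrightarrow> S i < n" and u: "upd_spec D (cands2 D S N N 0 0) D'" and b: "below D g x"
  shows "below D' g x"
proof (rule upd_spec_old[OF u _ b])
  fix l l' assume l: "D g = Some l" "(g, l') \<in> cands2 D S N N 0 0"
  then obtain i j k where ijk: "i < N" "j < N" "k < N" "(g, l') \<in> cand2 D (S i) (S j) (S k)"
    by (auto simp: cands2_def)
  then have "g = S i * n + S j" by (auto simp: cand2_def)
  then have "(g, l) \<in> cand2 D (S i) (S j) (S k)" using l by (auto simp: cand2_def)
  then show "(g, l) \<in> cands2 D S N N 0 0" using ijk by (auto simp: cands2_def)
qed

lemma phase2_opt:
  assumes o: "opt2 (S ` {..<N}) h k D" and S: "\<And>i. i < N \<Longrightarrow> S i < n" and u: "upd_spec D (cands2 D S N N 0 0) D'"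
  shows "opt2 (S ` {..<N}) h (Suc k) D'"
  unfolding opt2_def
proof (intro ballI allI impI)
  fix x v es assume xv: "x \<in> S ` {..<N}" "v \<in> S ` {..<N}" and hp: "hops (S ` {..<N}) h (Suc k) x es v"
  show "below D' (x * n + v) (val (line es))"
  proof (cases "hops (S ` {..<N}) h k x es v")
    case True
    then show ?thesis using o xv phase2_below[OF S u] unfolding opt2_def by blast
  next
    case False
    then obtain y as bs where y: "y \<in> S ` {..<N}" "es = as @ bs" "hops (S ` {..<N}) h k x as y" "hops (S ` {..<N}) h k y bs v"
      using hp by auto
    then have "below D (x * n + y) (val (line as))" "below D (y * n + v) (val (line bs))"
      using o xv unfolding opt2_def by blast+
    then obtain l1 l2 where l: "D (x * n + y) = Some l1" "D (y * n + v) = Some l2"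
        "val l1 \<le> val (line as)" "val l2 \<le> val (line bs)" by (auto simp: below_def)
    then have "(x * n + v, plus_line l1 l2) \<in> cand2 D x v y" by (auto simp: cand2_def)
    then have "(x * n + v, plus_line l1 l2) \<in> cands2 D S N N 0 0" using xv y(1) by (auto simp: cands2_def)
    from upd_spec_cand[OF u this] l(3,4) show ?thesis
      unfolding y(2) below_def line_append val_plus by force
  qed
qed

definition visits :: "nat set \<Rightarrow> nat list \<Rightarrow> nat" where
  "visits S es = length (filter (\<lambda>e. dst e \<in> S) es)"

definition windows :: "nat set \<Rightarrow> nat \<Rightarrow> nat list \<Rightarrow> bool" where
  "windows S h es \<longleftrightarrow> (\<forall>as bs cs. es = as @ bs @ cs \<longrightarrow> length bs = h \<longrightarrow> (\<exists>e\<in>set bs. dst e \<in> S))"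

lemma windows_append: "windows S h (es @ fs) \<Longrightarrow> windows S h es \<and> windows S h fs"
  unfolding windows_def by (metis append.assoc)

lemma visits_split:
  "0 < k \<Longrightarrow> k \<le> visits S es \<Longrightarrow> \<exists>as bs. es = as @ bs \<and> visits S as = k \<and> as \<noteq> [] \<and> dst (last as) \<in> S"
proof (induction es rule: rev_induct)
  case (snoc e es)
  show ?case
  proof (cases "k \<le> visits S es")
    case True
    then show ?thesis using snoc by (metis append.assoc)
  next
    case False
    then have "dst e \<in> S \<and> visits S (es @ [e]) = k" using snoc.prems by (auto simp: visits_def split: if_splits)
    then show ?thesis by (intro exI[of _ "es @ [e]"] exI[of _ "[]"]) auto
  qed
qed (simp add: visits_def)

text \<open>Cutting after visit number \<open>2 ^ k\<close> ends the first part in \<open>S\<close>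
  and leaves at most \<open>2 ^ k\<close> visits on either side. At the bottom the only visit is the
  last arc; what precedes it avoids \<open>S\<close> and so has fewer than \<open>h\<close>
  arcs.\<close>

lemma hops_if_windows:
  "walk u es v \<Longrightarrow> es \<noteq> [] \<Longrightarrow> v \<in> S \<Longrightarrow> windows S h es \<Longrightarrow> visits S es \<le> 2 ^ k \<Longrightarrow> hops S h k u es v"
proof (induction k arbitrary: u es v)
  case 0
  define fs e where "fs = butlast es" and "e = last es"
  have es: "es = fs @ [e]" using 0(2) by (simp add: fs_def e_def)
  then have "dst e \<in> S" using 0 by (auto simp: walk_append)
  then have no: "\<forall>f\<in>set fs. dst f \<notin> S" using 0(5) es by (auto simp: visits_def filter_empty_conv)
  have "length es \<le> h"
  proof (rule ccontr)
    assume a: "\<not> ?thesis"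
    then have "es = [] @ take h fs @ (drop h fs @ [e])" "length (take h fs) = h" using es by auto
    then have "\<exists>f\<in>set (take h fs). dst f \<in> S" using 0(4) unfolding windows_def by blast
    then show False using no by (meson in_set_takeD)
  qed
  then show ?case using 0 by simp
next
  case (Suc k)
  show ?case
  proof (cases "visits S es \<le> 2 ^ k")
    case True
    then show ?thesis using Suc by simp
  next
    case False
    then have "0 < (2::nat) ^ k" "2 ^ k \<le> visits S es" by auto
    from visits_split[OF this] obtain as bs where ab: "es = as @ bs" "visits S as = 2 ^ k" "as \<noteq> []" "dst (last as) \<in> S"
      by blast
    then obtain x where x: "walk u as x" "walk x bs v" using Suc.prems(1) by (auto simp: walk_append)
    then have "x \<in> S" using walk_last[OF x(1)] ab by simp
    moreover have vb: "visits S bs \<le> 2 ^ k" "visits S bs \<noteq> 0" using ab Suc.prems(5) False by (auto simp: visits_def)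
    moreover have "bs \<noteq> []" using vb(2) by (auto simp: visits_def)
    moreover have "windows S h as" "windows S h bs" using windows_append[of S h as bs] Suc.prems(4) ab(1) by simp_all
    ultimately have "hops S h k u as x" "hops S h k x bs v"
      using Suc.IH[OF x(1) ab(3)] Suc.IH[OF x(2)] Suc.prems(3) ab(2) by auto
    then show ?thesis using ab(1) \<open>x \<in> S\<close> by auto
  qed
qed

text \<open>The rotations make the windows cyclic. A factor of length \<open>h\<close> of any
  rotation of \<open>q\<close> is one of them, so the condition does not depend on where the cycle
  starts.\<close>

definition hits :: "nat set \<Rightarrow> nat \<Rightarrow> nat list \<Rightarrow> bool" where
  "hits S h q \<longleftrightarrow> (\<forall>r<length q. \<exists>e\<in>set (take h (rotate r q)). dst e \<in> S)"

lemma walk_rotate: "walk u q u \<Longrightarrow> \<exists>x. walk x (rotate r q) x"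
proof -
  assume a: "walk u q u"
  have "rotate r q = drop (r mod length q) q @ take (r mod length q) q" by (rule rotate_drop_take)
  moreover have "walk u (take (r mod length q) q @ drop (r mod length q) q) u" using a by simp
  then obtain y where "walk u (take (r mod length q) q) y" "walk y (drop (r mod length q) q) u"
    unfolding walk_append by blast
  ultimately show ?thesis by (metis walk_append)
qed

text \<open>Rotate the cycle so that it ends in a sampled vertex. It has at most \<open>n\<close>
  arcs and hence at most \<open>2 ^ k\<close> visits, so it is within reach of \<open>k\<close>
  squarings. A cycle of at most \<open>h\<close> arcs is already on the diagonal after the first
  phase, whatever the sample.\<close>

lemma opt_diagonal:
  assumes q: "cyc q" "wt c q = lam * wt t q" and o: "opt1 h D" "opt2 S h k D" and S: "S \<subseteq> {..<n}"
    and k: "n \<le> 2 ^ k" and good: "length q \<le> h \<or> hits S h q"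
  shows "\<exists>u<n. below D (u * n + u) 0"
proof (cases "length q \<le> h")
  case True
  obtain u where u: "walk u q u" "q \<noteq> []" using q(1) by (auto simp: cyc_def closed_def)
  then have "below D (u * n + u) (val (line q))" using o(1) True unfolding opt1_def by blast
  then show ?thesis using walk_ends[OF u] q(2) by (auto simp: val_def line_def)
next
  case False
  with good have hit: "hits S h q" by simp
  obtain u where u: "walk u q u" "q \<noteq> []" using q(1) by (auto simp: cyc_def closed_def)
  then obtain e where e: "e \<in> set q" "dst e \<in> S" using hit False unfolding hits_def
    by (metis gr0I in_set_takeD length_0_conv set_rotate)
  then obtain i where i: "i < length q" "q ! i = e" by (auto simp: in_set_conv_nth)
  define es where "es = rotate (Suc i) q"
  have ne: "es \<noteq> []" "length es = length q" using u by (auto simp: es_def)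
  have "es ! (length q - 1) = q ! ((Suc i + (length q - 1)) mod length q)"
    unfolding es_def by (rule nth_rotate) (use i in simp)
  moreover have "Suc i + (length q - 1) = i + length q" using i by simp
  ultimately have "last es = e" using ne i by (simp add: last_conv_nth)
  obtain x where x: "walk x es x" using walk_rotate[OF u(1), of "Suc i"] unfolding es_def by blast
  then have xS: "x \<in> S" using walk_last[OF x ne(1)] \<open>last es = e\<close> e by simp
  have "windows S h es"
    unfolding windows_def
  proof (intro allI impI)
    fix as bs cs assume d: "es = as @ bs @ cs" "length bs = h"
    have "rotate (length as) es = bs @ cs @ as" using d by (simp add: rotate_append)
    moreover have "rotate (length as + Suc i) q = rotate (length as) es" unfolding es_def by (simp only: rotate_rotate)
    ultimately have "take h (rotate (length as + Suc i) q) = bs" using d by simp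
    moreover have "rotate (length as + Suc i) q = rotate ((length as + Suc i) mod length q) q" by (rule rotate_conv_mod)
    ultimately show "\<exists>e\<in>set bs. dst e \<in> S"
      using hit u unfolding hits_def by (metis length_greater_0_conv mod_less_divisor)
  qed
  moreover have "visits S es \<le> 2 ^ k"
  proof -
    have "visits S es \<le> length q" unfolding visits_def ne(2)[symmetric] by (rule length_filter_le)
    then show ?thesis using distinct_length[OF u(1)] q(1) k by (simp add: cyc_def)
  qed
  ultimately have "hops S h k x es x" using hops_if_windows[OF x ne(1) xS] by blast
  then have "below D (x * n + x) (val (line es))" using o(2) xS unfolding opt2_def by blast
  moreover have "wt w es = wt w q" for w
    unfolding es_def rotate_drop_take by (metis add.commute append_take_drop_id wt_simps(3))
  ultimately show ?thesis using xS S q(2) by (auto simp: val_def line_def)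
qed

text \<open>A diagonal entry is the line of a closed walk, which has nonnegative weight at
  \<open>lam\<close>. So a ratio read off the diagonal can only be too large.\<close>

lemma sound_diagonal:
  assumes "sound D" "u < n" "D (u * n + u) = Some l"
  shows "0 \<le> val l" "0 < snd l" "lam \<le> fst l / snd l" "val l \<le> 0 \<longleftrightarrow> fst l / snd l = lam"
proof -
  obtain es where "es \<noteq> []" "walk u es u" "l = line es" using assms unfolding sound_def by blast
  then have es: "closed es" "l = line es" by (auto simp: closed_def)
  show 1: "0 \<le> val l" using closed_lam es by (simp add: val_line)
  show 2: "0 < snd l" using closed_pos es by (simp add: line_def)
  show 3: "lam \<le> fst l / snd l" using 1 2 by (simp add: val_def pos_le_divide_eq)
  show "val l \<le> 0 \<longleftrightarrow> fst l / snd l = lam" using 1 2 by (auto simp: val_def field_simps)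
qed

end

section \<open>Bellman-Ford and cycle search as programs\<close>

text \<open>
  Word arrays: 0 tails, 1 heads, 2 allowed arcs, 3 marks, 4 successor arcs, 5 samples, 6 table entry
  present, 7 candidate's table index, 8 pending candidate of an index, 9 and 10 pairs, 11 and 12
  sorted pairs, 13 dropped, 32 output. Real arrays: 0 costs, 1 times, 2 distances, 3 and 4
  table lines, 5 and 6 candidate lines, 7 crossing points. Word variables 0 to 4: \<open>n\<close>, \<open>m\<close>, \<open>L\<close>,
  \<open>h\<close>, \<open>N\<close>. Real variable 0 is the argument of the decision procedure.
\<close>

locale mach = ram W off IM + arc_graph n m src dst for W off IM n m :: nat and src dst :: "nat \<Rightarrow> nat" +
  fixes c t :: "nat \<Rightarrow> real"
  assumes nIM: "n < IM" and mIM: "m < IM" and m_off: "m \<le> off"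
begin

lemma IM_W: "IM + 32 \<le> W" using fits by linarith

definition inp :: "st \<Rightarrow> bool" where
  "inp s \<longleftrightarrow> wv s 0 = n \<and> wv s 1 = m \<and>
     (\<forall>e<m. wa s 0 e = src e \<and> wa s 1 e = dst e \<and> ra s 0 e = c e \<and> ra s 1 e = t e)"

lemma inp_frame:
  assumes "inp s" "frame p s s'" "0 \<notin> modW p" "1 \<notin> modW p" "0 \<notin> modWA p" "1 \<notin> modWA p" "0 \<notin> modRA p" "1 \<notin> modRA p"
  shows "inp s'"
proof -
  have "wv s' 0 = wv s 0" "wv s' 1 = wv s 1" "wa s' 0 = wa s 0" "wa s' 1 = wa s 1" "ra s' 0 = ra s 0" "ra s' 1 = ra s 1"
    using assms(2-) unfolding frame_def by blast+
  then show ?thesis using assms(1) unfolding inp_def by simp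
qed

lemma inpD: "inp s \<Longrightarrow> wv s 0 = n" "inp s \<Longrightarrow> wv s (Suc 0) = m"
  "inp s \<Longrightarrow> e < m \<Longrightarrow> wa s 0 e = src e" "inp s \<Longrightarrow> e < m \<Longrightarrow> wa s (Suc 0) e = dst e"
  "inp s \<Longrightarrow> e < m \<Longrightarrow> ra s 0 e = c e" "inp s \<Longrightarrow> e < m \<Longrightarrow> ra s (Suc 0) e = t e"
  unfolding inp_def by auto

lemma inp_upd: "inp s \<Longrightarrow> i \<noteq> 0 \<Longrightarrow> i \<noteq> 1 \<Longrightarrow> inp (s\<lparr>wv := (wv s)(i := x), clk := y\<rparr>)"
  unfolding inp_def by simp

lemma src_IM: "e < m \<Longrightarrow> src e < IM" "e < m \<Longrightarrow> dst e < IM"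
  using src dst nIM less_trans by blast+

lemma lt_IM: "e < m \<Longrightarrow> e < IM" "v < n \<Longrightarrow> v < IM" "e < m \<Longrightarrow> e < W" "v < n \<Longrightarrow> v < W" "v < n \<Longrightarrow> Suc v < W" "n < W" "m < W"
    "0 < W" "Suc 0 < W"
  using nIM mIM IM_W by auto

end

definition arc_weight :: rexp where
  "arc_weight = RB Sub (RL 0 (WV 6)) (RB Mul (RV 0) (RL 1 (WV 6)))"

definition RELAX :: cmd where
  "RELAX = (RSet 1 (RB Add (RL 2 (WL 0 (WV 6))) arc_weight) ;;
     If (RLess (RV 1) (RL 2 (WL 1 (WV 6)))) (RSt 2 (WL 1 (WV 6)) (RV 1)) SKIP)"

definition CHECK :: cmd where
  "CHECK = If (RLess (RB Add (RL 2 (WL 0 (WV 6))) arc_weight) (RL 2 (WL 1 (WV 6)))) (WSet 7 (WC 1)) SKIP"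

definition BF :: cmd where
  "BF = (For 6 0 (RSt 2 (WV 6) (RW (WC 0))) ;; For 5 0 (For 6 1 RELAX) ;; WSet 7 (WC 0) ;; For 6 1 CHECK)"

lemma mod_BF [simp]: "modW RELAX = {}" "modR RELAX = {1}" "modWA RELAX = {}" "modRA RELAX = {2}"
    "modW CHECK = {7}" "modR CHECK = {}" "modWA CHECK = {}" "modRA CHECK = {}"
    "modW BF = {5, 6, 7}" "modR BF = {1}" "modWA BF = {}" "modRA BF = {2}"
  by (auto simp: RELAX_def CHECK_def BF_def)

context mach
begin

lemma wp_bf_round:
  assumes i: "inp s" and x: "rv s 0 = x" and d: "bf_inv (\<lambda>e. c e - x * t e) k 0 (ra s 2)"
    and post: "\<And>s'. bf_inv (\<lambda>e. c e - x * t e) (Suc k) 0 (ra s' 2) \<Longrightarrow> frame (For 6 1 RELAX) s s' \<Longrightarrow>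
      clk s' \<le> clk s + m * 90 + 9 \<Longrightarrow> R s'"
  shows "wp (For 6 1 RELAX) R s"
proof (rule wp_For[where N = m and I = "\<lambda>j s. bf_inv (\<lambda>e. c e - x * t e) k j (ra s 2)" and \<tau> = 78])
  fix j and s' :: st assume j: "j < m" and I: "bf_inv (\<lambda>e. c e - x * t e) k j (ra s' 2)"
    and w: "wv s' 6 = j" and f: "frame (For 6 1 RELAX) s s'"
  have i': "inp s'" by (rule inp_frame[OF i f]) auto
  have x': "rv s' 0 = x" using f x by (auto simp: frame_def)
  show "wp RELAX (\<lambda>s''. bf_inv (\<lambda>e. c e - x * t e) k (Suc j) (ra s'' 2) \<and> clk s'' \<le> clk s' + 78) s'"
    using bf_inv_relax[OF I j] j w x' inpD[OF i'] src_IM[OF j] lt_IM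
    by (simp add: RELAX_def arc_weight_def wp_simps relax_def split: if_splits)
next
  fix s' :: st assume "bf_inv (\<lambda>e. c e - x * t e) k m (ra s' 2)" "frame (For 6 1 RELAX) s s'" "clk s' \<le> clk s + m * (78 + 12) + 9"
  then show "R s'" using post[OF bf_inv_round] by simp
qed (use d inpD[OF i] lt_IM in auto)

lemma wp_BF:
  assumes i: "inp s" and x: "rv s 0 = x"
    and post: "\<And>s'. frame BF s s' \<Longrightarrow> wv s' 7 = (if \<exists>q. closed q \<and> wt (\<lambda>e. c e - x * t e) q < 0 then 1 else 0) \<Longrightarrow>
      (wv s' 7 = 0 \<Longrightarrow> \<forall>e<m. ra s' 2 (dst e) \<le> ra s' 2 (src e) + (c e - x * t e)) \<Longrightarrow>
      clk s' \<le> clk s + 200 * (n * m + n + m + 1) \<Longrightarrow> R s'"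
  shows "wp BF R s"
proof -
  let ?w = "\<lambda>e. c e - x * t e"
  have "wp (For 6 0 (RSt 2 (WV 6) (RW (WC 0)))) (wp (For 5 0 (For 6 1 RELAX)) (wp (WSet 7 (WC 0)) (wp (For 6 1 CHECK) (\<lambda>s'. frame BF s s' \<longrightarrow> R s')))) s"
  proof (rule wp_For[where N = n and I = "\<lambda>j s. \<forall>v<j. ra s 2 v = 0" and \<tau> = 20])
    fix j and s' :: st assume "j < n" "\<forall>v<j. ra s' 2 v = 0" "wv s' 6 = j"
    then show "wp (RSt 2 (WV 6) (RW (WC 0))) (\<lambda>s''. (\<forall>v<Suc j. ra s'' 2 v = 0) \<and> clk s'' \<le> clk s' + 20) s'"
      using lt_IM by (simp add: wp_simps less_Suc_eq)
  next
    fix s1 :: st assume d0: "\<forall>v<n. ra s1 2 v = 0" and f1: "frame (For 6 0 (RSt 2 (WV 6) (RW (WC 0)))) s s1"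
      and t1: "clk s1 \<le> clk s + n * (20 + 12) + 9"
    have i1: "inp s1" by (rule inp_frame[OF i f1]) auto
    have x1: "rv s1 0 = x" using f1 x by (auto simp: frame_def)
    show "wp (For 5 0 (For 6 1 RELAX)) (wp (WSet 7 (WC 0)) (wp (For 6 1 CHECK) (\<lambda>s'. frame BF s s' \<longrightarrow> R s'))) s1"
    proof (rule wp_For[where N = n and I = "\<lambda>k s. bf_inv ?w k 0 (ra s 2)" and \<tau> = "m * 90 + 9"])
      fix k and s' :: st assume k: "k < n" and I: "bf_inv ?w k 0 (ra s' 2)" and f: "frame (For 5 0 (For 6 1 RELAX)) s1 s'"
      have i': "inp s'" by (rule inp_frame[OF i1 f]) auto
      have x': "rv s' 0 = x" using f x1 by (auto simp: frame_def)
      show "wp (For 6 1 RELAX) (\<lambda>s''. bf_inv ?w (Suc k) 0 (ra s'' 2) \<and> clk s'' \<le> clk s' + (m * 90 + 9)) s'"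
        by (rule wp_bf_round[OF i' x' I]) auto
    next
      fix s2 :: st assume d2: "bf_inv ?w n 0 (ra s2 2)" and f2: "frame (For 5 0 (For 6 1 RELAX)) s1 s2"
        and t2: "clk s2 \<le> clk s1 + n * (m * 90 + 9 + 12) + 9"
      have i2: "inp s2" by (rule inp_frame[OF i1 f2]) auto
      have x2: "rv s2 0 = x" using f2 x1 by (auto simp: frame_def)
      define s3 where "s3 = s2\<lparr>wv := (wv s2)(7 := 0), clk := clk s2 + 3\<rparr>"
      have i3: "inp s3" unfolding s3_def by (rule inp_upd[OF i2]) auto
      have x3: "rv s3 0 = x" using x2 by (simp add: s3_def)
      let ?viol = "\<lambda>j d. \<exists>e<j. d (src e) + ?w e < (d :: nat \<Rightarrow> real) (dst e)"
      have "wp (For 6 1 CHECK) (\<lambda>s'. frame BF s s' \<longrightarrow> R s') s3"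
      proof (rule wp_For[where N = m and I = "\<lambda>j s. wv s 7 = (if ?viol j (ra s2 2) then 1 else 0)" and \<tau> = 72])
        fix j and s' :: st assume j: "j < m" and I: "wv s' 7 = (if ?viol j (ra s2 2) then 1 else 0)"
          and w: "wv s' 6 = j" and f: "frame (For 6 1 CHECK) s3 s'"
        have i': "inp s'" by (rule inp_frame[OF i3 f]) auto
        have x': "rv s' 0 = x" "ra s' 2 = ra s2 2" using f x3 by (auto simp: frame_def s3_def)
        show "wp CHECK (\<lambda>s''. wv s'' 7 = (if ?viol (Suc j) (ra s2 2) then 1 else 0) \<and> clk s'' \<le> clk s' + 72) s'"
          using I j w x' inpD[OF i'] src_IM[OF j] lt_IM
          by (auto simp add: CHECK_def arc_weight_def wp_simps less_Suc_eq)
      next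
        fix s4 :: st assume v4: "wv s4 7 = (if ?viol m (ra s2 2) then 1 else 0)" and f4: "frame (For 6 1 CHECK) s3 s4"
          and t4: "clk s4 \<le> clk s3 + m * (72 + 12) + 9"
        have d4: "ra s4 2 = ra s2 2" using f4 by (auto simp: frame_def s3_def)
        note b = bf_inv_final[OF d2]
        have T: "clk s4 \<le> clk s + 200 * (n * m + n + m + 1)"
          using t4 t2 t1 by (simp add: s3_def algebra_simps)
        have v: "wv s4 7 = (if \<exists>q. closed q \<and> wt ?w q < 0 then 1 else 0)" using v4 unfolding b .
        have z: "\<forall>e<m. ra s4 2 (dst e) \<le> ra s4 2 (src e) + ?w e" if "wv s4 7 = 0"
          using v4 that unfolding d4 by (metis not_less zero_neq_one)
        show "frame BF s s4 \<longrightarrow> R s4" using post[OF _ v z T] by blast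
      qed (use inpD[OF i3] lt_IM in \<open>auto simp: s3_def\<close>)
      then show "wp (WSet 7 (WC 0)) (wp (For 6 1 CHECK) (\<lambda>s'. frame BF s s' \<longrightarrow> R s')) s2"
        using lt_IM by (simp add: wp_simps s3_def Suc_numerals)
    qed (use inpD[OF i1] lt_IM bf_inv_init d0 in auto)
  qed (use inpD[OF i] lt_IM in auto)
  then have "wp BF (\<lambda>s'. frame BF s s' \<longrightarrow> R s') s" unfolding BF_def wp_Seq .
  then show ?thesis by (rule wp_conseq) auto
qed

end

definition MSTEP :: cmd where
  "MSTEP = If (WLess (WC 0) (WL 2 (WV 6)))
     (If (WLess (WL 3 (WL 1 (WV 6))) (WV 5)) SKIP
       (WSt 4 (WL 0 (WV 6)) (WV 6) ;; WSt 3 (WL 0 (WV 6)) (WB Add (WV 5) (WC 1)))) SKIP"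

text \<open>Variable 9 receives the vertex found plus one, and zero stands for none.\<close>

definition MARK :: cmd where
  "MARK = (For 6 0 (WSt 3 (WV 6) (WC 0)) ;; For 5 0 (For 6 1 MSTEP) ;; WSet 9 (WC 0) ;;
     For 6 0 (If (WLess (WL 3 (WV 6)) (WV 0)) SKIP (WSet 9 (WB Add (WV 6) (WC 1)))))"

lemma mod_MARK [simp]: "modW MSTEP = {}" "modR MSTEP = {}" "modWA MSTEP = {3, 4}" "modRA MSTEP = {}"
    "modW MARK = {5, 6, 9}" "modR MARK = {}" "modWA MARK = {3, 4}" "modRA MARK = {}"
  by (auto simp: MSTEP_def MARK_def)

context mach
begin

lemma wp_mark_round:
  assumes i: "inp s" and k: "wv s 5 = k" "k < n" and d: "mk_inv (\<lambda>e. 0 < wa s 2 e) k 0 (wa s 3) (wa s 4)"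
    and post: "\<And>s'. mk_inv (\<lambda>e. 0 < wa s 2 e) (Suc k) 0 (wa s' 3) (wa s' 4) \<Longrightarrow> frame (For 6 1 MSTEP) s s' \<Longrightarrow>
      clk s' \<le> clk s + m * 90 + 9 \<Longrightarrow> R s'"
  shows "wp (For 6 1 MSTEP) R s"
proof (rule wp_For[where N = m and I = "\<lambda>j s'. mk_inv (\<lambda>e. 0 < wa s 2 e) k j (wa s' 3) (wa s' 4)" and \<tau> = 78])
  fix j and s' :: st assume j: "j < m" and I: "mk_inv (\<lambda>e. 0 < wa s 2 e) k j (wa s' 3) (wa s' 4)"
    and w: "wv s' 6 = j" and f: "frame (For 6 1 MSTEP) s s'"
  have i': "inp s'" by (rule inp_frame[OF i f]) auto
  have k': "wv s' 5 = k" "wa s' 2 = wa s 2" using f k by (auto simp: frame_def)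
  show "wp MSTEP (\<lambda>s''. mk_inv (\<lambda>e. 0 < wa s 2 e) k (Suc j) (wa s'' 3) (wa s'' 4) \<and> clk s'' \<le> clk s' + 78) s'"
    using mk_inv_step[OF I j] mk_inv_skip[OF I j] j w k' k(2) inpD[OF i'] src_IM[OF j] lt_IM
    by (simp add: MSTEP_def wp_simps not_less)
next
  fix s' :: st assume "mk_inv (\<lambda>e. 0 < wa s 2 e) k m (wa s' 3) (wa s' 4)" "frame (For 6 1 MSTEP) s s'" "clk s' \<le> clk s + m * (78 + 12) + 9"
  then show "R s'" using post[OF mk_inv_round] by simp
qed (use d inpD[OF i] lt_IM in auto)

lemma wp_MARK:
  assumes i: "inp s" and al: "al = (\<lambda>e. 0 < wa s 2 e)"
    and post: "\<And>s'. frame MARK s s' \<Longrightarrow> mk_inv al n 0 (wa s' 3) (wa s' 4) \<Longrightarrow>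
      (wv s' 9 = 0 \<Longrightarrow> \<forall>q. closed q \<longrightarrow> \<not> (\<forall>e\<in>set q. al e)) \<Longrightarrow>
      (\<And>u. wv s' 9 = Suc u \<Longrightarrow> u < n \<and> n \<le> wa s' 3 u) \<Longrightarrow>
      clk s' \<le> clk s + 200 * (n * m + n + m + 1) \<Longrightarrow> R s'"
  shows "wp MARK R s"
proof -
  let ?last = "For 6 0 (If (WLess (WL 3 (WV 6)) (WV 0)) SKIP (WSet 9 (WB Add (WV 6) (WC 1))))"
  have "wp (For 6 0 (WSt 3 (WV 6) (WC 0))) (wp (For 5 0 (For 6 1 MSTEP)) (wp (WSet 9 (WC 0)) (wp ?last (\<lambda>s'. frame MARK s s' \<longrightarrow> R s')))) s"
  proof (rule wp_For[where N = n and I = "\<lambda>j s. \<forall>v<j. wa s 3 v = 0" and \<tau> = 9])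
    fix j and s' :: st assume "j < n" "\<forall>v<j. wa s' 3 v = 0" "wv s' 6 = j"
    then show "wp (WSt 3 (WV 6) (WC 0)) (\<lambda>s''. (\<forall>v<Suc j. wa s'' 3 v = 0) \<and> clk s'' \<le> clk s' + 9) s'"
      using lt_IM by (simp add: wp_simps less_Suc_eq)
  next
    fix s1 :: st assume d0: "\<forall>v<n. wa s1 3 v = 0" and f1: "frame (For 6 0 (WSt 3 (WV 6) (WC 0))) s s1"
      and t1: "clk s1 \<le> clk s + n * (9 + 12) + 9"
    have i1: "inp s1" by (rule inp_frame[OF i f1]) auto
    have a1: "wa s1 2 = wa s 2" using f1 by (auto simp: frame_def)
    show "wp (For 5 0 (For 6 1 MSTEP)) (wp (WSet 9 (WC 0)) (wp ?last (\<lambda>s'. frame MARK s s' \<longrightarrow> R s'))) s1"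
    proof (rule wp_For[where N = n and I = "\<lambda>k s. mk_inv al k 0 (wa s 3) (wa s 4)" and \<tau> = "m * 90 + 9"])
      fix k and s' :: st assume k: "k < n" and I: "mk_inv al k 0 (wa s' 3) (wa s' 4)" and k5: "wv s' 5 = k"
        and f: "frame (For 5 0 (For 6 1 MSTEP)) s1 s'"
      have i': "inp s'" by (rule inp_frame[OF i1 f]) auto
      have a': "al = (\<lambda>e. 0 < wa s' 2 e)" using f a1 al by (auto simp: frame_def)
      show "wp (For 6 1 MSTEP) (\<lambda>s''. mk_inv al (Suc k) 0 (wa s'' 3) (wa s'' 4) \<and> clk s'' \<le> clk s' + (m * 90 + 9)) s'"
        by (rule wp_mark_round[OF i' k5 k I[unfolded a']]) (auto simp: a')
    next
      fix s2 :: st assume d2: "mk_inv al n 0 (wa s2 3) (wa s2 4)" and f2: "frame (For 5 0 (For 6 1 MSTEP)) s1 s2"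
        and t2: "clk s2 \<le> clk s1 + n * (m * 90 + 9 + 12) + 9"
      have i2: "inp s2" by (rule inp_frame[OF i1 f2]) auto
      define s3 where "s3 = s2\<lparr>wv := (wv s2)(9 := 0), clk := clk s2 + 3\<rparr>"
      have i3: "inp s3" unfolding s3_def by (rule inp_upd[OF i2]) auto
      let ?I = "\<lambda>j s. (wv s 9 = 0 \<longrightarrow> (\<forall>u<j. wa s2 3 u < n)) \<and> (\<forall>u. wv s 9 = Suc u \<longrightarrow> u < n \<and> n \<le> wa s2 3 u)"
      have "wp ?last (\<lambda>s'. frame MARK s s' \<longrightarrow> R s') s3"
      proof (rule wp_For[where N = n and I = ?I and \<tau> = 72])
        fix j and s' :: st assume j: "j < n" and I: "?I j s'" and w: "wv s' 6 = j" and f: "frame ?last s3 s'"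
        have i': "inp s'" by (rule inp_frame[OF i3 f]) auto
        have x': "wa s' 3 = wa s2 3" using f by (auto simp: frame_def s3_def)
        show "wp (If (WLess (WL 3 (WV 6)) (WV 0)) SKIP (WSet 9 (WB Add (WV 6) (WC 1)))) (\<lambda>s''. ?I (Suc j) s'' \<and> clk s'' \<le> clk s' + 72) s'"
          using I j w x' inpD(1)[OF i'] lt_IM
          by (auto simp add: wp_simps less_Suc_eq)
      next
        fix s4 :: st assume v4: "?I n s4" and f4: "frame ?last s3 s4"
          and t4: "clk s4 \<le> clk s3 + n * (72 + 12) + 9"
        have d4: "wa s4 3 = wa s2 3" "wa s4 4 = wa s2 4" using f4 by (auto simp: frame_def s3_def)
        have n: "\<forall>q. closed q \<longrightarrow> \<not> (\<forall>e\<in>set q. al e)" if "wv s4 9 = 0"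
          using mk_inv_complete[OF d2] v4 that by (meson not_less)
        show "frame MARK s s4 \<longrightarrow> R s4"
          using post[of s4, unfolded d4, OF _ d2 n] v4 t4 t2 t1 by (simp add: s3_def algebra_simps)
      qed (use inpD[OF i3] lt_IM in \<open>auto simp: s3_def\<close>)
      then show "wp (WSet 9 (WC 0)) (wp ?last (\<lambda>s'. frame MARK s s' \<longrightarrow> R s')) s2"
        using lt_IM by (simp add: wp_simps s3_def Suc_numerals)
    qed (use inpD[OF i1] lt_IM mk_inv_init d0 in auto)
  qed (use inpD[OF i] lt_IM in auto)
  then have "wp MARK (\<lambda>s'. frame MARK s s' \<longrightarrow> R s') s" unfolding MARK_def wp_Seq .
  then show ?thesis by (rule wp_conseq) auto
qed

end

text \<open>The language only compares by less-than. The two truncated differences add up to the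
  distance between variables 10 and 11, which is zero exactly on returning to the start. Array 32 is
  the input region, which may be overwritten because \<open>COPY\<close> has saved its
  contents.\<close>

definition TRAVERSE :: cmd where
  "TRAVERSE = (WSt 32 (WV 12) (WL 4 (WV 11)) ;; WSet 11 (WL 1 (WL 4 (WV 11))) ;; WSet 12 (WB Add (WV 12) (WC 1)) ;;
     WSet 13 (WB Add (WB Sub (WV 11) (WV 10)) (WB Sub (WV 10) (WV 11))))"

text \<open>The first \<open>n\<close> steps lead onto the cycle. Variable 13 starts at 1 since the
  traversal begins at the very vertex at which it is to stop.\<close>

definition EXTRACT :: cmd where
  "EXTRACT = (WSet 10 (WB Sub (WV 9) (WC 1)) ;; For 5 0 (WSet 10 (WL 1 (WL 4 (WV 10)))) ;;
     WSet 11 (WV 10) ;; WSet 12 (WC 0) ;; WSet 13 (WC 1) ;; While (WLess (WC 0) (WV 13)) TRAVERSE ;; WSet 0 (WV 12))"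

lemma mod_EXTRACT [simp]: "modW TRAVERSE = {11, 12, 13}" "modR TRAVERSE = {}" "modWA TRAVERSE = {32}" "modRA TRAVERSE = {}"
  by (auto simp: TRAVERSE_def)

context mach
begin

lemma cyc_length: "cyc q \<Longrightarrow> length q \<le> m"
proof -
  assume "cyc q"
  then have "distinct q" "set q \<subseteq> {..<m}" using walk_set by (auto simp: cyc_def closed_def distinct_map)
  then show ?thesis using card_mono[of "{..<m}" "set q"] by (simp add: distinct_card)
qed

lemma wp_EXTRACT:
  assumes i: "inp s" and mk: "mk_inv al n 0 (wa s 3) (wa s 4)" and u: "wv s 9 = Suc u" "u < n" "n \<le> wa s 3 u"
    and post: "\<And>s' q. cyc q \<Longrightarrow> \<forall>e\<in>set q. al e \<Longrightarrow> map (wa s' 32) [0..<wv s' 0] = q \<Longrightarrow>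
      clk s' \<le> clk s + 100 * (n + 1) \<Longrightarrow> R s'"
  shows "wp EXTRACT R s"
proof -
  define f where "f = (\<lambda>v. dst (wa s 4 v))"
  define x where "x = (f ^^ n) u"
  obtain p where p: "0 < p" "p \<le> n" "(f ^^ p) x = x" "\<forall>i<p. 0 < i \<longrightarrow> (f ^^ i) x \<noteq> x"
      "\<forall>i. (f ^^ i) x < n \<and> wa s 4 ((f ^^ i) x) < m"
      "cyc (map (\<lambda>i. wa s 4 ((f ^^ i) x)) [0..<p])" "\<forall>e\<in>set (map (\<lambda>i. wa s 4 ((f ^^ i) x)) [0..<p]). al e"
    using mk_inv_cycle[OF mk u(2,3)] unfolding f_def x_def by blast
  have valid: "(f ^^ i) u < n \<and> (i < n \<longrightarrow> wa s 4 ((f ^^ i) u) < m)" if "i \<le> n" for i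
  proof -
    have "(f ^^ i) u < n \<and> n - i \<le> wa s 3 ((f ^^ i) u)" if "i \<le> n" for i
      using that
    proof (induction i)
      case (Suc i)
      then have 1: "(f ^^ i) u < n" "n - i \<le> wa s 3 ((f ^^ i) u)" "0 < n - i" by auto
      then have "wa s 4 ((f ^^ i) u) < m" "wa s 3 ((f ^^ i) u) \<le> Suc (wa s 3 (f ((f ^^ i) u)))"
        using mk unfolding mk_inv_def f_def by (meson less_le_trans)+
      then show ?case using 1 dst unfolding f_def by auto
    qed (use u in auto)
    from this[OF that] show ?thesis using mk unfolding mk_inv_def by auto
  qed
  define s1 where "s1 = s\<lparr>wv := (wv s)(10 := u), clk := clk s + 6\<rparr>"
  have i1: "inp s1" unfolding s1_def by (rule inp_upd[OF i]) auto
  let ?rest = "WSet 11 (WV 10) ;; WSet 12 (WC 0) ;; WSet 13 (WC 1) ;; While (WLess (WC 0) (WV 13)) TRAVERSE ;; WSet 0 (WV 12)"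
  have "wp (For 5 0 (WSet 10 (WL 1 (WL 4 (WV 10))))) (wp ?rest R) s1"
  proof (rule wp_For[where N = n and I = "\<lambda>k s. wv s 10 = (f ^^ k) u" and \<tau> = 16])
    fix k and s' :: st assume k: "k < n" "wv s' 10 = (f ^^ k) u" and fr: "frame (For 5 0 (WSet 10 (WL 1 (WL 4 (WV 10))))) s1 s'"
    have i': "inp s'" by (rule inp_frame[OF i1 fr]) auto
    have w4: "wa s' 4 = wa s 4" using fr by (auto simp: frame_def s1_def)
    show "wp (WSet 10 (WL 1 (WL 4 (WV 10)))) (\<lambda>s''. wv s'' 10 = (f ^^ Suc k) u \<and> clk s'' \<le> clk s' + 16) s'"
      using k w4 valid[of k] inpD[OF i'] lt_IM by (auto simp: wp_simps f_def)
  next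
    fix s2 :: st assume w2: "wv s2 10 = (f ^^ n) u" and f2: "frame (For 5 0 (WSet 10 (WL 1 (WL 4 (WV 10))))) s1 s2"
      and t2: "clk s2 \<le> clk s1 + n * (16 + 12) + 9"
    have i2: "inp s2" by (rule inp_frame[OF i1 f2]) auto
    have a2: "wa s2 4 = wa s 4" using f2 by (auto simp: frame_def s1_def)
    define s3 where "s3 = s2\<lparr>wv := ((wv s2)(11 := x, 12 := 0, 13 := 1)), clk := clk s2 + 10\<rparr>"
    have i3: "inp s3" using i2 unfolding inp_def s3_def by simp
    have "wp (While (WLess (WC 0) (WV 13)) TRAVERSE) (wp (WSet 0 (WV 12)) R) s3"
    proof (rule wp_WhileP[where N = p and ph = "\<lambda>_ _. 0" and \<tau> = 50 and
          I = "\<lambda>k s'. wv s' 11 = (f ^^ k) x \<and> wv s' 12 = k \<and> (0 < wv s' 13 \<longleftrightarrow> k < p) \<and>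
            (\<forall>i<k. wa s' 32 i = wa s 4 ((f ^^ i) x))"])
      fix k and s' :: st assume k: "k < p" and I: "wv s' 11 = (f ^^ k) x \<and> wv s' 12 = k \<and> (0 < wv s' 13 \<longleftrightarrow> k < p) \<and>
            (\<forall>i<k. wa s' 32 i = wa s 4 ((f ^^ i) x))" and fr: "frame TRAVERSE s3 s'"
      have i': "inp s'" by (rule inp_frame[OF i3 fr]) auto
      have w4: "wa s' 4 = wa s 4" "wv s' 10 = x" using fr a2 w2 by (auto simp: frame_def s3_def x_def)
      \<comment> \<open>The output fits into array 32, because a cycle has at most \<open>m\<close>
        arcs.\<close>
      have km: "k < off" "Suc k < W" using k p(2) cyc_length[OF p(6)] m_off lt_IM by auto
      have xn: "x < n" "(f ^^ k) x < n" "wa s 4 ((f ^^ k) x) < m" "(f ^^ Suc k) x < n" using p(5)[rule_format, of 0] p(5)[rule_format, of k] p(5)[rule_format, of "Suc k"] by auto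
      have z: "(0 < ((f ^^ Suc k) x - x) + (x - (f ^^ Suc k) x)) = (Suc k < p)"
      proof (cases "Suc k < p")
        case True
        then have "(f ^^ Suc k) x \<noteq> x" using p(4) by blast
        then show ?thesis using True by linarith
      next
        case False
        then have "Suc k = p" using k by simp
        then show ?thesis using p(3) by (simp only:) simp
      qed
      have zW: "((f ^^ Suc k) x - x) + (x - (f ^^ Suc k) x) < W" using xn lt_IM(4)[of x] lt_IM(4)[of "(f ^^ Suc k) x"] by linarith
      have fS: "dst (wa s 4 ((f ^^ k) x)) = (f ^^ Suc k) x" by (simp add: f_def)
      show "wp TRAVERSE (\<lambda>s''. (wv s'' 11 = (f ^^ Suc k) x \<and> wv s'' 12 = Suc k \<and> (0 < wv s'' 13 \<longleftrightarrow> Suc k < p) \<and>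
            (\<forall>i<Suc k. wa s'' 32 i = wa s 4 ((f ^^ i) x))) \<and> clk s'' + 0 \<le> clk s' + 0 + 50) s'"
        using I w4 xn km z zW lt_IM(1,2,8,9) inpD[OF i'] fS unfolding TRAVERSE_def
        by (simp add: wp_simps less_Suc_eq del: funpow.simps)
    next
      fix k and s' :: st assume "wv s' 11 = (f ^^ k) x \<and> wv s' 12 = k \<and> (0 < wv s' 13 \<longleftrightarrow> k < p) \<and> (\<forall>i<k. wa s' 32 i = wa s 4 ((f ^^ i) x))"
      then show "okB s' (WLess (WC 0) (WV 13)) \<and> (evB s' (WLess (WC 0) (WV 13)) \<longleftrightarrow> k < p)" using lt_IM by simp
    next
      fix s4 :: st assume I: "wv s4 11 = (f ^^ p) x \<and> wv s4 12 = p \<and> (0 < wv s4 13 \<longleftrightarrow> p < p) \<and> (\<forall>i<p. wa s4 32 i = wa s 4 ((f ^^ i) x))"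
        and t4: "clk s4 + 0 \<le> clk s3 + 0 + p * (50 + costB (WLess (WC 0) (WV 13)) + 1) + costB (WLess (WC 0) (WV 13)) + 1"
      define s5 where "s5 = s4\<lparr>wv := (wv s4)(0 := p), clk := clk s4 + 4\<rparr>"
      have "map (wa s5 32) [0..<wv s5 0] = map (\<lambda>i. wa s 4 ((f ^^ i) x)) [0..<p]" using I by (simp add: s5_def)
      moreover have "clk s5 \<le> clk s + 100 * (n + 1)" using t4 t2 p(2) by (simp add: s5_def s3_def s1_def)
      ultimately have "R s5" using post[OF p(6,7)] by blast
      then show "wp (WSet 0 (WV 12)) R s4" using I by (simp add: wp_simps s5_def eval_nat_numeral)
    qed (use p in \<open>auto simp: s3_def\<close>)
    then show "wp ?rest R s2" using w2 lt_IM by (simp add: wp_simps s3_def x_def eval_nat_numeral)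
  qed (use inpD[OF i1] lt_IM in \<open>auto simp: s1_def\<close>)
  then show ?thesis using u lt_IM unfolding EXTRACT_def wp_Seq by (simp add: wp_simps s1_def eval_nat_numeral)
qed

end

section \<open>Merge sort\<close>

text \<open>A permutation is sorted by its keys; aligned blocks of length \<open>w\<close> are sorted.\<close>

definition srt :: "(nat \<Rightarrow> real) \<Rightarrow> nat \<Rightarrow> nat \<Rightarrow> (nat \<Rightarrow> nat) \<Rightarrow> bool" where
  "srt key w p a \<longleftrightarrow> (\<forall>x y. x < y \<longrightarrow> y < p \<longrightarrow> x div w = y div w \<longrightarrow> key (a x) \<le> key (a y))"

definition pref :: "(nat \<Rightarrow> nat) \<Rightarrow> nat \<Rightarrow> nat \<Rightarrow> nat multiset" where
  "pref a i j = mset (map a [i..<j])"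

lemma pref_Suc: "i \<le> j \<Longrightarrow> pref a i (Suc j) = add_mset (a j) (pref a i j)" by (simp add: pref_def)
lemma pref_empty: "pref a i i = {#}" by (simp add: pref_def)
lemma pref_upd: "pref (b(k := v)) i k = pref b i k" by (simp add: pref_def)
lemma pref_split: "i \<le> j \<Longrightarrow> j \<le> k \<Longrightarrow> pref a i k = pref a i j + pref a j k"
  unfolding pref_def by (metis map_append mset_append upt_add_eq_append le_Suc_ex)

definition mdone :: "(nat \<Rightarrow> real) \<Rightarrow> nat \<Rightarrow> nat \<Rightarrow> (nat \<Rightarrow> nat) \<Rightarrow> nat \<Rightarrow> (nat \<Rightarrow> nat) \<Rightarrow> bool" where
  "mdone key w p a k b \<longleftrightarrow> k \<le> p \<and> (k = p \<or> 2 * w dvd k) \<and> pref b 0 k = pref a 0 k \<and> srt key (2 * w) k b"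

text \<open>State in the middle of merging the two blocks from \<open>lo\<close>. Cutting
  \<open>mid\<close> and \<open>hi\<close> off at \<open>p\<close> covers a last pair of blocks
  whose right half is short or empty.\<close>

definition mrun :: "(nat \<Rightarrow> real) \<Rightarrow> nat \<Rightarrow> nat \<Rightarrow> (nat \<Rightarrow> nat) \<Rightarrow> nat \<Rightarrow> nat \<Rightarrow> nat \<Rightarrow> nat \<Rightarrow> nat \<Rightarrow> nat \<Rightarrow> (nat \<Rightarrow> nat) \<Rightarrow> bool" where
  "mrun key w p a lo k i mid j hi b \<longleftrightarrow> 2 * w dvd lo \<and> lo \<le> i \<and> i \<le> mid \<and> mid \<le> j \<and> j \<le> hi \<and>
     mid = min (lo + w) p \<and> hi = min (lo + 2 * w) p \<and> k + mid = i + j \<and>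
     pref b 0 k = pref a 0 i + pref a mid j \<and> srt key (2 * w) k b \<and>
     (\<forall>x y. lo \<le> x \<longrightarrow> x < k \<longrightarrow> i \<le> y \<and> y < mid \<or> j \<le> y \<and> y < hi \<longrightarrow> key (b x) \<le> key (a y))"

lemma block: "d dvd lo \<Longrightarrow> lo \<le> x \<Longrightarrow> x < lo + d \<Longrightarrow> x div d = lo div (d::nat)"
proof -
  assume a: "d dvd lo" "lo \<le> x" "x < lo + d"
  then obtain q r where "lo = d * q" "x = d * q + r" "r < d" by (metis dvdE le_Suc_ex nat_add_left_cancel_less)
  then show ?thesis by simp
qed

lemma mrun_start:
  assumes d: "mdone key w p a k b" and k: "k < p"
  shows "mrun key w p a k k k (min (k + w) p) (min (k + w) p) (min (min (k + w) p + w) p) b"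
  using d k unfolding mdone_def mrun_def by (auto simp: pref_empty min_def)

lemma mrun_finish:
  assumes r: "mrun key w p a lo hi i mid j hi b"
  shows "mdone key w p a hi b"
proof -
  have b: "i = mid" "j = hi" "mid \<le> hi" using r unfolding mrun_def by auto
  have "pref b 0 hi = pref a 0 i + pref a mid j" using r unfolding mrun_def by blast
  then have "pref b 0 hi = pref a 0 hi" using b pref_split[of 0 mid hi a] by simp
  moreover have "hi = p \<or> 2 * w dvd hi" using r unfolding mrun_def by (auto simp: min_def)
  ultimately show ?thesis using r unfolding mdone_def mrun_def by auto
qed

text \<open>\<open>z\<close> is the smaller one of the two front elements and hence minimal among
  everything left in both blocks. This is what carries the last clause of \<open>mrun\<close> over
  to the new output element.\<close>

lemma mrun_take:
  assumes r: "mrun key w p a lo k i mid j hi b" and w: "0 < w" and s: "srt key w p a" and k: "k < hi"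
    and z: "i' = Suc i \<and> j' = j \<and> z = i \<and> i < mid \<and> (j < hi \<longrightarrow> key (a i) \<le> key (a j)) \<or>
      i' = i \<and> j' = Suc j \<and> z = j \<and> j < hi \<and> (i < mid \<longrightarrow> key (a j) \<le> key (a i))"
  shows "mrun key w p a lo (Suc k) i' mid j' hi (b(k := a z))"
proof -
  have r1: "2 * w dvd lo" "lo \<le> i" "i \<le> mid" "mid \<le> j" "j \<le> hi" "k + mid = i + j" "mid = min (lo + w) p" "hi = min (lo + 2 * w) p"
    and pr: "pref b 0 k = pref a 0 i + pref a mid j" and sb: "srt key (2 * w) k b"
    and le: "\<And>x y. lo \<le> x \<Longrightarrow> x < k \<Longrightarrow> i \<le> y \<and> y < mid \<or> j \<le> y \<and> y < hi \<Longrightarrow> key (b x) \<le> key (a y)"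
    using r unfolding mrun_def by blast+
  have wd: "w dvd lo" using r1(1) by (rule dvd_mult_right)
  have sa: "key (a x) \<le> key (a y)" if "x \<le> y" "lo \<le> x \<and> y < mid \<or> mid \<le> x \<and> y < hi" for x y
  proof (cases "x = y")
    case False
    have "x div w = y div w"
    proof (cases "y < mid")
      case True
      then show ?thesis using that r1 block[OF wd, of x] block[OF wd, of y] by auto
    next
      case False
      then have m: "mid = lo + w" using that r1 by (auto simp: min_def split: if_splits)
      have "w dvd lo + w" using wd by simp
      then show ?thesis using that r1 False m block[of w "lo + w" x] block[of w "lo + w" y] by auto
    qed
    then show ?thesis using s that False r1 unfolding srt_def by auto
  qed simp
  have zmin: "key (a z) \<le> key (a y)" if "i' \<le> y \<and> y < mid \<or> j' \<le> y \<and> y < hi" for y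
  proof -
    from z consider "z = i" "i' = Suc i" "j' = j" "i < mid" "j < hi \<longrightarrow> key (a i) \<le> key (a j)" |
      "z = j" "j' = Suc j" "i' = i" "j < hi" "i < mid \<longrightarrow> key (a j) \<le> key (a i)" by blast
    then show ?thesis
    proof cases
      case 1
      show ?thesis
      proof (cases "i' \<le> y \<and> y < mid")
        case True
        then show ?thesis using sa[of i y] 1(1,2) True r1(2-5) by simp
      next
        case False
        then have "j \<le> y" "y < hi" using that 1 by auto
        then show ?thesis using sa[of j y] 1(1,5) r1(2-5) by force
      qed
    next
      case 2
      show ?thesis
      proof (cases "j' \<le> y \<and> y < hi")
        case True
        then show ?thesis using sa[of j y] 2(1,2) True r1(2-5) by simp
      next
        case False
        then have "i \<le> y" "y < mid" using that 2 by auto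
        then show ?thesis using sa[of i y] 2(1,5) r1(2-5) by force
      qed
    qed
  qed
  have old: "key (b x) \<le> key (a z)" if "lo \<le> x" "x < k" for x
    using le[OF that, of z] z r1 by auto
  have kb: "k div (2 * w) = lo div (2 * w)"
    using block[OF r1(1), of k] r1 k by auto
  have "srt key (2 * w) (Suc k) (b(k := a z))"
    unfolding srt_def
  proof (intro allI impI)
    fix x y assume xy: "x < y" "y < Suc k" "x div (2 * w) = y div (2 * w)"
    show "key ((b(k := a z)) x) \<le> key ((b(k := a z)) y)"
    proof (cases "y = k")
      case True
      have "lo = lo div (2 * w) * (2 * w)" using r1(1) by simp
      also have "\<dots> = x div (2 * w) * (2 * w)" using xy True kb by simp
      also have "\<dots> \<le> x" by (rule div_times_less_eq_dividend)
      finally show ?thesis using old xy True by simp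
    next
      case False
      then show ?thesis using sb xy unfolding srt_def by auto
    qed
  qed
  moreover have "pref (b(k := a z)) 0 (Suc k) = pref a 0 i' + pref a mid j'"
    using z pr r1 by (auto simp: pref_Suc pref_upd)
  moreover have "key ((b(k := a z)) x) \<le> key (a y)" if "lo \<le> x" "x < Suc k" "i' \<le> y \<and> y < mid \<or> j' \<le> y \<and> y < hi" for x y
  proof (cases "x = k")
    case True
    then show ?thesis using zmin that by simp
  next
    case False
    then show ?thesis using le[of x y] that z by auto
  qed
  ultimately show ?thesis using r1 z unfolding mrun_def by auto
qed

abbreviation wmin :: "nat \<Rightarrow> wexp \<Rightarrow> cmd" where
  "wmin i e \<equiv> If (WLess e (WV 14)) (WSet i e) (WSet i (WV 14))"

definition TAKE :: "nat \<Rightarrow> cmd" where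
  "TAKE i = (WSt 12 (WV 18) (WL 11 (WV i)) ;; WSet i (WB Add (WV i) (WC 1)))"

text \<open>Variables 18 to 22 hold \<open>k\<close>, \<open>i\<close>, \<open>mid\<close>,
  \<open>j\<close> and \<open>hi\<close>. One call emits one element and opens the next pair of
  blocks when the present one is used up, so a level is a single loop over output positions and
  visibly takes linear time.\<close>

definition MERGE :: cmd where
  "MERGE = (If (WLess (WV 18) (WV 22)) SKIP
     (WSet 19 (WV 18) ;; wmin 20 (WB Add (WV 18) (WV 16)) ;; WSet 21 (WV 20) ;; wmin 22 (WB Add (WV 20) (WV 16))) ;;
     If (WLess (WV 19) (WV 20))
       (If (WLess (WV 21) (WV 22)) (If (RLess (RL 7 (WL 11 (WV 21))) (RL 7 (WL 11 (WV 19)))) (TAKE 21) (TAKE 19)) (TAKE 19))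
       (TAKE 21))"

text \<open>Setting variable 22 to zero makes the first \<open>MERGE\<close> open a pair of
  blocks.\<close>

definition LEVEL :: cmd where
  "LEVEL = (WSet 22 (WC 0) ;; For 18 14 MERGE ;; For 18 14 (WSt 11 (WV 18) (WL 12 (WV 18))) ;; WSet 16 (WB Add (WV 16) (WV 16)))"

definition SORT :: cmd where
  "SORT = (For 18 14 (WSt 11 (WV 18) (WV 18)) ;; WSet 16 (WC 1) ;; For 17 15 LEVEL)"

lemma mod_SORT [simp]: "modW MERGE = {19, 20, 21, 22}" "modR MERGE = {}" "modWA MERGE = {12}" "modRA MERGE = {}"
  "modW LEVEL = {16, 18, 19, 20, 21, 22}" "modR LEVEL = {}" "modWA LEVEL = {11, 12}" "modRA LEVEL = {}"
  "modW SORT = {16, 17, 18, 19, 20, 21, 22}" "modR SORT = {}" "modWA SORT = {11, 12}" "modRA SORT = {}"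
  by (auto simp: MERGE_def TAKE_def LEVEL_def SORT_def)

context ram
begin

text \<open>The first disjunct covers the start of a level, where no pair of blocks has been opened;
  at later borders there is a finished run.\<close>

definition merge_inv :: "(nat \<Rightarrow> real) \<Rightarrow> nat \<Rightarrow> nat \<Rightarrow> (nat \<Rightarrow> nat) \<Rightarrow> nat \<Rightarrow> nat \<Rightarrow> nat \<Rightarrow> nat \<Rightarrow> nat \<Rightarrow> (nat \<Rightarrow> nat) \<Rightarrow> bool" where
  "merge_inv key w p a k i mid j hi b \<longleftrightarrow> k = hi \<and> mdone key w p a k b \<or> k \<le> hi \<and> (\<exists>lo. mrun key w p a lo k i mid j hi b)"

lemma merge_inv_done: "merge_inv key w p a p i mid j hi b \<Longrightarrow> mdone key w p a p b"
proof (unfold merge_inv_def, elim disjE conjE exE)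
  fix lo assume "p \<le> hi" and r: "mrun key w p a lo p i mid j hi b"
  moreover have "hi \<le> p" using r unfolding mrun_def by simp
  ultimately have "hi = p" by simp
  then show "mdone key w p a p b" using mrun_finish r by blast
qed

lemma wp_MERGE:
  assumes s: "srt key w p a" "0 < w" and k: "k < p" and pI: "p < IM" "w \<le> IM" and aI: "\<And>x. x < p \<Longrightarrow> a x < IM"
    and v: "wv s 18 = k" "wv s 14 = p" "wv s 16 = w" "wa s 11 = a" "ra s 7 = key"
    and I: "merge_inv key w p a k (wv s 19) (wv s 20) (wv s 21) (wv s 22) (wa s 12)"
  shows "wp MERGE (\<lambda>s'. merge_inv key w p a (Suc k) (wv s' 19) (wv s' 20) (wv s' 21) (wv s' 22) (wa s' 12) \<and>
    clk s' \<le> clk s + 200) s"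
proof -
  have IW: "p < W" "Suc p < W" "p + w < W" "Suc 0 < W" using pI fits by linarith+
  let ?second = "If (WLess (WV 19) (WV 20))
       (If (WLess (WV 21) (WV 22)) (If (RLess (RL 7 (WL 11 (WV 21))) (RL 7 (WL 11 (WV 19)))) (TAKE 21) (TAKE 19)) (TAKE 19))
       (TAKE 21)"
  have second: "wp ?second (\<lambda>s'. merge_inv key w p a (Suc k) (wv s' 19) (wv s' 20) (wv s' 21) (wv s' 22) (wa s' 12) \<and>
      clk s' \<le> clk s + 200) s1"
    if r: "mrun key w p a lo k (wv s1 19) (wv s1 20) (wv s1 21) (wv s1 22) (wa s1 12)" and h: "k < wv s1 22"
      and v1: "wv s1 18 = k" "wa s1 11 = a" "ra s1 7 = key" and t: "clk s1 \<le> clk s + 100" for s1 lo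
  proof -
    have b: "wv s1 19 \<le> wv s1 20" "wv s1 20 \<le> p" "wv s1 22 \<le> p" "wv s1 20 \<le> wv s1 21" "wv s1 21 \<le> wv s1 22"
        "k + wv s1 20 = wv s1 19 + wv s1 21"
      using r unfolding mrun_def by auto
    have tk: "merge_inv key w p a (Suc k) i' (wv s1 20) j' (wv s1 22) ((wa s1 12)(k := a z))"
      if "i' = Suc (wv s1 19) \<and> j' = wv s1 21 \<and> z = wv s1 19 \<and> wv s1 19 < wv s1 20 \<and> (wv s1 21 < wv s1 22 \<longrightarrow> key (a (wv s1 19)) \<le> key (a (wv s1 21))) \<or>
      i' = wv s1 19 \<and> j' = Suc (wv s1 21) \<and> z = wv s1 21 \<and> wv s1 21 < wv s1 22 \<and> (wv s1 19 < wv s1 20 \<longrightarrow> key (a (wv s1 21)) \<le> key (a (wv s1 19)))"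
      for i' j' z
      using mrun_take[OF r s(2,1) h that] h unfolding merge_inv_def by auto
    show ?thesis
    proof (cases "wv s1 19 < wv s1 20")
      case T1: True
      then have i: "wv s1 19 < p" using b by linarith
      show ?thesis
      proof (cases "wv s1 21 < wv s1 22")
        case T2: True
        then have j: "wv s1 21 < p" using b by linarith
        show ?thesis using T1 T2 i j tk[of "Suc (wv s1 19)" "wv s1 21" "wv s1 19"] tk[of "wv s1 19" "Suc (wv s1 21)" "wv s1 21"]
            v1 t IW pI k aI[OF i] aI[OF j]
          by (simp add: wp_simps TAKE_def)
      next
        case False
        then show ?thesis using T1 i tk[of "Suc (wv s1 19)" "wv s1 21" "wv s1 19"] v1 t IW pI k aI[OF i]
          by (simp add: wp_simps TAKE_def)
      qed
    next
      case False
      then have T2: "wv s1 21 < wv s1 22" using b h by linarith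
      then have j: "wv s1 21 < p" using b by linarith
      show ?thesis using False T2 j tk[of "wv s1 19" "Suc (wv s1 21)" "wv s1 21"] v1 t IW pI k aI[OF j]
        by (simp add: wp_simps TAKE_def)
    qed
  qed
  show ?thesis
  proof (cases "k < wv s 22")
    case True
    then obtain lo where r: "mrun key w p a lo k (wv s 19) (wv s 20) (wv s 21) (wv s 22) (wa s 12)"
      using I unfolding merge_inv_def by auto
    show ?thesis
      unfolding MERGE_def wp_Seq wp_If[of _ SKIP]
      using True v second[of lo "s\<lparr>clk := clk s + 5\<rparr>"] r by (simp add: wp_SKIP)
  next
    case False
    then have d: "mdone key w p a k (wa s 12)"
      using I mrun_finish unfolding merge_inv_def by (auto simp: le_less)
    let ?mid = "min (k + w) p"
    let ?hi = "min (?mid + w) p"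
    note r = mrun_start[OF d k]
    have h: "k < ?hi" using k s(2) by auto
    have m: "?mid \<le> p" "?mid + w < W" using IW by auto
    have "wp (WSet 19 (WV 18) ;; wmin 20 (WB Add (WV 18) (WV 16)) ;; WSet 21 (WV 20) ;; wmin 22 (WB Add (WV 20) (WV 16)))
      (\<lambda>s1. s1 = s\<lparr>wv := (wv s)(19 := k, 20 := ?mid, 21 := ?mid, 22 := ?hi), clk := clk s1\<rparr> \<and> clk s1 \<le> clk s + 80) (s\<lparr>clk := clk s + 5\<rparr>)"
      using v IW m k by (auto simp: wp_simps min_def)
    then have "wp (WSet 19 (WV 18) ;; wmin 20 (WB Add (WV 18) (WV 16)) ;; WSet 21 (WV 20) ;; wmin 22 (WB Add (WV 20) (WV 16)))
      (\<lambda>s1. wp ?second (\<lambda>s'. merge_inv key w p a (Suc k) (wv s' 19) (wv s' 20) (wv s' 21) (wv s' 22) (wa s' 12) \<and>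
      clk s' \<le> clk s + 200) (s1\<lparr>clk := clk s1 + 1\<rparr>)) (s\<lparr>clk := clk s + 5\<rparr>)"
    proof (rule wp_conseq)
      fix s1 assume e: "s1 = s\<lparr>wv := (wv s)(19 := k, 20 := ?mid, 21 := ?mid, 22 := ?hi), clk := clk s1\<rparr> \<and> clk s1 \<le> clk s + 80"
      define z where "z = clk s1"
      have s1: "s1 = s\<lparr>wv := (wv s)(19 := k, 20 := ?mid, 21 := ?mid, 22 := ?hi), clk := z\<rparr>" "z \<le> clk s + 80" using e by (auto simp: z_def)
      show "wp ?second (\<lambda>s'. merge_inv key w p a (Suc k) (wv s' 19) (wv s' 20) (wv s' 21) (wv s' 22) (wa s' 12) \<and>
          clk s' \<le> clk s + 200) (s1\<lparr>clk := clk s1 + 1\<rparr>)"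
        by (rule second[of k]) (use r h v s1(2) in \<open>simp_all add: s1(1)\<close>)
    qed
    then show ?thesis unfolding MERGE_def wp_Seq[of "If _ SKIP _"] wp_If[of "WLess (WV 18) (WV 22)"] using False v by simp
  qed
qed

lemma wp_LEVEL:
  assumes s: "srt key w p a" "0 < w" and pI: "p < IM" "w \<le> IM" and aI: "\<And>x. x < p \<Longrightarrow> a x < IM"
    and v: "wv s 14 = p" "wv s 16 = w" "wa s 11 = a" "ra s 7 = key"
    and post: "\<And>s'. srt key (2 * w) p (wa s' 11) \<Longrightarrow> pref (wa s' 11) 0 p = pref a 0 p \<Longrightarrow> wv s' 16 = 2 * w \<Longrightarrow>
      frame LEVEL s s' \<Longrightarrow> clk s' \<le> clk s + 250 * p + 30 \<Longrightarrow> R s'"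
  shows "wp LEVEL R s"
proof -
  have IW: "p < W" "w + w < W" "0 < W" using pI fits by linarith+
  define s1 where "s1 = s\<lparr>wv := (wv s)(22 := 0), clk := clk s + costW (WC 0) + 2\<rparr>"
  let ?cp = "For 18 14 (WSt 11 (WV 18) (WL 12 (WV 18)))" and ?dbl = "WSet 16 (WB Add (WV 16) (WV 16))"
  have "wp (For 18 14 MERGE) (wp ?cp (wp ?dbl (\<lambda>s'. frame LEVEL s s' \<longrightarrow> R s'))) s1"
  proof (rule wp_For[where N = p and \<tau> = 200 and
        I = "\<lambda>k s. merge_inv key w p a k (wv s 19) (wv s 20) (wv s 21) (wv s 22) (wa s 12)"])
    show "merge_inv key w p a 0 (wv s1 19) (wv s1 20) (wv s1 21) (wv s1 22) (wa s1 12)"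
      by (simp add: merge_inv_def mdone_def s1_def pref_def srt_def)
  next
    fix k and s' :: st assume k: "k < p" "wv s' 18 = k" and f: "frame (For 18 14 MERGE) s1 s'"
      and I: "merge_inv key w p a k (wv s' 19) (wv s' 20) (wv s' 21) (wv s' 22) (wa s' 12)"
    show "wp MERGE (\<lambda>s''. merge_inv key w p a (Suc k) (wv s'' 19) (wv s'' 20) (wv s'' 21) (wv s'' 22) (wa s'' 12) \<and>
        clk s'' \<le> clk s' + 200) s'"
      by (rule wp_MERGE[OF s k(1) pI aI]) (use k f v I in \<open>auto simp: frame_def s1_def\<close>)
  next
    fix s2 :: st assume I: "merge_inv key w p a p (wv s2 19) (wv s2 20) (wv s2 21) (wv s2 22) (wa s2 12)"
      and f2: "frame (For 18 14 MERGE) s1 s2" and t2: "clk s2 \<le> clk s1 + p * (200 + 12) + 9"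
    define b where "b = wa s2 12"
    have d: "mdone key w p a p b" using merge_inv_done[OF I] by (simp add: b_def)
    have bI: "b x < IM" if "x < p" for x
    proof -
      have "b x \<in># pref b 0 p" using that by (simp add: pref_def)
      then have "b x \<in># pref a 0 p" using d unfolding mdone_def by simp
      then show ?thesis using aI by (auto simp: pref_def)
    qed
    have v2: "wv s2 14 = p" "wv s2 16 = w" using f2 v by (auto simp: frame_def s1_def)
    show "wp ?cp (wp ?dbl (\<lambda>s'. frame LEVEL s s' \<longrightarrow> R s')) s2"
    proof (rule wp_For[where N = p and \<tau> = 20 and I = "\<lambda>k s. \<forall>x<k. wa s 11 x = b x"])
      fix k and s' :: st assume k: "k < p" "wv s' 18 = k" "\<forall>x<k. wa s' 11 x = b x" and f: "frame ?cp s2 s'"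
      have "wa s' 12 = b" using f by (auto simp: frame_def b_def)
      then show "wp (WSt 11 (WV 18) (WL 12 (WV 18))) (\<lambda>s''. (\<forall>x<Suc k. wa s'' 11 x = b x) \<and> clk s'' \<le> clk s' + 20) s'"
        using k bI[of k] pI by (simp add: wp_simps less_Suc_eq)
    next
      fix s3 :: st assume b3: "\<forall>x<p. wa s3 11 x = b x" and f3: "frame ?cp s2 s3" and t3: "clk s3 \<le> clk s2 + p * (20 + 12) + 9"
      have "map (wa s3 11) [0..<p] = map b [0..<p]" using b3 by simp
      then have "pref (wa s3 11) 0 p = pref b 0 p" unfolding pref_def by (rule arg_cong)
      then have "srt key (2 * w) p (wa s3 11)" "pref (wa s3 11) 0 p = pref a 0 p"
        using d b3 unfolding mdone_def srt_def by auto
      moreover have "wv s3 16 = w" using f3 v2 by (auto simp: frame_def)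
      ultimately show "wp ?dbl (\<lambda>s'. frame LEVEL s s' \<longrightarrow> R s') s3"
        using IW t3 t2 post[of "s3\<lparr>wv := (wv s3)(16 := w + w), clk := 7 + clk s3\<rparr>"]
        by (simp add: wp_simps mult_2 s1_def)
    qed (use v2 IW in auto)
  qed (use v IW in \<open>auto simp: s1_def\<close>)
  then have "wp (WSet 22 (WC 0)) (wp (For 18 14 MERGE) (wp ?cp (wp ?dbl (\<lambda>s'. frame LEVEL s s' \<longrightarrow> R s')))) s"
    using IW by (simp add: wp_WSet s1_def)
  then have "wp LEVEL (\<lambda>s'. frame LEVEL s s' \<longrightarrow> R s') s" unfolding LEVEL_def wp_Seq .
  then show ?thesis by (rule wp_conseq) auto
qed

text \<open>The number \<open>lv\<close> of levels is fixed by the caller and may exceed the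
  logarithm of \<open>p\<close>; a surplus level merges with an empty right half and keeps the
  order.\<close>

lemma wp_SORT:
  assumes pI: "p < IM" "2 ^ lv \<le> IM" "p \<le> 2 ^ lv" and lv: "lv < W"
    and v: "wv s 14 = p" "wv s 15 = lv"
    and post: "\<And>s'. \<forall>x y. x < y \<longrightarrow> y < p \<longrightarrow> ra s 7 (wa s' 11 x) \<le> ra s 7 (wa s' 11 y) \<Longrightarrow>
      pref (wa s' 11) 0 p = mset [0..<p] \<Longrightarrow> frame SORT s s' \<Longrightarrow>
      clk s' \<le> clk s + (lv + 1) * (250 * p + 60) \<Longrightarrow> R s'"
  shows "wp SORT R s"
proof -
  have IW: "p < W" "0 < W" "Suc 0 < W" using pI fits by linarith+
  let ?ini = "For 18 14 (WSt 11 (WV 18) (WV 18))"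
  have "wp ?ini (wp (WSet 16 (WC 1)) (wp (For 17 15 LEVEL) (\<lambda>s'. frame SORT s s' \<longrightarrow> R s'))) s"
  proof (rule wp_For[where N = p and \<tau> = 15 and I = "\<lambda>k s. \<forall>x<k. wa s 11 x = x"])
    fix k and s' :: st assume k: "k < p" "wv s' 18 = k" "\<forall>x<k. wa s' 11 x = x"
    then show "wp (WSt 11 (WV 18) (WV 18)) (\<lambda>s''. (\<forall>x<Suc k. wa s'' 11 x = x) \<and> clk s'' \<le> clk s' + 15) s'"
      using pI by (simp add: wp_simps less_Suc_eq)
  next
    fix s1 :: st assume a1: "\<forall>x<p. wa s1 11 x = x" and f1: "frame ?ini s s1" and t1: "clk s1 \<le> clk s + p * (15 + 12) + 9"
    define s2 where "s2 = s1\<lparr>wv := (wv s1)(16 := 1), clk := clk s1 + costW (WC 1) + 2\<rparr>"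
    have v2: "wv s2 14 = p" "wv s2 15 = lv" "ra s2 7 = ra s 7" using f1 v by (auto simp: frame_def s2_def)
    have "map (wa s2 11) [0..<p] = [0..<p]" using a1 by (intro map_idI) (simp add: s2_def)
    then have pa: "pref (wa s2 11) 0 p = mset [0..<p]" by (simp only: pref_def)
    have "wp (For 17 15 LEVEL) (\<lambda>s'. frame SORT s s' \<longrightarrow> R s') s2"
    proof (rule wp_For[where N = lv and \<tau> = "250 * p + 30" and
          I = "\<lambda>l s'. wv s' 16 = 2 ^ l \<and> srt (ra s 7) (2 ^ l) p (wa s' 11) \<and> pref (wa s' 11) 0 p = mset [0..<p]"])
      show "wv s2 16 = 2 ^ 0 \<and> srt (ra s 7) (2 ^ 0) p (wa s2 11) \<and> pref (wa s2 11) 0 p = mset [0..<p]"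
        using pa by (auto simp: s2_def srt_def)
    next
      fix l and s' :: st assume l: "l < lv" and f: "frame (For 17 15 LEVEL) s2 s'"
        and I: "wv s' 16 = 2 ^ l \<and> srt (ra s 7) (2 ^ l) p (wa s' 11) \<and> pref (wa s' 11) 0 p = mset [0..<p]"
      have l2: "(2::nat) ^ l \<le> IM" using l pI(2) power_increasing[of l lv "2::nat"] by linarith
      have aI: "wa s' 11 x < IM" if "x < p" for x
      proof -
        have "wa s' 11 x \<in># pref (wa s' 11) 0 p" using that by (simp add: pref_def)
        then have "wa s' 11 x < p" using I by simp
        then show ?thesis using pI by linarith
      qed
      have v': "wv s' 14 = p" "ra s' 7 = ra s 7" using f v2 by (auto simp: frame_def)
      show "wp LEVEL (\<lambda>s''. (wv s'' 16 = 2 ^ Suc l \<and> srt (ra s 7) (2 ^ Suc l) p (wa s'' 11) \<and> pref (wa s'' 11) 0 p = mset [0..<p]) \<and>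
          clk s'' \<le> clk s' + (250 * p + 30)) s'"
        by (rule wp_LEVEL[of "ra s 7" "2 ^ l" p "wa s' 11"]) (use I l2 aI v' pI in auto)
    next
      fix s3 :: st assume I: "wv s3 16 = 2 ^ lv \<and> srt (ra s 7) (2 ^ lv) p (wa s3 11) \<and> pref (wa s3 11) 0 p = mset [0..<p]"
        and t3: "clk s3 \<le> clk s2 + lv * (250 * p + 30 + 12) + 9"
      have "clk s3 \<le> clk s + (lv + 1) * (250 * p + 60)" using t3 t1 by (simp add: s2_def algebra_simps)
      moreover have "\<forall>x y. x < y \<longrightarrow> y < p \<longrightarrow> ra s 7 (wa s3 11 x) \<le> ra s 7 (wa s3 11 y)"
        using I pI(3) unfolding srt_def by simp
      ultimately show "frame SORT s s3 \<longrightarrow> R s3" using post I by blast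
    qed (use v2 lv in auto)
    then show "wp (WSet 16 (WC 1)) (wp (For 17 15 LEVEL) (\<lambda>s'. frame SORT s s' \<longrightarrow> R s')) s1"
      using IW by (simp add: wp_WSet s2_def)
  qed (use v IW in auto)
  then have "wp SORT (\<lambda>s'. frame SORT s s' \<longrightarrow> R s') s" unfolding SORT_def wp_Seq .
  then show ?thesis by (rule wp_conseq) auto
qed

end

section \<open>Pruning candidates\<close>

text \<open>\<open>G\<close> gives the table index of a candidate. \<open>pe\<close> stores the
  pending candidate of an index plus one, with zero for none.\<close>

definition pair_inv :: "(nat \<Rightarrow> nat) \<Rightarrow> nat \<Rightarrow> nat \<Rightarrow> (nat \<Rightarrow> nat) \<Rightarrow> (nat \<Rightarrow> nat) \<Rightarrow> (nat \<Rightarrow> nat) \<Rightarrow> bool" where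
  "pair_inv G k p pe pa pb \<longleftrightarrow>
     (\<forall>g a. pe g = Suc a \<longrightarrow> a < k \<and> G a = g \<and> (\<forall>i<p. pa i \<noteq> a \<and> pb i \<noteq> a)) \<and>
     (\<forall>i<p. pa i < pb i \<and> pb i < k \<and> G (pa i) = G (pb i)) \<and>
     (\<forall>i<p. \<forall>j<p. i \<noteq> j \<longrightarrow> pa i \<noteq> pa j \<and> pa i \<noteq> pb j \<and> pb i \<noteq> pb j) \<and>
     (\<forall>a<k. (\<exists>i<p. pa i = a \<or> pb i = a) \<or> pe (G a) = Suc a) \<and> p \<le> k"

lemma pair_inv_pend:
  assumes i: "pair_inv G k p pe pa pb" and z: "pe (G k) = 0"
  shows "pair_inv G (Suc k) p (pe(G k := Suc k)) pa pb"
proof -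
  have "\<forall>i<p. pa i \<noteq> k \<and> pb i \<noteq> k" using i unfolding pair_inv_def by fastforce
  moreover have "\<forall>a<k. (\<exists>i<p. pa i = a \<or> pb i = a) \<or> (G a \<noteq> G k \<and> pe (G a) = Suc a)"
    using i z unfolding pair_inv_def by (metis Zero_not_Suc)
  ultimately show ?thesis using i unfolding pair_inv_def by (auto simp: less_Suc_eq)
qed

lemma pair_inv_pair:
  assumes i: "pair_inv G k p pe pa pb" and z: "pe (G k) = Suc a"
  shows "pair_inv G (Suc k) (Suc p) (pe(G k := 0)) (pa(p := a)) (pb(p := k))"
proof -
  have a: "a < k" "G a = G k" "\<And>i. i < p \<Longrightarrow> pa i \<noteq> a \<and> pb i \<noteq> a" using i z unfolding pair_inv_def by auto
  have k: "\<And>i. i < p \<Longrightarrow> pa i < k \<and> pb i < k" using i unfolding pair_inv_def by fastforce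
  have "(\<exists>i<Suc p. (pa(p := a)) i = x \<or> (pb(p := k)) i = x) \<or> (pe(G k := 0)) (G x) = Suc x" if "x < Suc k" for x
  proof (cases "x = k \<or> x = a")
    case True
    then show ?thesis by (intro disjI1 exI[of _ p]) auto
  next
    case False
    then have "(\<exists>i<p. pa i = x \<or> pb i = x) \<or> pe (G x) = Suc x" using i that unfolding pair_inv_def by auto
    then show ?thesis
    proof
      assume "\<exists>i<p. pa i = x \<or> pb i = x"
      then obtain j where "j < p" "pa j = x \<or> pb j = x" by blast
      then show ?thesis by (intro disjI1 exI[of _ j]) auto
    next
      assume "pe (G x) = Suc x"
      then show ?thesis using False z by auto
    qed
  qed
  moreover have "x < Suc k \<and> G x = g \<and> (\<forall>i<Suc p. (pa(p := a)) i \<noteq> x \<and> (pb(p := k)) i \<noteq> x)"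
    if "(pe(G k := 0)) g = Suc x" for g x
  proof -
    have g: "g \<noteq> G k" "pe g = Suc x" using that by (auto split: if_splits)
    then have "x < k" "G x = g" "\<forall>i<p. pa i \<noteq> x \<and> pb i \<noteq> x" using i unfolding pair_inv_def by auto
    then show ?thesis using a g by (auto simp: less_Suc_eq)
  qed
  moreover have "\<forall>i<Suc p. (pa(p := a)) i < (pb(p := k)) i \<and> (pb(p := k)) i < Suc k \<and> G ((pa(p := a)) i) = G ((pb(p := k)) i)"
    using i a unfolding pair_inv_def by (auto simp: less_Suc_eq)
  moreover have "\<forall>i<Suc p. \<forall>j<Suc p. i \<noteq> j \<longrightarrow> (pa(p := a)) i \<noteq> (pa(p := a)) j \<and> (pa(p := a)) i \<noteq> (pb(p := k)) j \<and> (pb(p := k)) i \<noteq> (pb(p := k)) j"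
    using i a(1) a(3) k unfolding pair_inv_def by (auto simp: less_Suc_eq)
  moreover have "Suc p \<le> Suc k" using i unfolding pair_inv_def by simp
  ultimately show ?thesis unfolding pair_inv_def by blast
qed

text \<open>Unpaired candidates are the pending ones of their indices, so they have different
  indices.\<close>

lemma pair_inv_count:
  assumes i: "pair_inv G M p pe pa pb"
  shows "M \<le> 2 * p + card (G ` {..<M})"
proof -
  let ?P = "pa ` {..<p} \<union> pb ` {..<p}" and ?U = "{a. a < M \<and> pe (G a) = Suc a}"
  have "{..<M} \<subseteq> ?P \<union> ?U" using i unfolding pair_inv_def by fastforce
  then have "M \<le> card (?P \<union> ?U)" using card_mono[of "?P \<union> ?U" "{..<M}"] by simp
  also have "\<dots> \<le> card ?P + card ?U" by (rule card_Un_le)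
  also have "card ?P \<le> 2 * p"
    using card_Un_le[of "pa ` {..<p}" "pb ` {..<p}"] card_image_le[of "{..<p}" pa] card_image_le[of "{..<p}" pb] by simp
  also have "card ?U \<le> card (G ` {..<M})"
  proof (rule card_inj_on_le[of G])
    show "inj_on G ?U"
    proof (rule inj_onI)
      fix a b assume "a \<in> ?U" "b \<in> ?U" and e: "G a = G b"
      then have "pe (G a) = Suc a" "pe (G b) = Suc b" by simp_all
      then show "a = b" unfolding e by simp
    qed
  qed auto
  finally show ?thesis by simp
qed

definition crossing :: "line \<Rightarrow> line \<Rightarrow> real" where
  "crossing a b = (fst a - fst b) / (snd a - snd b)"

text \<open>Which of the lines \<open>a\<close> and \<open>b\<close> is not below the other one to the left (\<open>neg\<close>) or right of their crossing.\<close>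

definition loser :: "bool \<Rightarrow> line \<Rightarrow> line \<Rightarrow> nat \<Rightarrow> nat \<Rightarrow> nat" where
  "loser neg a b x y = (if snd a < snd b then if neg then y else x
     else if snd b < snd a then if neg then x else y else if fst a < fst b then y else x)"

definition winner :: "bool \<Rightarrow> line \<Rightarrow> line \<Rightarrow> nat \<Rightarrow> nat \<Rightarrow> nat" where
  "winner neg a b x y = (if snd a < snd b then if neg then x else y
     else if snd b < snd a then if neg then y else x else if fst a < fst b then x else y)"

text \<open>A weak inequality is enough because the lines agree where they cross. For parallel lines
  the quotient is 0 by convention and carries no information, but then \<open>loser\<close> compares
  the intercepts and ignores \<open>neg\<close>.\<close>

lemma (in ratio) loser_val:
  assumes "if neg then lam \<le> crossing (f x) (f y) else crossing (f x) (f y) \<le> lam"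
  shows "val (f (winner neg (f x) (f y) x y)) \<le> val (f (loser neg (f x) (f y) x y))"
proof -
  consider "snd (f x) < snd (f y)" | "snd (f y) < snd (f x)" | "snd (f x) = snd (f y)" by linarith
  then show ?thesis
    using assms by cases (auto simp: winner_def loser_def val_def crossing_def neg_le_divide_eq neg_divide_le_eq
      pos_le_divide_eq pos_divide_le_eq algebra_simps split: if_splits)
qed

text \<open>The sorted positions whose crossing must lie on the same side of \<open>lam\<close> as
  the median crossing: from the median upwards if \<open>lam\<close> is below it, downwards
  otherwise. The median is included in both cases, so at least half of the pairs qualify.\<close>

definition resolved :: "bool \<Rightarrow> nat \<Rightarrow> nat \<Rightarrow> bool" where
  "resolved neg p q \<longleftrightarrow> (if neg then p div 2 \<le> q else q \<le> p div 2)"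

lemma resolved_count: "p \<le> 2 * card {q. q < p \<and> resolved neg p q}"
proof (cases neg)
  case True
  then have "{q. q < p \<and> resolved neg p q} = {p div 2..<p}" by (auto simp: resolved_def)
  then show ?thesis by simp
next
  case False
  then have "{q. q < p \<and> resolved neg p q} = {..<min p (Suc (p div 2))}" by (auto simp: resolved_def)
  moreover have "p div 2 * 2 + p mod 2 = p" "p mod 2 < 2" by auto
  then have "p \<le> 2 * min p (Suc (p div 2))" by (auto simp: min_def)
  ultimately show ?thesis by simp
qed

text \<open>\<open>l q\<close> and \<open>w q\<close> are the loser and the winner of the \<open>q\<close>-th pair in sorted order.\<close>

lemma prune_pass:
  fixes val :: "line \<Rightarrow> real"
  assumes pi: "pair_inv G M p pe pa pb" and bij: "bij_betw ix {..<p} {..<p}"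
    and lw: "\<And>q. q < p \<Longrightarrow> (l q = pa (ix q) \<and> w q = pb (ix q)) \<or> (l q = pb (ix q) \<and> w q = pa (ix q))"
    and Q: "Q \<subseteq> {..<p}" "p \<le> 2 * card Q" and v: "\<And>q. q \<in> Q \<Longrightarrow> val (f (w q)) \<le> val (f (l q))"
  defines "E \<equiv> (\<lambda>k. (G k, f k)) ` {..<M}" and "E' \<equiv> (\<lambda>k. (G k, f k)) ` ({..<M} - l ` Q)"
  shows "card ({..<M} - l ` Q) + card Q = M" "M \<le> 4 * card Q + card (fst ` E)"
    "\<And>g x. (g, x) \<in> E \<Longrightarrow> \<exists>y. (g, y) \<in> E' \<and> val y \<le> val x" "p \<le> 2 * card Q"
proof -
  have ix: "ix q < p" if "q < p" for q using bij that by (auto simp: bij_betw_def)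
  have ixi: "ix q = ix r \<Longrightarrow> q = r" if "q < p" "r < p" for q r using bij that by (auto simp: bij_betw_def inj_on_def)
  have dis: "l q \<noteq> l r \<and> l q \<noteq> w r" if "q < p" "r < p" "q \<noteq> r" for q r
  proof -
    have "ix q \<noteq> ix r" using ixi that by blast
    then show ?thesis using lw[OF that(1)] lw[OF that(2)] ix[OF that(1)] ix[OF that(2)] pi unfolding pair_inv_def by metis
  qed
  have lM: "l q < M \<and> w q < M \<and> G (l q) = G (w q) \<and> l q \<noteq> w q" if "q < p" for q
  proof -
    have "pa (ix q) < pb (ix q)" "pb (ix q) < M" "G (pa (ix q)) = G (pb (ix q))" using pi ix[OF that] unfolding pair_inv_def by blast+
    then show ?thesis using lw[OF that] by auto
  qed
  have fin: "finite Q" using Q(1) finite_subset by blast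
  have "inj_on l Q" using dis Q(1) by (intro inj_onI) blast
  then have "card (l ` Q) = card Q" by (rule card_image)
  moreover have "l ` Q \<subseteq> {..<M}" using lM Q(1) by auto
  ultimately show "card ({..<M} - l ` Q) + card Q = M"
    using card_Diff_subset[of "l ` Q" "{..<M}"] card_mono[of "{..<M}" "l ` Q"] fin by simp
  have "fst ` E = G ` {..<M}" by (auto simp: E_def image_image)
  then show "M \<le> 4 * card Q + card (fst ` E)" using pair_inv_count[OF pi] Q(2) by simp
  show "\<exists>y. (g, y) \<in> E' \<and> val y \<le> val x" if "(g, x) \<in> E" for g x
  proof -
    obtain k where k: "k < M" "g = G k" "x = f k" using \<open>(g, x) \<in> E\<close> by (auto simp: E_def)
    show ?thesis
    proof (cases "k \<in> l ` Q")
      case False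
      then have "(g, f k) \<in> E'" using k by (auto simp: E'_def)
      then show ?thesis using k by blast
    next
      case True
      then obtain q where q: "q \<in> Q" "k = l q" by blast
      then have qp: "q < p" using Q(1) by auto
      \<comment> \<open>The pairs are disjoint, so the winner of one pair is not the loser of
        another and survives.\<close>
      have "w q \<notin> l ` Q"
      proof
        assume "w q \<in> l ` Q"
        then obtain r where r: "r \<in> Q" "w q = l r" by blast
        then have "r < p" using Q(1) by auto
        then show False using dis[OF _ qp, of r] lM[OF qp] r(2) by metis
      qed
      then have "(G (w q), f (w q)) \<in> E'" using lM[OF qp] by (auto simp: E'_def)
      moreover have "G (w q) = g" "val (f (w q)) \<le> val x" using k q v lM[OF qp] by auto
      ultimately show ?thesis by blast
    qed
  qed
  show "p \<le> 2 * card Q" by fact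
qed

lemma bij_if_pref: "pref ix 0 p = mset [0..<p] \<Longrightarrow> bij_betw ix {..<p} {..<p}"
proof -
  assume a: "pref ix 0 p = mset [0..<p]"
  then have m: "mset (map ix [0..<p]) = mset [0..<p]" by (simp only: pref_def)
  have "set (map ix [0..<p]) = set [0..<p]" using mset_eq_setD[OF m] .
  then have "ix ` {..<p} = {..<p}" by (simp add: lessThan_atLeast0)
  then show ?thesis by (simp add: bij_betw_def eq_card_imp_inj_on)
qed

section \<open>The pruning pass as a program\<close>

definition PAIR :: cmd where
  "PAIR = (WSet 27 (WL 7 (WV 26)) ;;
     If (WLess (WC 0) (WL 8 (WV 27)))
       (WSet 28 (WB Sub (WL 8 (WV 27)) (WC 1)) ;; WSt 9 (WV 14) (WV 28) ;; WSt 10 (WV 14) (WV 26) ;;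
        RSt 7 (WV 14) (RB Div (RB Sub (RL 5 (WV 28)) (RL 5 (WV 26))) (RB Sub (RL 6 (WV 28)) (RL 6 (WV 26)))) ;;
        WSt 8 (WV 27) (WC 0) ;; WSet 14 (WB Add (WV 14) (WC 1)))
       (WSt 8 (WV 27) (WB Add (WV 26) (WC 1))))"

definition CLEAR :: cmd where
  "CLEAR = WSt 8 (WL 7 (WV 26)) (WC 0)"

definition KILL :: cmd where
  "KILL = (WSet 28 (WL 9 (WL 11 (WV 26))) ;; WSet 29 (WL 10 (WL 11 (WV 26))) ;;
     If (RLess (RL 6 (WV 28)) (RL 6 (WV 29))) (If (WLess (WC 0) (WV 7)) (WSt 13 (WV 29) (WC 1)) (WSt 13 (WV 28) (WC 1)))
      (If (RLess (RL 6 (WV 29)) (RL 6 (WV 28))) (If (WLess (WC 0) (WV 7)) (WSt 13 (WV 28) (WC 1)) (WSt 13 (WV 29) (WC 1)))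
       (If (RLess (RL 5 (WV 28)) (RL 5 (WV 29))) (WSt 13 (WV 29) (WC 1)) (WSt 13 (WV 28) (WC 1)))))"

definition KILLQ :: cmd where
  "KILLQ = If (WLess (WC 0) (WV 7)) (If (WLess (WV 26) (WB Div (WV 14) (WC 2))) SKIP KILL)
     (If (WLess (WB Div (WV 14) (WC 2)) (WV 26)) SKIP KILL)"

text \<open>The survivors move to the front in place, which is safe as the write position never
  overtakes the read position. The flags of the dropped candidates are reset on the way, ready for
  the next pass.\<close>

definition COMPACT :: cmd where
  "COMPACT = If (WLess (WC 0) (WL 13 (WV 26))) (WSt 13 (WV 26) (WC 0))
     (WSt 7 (WV 30) (WL 7 (WV 26)) ;; RSt 5 (WV 30) (RL 5 (WV 26)) ;; RSt 6 (WV 30) (RL 6 (WV 26)) ;;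
      WSet 30 (WB Add (WV 30) (WC 1)))"

text \<open>Without pairs, real variable 0 keeps an arbitrary value. This is harmless: no position
  is then resolved, whatever the Bellman-Ford run reports.\<close>

definition PASS :: cmd where
  "PASS = (WSet 14 (WC 0) ;; For 26 23 PAIR ;; For 26 23 CLEAR ;; SORT ;;
     If (WLess (WC 0) (WV 14)) (RSet 0 (RL 7 (WL 11 (WB Div (WV 14) (WC 2))))) SKIP ;;
     BF ;; For 26 14 KILLQ ;; WSet 30 (WC 0) ;; For 26 23 COMPACT ;; WSet 23 (WV 30))"

definition RESOLVE :: cmd where
  "RESOLVE = For 25 24 PASS"

lemma mod_PASS [simp]: "modW PAIR = {14, 27, 28}" "modR PAIR = {}" "modWA PAIR = {8, 9, 10}" "modRA PAIR = {7}"
  "modW CLEAR = {}" "modR CLEAR = {}" "modWA CLEAR = {8}" "modRA CLEAR = {}"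
  "modW KILL = {28, 29}" "modR KILL = {}" "modWA KILL = {13}" "modRA KILL = {}"
  "modW KILLQ = {28, 29}" "modR KILLQ = {}" "modWA KILLQ = {13}" "modRA KILLQ = {}"
  "modW COMPACT = {30}" "modR COMPACT = {}" "modWA COMPACT = {7, 13}" "modRA COMPACT = {5, 6}"
  by (auto simp: PAIR_def CLEAR_def KILL_def KILLQ_def COMPACT_def)

lemma mod_PASS' [simp]: "modW PASS = {5, 6, 7, 14, 16, 17, 18, 19, 20, 21, 22, 23, 26, 27, 28, 29, 30}" "modR PASS = {0, 1}"
  "modWA PASS = {7, 8, 9, 10, 11, 12, 13}" "modRA PASS = {2, 5, 6, 7}"
  unfolding PASS_def by auto

lemma mod_RESOLVE [simp]: "modW RESOLVE = insert 25 (modW PASS)" "modR RESOLVE = modR PASS"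
  "modWA RESOLVE = modWA PASS" "modRA RESOLVE = modRA PASS"
  by (auto simp: RESOLVE_def)

definition entry :: "st \<Rightarrow> nat \<Rightarrow> line" where
  "entry s k = (ra s 5 k, ra s 6 k)"

lemma entry_upd: "entry (s\<lparr>wv := x, clk := y\<rparr>) = entry s" "entry (s\<lparr>clk := y\<rparr>) = entry s" "entry (s\<lparr>wv := x\<rparr>) = entry s"
  by (simp_all add: entry_def fun_eq_iff)

context ram
begin

lemma wp_PAIRS:
  assumes M: "wv s 23 = M" "M < IM" and p: "wv s 14 = 0" and pe: "\<And>g. wa s 8 g = 0" and G: "\<And>k. k < M \<Longrightarrow> wa s 7 k < IM"
    and post: "\<And>s'. pair_inv (wa s 7) M (wv s' 14) (wa s' 8) (wa s' 9) (wa s' 10) \<Longrightarrow>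
       \<forall>i<wv s' 14. ra s' 7 i = crossing (entry s (wa s' 9 i)) (entry s (wa s' 10 i)) \<Longrightarrow>
       frame (For 26 23 PAIR) s s' \<Longrightarrow> clk s' \<le> clk s + 142 * M + 9 \<Longrightarrow> R s'"
  shows "wp (For 26 23 PAIR) R s"
proof (rule wp_For[where N = M and \<tau> = 130 and I = "\<lambda>k s'. pair_inv (wa s 7) k (wv s' 14) (wa s' 8) (wa s' 9) (wa s' 10) \<and>
    (\<forall>i<wv s' 14. ra s' 7 i = crossing (entry s (wa s' 9 i)) (entry s (wa s' 10 i)))"])
  show "pair_inv (wa s 7) 0 (wv s 14) (wa s 8) (wa s 9) (wa s 10) \<and>
    (\<forall>i<wv s 14. ra s 7 i = crossing (entry s (wa s 9 i)) (entry s (wa s 10 i)))"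
    using p pe by (simp add: pair_inv_def)
next
  fix k and s' :: st assume k: "k < M" "wv s' 26 = k" and f: "frame (For 26 23 PAIR) s s'"
    and I: "pair_inv (wa s 7) k (wv s' 14) (wa s' 8) (wa s' 9) (wa s' 10) \<and>
    (\<forall>i<wv s' 14. ra s' 7 i = crossing (entry s (wa s' 9 i)) (entry s (wa s' 10 i)))"
  have fr: "wa s' 7 = wa s 7" "ra s' 5 = ra s 5" "ra s' 6 = ra s 6" using f by (auto simp: frame_def)
  have p: "wv s' 14 \<le> k" using I unfolding pair_inv_def by blast
  have b: "wv s' 14 < IM" "k < IM" "Suc k < W" "Suc (wv s' 14) < W" "0 < W" "Suc 0 < W" using p k M fits by linarith+
  show "wp PAIR (\<lambda>s''. (pair_inv (wa s 7) (Suc k) (wv s'' 14) (wa s'' 8) (wa s'' 9) (wa s'' 10) \<and>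
    (\<forall>i<wv s'' 14. ra s'' 7 i = crossing (entry s (wa s'' 9 i)) (entry s (wa s'' 10 i)))) \<and> clk s'' \<le> clk s' + 130) s'"
  proof (cases "wa s' 8 (wa s 7 k)")
    case 0
    then show ?thesis using pair_inv_pend[OF conjunct1[OF I] 0] I k G[OF k(1)] fr b
      by (simp add: PAIR_def wp_simps)
  next
    case (Suc a)
    have a: "a < IM" using I Suc b unfolding pair_inv_def by (meson less_trans)
    show ?thesis using pair_inv_pair[OF conjunct1[OF I] Suc] I k G[OF k(1)] fr b a Suc
      by (simp add: PAIR_def wp_simps less_Suc_eq crossing_def entry_def) auto
  qed
next
  fix s' :: st assume "pair_inv (wa s 7) M (wv s' 14) (wa s' 8) (wa s' 9) (wa s' 10) \<and>
    (\<forall>i<wv s' 14. ra s' 7 i = crossing (entry s (wa s' 9 i)) (entry s (wa s' 10 i)))" "frame (For 26 23 PAIR) s s'"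
    "clk s' \<le> clk s + M * (130 + 12) + 9"
  then show "R s'" using post[of s'] by (simp add: mult.commute)
qed (use M fits in auto)

text \<open>Only indices of candidates can have a pending mark. Clearing along the candidate list
  thus takes time proportional to \<open>M\<close>, without touching the rest of the quadratic
  table.\<close>

lemma wp_CLEARS:
  assumes M: "wv s 23 = M" "M < IM" and G: "\<And>k. k < M \<Longrightarrow> wa s 7 k < IM" and pe: "pair_inv (wa s 7) M p (wa s 8) pa pb"
    and post: "\<And>s'. (\<And>g. wa s' 8 g = 0) \<Longrightarrow> frame (For 26 23 CLEAR) s s' \<Longrightarrow> clk s' \<le> clk s + 42 * M + 9 \<Longrightarrow> R s'"
  shows "wp (For 26 23 CLEAR) R s"
proof (rule wp_For[where N = M and \<tau> = 30 and I = "\<lambda>k s'. \<forall>g. wa s' 8 g \<noteq> 0 \<longrightarrow> (\<exists>a. k \<le> a \<and> a < M \<and> wa s 7 a = g)"])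
  show "\<forall>g. wa s 8 g \<noteq> 0 \<longrightarrow> (\<exists>a. 0 \<le> a \<and> a < M \<and> wa s 7 a = g)"
    using pe unfolding pair_inv_def by (metis not0_implies_Suc le0)
next
  fix k and s' :: st assume k: "k < M" "wv s' 26 = k" and f: "frame (For 26 23 CLEAR) s s'"
    and I: "\<forall>g. wa s' 8 g \<noteq> 0 \<longrightarrow> (\<exists>a. k \<le> a \<and> a < M \<and> wa s 7 a = g)"
  have fr: "wa s' 7 = wa s 7" using f by (auto simp: frame_def)
  have "\<forall>g. ((wa s' 8)(wa s 7 k := 0)) g \<noteq> 0 \<longrightarrow> (\<exists>a. Suc k \<le> a \<and> a < M \<and> wa s 7 a = g)"
    using I by (metis Suc_leI fun_upd_apply le_neq_implies_less)
  then show "wp CLEAR (\<lambda>s''. (\<forall>g. wa s'' 8 g \<noteq> 0 \<longrightarrow> (\<exists>a. Suc k \<le> a \<and> a < M \<and> wa s 7 a = g)) \<and> clk s'' \<le> clk s' + 30) s'"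
    using k fr G[OF k(1)] M fits by (simp add: CLEAR_def wp_simps)
next
  fix s' :: st assume "\<forall>g. wa s' 8 g \<noteq> 0 \<longrightarrow> (\<exists>a. M \<le> a \<and> a < M \<and> wa s 7 a = g)" "frame (For 26 23 CLEAR) s s'"
    "clk s' \<le> clk s + M * (30 + 12) + 9"
  then show "R s'" using post[of s'] by (force simp: mult.commute)
qed (use M fits in auto)

lemma wp_KILLS:
  assumes p: "wv s 14 = p" "p < IM" and ix: "\<And>q. q < p \<Longrightarrow> wa s 11 q < IM" and ab: "\<And>q. q < p \<Longrightarrow> wa s 9 (wa s 11 q) < IM \<and> wa s 10 (wa s 11 q) < IM"
    and d: "\<And>a. wa s 13 a = 0"
    and l: "l = (\<lambda>q. loser (0 < wv s 7) (entry s (wa s 9 (wa s 11 q))) (entry s (wa s 10 (wa s 11 q))) (wa s 9 (wa s 11 q)) (wa s 10 (wa s 11 q)))"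
    and post: "\<And>s'. (\<And>a. 0 < wa s' 13 a \<longleftrightarrow> a \<in> l ` {q. q < p \<and> resolved (0 < wv s 7) p q}) \<Longrightarrow> frame (For 26 14 KILLQ) s s' \<Longrightarrow>
      clk s' \<le> clk s + 162 * p + 9 \<Longrightarrow> R s'"
  shows "wp (For 26 14 KILLQ) R s"
proof (rule wp_For[where N = p and \<tau> = 150 and I = "\<lambda>k s'. \<forall>a. 0 < wa s' 13 a \<longleftrightarrow> a \<in> l ` {q. q < k \<and> resolved (0 < wv s 7) p q}"])
  fix k and s' :: st assume k: "k < p" "wv s' 26 = k" and f: "frame (For 26 14 KILLQ) s s'"
    and I: "\<forall>a. 0 < wa s' 13 a \<longleftrightarrow> a \<in> l ` {q. q < k \<and> resolved (0 < wv s 7) p q}"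
  have fr: "wa s' 9 = wa s 9" "wa s' 10 = wa s 10" "wa s' 11 = wa s 11" "ra s' 5 = ra s 5" "ra s' 6 = ra s 6" "wv s' 7 = wv s 7" "wv s' 14 = p"
    using f p by (auto simp: frame_def)
  have b: "0 < W" "Suc 0 < W" "2 < W" "k < IM" using k p fits by linarith+
  have lk: "l k < IM" using ab[OF k(1)] by (simp add: l loser_def)
  let ?Q = "\<lambda>s'' k. \<forall>a. 0 < wa s'' 13 a \<longleftrightarrow> a \<in> l ` {q. q < k \<and> resolved (0 < wv s 7) p q}"
  show "wp KILLQ (\<lambda>s''. ?Q s'' (Suc k) \<and> clk s'' \<le> clk s' + 150) s'"
  proof (cases "resolved (0 < wv s 7) p k")
    case False
    then have "{q. q < Suc k \<and> resolved (0 < wv s 7) p q} = {q. q < k \<and> resolved (0 < wv s 7) p q}" by (auto simp: less_Suc_eq)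
    then show ?thesis using False I k fr b by (auto simp: KILLQ_def wp_simps resolved_def)
  next
    case True
    then have "{q. q < Suc k \<and> resolved (0 < wv s 7) p q} = insert k {q. q < k \<and> resolved (0 < wv s 7) p q}" by (auto simp: less_Suc_eq)
    then have Q: "\<forall>a. 0 < ((wa s' 13)(l k := Suc 0)) a \<longleftrightarrow> a \<in> l ` {q. q < Suc k \<and> resolved (0 < wv s 7) p q}" using I by auto
    have K0: "wp KILL (\<lambda>s''. wa s'' 13 = (wa s' 13)(l k := Suc 0) \<and> clk s'' \<le> clk s' + 140) (s'\<lparr>clk := z\<rparr>)" if "z \<le> clk s' + 20" for z
      using k fr b ix[OF k(1)] ab[OF k(1)] that
      by (simp add: KILL_def wp_simps l loser_def entry_def)
    have K: "wp KILL (\<lambda>s''. ?Q s'' (Suc k) \<and> clk s'' \<le> clk s' + 140) (s'\<lparr>clk := z\<rparr>)" if "z \<le> clk s' + 20" for z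
      by (rule wp_conseq[OF K0[OF that]]) (use Q in auto)
    have KR: "wp KILL R (s'\<lparr>clk := z\<rparr>)"
      if "z \<le> clk s' + 20" "\<And>s''. ?Q s'' (Suc k) \<Longrightarrow> clk s'' \<le> clk s' + 140 \<Longrightarrow> R s''" for R z
      by (rule wp_conseq[OF K[OF that(1)]]) (use that(2) in auto)
    show ?thesis
    proof (cases "0 < wv s 7")
      case neg: True
      then have "\<not> k < p div 2" using True by (simp add: resolved_def)
      then show ?thesis unfolding KILLQ_def using neg k fr b by (simp add: wp_If) (rule KR; simp)
    next
      case neg: False
      then have "\<not> p div 2 < k" using True by (simp add: resolved_def)
      then show ?thesis unfolding KILLQ_def using neg k fr b by (simp add: wp_If) (rule KR; simp)
    qed
  qed
next
  fix s' :: st assume "\<forall>a. 0 < wa s' 13 a \<longleftrightarrow> a \<in> l ` {q. q < p \<and> resolved (0 < wv s 7) p q}" "frame (For 26 14 KILLQ) s s'"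
    "clk s' \<le> clk s + p * (150 + 12) + 9"
  then show "R s'" using post[of s'] by (simp add: mult.commute)
qed (use p d fits in auto)

lemma wp_COMPACTS:
  assumes M: "wv s 23 = M" "M < IM" and G: "\<And>k. k < M \<Longrightarrow> wa s 7 k < IM" and z: "wv s 30 = 0"
    and D: "\<And>a. 0 < wa s 13 a \<longleftrightarrow> a \<in> D" "D \<subseteq> {..<M}"
    and post: "\<And>s'. wv s' 30 = card ({..<M} - D) \<Longrightarrow> (\<And>a. wa s' 13 a = 0) \<Longrightarrow>
      (\<lambda>k. (wa s' 7 k, entry s' k)) ` {..<wv s' 30} = (\<lambda>k. (wa s 7 k, entry s k)) ` ({..<M} - D) \<Longrightarrow>
      frame (For 26 23 COMPACT) s s' \<Longrightarrow> clk s' \<le> clk s + 112 * M + 9 \<Longrightarrow> R s'"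
  shows "wp (For 26 23 COMPACT) R s"
proof -
  define P where "P k cnt dd a7 en \<longleftrightarrow> cnt = card ({..<k} - D) \<and> (\<forall>a. 0 < dd a \<longleftrightarrow> a \<in> D \<and> k \<le> a) \<and>
      (\<forall>a\<ge>k. a7 a = wa s 7 a \<and> en a = entry s a) \<and>
      (\<lambda>k. (a7 k, en k)) ` {..<cnt} = (\<lambda>k. (wa s 7 k, entry s k)) ` ({..<k} - D)" for k cnt and dd a7 :: "nat \<Rightarrow> nat" and en
  show ?thesis
  proof (rule wp_For[where N = M and \<tau> = 100 and I = "\<lambda>k s'. P k (wv s' 30) (wa s' 13) (wa s' 7) (entry s')"])
  fix k and s' :: st assume k: "k < M" "wv s' 26 = k" and f: "frame (For 26 23 COMPACT) s s'"
    and I0: "P k (wv s' 30) (wa s' 13) (wa s' 7) (entry s')"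
  have I: "wv s' 30 = card ({..<k} - D) \<and>
    (\<forall>a. 0 < wa s' 13 a \<longleftrightarrow> a \<in> D \<and> k \<le> a) \<and> (\<forall>a\<ge>k. wa s' 7 a = wa s 7 a \<and> entry s' a = entry s a) \<and>
    (\<lambda>k. (wa s' 7 k, entry s' k)) ` {..<wv s' 30} = (\<lambda>k. (wa s 7 k, entry s k)) ` ({..<k} - D)"
    using I0 unfolding P_def .
  define ct where "ct = wv s' 30"
  have ct: "ct = card ({..<k} - D)" using I by (simp add: ct_def)
  have ctk: "ct \<le> k" unfolding ct using card_mono[of "{..<k}" "{..<k} - D"] by simp
  have b: "0 < W" "Suc ct < W" "ct < IM" "k < IM" "Suc 0 < W" using ctk k M fits by linarith+
  have Gk: "wa s' 7 k = wa s 7 k" "wa s 7 k < IM" "ra s' 5 k = ra s 5 k" "ra s' 6 k = ra s 6 k"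
    using I G[OF k(1)] by (auto simp: entry_def)
  show "wp COMPACT (\<lambda>s''. P (Suc k) (wv s'' 30) (wa s'' 13) (wa s'' 7) (entry s'') \<and> clk s'' \<le> clk s' + 100) s'"
  proof (cases "k \<in> D")
    case True
    then have "{..<Suc k} - D = {..<k} - D" by (auto simp: less_Suc_eq)
    moreover have "0 < wa s' 13 k" using True I by auto
    moreover have "\<forall>a. 0 < ((wa s' 13)(k := 0)) a \<longleftrightarrow> a \<in> D \<and> Suc k \<le> a" using I by (auto simp: Suc_le_eq le_less)
    moreover have "(\<lambda>k. (wa s' 7 k, entry s' k)) ` {..<card ({..<k} - D)} = (\<lambda>k. (wa s 7 k, entry s k)) ` ({..<k} - D)"
      unfolding ct[symmetric] ct_def using I by blast
    ultimately show ?thesis using I k b by (simp add: COMPACT_def wp_simps entry_def P_def)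
  next
    case False
    then have e: "{..<Suc k} - D = insert k ({..<k} - D)" by auto
    have c: "card ({..<Suc k} - D) = Suc ct" unfolding e ct by simp
    have n: "wa s' 13 k = 0" using False I by auto
    have d: "\<forall>a. 0 < wa s' 13 a \<longleftrightarrow> a \<in> D \<and> Suc k \<le> a" using I False by (auto simp: Suc_le_eq le_less)
    have im: "(\<lambda>j. (((wa s' 7)(ct := wa s 7 k)) j, ((ra s' 5)(ct := ra s 5 k)) j, ((ra s' 6)(ct := ra s 6 k)) j)) ` {..<Suc ct} =
        (\<lambda>k. (wa s 7 k, ra s 5 k, ra s 6 k)) ` ({..<Suc k} - D)"
    proof -
      have "(\<lambda>j. (((wa s' 7)(ct := wa s 7 k)) j, ((ra s' 5)(ct := ra s 5 k)) j, ((ra s' 6)(ct := ra s 6 k)) j)) ` {..<Suc ct} =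
          insert (wa s 7 k, ra s 5 k, ra s 6 k) ((\<lambda>k. (wa s' 7 k, ra s' 5 k, ra s' 6 k)) ` {..<ct})"
        by (auto simp: lessThan_Suc)
      also have "(\<lambda>k. (wa s' 7 k, ra s' 5 k, ra s' 6 k)) ` {..<ct} = (\<lambda>k. (wa s 7 k, ra s 5 k, ra s 6 k)) ` ({..<k} - D)"
        unfolding ct_def using I unfolding entry_def by blast
      finally show ?thesis unfolding e by simp
    qed
    have ne: "\<forall>a\<ge>Suc k. ((wa s' 7)(ct := wa s 7 k)) a = wa s 7 a \<and> ((ra s' 5)(ct := ra s 5 k)) a = ra s 5 a \<and> ((ra s' 6)(ct := ra s 6 k)) a = ra s 6 a"
      using I ctk by (auto simp: entry_def)
    show ?thesis using n d im ne c k b Gk unfolding COMPACT_def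
      by (simp add: wp_simps entry_def ct_def[symmetric] P_def del: fun_upd_apply) (simp add: fun_upd_same)
  qed
next
  fix s' :: st assume I: "P M (wv s' 30) (wa s' 13) (wa s' 7) (entry s')"
    and f: "frame (For 26 23 COMPACT) s s'" and t: "clk s' \<le> clk s + M * (100 + 12) + 9"
  note I = I[unfolded P_def]
  from I have 1: "wv s' 30 = card ({..<M} - D)"
    and 2: "(\<lambda>k. (wa s' 7 k, entry s' k)) ` {..<wv s' 30} = (\<lambda>k. (wa s 7 k, entry s k)) ` ({..<M} - D)" by blast+
  from I D(2) have "\<And>a. wa s' 13 a = 0" by (metis lessThan_iff not_gr0 not_le subsetD)
  then show "R s'" by (rule post[OF 1 _ 2 f]) (use t in simp)
next
  show "P 0 (wv s 30) (wa s 13) (wa s 7) (entry s)" using z D unfolding P_def by simp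
qed (use M fits in \<open>auto simp: entry_upd\<close>)
qed

end

definition entries :: "st \<Rightarrow> (nat \<times> line) set" where
  "entries s = (\<lambda>k. (wa s 7 k, entry s k)) ` {..<wv s 23}"

locale mrat = mach W off IM n m src dst c t + ratio n m src dst c t
  for W off IM n m :: nat and src dst :: "nat \<Rightarrow> nat" and c t :: "nat \<Rightarrow> real"
begin

text \<open>The relation is transitive, so the passes compose, and it preserves the set of indices,
  so their number can serve as a fixed reference point.\<close>

definition covers :: "(nat \<times> line) set \<Rightarrow> (nat \<times> line) set \<Rightarrow> bool" where
  "covers E E' \<longleftrightarrow> E' \<subseteq> E \<and> (\<forall>g x. (g, x) \<in> E \<longrightarrow> (\<exists>y. (g, y) \<in> E' \<and> val y \<le> val x))"

lemma covers_refl: "covers E E" unfolding covers_def by blast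

lemma covers_trans: "covers E E' \<Longrightarrow> covers E' E'' \<Longrightarrow> covers E E''"
  unfolding covers_def by (meson order_trans subset_trans)

lemma covers_fst: "covers E E' \<Longrightarrow> fst ` E' = fst ` E"
  unfolding covers_def by force

definition ready :: "st \<Rightarrow> bool" where
  "ready s \<longleftrightarrow> inp s \<and> (\<forall>g. wa s 8 g = 0) \<and> (\<forall>a. wa s 13 a = 0)"

text \<open>\<open>r\<close> is the number of dropped candidates and \<open>p\<close> the number of
  pairs. The bound \<open>p \<le> 2 * r\<close> allows the caller to charge the cost of sorting to
  the dropped candidates.\<close>

lemma wp_PASS:
  assumes rd: "ready s" and M: "wv s 23 = M" and lv: "wv s 15 = lv" "M \<le> 2 ^ lv" "2 ^ lv < IM" "lv < W"
    and G: "\<And>k. k < M \<Longrightarrow> wa s 7 k < IM"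
    and post: "\<And>s' r p. wv s' 23 + r = M \<Longrightarrow> M \<le> 4 * r + card (fst ` entries s) \<Longrightarrow> p \<le> 2 * r \<Longrightarrow>
       covers (entries s) (entries s') \<Longrightarrow> ready s' \<Longrightarrow> frame PASS s s' \<Longrightarrow>
       clk s' \<le> clk s + (lv + 1) * (250 * p + 60) + 200 * (n * m + n + m + 1) + 500 * M + 200 \<Longrightarrow> R s'"
  shows "wp PASS R s"
proof -
  have i: "inp s" and pe: "\<And>g. wa s 8 g = 0" and dd: "\<And>a. wa s 13 a = 0" using rd by (auto simp: ready_def)
  have MI: "M < IM" using lv by linarith
  have W0: "0 < W" "Suc 0 < W" "2 < W" "M < W" using MI fits by linarith+
  let ?R = "\<lambda>s'. frame PASS s s' \<longrightarrow> R s'"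
  define s1 where "s1 = s\<lparr>wv := (wv s)(14 := 0), clk := clk s + costW (WC 0) + 2\<rparr>"
  let ?setx = "If (WLess (WC 0) (WV 14)) (RSet 0 (RL 7 (WL 11 (WB Div (WV 14) (WC 2))))) SKIP"
  let ?c5 = "wp (WSet 30 (WC 0)) (wp (For 26 23 COMPACT) (wp (WSet 23 (WV 30)) ?R))"
  let ?c4 = "wp ?setx (wp BF (wp (For 26 14 KILLQ) ?c5))"
  have "wp (For 26 23 PAIR) (wp (For 26 23 CLEAR) (wp SORT ?c4)) s1"
  proof (rule wp_PAIRS)
    fix s2 :: st assume pi: "pair_inv (wa s1 7) M (wv s2 14) (wa s2 8) (wa s2 9) (wa s2 10)"
      and px: "\<forall>i<wv s2 14. ra s2 7 i = crossing (entry s1 (wa s2 9 i)) (entry s1 (wa s2 10 i))"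
      and f2: "frame (For 26 23 PAIR) s1 s2" and t2: "clk s2 \<le> clk s1 + 142 * M + 9"
    define p pa pb where "p = wv s2 14" and "pa = wa s2 9" and "pb = wa s2 10"
    have e2: "wa s2 7 = wa s 7" "wv s2 23 = M" "wv s2 15 = lv" "entry s2 = entry s" "wa s2 13 = wa s 13"
      using f2 M lv by (auto simp: frame_def s1_def entry_def fun_eq_iff)
    have pi: "pair_inv (wa s 7) M p (wa s2 8) pa pb" using pi by (simp add: s1_def p_def pa_def pb_def)
    have px: "\<forall>i<p. ra s2 7 i = crossing (entry s (pa i)) (entry s (pb i))"
      using px by (simp add: s1_def p_def pa_def pb_def entry_upd)
    have pM: "p \<le> M" "\<And>i. i < p \<Longrightarrow> pa i < M \<and> pb i < M" using pi unfolding pair_inv_def by (blast, meson less_trans)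
    show "wp (For 26 23 CLEAR) (wp SORT ?c4) s2"
    proof (rule wp_CLEARS)
      show "wv s2 23 = M" "M < IM" by fact+
      show "pair_inv (wa s2 7) M p (wa s2 8) pa pb" using pi by (simp only: e2)
      show "\<And>k. k < M \<Longrightarrow> wa s2 7 k < IM" using G by (simp only: e2)
      fix s3 :: st assume pe3: "\<And>g. wa s3 8 g = 0" and f3: "frame (For 26 23 CLEAR) s2 s3" and t3: "clk s3 \<le> clk s2 + 42 * M + 9"
      have e3: "wa s3 7 = wa s 7" "wv s3 23 = M" "wv s3 15 = lv" "entry s3 = entry s" "wa s3 13 = wa s 13" "wv s3 14 = p"
          "wa s3 9 = pa" "wa s3 10 = pb" "ra s3 7 = ra s2 7"
        using f3 e2 by (auto simp: frame_def entry_def fun_eq_iff p_def pa_def pb_def)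
      show "wp SORT ?c4 s3"
      proof (rule wp_SORT[where lv = lv and p = p])
        fix s4 :: st assume so: "\<forall>x y. x < y \<longrightarrow> y < p \<longrightarrow> ra s3 7 (wa s4 11 x) \<le> ra s3 7 (wa s4 11 y)"
          and pm: "pref (wa s4 11) 0 p = mset [0..<p]" and f4: "frame SORT s3 s4"
          and t4: "clk s4 \<le> clk s3 + (lv + 1) * (250 * p + 60)"
        define ix where "ix = wa s4 11"
        have e4: "wa s4 7 = wa s 7" "wv s4 23 = M" "entry s4 = entry s" "wa s4 13 = wa s 13" "wv s4 14 = p"
          "wa s4 9 = pa" "wa s4 10 = pb" "ra s4 7 = ra s2 7" "wa s4 8 = wa s3 8"
          using f4 e3 by (auto simp: frame_def entry_def fun_eq_iff)
        have bij: "bij_betw ix {..<p} {..<p}" using bij_if_pref pm by (simp add: ix_def)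
        have ixp: "ix q < p" if "q < p" for q using bij that by (auto simp: bij_betw_def)
        have so: "ra s2 7 (ix x) \<le> ra s2 7 (ix y)" if "x \<le> y" "y < p" for x y
          using so that unfolding e3 ix_def by (cases "x = y") auto
        define x where "x = (if 0 < p then ra s2 7 (ix (p div 2)) else rv s4 0)"
        have s5: "wp ?setx (\<lambda>s5. s5 = s4\<lparr>rv := (rv s4)(0 := x), clk := clk s5\<rparr> \<and> clk s5 \<le> clk s4 + 40) s4"
          using e4 ixp[of "p div 2"] pM(1) MI W0 by (auto simp: wp_simps x_def ix_def)
        show "?c4 s4"
        proof (rule wp_conseq[OF s5])
          fix s5 assume e: "s5 = s4\<lparr>rv := (rv s4)(0 := x), clk := clk s5\<rparr> \<and> clk s5 \<le> clk s4 + 40"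
          define z where "z = clk s5"
          have s5: "s5 = s4\<lparr>rv := (rv s4)(0 := x), clk := z\<rparr>" "z \<le> clk s4 + 40" using e by (auto simp: z_def)
          have "frame PASS s s4" using f2 f3 f4 by (auto simp: frame_def s1_def)
          then have "inp s4" by (rule inp_frame[OF i]) auto
          then have i5: "inp s5" by (simp add: inp_def s5)
          show "wp BF (wp (For 26 14 KILLQ) ?c5) s5"
          proof (rule wp_BF[OF i5])
            show "rv s5 0 = x" by (simp add: s5)
            fix s6 assume f6: "frame BF s5 s6" and n6: "wv s6 7 = (if \<exists>q. closed q \<and> wt (\<lambda>e. c e - x * t e) q < 0 then 1 else 0)"
              and t6: "clk s6 \<le> clk s5 + 200 * (n * m + n + m + 1)"
            have e6: "wa s6 7 = wa s 7" "wv s6 23 = M" "entry s6 = entry s" "wa s6 13 = wa s 13" "wv s6 14 = p"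
              "wa s6 9 = pa" "wa s6 10 = pb" "wa s6 11 = ix" "wa s6 8 = wa s3 8"
              using f6 e4 by (auto simp: frame_def entry_def fun_eq_iff s5 ix_def)
            define neg where "neg = (0 < wv s6 7)"
            have neg: "neg \<longleftrightarrow> lam < x" using n6 neg_iff[of x] by (simp add: neg_def)
            define l w where "l = (\<lambda>q. loser neg (entry s (pa (ix q))) (entry s (pb (ix q))) (pa (ix q)) (pb (ix q)))"
              and "w = (\<lambda>q. winner neg (entry s (pa (ix q))) (entry s (pb (ix q))) (pa (ix q)) (pb (ix q)))"
            define Q where "Q = {q. q < p \<and> resolved neg p q}"
            have lw: "(l q = pa (ix q) \<and> w q = pb (ix q)) \<or> (l q = pb (ix q) \<and> w q = pa (ix q))" for q
              by (auto simp: l_def w_def loser_def winner_def)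
            have v: "val (entry s (w q)) \<le> val (entry s (l q))" if "q \<in> Q" for q
            proof -
              have q: "q < p" "resolved neg p q" using that by (auto simp: Q_def)
              then have x: "x = ra s2 7 (ix (p div 2))" by (auto simp: x_def)
              have cr: "crossing (entry s (pa (ix q))) (entry s (pb (ix q))) = ra s2 7 (ix q)" using px ixp[OF q(1)] by simp
              have "if neg then lam \<le> ra s2 7 (ix q) else ra s2 7 (ix q) \<le> lam"
              proof (cases neg)
                case True
                then show ?thesis using so[of "p div 2" q] q neg x by (auto simp: resolved_def)
              next
                case False
                then show ?thesis using so[of q "p div 2"] q neg x by (auto simp: resolved_def)
              qed
              then show ?thesis unfolding l_def w_def by (intro loser_val) (simp only: cr)
            qed
            have Q: "Q \<subseteq> {..<p}" "p \<le> 2 * card Q" using resolved_count[of p neg] by (auto simp: Q_def)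
            note pr = prune_pass[OF pi bij lw Q, where f = "entry s" and val = val, OF v]
            have lM: "l ` Q \<subseteq> {..<M}"
            proof (rule image_subsetI)
              fix q assume "q \<in> Q"
              then have "q < p" using Q(1) by auto
              then show "l q \<in> {..<M}" using pM(2)[OF ixp] lw[of q] by auto
            qed
            show "wp (For 26 14 KILLQ) ?c5 s6"
            proof (rule wp_KILLS[where p = p and l = l])
              show "l = (\<lambda>q. loser (0 < wv s6 7) (entry s6 (wa s6 9 (wa s6 11 q))) (entry s6 (wa s6 10 (wa s6 11 q))) (wa s6 9 (wa s6 11 q)) (wa s6 10 (wa s6 11 q)))"
                by (simp add: l_def neg_def e6)
            next
              fix s7 :: st assume d7: "\<And>a. 0 < wa s7 13 a \<longleftrightarrow> a \<in> l ` {q. q < p \<and> resolved (0 < wv s6 7) p q}"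
                and f7: "frame (For 26 14 KILLQ) s6 s7" and t7: "clk s7 \<le> clk s6 + 162 * p + 9"
              have e7: "wa s7 7 = wa s 7" "wv s7 23 = M" "entry s7 = entry s" "wa s7 8 = wa s3 8"
                using f7 e6 by (auto simp: frame_def entry_def fun_eq_iff)
              have d7: "\<And>a. 0 < wa s7 13 a \<longleftrightarrow> a \<in> l ` Q" using d7 by (simp add: Q_def neg_def)
              define s8 where "s8 = s7\<lparr>wv := (wv s7)(30 := 0), clk := clk s7 + costW (WC 0) + 2\<rparr>"
              have e8: "wa s8 7 = wa s 7" "wv s8 23 = M" "entry s8 = entry s" "wa s8 8 = wa s3 8" "wv s8 30 = 0"
                using e7 by (auto simp: s8_def entry_upd)
              have "wp (For 26 23 COMPACT) (wp (WSet 23 (WV 30)) ?R) s8"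
              proof (rule wp_COMPACTS[where M = M and D = "l ` Q"])
                fix s9 :: st assume c9: "wv s9 30 = card ({..<M} - l ` Q)" and d9: "\<And>a. wa s9 13 a = 0"
                  and im: "(\<lambda>k. (wa s9 7 k, entry s9 k)) ` {..<wv s9 30} = (\<lambda>k. (wa s8 7 k, entry s8 k)) ` ({..<M} - l ` Q)"
                  and f9: "frame (For 26 23 COMPACT) s8 s9" and t9: "clk s9 \<le> clk s8 + 112 * M + 9"
                define s10 where "s10 = s9\<lparr>wv := (wv s9)(23 := wv s9 30), clk := clk s9 + costW (WV 30) + 2\<rparr>"
                have en: "entries s10 = (\<lambda>k. (wa s 7 k, entry s k)) ` ({..<M} - l ` Q)"
                  using im unfolding entries_def s10_def e8 by (simp add: entry_upd)
                have es: "entries s = (\<lambda>k. (wa s 7 k, entry s k)) ` {..<M}" by (simp add: entries_def M)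
                have "?R s10"
                proof
                  assume f: "frame PASS s s10"
                  show "R s10"
                  proof (rule post[OF _ _ _ _ _ f])
                    show "wv s10 23 + card Q = M" using pr(1) c9 by (simp add: s10_def)
                    show "M \<le> 4 * card Q + card (fst ` entries s)" using pr(2) unfolding es .
                    show "p \<le> 2 * card Q" by fact
                    show "covers (entries s) (entries s10)" using pr(3) unfolding en es covers_def by blast
                    have "inp s10" by (rule inp_frame[OF i f]) auto
                    moreover have "wa s10 8 = wa s3 8" using f9 e8 by (auto simp: s10_def frame_def)
                    ultimately show "ready s10" using pe3 d9 by (simp add: ready_def s10_def)
                    show "clk s10 \<le> clk s + (lv + 1) * (250 * p + 60) + 200 * (n * m + n + m + 1) + 500 * M + 200"
                      using t9 t7 t6 s5(2) t4 t3 t2 pM(1) by (simp add: s10_def s8_def s5(1) s1_def)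
                  qed
                qed
                then show "wp (WSet 23 (WV 30)) ?R s9" by (simp add: wp_WSet s10_def)
              qed (use e8 MI G d7 lM in \<open>auto simp: s8_def\<close>)
              then show "?c5 s7" using W0 by (simp add: wp_WSet s8_def)
            next
              have "ix q < IM \<and> pa (ix q) < IM \<and> pb (ix q) < IM" if "q < p" for q
                using pM(1) pM(2)[OF ixp[OF that]] ixp[OF that] MI by linarith
              then show "\<And>q. q < p \<Longrightarrow> wa s6 11 q < IM" "\<And>q. q < p \<Longrightarrow> wa s6 9 (wa s6 11 q) < IM \<and> wa s6 10 (wa s6 11 q) < IM"
                by (simp_all add: e6)
            qed (use e6 MI pM(1) dd in auto)
          qed
        qed
      qed (use e3 lv pM MI in auto)
    qed
  qed (use M MI pe G in \<open>auto simp: s1_def\<close>)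
  then have "wp (WSet 14 (WC 0)) (wp (For 26 23 PAIR) (wp (For 26 23 CLEAR) (wp SORT ?c4))) s"
    using W0 by (simp add: wp_WSet s1_def)
  then have "wp PASS ?R s" unfolding PASS_def wp_Seq .
  then show ?thesis by (rule wp_conseq) auto
qed

text \<open>The excess of the candidates over the number \<open>g\<close> of indices shrinks to at
  most three quarters in each pass. It is initially at most \<open>2 ^ lv\<close>, and 2 * 27 < 64,
  so \<open>3 * lv\<close> passes make it vanish. Then every index has exactly one
  candidate.\<close>

lemma wp_RESOLVE:
  assumes rd: "ready s" and M: "wv s 23 = M" and lv: "wv s 15 = lv" "M \<le> 2 ^ lv" "2 ^ lv < IM" "3 * lv < W" "0 < lv"
    and J: "wv s 24 = 3 * lv" and G: "\<And>k. k < M \<Longrightarrow> wa s 7 k < IM"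
    and post: "\<And>s'. ready s' \<Longrightarrow> covers (entries s) (entries s') \<Longrightarrow> inj_on (wa s' 7) {..<wv s' 23} \<Longrightarrow> wv s' 23 \<le> M \<Longrightarrow>
       frame RESOLVE s s' \<Longrightarrow>
       clk s' \<le> clk s + 3 * lv * ((lv + 1) * 60 + 200 * (n * m + n + m + 1) + 500 * M + 220) + 500 * (lv + 1) * M + 9 \<Longrightarrow> R s'"
  shows "wp RESOLVE R s"
proof -
  define g where "g = card (fst ` entries s)"
  let ?I = "\<lambda>j s'. ready s' \<and> covers (entries s) (entries s') \<and> wv s' 23 \<le> M \<and> 4 ^ j * (wv s' 23 - g) \<le> 3 ^ j * (M - g)"
  have small: "g \<le> wv s' 23" if "covers (entries s) (entries s')" for s'
  proof -
    have "g = card (fst ` entries s')" using covers_fst[OF that] by (simp add: g_def)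
    also have "fst ` entries s' = wa s' 7 ` {..<wv s' 23}" by (auto simp: entries_def image_image)
    finally show ?thesis using card_image_le[of "{..<wv s' 23}" "wa s' 7"] by simp
  qed
  show ?thesis unfolding RESOLVE_def
  \<comment> \<open>Each candidate carries a potential of 500 (lv + 1). Sorting costs 250 (lv + 1)
    per pair, and there are at most two pairs per dropped candidate.\<close>
  proof (rule wp_ForP[where N = "3 * lv" and I = ?I and ph = "\<lambda>_ s'. 500 * (lv + 1) * wv s' 23" and
        \<tau> = "(lv + 1) * 60 + 200 * (n * m + n + m + 1) + 500 * M + 200"])
    show "?I 0 s" using rd M covers_refl by simp
  next
    fix j and s' :: st assume j: "j < 3 * lv" and I: "?I j s'" and f: "frame (For 25 24 PASS) s s'"
    have e: "wv s' 15 = lv" using f lv by (auto simp: frame_def)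
    have rd': "ready s'" and cv: "covers (entries s) (entries s')" and M': "wv s' 23 \<le> M"
      and dec: "4 ^ j * (wv s' 23 - g) \<le> 3 ^ j * (M - g)" using I by auto
    have G': "wa s' 7 k < IM" if "k < wv s' 23" for k
    proof -
      have "(wa s' 7 k, entry s' k) \<in> entries s'" using that by (auto simp: entries_def)
      then have "(wa s' 7 k, entry s' k) \<in> entries s" using cv by (auto simp: covers_def)
      then show ?thesis using G M by (auto simp: entries_def)
    qed
    show "wp PASS (\<lambda>s''. ?I (Suc j) s'' \<and> clk s'' + 500 * (lv + 1) * wv s'' 23 \<le>
      clk s' + 500 * (lv + 1) * wv s' 23 + ((lv + 1) * 60 + 200 * (n * m + n + m + 1) + 500 * M + 200)) s'"
    proof (rule wp_PASS[OF rd' refl e _ lv(3) _ G'])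
      show "wv s' 23 \<le> 2 ^ lv" "lv < W" using M' lv by auto
      fix s'' :: st and r p assume r: "wv s'' 23 + r = wv s' 23" "wv s' 23 \<le> 4 * r + card (fst ` entries s')" "p \<le> 2 * r"
        and cv': "covers (entries s') (entries s'')" and rd'': "ready s''"
        and t: "clk s'' \<le> clk s' + (lv + 1) * (250 * p + 60) + 200 * (n * m + n + m + 1) + 500 * wv s' 23 + 200"
      have cv2: "covers (entries s) (entries s'')" using covers_trans[OF cv cv'] .
      \<comment> \<open>No index is lost, so \<open>g\<close> also counts the indices present before
        this pass; the at least quarter of the excess that is dropped can be measured against the
        same \<open>g\<close> afterwards.\<close>
      have "card (fst ` entries s') = g" using covers_fst[OF cv] by (simp add: g_def)
      then have "wv s' 23 - g \<le> 4 * r" using r(2) by linarith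
      then have "4 * (wv s'' 23 - g) \<le> 3 * (wv s' 23 - g)" using r(1) small[OF cv2] by linarith
      then have "4 ^ j * (4 * (wv s'' 23 - g)) \<le> 4 ^ j * (3 * (wv s' 23 - g))" by (rule mult_le_mono2)
      also have "\<dots> = 3 * (4 ^ j * (wv s' 23 - g))" by simp
      also have "\<dots> \<le> 3 * (3 ^ j * (M - g))" using dec by (rule mult_le_mono2)
      finally have d: "4 ^ Suc j * (wv s'' 23 - g) \<le> 3 ^ Suc j * (M - g)" by (simp add: mult.assoc mult.left_commute)
      have "(lv + 1) * (250 * p) \<le> (lv + 1) * (500 * r)" using r(3) by (intro mult_le_mono2) linarith
      moreover have "(lv + 1) * (250 * p + 60) = (lv + 1) * (250 * p) + (lv + 1) * 60" by (rule distrib_left)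
      moreover have "500 * (lv + 1) * wv s' 23 = 500 * (lv + 1) * wv s'' 23 + (lv + 1) * (500 * r)"
        unfolding r(1)[symmetric] by (simp add: algebra_simps)
      ultimately have "clk s'' + 500 * (lv + 1) * wv s'' 23 \<le>
          clk s' + 500 * (lv + 1) * wv s' 23 + ((lv + 1) * 60 + 200 * (n * m + n + m + 1) + 500 * M + 200)"
        using t M' by linarith
      then show "?I (Suc j) s'' \<and> clk s'' + 500 * (lv + 1) * wv s'' 23 \<le>
          clk s' + 500 * (lv + 1) * wv s' 23 + ((lv + 1) * 60 + 200 * (n * m + n + m + 1) + 500 * M + 200)"
        using rd'' cv2 d r(1) M' by simp
    qed
  next
    fix s' :: st assume I: "?I (3 * lv) s'" and f: "frame (For 25 24 PASS) s s'"
      and t: "clk s' + 500 * (lv + 1) * wv s' 23 \<le> clk s + 500 * (lv + 1) * wv s 23 +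
        3 * lv * ((lv + 1) * 60 + 200 * (n * m + n + m + 1) + 500 * M + 200 + 12) + 9"
    have rd': "ready s'" and cv: "covers (entries s) (entries s')" and M': "wv s' 23 \<le> M"
      and dec: "4 ^ (3 * lv) * (wv s' 23 - g) \<le> 3 ^ (3 * lv) * (M - g)" using I by auto
    have "wv s' 23 - g = 0"
    proof (rule ccontr)
      assume "wv s' 23 - g \<noteq> 0"
      then have "4 ^ (3 * lv) \<le> 4 ^ (3 * lv) * (wv s' 23 - g)" by simp
      also have "\<dots> \<le> 3 ^ (3 * lv) * (M - g)" by fact
      also have "\<dots> \<le> 3 ^ (3 * lv) * 2 ^ lv" using lv(2) by (intro mult_le_mono2) simp
      also have "\<dots> = (54::nat) ^ lv" unfolding power_mult power_mult_distrib[symmetric] by simp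
      also have "\<dots> < 64 ^ lv" using lv(5) by (intro power_strict_mono) auto
      also have "(64::nat) ^ lv = 4 ^ (3 * lv)" unfolding power_mult by simp
      finally show False by simp
    qed
    then have "wv s' 23 = g" using small[OF cv] by simp
    moreover have "g = card (wa s' 7 ` {..<wv s' 23})"
      unfolding g_def covers_fst[OF cv, symmetric] by (simp add: entries_def image_image)
    ultimately have inj: "inj_on (wa s' 7) {..<wv s' 23}" by (intro eq_card_imp_inj_on) auto
    have le: "3 * lv * ((lv + 1) * 60 + 200 * (n * m + n + m + 1) + 500 * M + 200 + 12) \<le>
      3 * lv * ((lv + 1) * 60 + 200 * (n * m + n + m + 1) + 500 * M + 220)" by (intro mult_le_mono2) simp
    have "clk s' \<le> clk s + 500 * (lv + 1) * M + 3 * lv * ((lv + 1) * 60 + 200 * (n * m + n + m + 1) + 500 * M + 200 + 12) + 9"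
      using t unfolding M by (rule order_trans[OF le_add1])
    also have "\<dots> \<le> clk s + 500 * (lv + 1) * M + 3 * lv * ((lv + 1) * 60 + 200 * (n * m + n + m + 1) + 500 * M + 220) + 9"
      by (intro add_mono le order_refl)
    finally have "clk s' \<le> clk s + 3 * lv * ((lv + 1) * 60 + 200 * (n * m + n + m + 1) + 500 * M + 220) + 500 * (lv + 1) * M + 9"
      by (simp only: ac_simps)
    then show "R s'" by (intro post[OF rd' cv inj M']) (auto simp: f RESOLVE_def)
  qed (use J lv in \<open>auto simp: ready_def inp_def covers_def entries_def entry_upd\<close>)
qed

end

section \<open>The two phases\<close>

text \<open>\<open>entries\<close> with the arrays as separate arguments, so that writes to single
  arrays simplify. \<open>tabf\<close> plays the same role for the table.\<close>

definition ents :: "nat \<Rightarrow> (nat \<Rightarrow> nat) \<Rightarrow> (nat \<Rightarrow> real) \<Rightarrow> (nat \<Rightarrow> real) \<Rightarrow> (nat \<times> line) set" where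
  "ents M g x y = (\<lambda>k. (g k, (x k, y k))) ` {..<M}"

lemma entries_ents: "entries s = ents (wv s 23) (wa s 7) (ra s 5) (ra s 6)"
  by (simp add: entries_def ents_def entry_def)

lemma ents_0: "ents 0 g x y = {}" by (simp add: ents_def)

lemma ents_push: "ents (Suc M) (g(M := a)) (x(M := b)) (y(M := d)) = insert (a, (b, d)) (ents M g x y)"
  by (auto simp: ents_def lessThan_Suc)

definition tabf :: "(nat \<Rightarrow> nat) \<Rightarrow> (nat \<Rightarrow> real) \<Rightarrow> (nat \<Rightarrow> real) \<Rightarrow> nat \<Rightarrow> line option" where
  "tabf f x y g = (if f g = 0 then None else Some (x g, y g))"

abbreviation tab :: "st \<Rightarrow> nat \<Rightarrow> line option" where
  "tab s \<equiv> tabf (wa s 6) (ra s 3) (ra s 4)"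

definition PUSH :: "wexp \<Rightarrow> rexp \<Rightarrow> rexp \<Rightarrow> cmd" where
  "PUSH g x y = (WSt 7 (WV 23) g ;; RSt 5 (WV 23) x ;; RSt 6 (WV 23) y ;; WSet 23 (WB Add (WV 23) (WC 1)))"

abbreviation idxE :: "wexp \<Rightarrow> wexp \<Rightarrow> wexp" where
  "idxE u v \<equiv> WB Add (WB Mul u (WV 0)) v"

definition CAND1 :: cmd where
  "CAND1 = (WSet 34 (idxE (WV 31) (WL 1 (WV 32))) ;; WSet 35 (idxE (WV 31) (WL 0 (WV 32))) ;;
     If (WLess (WC 0) (WL 6 (WV 34))) (PUSH (WV 34) (RL 3 (WV 34)) (RL 4 (WV 34))) SKIP ;;
     If (WLess (WC 0) (WL 6 (WV 35)))
       (PUSH (WV 34) (RB Add (RL 3 (WV 35)) (RL 0 (WV 32))) (RB Add (RL 4 (WV 35)) (RL 1 (WV 32)))) SKIP)"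

definition CAND2 :: cmd where
  "CAND2 = (WSet 38 (idxE (WL 5 (WV 31)) (WL 5 (WV 36))) ;; WSet 39 (idxE (WL 5 (WV 31)) (WL 5 (WV 37))) ;;
     WSet 40 (idxE (WL 5 (WV 37)) (WL 5 (WV 36))) ;;
     If (WLess (WC 0) (WL 6 (WV 38))) (PUSH (WV 38) (RL 3 (WV 38)) (RL 4 (WV 38))) SKIP ;;
     If (WLess (WC 0) (WL 6 (WV 39))) (If (WLess (WC 0) (WL 6 (WV 40)))
       (PUSH (WV 38) (RB Add (RL 3 (WV 39)) (RL 3 (WV 40))) (RB Add (RL 4 (WV 39)) (RL 4 (WV 40)))) SKIP) SKIP)"

definition WRITE :: cmd where
  "WRITE = (WSet 34 (WL 7 (WV 32)) ;; WSt 6 (WV 34) (WC 1) ;; RSt 3 (WV 34) (RL 5 (WV 32)) ;; RSt 4 (WV 34) (RL 6 (WV 32)))"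

definition INIT1 :: cmd where
  "INIT1 = (WSet 34 (idxE (WL 0 (WV 32)) (WL 1 (WV 32))) ;; WSt 6 (WV 34) (WC 1) ;; RSt 3 (WV 34) (RL 0 (WV 32)) ;; RSt 4 (WV 34) (RL 1 (WV 32)))"

text \<open>All candidates of a round are formed from the old table, which is overwritten only after
  they have been resolved.\<close>

definition ROUND1 :: cmd where
  "ROUND1 = (WSet 23 (WC 0) ;; For 31 0 (For 32 1 CAND1) ;; RESOLVE ;; For 32 23 WRITE)"

definition ROUND2 :: cmd where
  "ROUND2 = (WSet 23 (WC 0) ;; For 31 4 (For 36 4 (For 37 4 CAND2)) ;; RESOLVE ;; For 32 23 WRITE)"

definition PHASE1 :: cmd where "PHASE1 = (For 32 1 INIT1 ;; For 33 3 ROUND1)"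
definition PHASE2 :: cmd where "PHASE2 = For 33 2 ROUND2"

lemma mod_phases [simp]:
  "modW CAND1 = {23, 34, 35}" "modR CAND1 = {}" "modWA CAND1 = {7}" "modRA CAND1 = {5, 6}"
  "modW CAND2 = {23, 38, 39, 40}" "modR CAND2 = {}" "modWA CAND2 = {7}" "modRA CAND2 = {5, 6}"
  "modW WRITE = {34}" "modR WRITE = {}" "modWA WRITE = {6}" "modRA WRITE = {3, 4}"
  "modW INIT1 = {34}" "modR INIT1 = {}" "modWA INIT1 = {6}" "modRA INIT1 = {3, 4}"
  by (auto simp: CAND1_def CAND2_def WRITE_def INIT1_def PUSH_def)

lemma mod_rounds [simp]:
  "modW ROUND1 = {23, 31, 32, 34, 35} \<union> modW RESOLVE" "modR ROUND1 = {0, 1}"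
  "modWA ROUND1 = {6, 7, 8, 9, 10, 11, 12, 13}" "modRA ROUND1 = {2, 3, 4, 5, 6, 7}"
  "modW ROUND2 = {23, 31, 32, 34, 36, 37, 38, 39, 40} \<union> modW RESOLVE" "modR ROUND2 = {0, 1}"
  "modWA ROUND2 = {6, 7, 8, 9, 10, 11, 12, 13}" "modRA ROUND2 = {2, 3, 4, 5, 6, 7}"
  unfolding ROUND1_def ROUND2_def by auto

context mrat
begin

definition sizes :: "nat \<Rightarrow> st \<Rightarrow> bool" where
  "sizes lv s \<longleftrightarrow> wv s 15 = lv \<and> wv s 24 = 3 * lv \<and> 2 ^ lv < IM \<and> 3 * lv < W \<and> 0 < lv \<and> n * n \<le> IM"

lemma sizes_frame: "sizes lv s \<Longrightarrow> frame p s s' \<Longrightarrow> 15 \<notin> modW p \<Longrightarrow> 24 \<notin> modW p \<Longrightarrow> sizes lv s'"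
  unfolding sizes_def frame_def by auto

lemma ready_frame:
  assumes "ready s" "frame p s s'" "0 \<notin> modW p" "1 \<notin> modW p" "0 \<notin> modWA p" "1 \<notin> modWA p" "0 \<notin> modRA p" "1 \<notin> modRA p"
    "8 \<notin> modWA p" "13 \<notin> modWA p"
  shows "ready s'"
proof -
  have "wa s' 8 = wa s 8" "wa s' 13 = wa s 13" using assms(2,9,10) unfolding frame_def by blast+
  then show ?thesis using inp_frame[OF _ assms(2-8)] assms(1) unfolding ready_def by simp
qed

lemma idx_IM: "u < n \<Longrightarrow> v < n \<Longrightarrow> n * n \<le> IM \<Longrightarrow> u * n + v < IM \<and> u * n + v < W \<and> u * n < W"
proof -
  assume a: "u < n" "v < n" "n * n \<le> IM"
  have "Suc u * n \<le> n * n" using a(1) by (intro mult_le_mono1) simp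
  then show ?thesis using a IM_W by simp
qed

lemma wp_CAND1:
  assumes rd: "ready s" and sz: "sizes lv s" and M: "wv s 23 = M" "Suc M < IM"
    and u: "wv s 31 = u" "u < n" and e: "wv s 32 = e" "e < m"
  shows "wp CAND1 (\<lambda>s'. entries s' = entries s \<union> cand1 (tab s) u e \<and> wv s' 23 \<le> wv s 23 + 2 \<and> clk s' \<le> clk s + 200) s"
proof -
  have i: "inp s" using rd by (simp add: ready_def)
  note I = inpD[OF i] lt_IM src_IM[OF e(2)]
  have b: "u * n + dst e < IM" "u * n + dst e < W" "u * n + src e < IM" "u * n + src e < W" "u * n < W"
    using idx_IM[OF u(2) dst[OF e(2)]] idx_IM[OF u(2) src[OF e(2)]] sz by (auto simp: sizes_def)
  have w: "M < IM" "Suc M < W" "Suc (Suc M) < W" using M IM_W by auto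
  let ?g = "u * n + dst e" and ?g' = "u * n + src e"
  show ?thesis
    using u e M I b w
    by (cases "wa s 6 ?g = 0"; cases "wa s 6 ?g' = 0")
      (simp_all add: CAND1_def PUSH_def wp_simps entries_ents cand1_def tabf_def ents_push plus_line_def insert_commute)
qed

lemma wp_CAND2:
  assumes rd: "ready s" and sz: "sizes lv s" and M: "wv s 23 = M" "Suc M < IM"
    and ij: "i < IM" "j < IM" "k < IM" "wv s 31 = i" "wv s 36 = j" "wv s 37 = k" "wa s 5 i < n" "wa s 5 j < n" "wa s 5 k < n"
  shows "wp CAND2 (\<lambda>s'. entries s' = entries s \<union> cand2 (tab s) (wa s 5 i) (wa s 5 j) (wa s 5 k) \<and> wv s' 23 \<le> wv s 23 + 2 \<and>
    clk s' \<le> clk s + 250) s"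
proof -
  have i: "inp s" using rd by (simp add: ready_def)
  note I = inpD(1)[OF i] lt_IM
  let ?u = "wa s 5 i" and ?v = "wa s 5 j" and ?x = "wa s 5 k"
  have nn: "n * n \<le> IM" using sz by (simp add: sizes_def)
  have b: "?u * n + ?v < IM" "?u * n + ?v < W" "?u * n < W" "?u * n + ?x < IM" "?u * n + ?x < W" "?x * n < W" "?x * n + ?v < IM" "?x * n + ?v < W"
    using idx_IM[OF ij(7,8) nn] idx_IM[OF ij(7,9) nn] idx_IM[OF ij(9,8) nn] by auto
  have w: "M < IM" "Suc M < W" "Suc (Suc M) < W" using M IM_W by auto
  show ?thesis
    using ij M I b w
    by (cases "wa s 6 (?u * n + ?v) = 0"; cases "wa s 6 (?u * n + ?x) = 0"; cases "wa s 6 (?x * n + ?v) = 0")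
      (simp_all add: CAND2_def PUSH_def wp_simps entries_ents cand2_def tabf_def ents_push plus_line_def insert_commute)
qed

text \<open>The resolved candidates have distinct indices, so no write destroys another one. As they
  cover \<open>E\<close>, each is the best candidate of its index at \<open>lam\<close>.\<close>

lemma wp_WRITES:
  assumes inj: "inj_on (wa s 7) {..<M}" and M: "wv s 23 = M" "M < IM" and G: "\<And>k. k < M \<Longrightarrow> wa s 7 k < IM"
    and cv: "covers E (entries s)"
    and post: "\<And>s'. upd_spec (tab s) E (tab s') \<Longrightarrow> frame (For 32 23 WRITE) s s' \<Longrightarrow> clk s' \<le> clk s + 112 * M + 9 \<Longrightarrow> R s'"
  shows "wp (For 32 23 WRITE) R s"
proof -
  define P where "P k T \<longleftrightarrow> (\<forall>j<k. T (wa s 7 j) = Some (entry s j)) \<and> (\<forall>g. (\<forall>j<k. wa s 7 j \<noteq> g) \<longrightarrow> T g = tab s g)" for k T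
  show ?thesis
  proof (rule wp_For[where N = M and \<tau> = 100 and I = "\<lambda>k s'. P k (tab s')"])
    show "P 0 (tab s)" by (simp add: P_def)
  next
    fix k and s' :: st assume k: "k < M" "wv s' 32 = k" and f: "frame (For 32 23 WRITE) s s'" and I: "P k (tab s')"
    have fr: "wa s' 7 = wa s 7" "ra s' 5 = ra s 5" "ra s' 6 = ra s 6" using f by (auto simp: frame_def)
    have nk: "wa s 7 j \<noteq> wa s 7 k" if "j < k" for j using inj that k(1) unfolding inj_on_def by auto
    have "P (Suc k) (tabf ((wa s' 6)(wa s 7 k := Suc 0)) ((ra s' 3)(wa s 7 k := ra s 5 k)) ((ra s' 4)(wa s 7 k := ra s 6 k)))"
      using I nk unfolding P_def by (auto simp: less_Suc_eq tabf_def entry_def)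
    then show "wp WRITE (\<lambda>s''. P (Suc k) (tab s'') \<and> clk s'' \<le> clk s' + 100) s'"
      using k fr G[OF k(1)] M IM_W by (simp add: WRITE_def wp_simps)
  next
    fix s' :: st assume I: "P M (tab s')" and f: "frame (For 32 23 WRITE) s s'" and t: "clk s' \<le> clk s + M * (100 + 12) + 9"
    have "upd_spec (tab s) E (tab s')"
      unfolding upd_spec_def
    proof (intro allI)
      fix g
      show "if \<exists>l. (g, l) \<in> E then \<exists>l. tab s' g = Some l \<and> (g, l) \<in> E \<and> (\<forall>l'. (g, l') \<in> E \<longrightarrow> val l \<le> val l')
        else tab s' g = tab s g"
      proof (cases "\<exists>l. (g, l) \<in> E")
        case True
        then obtain y where "(g, y) \<in> entries s" using cv unfolding covers_def by blast
        then obtain k where k: "k < M" "g = wa s 7 k" by (auto simp: entries_def M)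
        have 1: "tab s' g = Some (entry s k)" using I k unfolding P_def by simp
        have "(g, entry s k) \<in> entries s" using k by (auto simp: entries_def M)
        then have 2: "(g, entry s k) \<in> E" using cv unfolding covers_def by blast
        have "val (entry s k) \<le> val l'" if l': "(g, l') \<in> E" for l'
        proof -
          obtain z where z: "(g, z) \<in> entries s" "val z \<le> val l'" using cv l' unfolding covers_def by blast
          then obtain j where j: "j < M" "g = wa s 7 j" "z = entry s j" by (auto simp: entries_def M)
          then have "j = k" using inj k unfolding inj_on_def by auto
          then show ?thesis using z j by simp
        qed
        then show ?thesis using True 1 2 by auto
      next
        case False
        moreover have "(wa s 7 j, entry s j) \<in> E" if "j < M" for j
          using cv that unfolding covers_def entries_def M by blast
        ultimately have "\<forall>j<M. wa s 7 j \<noteq> g" by metis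
        then show ?thesis using False I unfolding P_def by simp
      qed
    qed
    then show "R s'" using post f t by (simp add: mult.commute)
  qed (use M IM_W in auto)
qed

definition RB :: "nat \<Rightarrow> nat \<Rightarrow> nat" where
  "RB lv M = 3 * lv * ((lv + 1) * 60 + 200 * (n * m + n + m + 1) + 500 * M + 220) + 500 * (lv + 1) * M + 9"

lemma RB_mono: "M \<le> M' \<Longrightarrow> RB lv M \<le> RB lv M'"
  unfolding RB_def by (intro add_mono mult_le_mono order_refl) auto

lemma wp_FINISH:
  assumes rd: "ready s" and sz: "sizes lv s" and M: "wv s 23 \<le> M" "M \<le> 2 ^ lv" and E: "entries s = E"
    and G: "\<And>g l. (g, l) \<in> E \<Longrightarrow> g < IM"
    and post: "\<And>s'. ready s' \<Longrightarrow> upd_spec (tab s) E (tab s') \<Longrightarrow> frame (RESOLVE ;; For 32 23 WRITE) s s' \<Longrightarrow>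
      clk s' \<le> clk s + RB lv M + 112 * M + 9 \<Longrightarrow> R s'"
  shows "wp RESOLVE (wp (For 32 23 WRITE) R) s"
proof -
  have GG: "wa s' 7 k < IM" if "covers E (entries s')" "k < wv s' 23" for s' k
  proof -
    have "(wa s' 7 k, entry s' k) \<in> entries s'" using that by (auto simp: entries_def)
    then show ?thesis using that G unfolding covers_def by blast
  qed
  have "wp RESOLVE (wp (For 32 23 WRITE) (\<lambda>s'. frame (RESOLVE ;; For 32 23 WRITE) s s' \<longrightarrow> R s')) s"
  proof (rule wp_RESOLVE[OF rd refl, of lv])
    show "wv s 15 = lv" "2 ^ lv < IM" "3 * lv < W" "0 < lv" "wv s 24 = 3 * lv" using sz by (auto simp: sizes_def)
    show "wv s 23 \<le> 2 ^ lv" using M by linarith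
    show "\<And>k. k < wv s 23 \<Longrightarrow> wa s 7 k < IM" using GG[of s] covers_refl E by metis
    fix s1 assume rd1: "ready s1" and cv: "covers (entries s) (entries s1)" and inj: "inj_on (wa s1 7) {..<wv s1 23}"
      and M1: "wv s1 23 \<le> wv s 23" and f1: "frame RESOLVE s s1"
      and t1: "clk s1 \<le> clk s + 3 * lv * ((lv + 1) * 60 + 200 * (n * m + n + m + 1) + 500 * wv s 23 + 220) + 500 * (lv + 1) * wv s 23 + 9"
    have t1: "clk s1 \<le> clk s + RB lv M" using t1 RB_mono[OF M(1), of lv] unfolding RB_def by linarith
    have tb: "tab s1 = tab s" using f1 by (auto simp: frame_def)
    have cv: "covers E (entries s1)" using cv E by simp
    show "wp (For 32 23 WRITE) (\<lambda>s'. frame (RESOLVE ;; For 32 23 WRITE) s s' \<longrightarrow> R s') s1"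
    proof (rule wp_WRITES[OF inj refl _ GG[OF cv] cv])
      show "wv s1 23 < IM" using M1 M sz unfolding sizes_def by linarith
      fix s2 assume u: "upd_spec (tab s1) E (tab s2)" and f2: "frame (For 32 23 WRITE) s1 s2" and t2: "clk s2 \<le> clk s1 + 112 * wv s1 23 + 9"
      have "ready s2" by (rule ready_frame[OF rd1 f2]) auto
      moreover have "clk s2 \<le> clk s + RB lv M + 112 * M + 9" using t1 t2 M1 M(1) by linarith
      ultimately show "frame (RESOLVE ;; For 32 23 WRITE) s s2 \<longrightarrow> R s2" using post u tb by simp
    qed
  qed
  then have "wp (RESOLVE ;; For 32 23 WRITE) (\<lambda>s'. frame (RESOLVE ;; For 32 23 WRITE) s s' \<longrightarrow> R s') s" unfolding wp_Seq .
  then have "wp (RESOLVE ;; For 32 23 WRITE) R s" by (rule wp_conseq) auto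
  then show ?thesis unfolding wp_Seq .
qed

lemma cands1_IM: "(g, l) \<in> cands1 D n 0 \<Longrightarrow> n * n \<le> IM \<Longrightarrow> g < IM"
  using idx_IM dst by (fastforce simp: cands1_def cand1_def)

lemma wp_ROUND1:
  assumes rd: "ready s" and sz: "sizes lv s" and M: "2 * (n * m) \<le> 2 ^ lv"
    and post: "\<And>s'. ready s' \<Longrightarrow> upd_spec (tab s) (cands1 (tab s) n 0) (tab s') \<Longrightarrow> frame ROUND1 s s' \<Longrightarrow>
      clk s' \<le> clk s + RB lv (2 * (n * m)) + 500 * (n * m + n + 1) \<Longrightarrow> R s'"
  shows "wp ROUND1 R s"
proof -
  let ?Q = "\<lambda>s'. frame ROUND1 s s' \<longrightarrow> R s'"
  define s1 where "s1 = s\<lparr>wv := (wv s)(23 := 0), clk := clk s + costW (WC 0) + 2\<rparr>"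
  have F1: "frame ROUND1 s s1" by (simp add: frame_def s1_def)
  have rd1: "ready s1" using rd by (simp add: ready_def inp_def s1_def)
  have sz1: "sizes lv s1" using sz by (simp add: sizes_def s1_def)
  have MI: "2 * (n * m) < IM" using M sz by (auto simp: sizes_def)
  define D where "D = tab s"
  have D1: "tab s1 = D" by (simp add: D_def s1_def)
  have "wp (For 31 0 (For 32 1 CAND1)) (wp RESOLVE (wp (For 32 23 WRITE) ?Q)) s1"
  proof (rule wp_For[where N = n and \<tau> = "m * 212 + 9" and I = "\<lambda>u s'. entries s' = cands1 D u 0 \<and> wv s' 23 \<le> 2 * (u * m)"])
    show "entries s1 = cands1 D 0 0 \<and> wv s1 23 \<le> 2 * (0 * m)" by (simp add: entries_ents ents_0 cands1_0 s1_def)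
  next
    fix u and s2 :: st assume u: "u < n" "wv s2 31 = u" and f: "frame (For 31 0 (For 32 1 CAND1)) s1 s2"
      and I: "entries s2 = cands1 D u 0 \<and> wv s2 23 \<le> 2 * (u * m)"
    have rd2: "ready s2" by (rule ready_frame[OF rd1 f]) auto
    have sz2: "sizes lv s2" by (rule sizes_frame[OF sz1 f]) auto
    have D2: "tab s2 = D" using f D1 by (auto simp: frame_def)
    show "wp (For 32 1 CAND1) (\<lambda>s3. (entries s3 = cands1 D (Suc u) 0 \<and> wv s3 23 \<le> 2 * (Suc u * m)) \<and> clk s3 \<le> clk s2 + (m * 212 + 9)) s2"
    proof (rule wp_For[where N = m and \<tau> = 200 and I = "\<lambda>e s'. entries s' = cands1 D u e \<and> wv s' 23 \<le> 2 * (u * m) + 2 * e"])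
      fix e and s3 :: st assume e: "e < m" "wv s3 32 = e" and f3: "frame (For 32 1 CAND1) s2 s3"
        and I3: "entries s3 = cands1 D u e \<and> wv s3 23 \<le> 2 * (u * m) + 2 * e"
      have rd3: "ready s3" by (rule ready_frame[OF rd2 f3]) auto
      have sz3: "sizes lv s3" by (rule sizes_frame[OF sz2 f3]) auto
      have D3: "tab s3 = D" using f3 D2 by (auto simp: frame_def)
      have u3: "wv s3 31 = u" using f3 u by (auto simp: frame_def)
      have "2 * (Suc u * m) \<le> 2 * (n * m)" using u(1) by (intro mult_le_mono2 mult_le_mono1) simp
      then have M3: "Suc (wv s3 23) < IM" using I3 MI e(1) by simp
      show "wp CAND1 (\<lambda>s''. (entries s'' = cands1 D u (Suc e) \<and> wv s'' 23 \<le> 2 * (u * m) + 2 * Suc e) \<and> clk s'' \<le> clk s3 + 200) s3"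
        by (rule wp_conseq[OF wp_CAND1[OF rd3 sz3 refl M3 u3 u(1) e(2,1)]]) (use I3 D3 in \<open>auto simp: cands1_Suc\<close>)
    qed (use I rd2 lt_IM cands1_round in \<open>auto simp: entries_ents ready_def inp_def\<close>)
  next
    fix s2 :: st assume I: "entries s2 = cands1 D n 0 \<and> wv s2 23 \<le> 2 * (n * m)" and f2: "frame (For 31 0 (For 32 1 CAND1)) s1 s2"
      and t2: "clk s2 \<le> clk s1 + n * (m * 212 + 9 + 12) + 9"
    have rd2: "ready s2" by (rule ready_frame[OF rd1 f2]) auto
    have sz2: "sizes lv s2" by (rule sizes_frame[OF sz1 f2]) auto
    have D2: "tab s2 = D" using f2 D1 by (auto simp: frame_def)
    show "wp RESOLVE (wp (For 32 23 WRITE) ?Q) s2"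
    proof (rule wp_FINISH[OF rd2 sz2 conjunct2[OF I] M conjunct1[OF I]])
      show "\<And>g l. (g, l) \<in> cands1 D n 0 \<Longrightarrow> g < IM" using cands1_IM sz unfolding sizes_def by blast
      fix s3 assume rd3: "ready s3" and u: "upd_spec (tab s2) (cands1 D n 0) (tab s3)"
        and t3: "clk s3 \<le> clk s2 + RB lv (2 * (n * m)) + 112 * (2 * (n * m)) + 9"
      have "clk s3 \<le> clk s + RB lv (2 * (n * m)) + 500 * (n * m + n + 1)"
        using t3 t2 by (simp add: s1_def algebra_simps)
      then show "?Q s3" using post[OF rd3] u D2 unfolding D_def by simp
    qed
  qed (use rd1 lt_IM in \<open>auto simp: entries_ents ready_def inp_def\<close>)
  then have "wp (WSet 23 (WC 0)) (wp (For 31 0 (For 32 1 CAND1)) (wp RESOLVE (wp (For 32 23 WRITE) ?Q))) s"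
    using lt_IM by (simp add: wp_WSet s1_def)
  then have "wp ROUND1 ?Q s" unfolding ROUND1_def wp_Seq .
  then show ?thesis by (rule wp_conseq) auto
qed

text \<open>Without parallel arcs every entry is initialised at most once, so the initial table is
  optimal for walks of one arc; each of the \<open>h\<close> rounds then adds one arc.\<close>

lemma wp_PHASE1:
  assumes rd: "ready s" and sz: "sizes lv s" and M: "2 * (n * m) \<le> 2 ^ lv" and z: "\<And>g. wa s 6 g = 0"
    and h: "wv s 3 = h" "h < W" and inj: "inj_on (\<lambda>e. (src e, dst e)) {..<m}"
    and post: "\<And>s'. ready s' \<Longrightarrow> sound (tab s') \<Longrightarrow> opt1 h (tab s') \<Longrightarrow> frame PHASE1 s s' \<Longrightarrow>
      clk s' \<le> clk s + h * (RB lv (2 * (n * m)) + 500 * (n * m + n + 1) + 12) + 112 * m + 18 \<Longrightarrow> R s'"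
  shows "wp PHASE1 R s"
proof -
  let ?Q = "\<lambda>s'. frame PHASE1 s s' \<longrightarrow> R s'"
  have nn: "n * n \<le> IM" using sz by (simp add: sizes_def)
  define P where "P k T \<longleftrightarrow> (\<forall>e<k. T (src e * n + dst e) = Some (c e, t e)) \<and>
    (\<forall>g. (\<forall>e<k. src e * n + dst e \<noteq> g) \<longrightarrow> T g = None)" for k T
  have "wp (For 32 1 INIT1) (wp (For 33 3 ROUND1) ?Q) s"
  proof (rule wp_For[where N = m and \<tau> = 100 and I = "\<lambda>k s'. P k (tab s')"])
    show "P 0 (tab s)" using z by (simp add: P_def tabf_def)
  next
    fix k and s' :: st assume k: "k < m" "wv s' 32 = k" and f: "frame (For 32 1 INIT1) s s'" and I: "P k (tab s')"
    have rd': "ready s'" by (rule ready_frame[OF rd f]) auto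
    then have i: "inp s'" by (simp add: ready_def)
    have nk: "src j * n + dst j \<noteq> src k * n + dst k" if "j < k" for j
    proof
      assume e: "src j * n + dst j = src k * n + dst k"
      have "j < m" using that k by simp
      from idx_inj[OF dst[OF this] dst[OF k(1)] e] have "(src j, dst j) = (src k, dst k)" by simp
      then show False using inj that k(1) unfolding inj_on_def by force
    qed
    let ?g = "src k * n + dst k"
    have "P (Suc k) (tabf ((wa s' 6)(?g := Suc 0)) ((ra s' 3)(?g := c k)) ((ra s' 4)(?g := t k)))"
      using I nk unfolding P_def by (auto simp: less_Suc_eq tabf_def)
    then show "wp INIT1 (\<lambda>s''. P (Suc k) (tab s'') \<and> clk s'' \<le> clk s' + 100) s'"
      using k inpD[OF i] idx_IM[OF src[OF k(1)] dst[OF k(1)] nn] lt_IM src_IM[OF k(1)] by (simp add: INIT1_def wp_simps)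
  next
    fix s1 :: st assume I: "P m (tab s1)" and f1: "frame (For 32 1 INIT1) s s1" and t1: "clk s1 \<le> clk s + m * (100 + 12) + 9"
    have rd1: "ready s1" by (rule ready_frame[OF rd f1]) auto
    have sz1: "sizes lv s1" by (rule sizes_frame[OF sz f1]) auto
    have h1: "wv s1 3 = h" using f1 h by (auto simp: frame_def)
    have so: "sound (tab s1)"
      unfolding sound_def
    proof (intro allI impI)
      fix u v l assume uv: "u < n" "v < n" "tab s1 (u * n + v) = Some l"
      then obtain e where e: "e < m" "src e * n + dst e = u * n + v" using I unfolding P_def by (metis option.distinct(1))
      from idx_inj[OF dst[OF e(1)] uv(2) e(2)] have "src e = u" "dst e = v" by auto
      moreover have "l = (c e, t e)" using I e uv(3) unfolding P_def by auto
      ultimately show "\<exists>es. es \<noteq> [] \<and> walk u es v \<and> l = line es"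
        using e(1) by (intro exI[of _ "[e]"]) (simp add: line_def)
    qed
    have op: "opt1 (Suc 0) (tab s1)"
      unfolding opt1_def
    proof (intro allI impI)
      fix u v es assume w: "walk u es v" "es \<noteq> []" "length es \<le> Suc 0"
      then obtain e where "es = [e]" by (cases es) auto
      then show "below (tab s1) (u * n + v) (val (line es))"
        using w I unfolding P_def below_def by (auto simp: line_def)
    qed
    show "wp (For 33 3 ROUND1) ?Q s1"
    proof (rule wp_For[where N = h and \<tau> = "RB lv (2 * (n * m)) + 500 * (n * m + n + 1)" and
          I = "\<lambda>k s'. ready s' \<and> sound (tab s') \<and> opt1 (Suc k) (tab s')"])
      fix k and s2 :: st assume f2: "frame (For 33 3 ROUND1) s1 s2" and I2: "ready s2 \<and> sound (tab s2) \<and> opt1 (Suc k) (tab s2)"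
      have sz2: "sizes lv s2" by (rule sizes_frame[OF sz1 f2]) auto
      show "wp ROUND1 (\<lambda>s'. (ready s' \<and> sound (tab s') \<and> opt1 (Suc (Suc k)) (tab s')) \<and>
          clk s' \<le> clk s2 + (RB lv (2 * (n * m)) + 500 * (n * m + n + 1))) s2"
        by (rule wp_ROUND1[OF conjunct1[OF I2] sz2 M]) (use I2 phase1_sound phase1_opt in auto)
    next
      fix s2 :: st assume I2: "ready s2 \<and> sound (tab s2) \<and> opt1 (Suc h) (tab s2)"
        and t2: "clk s2 \<le> clk s1 + h * (RB lv (2 * (n * m)) + 500 * (n * m + n + 1) + 12) + 9"
      have "opt1 h (tab s2)" using opt1_mono[of "Suc h" "tab s2" h] I2 by auto
      then show "?Q s2" using post[of s2] I2 t1 t2 by simp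
    qed (use h h1 rd1 so op in \<open>auto simp: ready_def inp_def\<close>)
  qed (use rd lt_IM in \<open>auto simp: ready_def inp_def\<close>)
  then have "wp PHASE1 ?Q s" unfolding PHASE1_def wp_Seq .
  then show ?thesis by (rule wp_conseq) auto
qed

lemma wp_ROUND2:
  assumes rd: "ready s" and sz: "sizes lv s" and M: "2 * (N * N * N) \<le> 2 ^ lv" "N < IM" and N: "wv s 4 = N"
    and S: "\<And>i. i < N \<Longrightarrow> wa s 5 i < n"
    and post: "\<And>s'. ready s' \<Longrightarrow> upd_spec (tab s) (cands2 (tab s) (wa s 5) N N 0 0) (tab s') \<Longrightarrow> frame ROUND2 s s' \<Longrightarrow>
      clk s' \<le> clk s + RB lv (2 * (N * N * N)) + 600 * (N * N * N + N * N + N + 1) \<Longrightarrow> R s'"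
  shows "wp ROUND2 R s"
proof -
  let ?Q = "\<lambda>s'. frame ROUND2 s s' \<longrightarrow> R s'"
  define s1 where "s1 = s\<lparr>wv := (wv s)(23 := 0), clk := clk s + costW (WC 0) + 2\<rparr>"
  have rd1: "ready s1" using rd by (simp add: ready_def inp_def s1_def)
  have sz1: "sizes lv s1" using sz by (simp add: sizes_def s1_def)
  have MI: "2 * (N * N * N) < IM" using M sz by (auto simp: sizes_def)
  have NW: "N < W" using M IM_W by simp
  define D A where "D = tab s" and "A = wa s 5"
  have D1: "tab s1 = D" "wa s1 5 = A" "wv s1 4 = N" using N by (simp_all add: D_def A_def s1_def)
  let ?l3 = "For 37 4 CAND2"
  let ?l2 = "For 36 4 ?l3"
  let ?l1 = "For 31 4 ?l2"
  let ?t3 = "N * 262 + 9"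
  let ?t2 = "N * (?t3 + 12) + 9"
  have "wp ?l1 (wp RESOLVE (wp (For 32 23 WRITE) ?Q)) s1"
  proof (rule wp_For[where N = N and \<tau> = ?t2 and I = "\<lambda>i s'. entries s' = cands2 D A N i 0 0 \<and> wv s' 23 \<le> 2 * (i * N * N)"])
    show "entries s1 = cands2 D A N 0 0 0 \<and> wv s1 23 \<le> 2 * (0 * N * N)" by (simp add: entries_ents ents_0 cands2_0 s1_def)
  next
    fix i and s2 :: st assume i: "i < N" "wv s2 31 = i" and f: "frame ?l1 s1 s2"
      and I: "entries s2 = cands2 D A N i 0 0 \<and> wv s2 23 \<le> 2 * (i * N * N)"
    have rd2: "ready s2" by (rule ready_frame[OF rd1 f]) auto
    have sz2: "sizes lv s2" by (rule sizes_frame[OF sz1 f]) auto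
    have D2: "tab s2 = D" "wa s2 5 = A" "wv s2 4 = N" using f D1 by (auto simp: frame_def)
    show "wp ?l2 (\<lambda>s3. (entries s3 = cands2 D A N (Suc i) 0 0 \<and> wv s3 23 \<le> 2 * (Suc i * N * N)) \<and> clk s3 \<le> clk s2 + ?t2) s2"
    proof (rule wp_For[where N = N and \<tau> = ?t3 and I = "\<lambda>j s'. entries s' = cands2 D A N i j 0 \<and> wv s' 23 \<le> 2 * (i * N * N + j * N)"])
      fix j and s3 :: st assume j: "j < N" "wv s3 36 = j" and f3: "frame ?l2 s2 s3"
        and I3: "entries s3 = cands2 D A N i j 0 \<and> wv s3 23 \<le> 2 * (i * N * N + j * N)"
      have rd3: "ready s3" by (rule ready_frame[OF rd2 f3]) auto
      have sz3: "sizes lv s3" by (rule sizes_frame[OF sz2 f3]) auto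
      have D3: "tab s3 = D" "wa s3 5 = A" "wv s3 4 = N" "wv s3 31 = i" using f3 D2 i by (auto simp: frame_def)
      show "wp ?l3 (\<lambda>s4. (entries s4 = cands2 D A N i (Suc j) 0 \<and> wv s4 23 \<le> 2 * (i * N * N + Suc j * N)) \<and> clk s4 \<le> clk s3 + ?t3) s3"
      proof (rule wp_For[where N = N and \<tau> = 250 and I = "\<lambda>k s'. entries s' = cands2 D A N i j k \<and> wv s' 23 \<le> 2 * (i * N * N + j * N + k)"])
        fix k and s4 :: st assume k: "k < N" "wv s4 37 = k" and f4: "frame ?l3 s3 s4"
          and I4: "entries s4 = cands2 D A N i j k \<and> wv s4 23 \<le> 2 * (i * N * N + j * N + k)"
        have rd4: "ready s4" by (rule ready_frame[OF rd3 f4]) auto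
        have sz4: "sizes lv s4" by (rule sizes_frame[OF sz3 f4]) auto
        have D4: "tab s4 = D" "wa s4 5 = A" "wv s4 31 = i" "wv s4 36 = j" using f4 D3 j by (auto simp: frame_def)
        have "i * N * N + (j * N + k) < N * N * N"
        proof -
          have "Suc j * N \<le> N * N" "Suc i * (N * N) \<le> N * (N * N)" using i(1) j(1) by (intro mult_le_mono1, simp)+
          then show ?thesis using k(1) by (simp add: mult.assoc)
        qed
        moreover have "wv s4 23 \<le> 2 * (i * N * N + j * N + k)" using I4 by blast
        moreover have "Suc y < IM" if "x < z" "y \<le> 2 * x" "2 * z < IM" for x y z :: nat using that by linarith
        ultimately have M4: "Suc (wv s4 23) < IM" using MI unfolding add.assoc by blast
        have b: "i < IM" "j < IM" "k < IM" "wa s4 5 i < n" "wa s4 5 j < n" "wa s4 5 k < n"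
          using i j k M(2) S unfolding D4 A_def by auto
        show "wp CAND2 (\<lambda>s''. (entries s'' = cands2 D A N i j (Suc k) \<and> wv s'' 23 \<le> 2 * (i * N * N + j * N + Suc k)) \<and> clk s'' \<le> clk s4 + 250) s4"
          by (rule wp_conseq[OF wp_CAND2[OF rd4 sz4 refl M4 b(1-3) D4(3,4) k(2) b(4-6)]]) (use I4 D4 in \<open>auto simp: cands2_Suc\<close>)
      qed (use I3 D3 NW cands2_round in \<open>auto simp: entries_ents\<close>)
    qed (use I D2 NW cands2_round in \<open>auto simp: entries_ents algebra_simps\<close>)
  next
    fix s2 :: st assume I: "entries s2 = cands2 D A N N 0 0 \<and> wv s2 23 \<le> 2 * (N * N * N)" and f2: "frame ?l1 s1 s2"
      and t2: "clk s2 \<le> clk s1 + N * (?t2 + 12) + 9"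
    have rd2: "ready s2" by (rule ready_frame[OF rd1 f2]) auto
    have sz2: "sizes lv s2" by (rule sizes_frame[OF sz1 f2]) auto
    have D2: "tab s2 = D" using f2 D1 by (auto simp: frame_def)
    show "wp RESOLVE (wp (For 32 23 WRITE) ?Q) s2"
    proof (rule wp_FINISH[OF rd2 sz2 conjunct2[OF I] M(1) conjunct1[OF I]])
      fix g l assume "(g, l) \<in> cands2 D A N N 0 0"
      then obtain i j where "i < N" "j < N" "g = A i * n + A j" by (auto simp: cands2_def cand2_def)
      then show "g < IM" using idx_IM S sz unfolding A_def sizes_def by blast
    next
      fix s3 assume rd3: "ready s3" and u: "upd_spec (tab s2) (cands2 D A N N 0 0) (tab s3)"
        and t3: "clk s3 \<le> clk s2 + RB lv (2 * (N * N * N)) + 112 * (2 * (N * N * N)) + 9"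
      have "clk s3 \<le> clk s + RB lv (2 * (N * N * N)) + 600 * (N * N * N + N * N + N + 1)"
        using t3 t2 by (simp add: s1_def algebra_simps)
      then show "?Q s3" using post[OF rd3] u D2 unfolding D_def A_def by simp
    qed
  qed (use D1 NW in \<open>auto simp: entries_ents\<close>)
  then have "wp (WSet 23 (WC 0)) (wp ?l1 (wp RESOLVE (wp (For 32 23 WRITE) ?Q))) s"
    using lt_IM by (simp add: wp_WSet s1_def)
  then have "wp ROUND2 ?Q s" unfolding ROUND2_def wp_Seq .
  then show ?thesis by (rule wp_conseq) auto
qed

text \<open>\<open>opt1\<close> is carried along for the optimal cycles of at most \<open>h\<close>
  arcs, which the sample need not meet.\<close>

lemma wp_PHASE2:
  assumes rd: "ready s" and sz: "sizes lv s" and M: "2 * (N * N * N) \<le> 2 ^ lv" "N < IM" and N: "wv s 4 = N" and L: "wv s 2 = L" "L < W"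
    and S: "\<And>i. i < N \<Longrightarrow> wa s 5 i < n" and so: "sound (tab s)" and op: "opt1 h (tab s)"
    and post: "\<And>s'. ready s' \<Longrightarrow> sound (tab s') \<Longrightarrow> opt1 h (tab s') \<Longrightarrow> opt2 (wa s 5 ` {..<N}) h L (tab s') \<Longrightarrow> frame PHASE2 s s' \<Longrightarrow>
      clk s' \<le> clk s + L * (RB lv (2 * (N * N * N)) + 600 * (N * N * N + N * N + N + 1) + 12) + 9 \<Longrightarrow> R s'"
  shows "wp PHASE2 R s"
  unfolding PHASE2_def
proof (rule wp_For[where N = L and \<tau> = "RB lv (2 * (N * N * N)) + 600 * (N * N * N + N * N + N + 1)" and
      I = "\<lambda>k s'. ready s' \<and> sound (tab s') \<and> opt1 h (tab s') \<and> opt2 (wa s 5 ` {..<N}) h k (tab s')"])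
  fix k and s' :: st assume f: "frame (For 33 2 ROUND2) s s'"
    and I: "ready s' \<and> sound (tab s') \<and> opt1 h (tab s') \<and> opt2 (wa s 5 ` {..<N}) h k (tab s')"
  have sz': "sizes lv s'" by (rule sizes_frame[OF sz f]) auto
  have f': "wv s' 4 = N" "wa s' 5 = wa s 5" using f N by (auto simp: frame_def)
  show "wp ROUND2 (\<lambda>s''. (ready s'' \<and> sound (tab s'') \<and> opt1 h (tab s'') \<and> opt2 (wa s 5 ` {..<N}) h (Suc k) (tab s'')) \<and>
      clk s'' \<le> clk s' + (RB lv (2 * (N * N * N)) + 600 * (N * N * N + N * N + N + 1))) s'"
  proof (rule wp_ROUND2[OF conjunct1[OF I] sz' M f'(1)])
    show S': "\<And>i. i < N \<Longrightarrow> wa s' 5 i < n" using S f' by simp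
    fix s'' assume rd'': "ready s''" and u: "upd_spec (tab s') (cands2 (tab s') (wa s' 5) N N 0 0) (tab s'')"
      and t: "clk s'' \<le> clk s' + RB lv (2 * (N * N * N)) + 600 * (N * N * N + N * N + N + 1)"
    have "sound (tab s'')" using phase2_sound[OF _ S' u] I by blast
    moreover have "opt1 h (tab s'')" using phase2_below[OF S' u] I unfolding opt1_def by blast
    moreover have "opt2 (wa s 5 ` {..<N}) h (Suc k) (tab s'')" using phase2_opt[OF _ S' u] I unfolding f' by blast
    ultimately show "(ready s'' \<and> sound (tab s'') \<and> opt1 h (tab s'') \<and> opt2 (wa s 5 ` {..<N}) h (Suc k) (tab s'')) \<and>
      clk s'' \<le> clk s' + (RB lv (2 * (N * N * N)) + 600 * (N * N * N + N * N + N + 1))" using rd'' t by simp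
  qed
qed (use L rd so op opt2_0 post in \<open>auto simp: PHASE2_def ready_def inp_def\<close>)

end

section \<open>The main program\<close>

definition SELSTEP :: cmd where
  "SELSTEP = (WSet 34 (idxE (WV 41) (WV 41)) ;;
     If (WLess (WC 0) (WL 6 (WV 34))) (RSet 3 (RB Div (RL 3 (WV 34)) (RL 4 (WV 34))) ;;
       If (WLess (WC 0) (WV 42)) (If (RLess (RV 3) (RV 2)) (RSet 2 (RV 3)) SKIP) (RSet 2 (RV 3) ;; WSet 42 (WC 1))) SKIP)"

definition SELECT :: cmd where
  "SELECT = (WSet 42 (WC 0) ;; For 41 0 SELSTEP)"

definition ALLARCS :: cmd where
  "ALLARCS = For 32 1 (WSt 2 (WV 32) (WC 1))"

definition TIGHT :: cmd where
  "TIGHT = For 6 1 (If (RLess (RL 2 (WL 1 (WV 6))) (RB Add (RL 2 (WL 0 (WV 6))) arc_weight)) (WSt 2 (WV 6) (WC 0)) SKIP)"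

text \<open>All outcomes share one search. Array 2 still allows all arcs if the diagonal is empty or
  Bellman-Ford rejects the selected ratio, and only the tight arcs otherwise.\<close>

definition FINAL :: cmd where
  "FINAL = (If (WLess (WC 0) (WV 42)) (RSet 0 (RV 2) ;; BF ;; If (WLess (WC 0) (WV 7)) SKIP TIGHT) SKIP ;; MARK ;; EXTRACT)"

text \<open>Acyclic inputs have no minimum ratio and need an exact answer, so they are settled
  before the tables are built. Inputs without arcs are caught first, as \<open>PRE\<close> computes
  no parameters for them.\<close>

definition MAIN :: cmd where
  "MAIN = If (WLess (WC 0) (WV 1))
     (ALLARCS ;; MARK ;; If (WLess (WC 0) (WV 9)) (PHASE1 ;; PHASE2 ;; SELECT ;; FINAL) (WSet 0 (WC 0)))
     (WSet 0 (WC 0))"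

lemma mod_main [simp]: "modW SELSTEP = {34, 42}" "modR SELSTEP = {2, 3}" "modWA SELSTEP = {}" "modRA SELSTEP = {}"
  "modW ALLARCS = {32}" "modR ALLARCS = {}" "modWA ALLARCS = {2}" "modRA ALLARCS = {}"
  "modW TIGHT = {6}" "modR TIGHT = {}" "modWA TIGHT = {2}" "modRA TIGHT = {}"
  "modW SELECT = {34, 41, 42}" "modR SELECT = {2, 3}" "modWA SELECT = {}" "modRA SELECT = {}"
  by (auto simp: SELSTEP_def SELECT_def ALLARCS_def TIGHT_def)

lemma mod_main_phases [simp]: "modW PHASE1 = {32, 33, 34} \<union> modW ROUND1" "modR PHASE1 = {0, 1}"
  "modWA PHASE1 = {6, 7, 8, 9, 10, 11, 12, 13}" "modRA PHASE1 = {2, 3, 4, 5, 6, 7}"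
  "modW PHASE2 = insert 33 (modW ROUND2)" "modR PHASE2 = {0, 1}"
  "modWA PHASE2 = {6, 7, 8, 9, 10, 11, 12, 13}" "modRA PHASE2 = {2, 3, 4, 5, 6, 7}"
  unfolding PHASE1_def PHASE2_def by auto

context mach
begin

lemma wp_Seq_fun: "wp (p ;; q) Q = wp p (wp q Q)"
  by (rule ext) (rule wp_Seq)

lemma wp_ALLARCS:
  assumes i: "inp s"
    and post: "\<And>s'. \<forall>e<m. 0 < wa s' 2 e \<Longrightarrow> frame ALLARCS s s' \<Longrightarrow> clk s' \<le> clk s + 32 * m + 9 \<Longrightarrow> R s'"
  shows "wp ALLARCS R s"
  unfolding ALLARCS_def
proof (rule wp_For[where N = m and \<tau> = 20 and I = "\<lambda>k s'. \<forall>e<k. 0 < wa s' 2 e"])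
  fix s' :: st assume "\<forall>e<m. 0 < wa s' 2 e" "frame (For 32 1 (WSt 2 (WV 32) (WC 1))) s s'" "clk s' \<le> clk s + m * (20 + 12) + 9"
  then show "R s'" using post[of s'] by (simp add: ALLARCS_def mult.commute)
qed (use inpD[OF i] lt_IM in \<open>auto simp: wp_simps less_Suc_eq\<close>)

lemma wp_TIGHT:
  assumes i: "inp s" and x: "rv s 0 = x" and al: "\<forall>e<m. 0 < wa s 2 e"
    and pot: "\<forall>e<m. ra s 2 (dst e) \<le> ra s 2 (src e) + (c e - x * t e)"
    and post: "\<And>s'. \<forall>e<m. 0 < wa s' 2 e \<longleftrightarrow> ra s 2 (dst e) = ra s 2 (src e) + (c e - x * t e) \<Longrightarrow> frame TIGHT s s' \<Longrightarrow>
      clk s' \<le> clk s + 112 * m + 9 \<Longrightarrow> R s'"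
  shows "wp TIGHT R s"
  unfolding TIGHT_def
proof (rule wp_For[where N = m and \<tau> = 100 and
      I = "\<lambda>k s'. \<forall>e<m. 0 < wa s' 2 e \<longleftrightarrow> (e < k \<longrightarrow> ra s 2 (dst e) = ra s 2 (src e) + (c e - x * t e))"])
  let ?B = "If (RLess (RL 2 (WL 1 (WV 6))) (RB Add (RL 2 (WL 0 (WV 6))) arc_weight)) (WSt 2 (WV 6) (WC 0)) SKIP"
  fix k and s' :: st assume k: "k < m" "wv s' 6 = k" and f: "frame (For 6 1 ?B) s s'"
    and I: "\<forall>e<m. 0 < wa s' 2 e \<longleftrightarrow> (e < k \<longrightarrow> ra s 2 (dst e) = ra s 2 (src e) + (c e - x * t e))"
  have i': "inp s'" by (rule inp_frame[OF i f]) auto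
  have e': "ra s' 2 = ra s 2" "rv s' 0 = x" using f x by (auto simp: frame_def)
  show "wp ?B (\<lambda>s''. (\<forall>e<m. 0 < wa s'' 2 e \<longleftrightarrow> (e < Suc k \<longrightarrow> ra s 2 (dst e) = ra s 2 (src e) + (c e - x * t e))) \<and>
      clk s'' \<le> clk s' + 100) s'"
  proof (cases "ra s 2 (dst k) < ra s 2 (src k) + (c k - x * t k)")
    case True
    have "\<forall>e<m. 0 < ((wa s' 2)(k := 0)) e \<longleftrightarrow> (e < Suc k \<longrightarrow> ra s 2 (dst e) = ra s 2 (src e) + (c e - x * t e))"
      using I True by (auto simp: less_Suc_eq)
    then show ?thesis using True k e' inpD[OF i'] src_IM[OF k(1)] lt_IM by (simp add: wp_simps arc_weight_def)
  next
    case False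
    then have "ra s 2 (dst k) = ra s 2 (src k) + (c k - x * t k)" using pot k(1) by force
    then have "\<forall>e<m. 0 < wa s' 2 e \<longleftrightarrow> (e < Suc k \<longrightarrow> ra s 2 (dst e) = ra s 2 (src e) + (c e - x * t e))"
      using I by (auto simp: less_Suc_eq)
    then show ?thesis using False k e' inpD[OF i'] src_IM[OF k(1)] lt_IM by (simp add: wp_simps arc_weight_def)
  qed
next
  fix s' :: st assume "\<forall>e<m. 0 < wa s' 2 e \<longleftrightarrow> (e < m \<longrightarrow> ra s 2 (dst e) = ra s 2 (src e) + (c e - x * t e))"
    "frame (For 6 1 (If (RLess (RL 2 (WL 1 (WV 6))) (RB Add (RL 2 (WL 0 (WV 6))) arc_weight)) (WSt 2 (WV 6) (WC 0)) SKIP)) s s'"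
    "clk s' \<le> clk s + m * (100 + 12) + 9"
  then show "R s'" using post[of s'] by (simp add: TIGHT_def mult.commute)
qed (use inpD[OF i] lt_IM al in auto)

text \<open>Stated outside \<open>mrat\<close>, which assumes that a cycle exists.\<close>

lemma wp_acyclic:
  assumes i: "inp s" and no: "\<And>q. \<not> cyc q"
    and post: "\<And>s'. wv s' 0 = 0 \<Longrightarrow> clk s' \<le> clk s + 300 * (n * m + n + m + 1) \<Longrightarrow> R s'"
  shows "wp MAIN R s"
proof (cases "0 < m")
  case True
  let ?s = "s\<lparr>clk := clk s + costB (WLess (WC 0) (WV 1))\<rparr>"
  let ?c = "If (WLess (WC 0) (WV 9)) (PHASE1 ;; PHASE2 ;; SELECT ;; FINAL) (WSet 0 (WC 0))"
  have i0: "inp ?s" using i by (simp add: inp_def)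
  have "wp ALLARCS (wp MARK (wp ?c R)) ?s"
  proof (rule wp_ALLARCS[OF i0])
    fix s1 :: st assume f1: "frame ALLARCS ?s s1" and t1: "clk s1 \<le> clk ?s + 32 * m + 9" and a1: "\<forall>e<m. 0 < wa s1 2 e"
    have i1: "inp s1" by (rule inp_frame[OF i0 f1]) auto
    show "wp MARK (wp ?c R) s1"
    proof (rule wp_MARK[OF i1 refl])
      fix s2 :: st assume mk: "mk_inv (\<lambda>e. 0 < wa s1 2 e) n 0 (wa s2 3) (wa s2 4)"
        and u: "\<And>u. wv s2 9 = Suc u \<Longrightarrow> u < n \<and> n \<le> wa s2 3 u" and t2: "clk s2 \<le> clk s1 + 200 * (n * m + n + m + 1)"
      have "wv s2 9 = 0"
      proof (cases "wv s2 9")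
        case (Suc u')
        then have "\<exists>q. cyc q" using mk_inv_cycle[OF mk, of u'] u[OF Suc] by blast
        then show ?thesis using no by blast
      qed
      moreover have fin: "R s3" if "wv s3 0 = 0" "clk s3 \<le> clk s2 + 20" for s3
        by (rule post) (use t1 t2 that in simp_all)
      ultimately show "wp ?c R s2" using lt_IM by (simp add: wp_If wp_WSet)
    qed
  qed
  then show ?thesis unfolding MAIN_def using True inpD[OF i] lt_IM by (simp add: wp_If wp_Seq_fun)
next
  case False
  have fin: "R s3" if "wv s3 0 = 0" "clk s3 \<le> clk s + 20" for s3
    by (rule post) (use that in simp_all)
  show ?thesis unfolding MAIN_def using False inpD[OF i] lt_IM by (simp add: wp_If wp_WSet) (rule fin; simp)
qed

end

context mrat
begin

lemma wp_SELECT: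
  assumes rd: "ready s" and nn: "n * n \<le> IM" and so: "sound (tab s)"
    and post: "\<And>s'. (0 < wv s' 42 \<Longrightarrow> lam \<le> rv s' 2) \<Longrightarrow>
      (\<exists>u<n. below (tab s) (u * n + u) 0 \<Longrightarrow> 0 < wv s' 42 \<and> rv s' 2 = lam) \<Longrightarrow>
      frame SELECT s s' \<Longrightarrow> clk s' \<le> clk s + 112 * n + 20 \<Longrightarrow> R s'"
  shows "wp SELECT R s"
proof -
  have i: "inp s" using rd by (simp add: ready_def)
  define s1 where "s1 = s\<lparr>wv := (wv s)(42 := 0), clk := clk s + costW (WC 0) + 2\<rparr>"
  have i1: "inp s1" using i by (simp add: inp_def s1_def)
  \<comment> \<open>The flag \<open>has\<close> replaces an infinite initial value for the
    minimum.\<close>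
  define P where "P k has b \<longleftrightarrow> (0 < has \<longrightarrow> (\<exists>u<n. \<exists>l. tab s (u * n + u) = Some l \<and> b = fst l / snd l)) \<and>
    (\<forall>u<k. \<forall>l. tab s (u * n + u) = Some l \<longrightarrow> 0 < has \<and> b \<le> fst l / snd l)" for k and has :: nat and b
  have "wp (For 41 0 SELSTEP) (\<lambda>s'. frame SELECT s s' \<longrightarrow> R s') s1"
  proof (rule wp_For[where N = n and \<tau> = 100 and I = "\<lambda>k s'. P k (wv s' 42) (rv s' 2)"])
    show "P 0 (wv s1 42) (rv s1 2)" by (simp add: P_def s1_def)
  next
    fix k and s' :: st assume k: "k < n" "wv s' 41 = k" and f: "frame (For 41 0 SELSTEP) s1 s'" and I: "P k (wv s' 42) (rv s' 2)"
    have i': "inp s'" by (rule inp_frame[OF i1 f]) auto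
    have tb: "wa s' 6 = wa s 6" "ra s' 3 = ra s 3" "ra s' 4 = ra s 4" using f by (auto simp: frame_def s1_def)
    have b: "k * n + k < IM" "k * n + k < W" "k * n < W" using idx_IM[OF k(1) k(1) nn] by auto
    show "wp SELSTEP (\<lambda>s''. P (Suc k) (wv s'' 42) (rv s'' 2) \<and> clk s'' \<le> clk s' + 100) s'"
    proof (cases "wa s 6 (k * n + k) = 0")
      case True
      then have "tab s (k * n + k) = None" by (simp add: tabf_def)
      then have "P (Suc k) (wv s' 42) (rv s' 2)" using I unfolding P_def by (auto simp: less_Suc_eq)
      then show ?thesis using True k tb b inpD(1)[OF i'] lt_IM by (simp add: SELSTEP_def wp_simps)
    next
      case False
      let ?q = "ra s 3 (k * n + k) / ra s 4 (k * n + k)"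
      have tk: "tab s (k * n + k) = Some (ra s 3 (k * n + k), ra s 4 (k * n + k))" using False by (simp add: tabf_def)
      have p1: "P (Suc k) h ?q" if "wv s' 42 = 0 \<or> ?q < rv s' 2" "0 < h" for h
        unfolding P_def
      proof (intro conjI impI allI)
        show "\<exists>u<n. \<exists>l. tab s (u * n + u) = Some l \<and> ?q = fst l / snd l" using tk k(1) by force
        fix u l assume ul: "u < Suc k" "tab s (u * n + u) = Some l"
        show "0 < h" by fact
        show "?q \<le> fst l / snd l"
        proof (cases "u = k")
          case True
          then have "l = (ra s 3 (k * n + k), ra s 4 (k * n + k))" using ul tk by simp
          then show ?thesis by simp
        next
          case False
          then have "u < k" using ul by simp
          then have "0 < wv s' 42" "rv s' 2 \<le> fst l / snd l" using I ul unfolding P_def by blast+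
          then show ?thesis using that by simp
        qed
      qed
      have p2: "P (Suc k) (wv s' 42) (rv s' 2)" if "0 < wv s' 42" "\<not> ?q < rv s' 2"
        using I that tk unfolding P_def by (auto simp: less_Suc_eq)
      show ?thesis using False k tb b inpD(1)[OF i'] lt_IM p1[of "wv s' 42"] p1[of 1] p2
        by (simp add: SELSTEP_def wp_simps)
    qed
  next
    fix s' :: st assume I: "P n (wv s' 42) (rv s' 2)" and t: "clk s' \<le> clk s1 + n * (100 + 12) + 9"
    have 1: "lam \<le> rv s' 2" if "0 < wv s' 42"
      using I that sound_diagonal(3)[OF so] unfolding P_def by metis
    have 2: "0 < wv s' 42 \<and> rv s' 2 = lam" if ex: "\<exists>u<n. below (tab s) (u * n + u) 0"
    proof -
      obtain u l where u: "u < n" "tab s (u * n + u) = Some l" "val l \<le> 0" using ex by (auto simp: below_def)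
      then have "fst l / snd l = lam" using sound_diagonal(4)[OF so] by blast
      moreover have h: "0 < wv s' 42" "rv s' 2 \<le> fst l / snd l" using I u unfolding P_def by blast+
      ultimately show ?thesis using 1 by simp
    qed
    show "frame SELECT s s' \<longrightarrow> R s'" using post[OF 1 2] t by (simp add: s1_def)
  qed (use inpD[OF i1] lt_IM in auto)
  then have "wp (WSet 42 (WC 0)) (wp (For 41 0 SELSTEP) (\<lambda>s'. frame SELECT s s' \<longrightarrow> R s')) s"
    using lt_IM by (simp add: wp_WSet s1_def)
  then have "wp SELECT (\<lambda>s'. frame SELECT s s' \<longrightarrow> R s') s" unfolding SELECT_def wp_Seq .
  then show ?thesis by (rule wp_conseq) auto
qed

lemma wp_FINAL:
  assumes i: "inp s" and al: "\<forall>e<m. 0 < wa s 2 e" and b: "0 < wv s 42 \<Longrightarrow> lam \<le> rv s 2"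
    and post: "\<And>s' q. cyc q \<Longrightarrow> (0 < wv s 42 \<Longrightarrow> rv s 2 = lam \<Longrightarrow> wt c q = lam * wt t q) \<Longrightarrow> map (wa s' 32) [0..<wv s' 0] = q \<Longrightarrow>
      clk s' \<le> clk s + 700 * (n * m + n + m + 1) \<Longrightarrow> R s'"
  shows "wp FINAL R s"
proof -
  let ?G = "0 < wv s 42 \<and> rv s 2 = lam"
  \<comment> \<open>The final search always has something to find: either all arcs are allowed, or
    all arcs of an optimal cycle are tight.\<close>
  let ?S = "\<lambda>s1. inp s1 \<and> (\<forall>q. cyc q \<longrightarrow> (\<forall>e\<in>set q. 0 < wa s1 2 e) \<longrightarrow> ?G \<longrightarrow> wt c q = lam * wt t q) \<and>
    (\<exists>q. closed q \<and> (\<forall>e\<in>set q. 0 < wa s1 2 e)) \<and> clk s1 \<le> clk s + 330 * (n * m + n + m + 1)"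
  have all: "\<exists>q. closed q \<and> (\<forall>e\<in>set q. 0 < wa s1 2 e)" if "\<forall>e<m. 0 < wa s1 2 e" for s1
  proof -
    obtain q where "cyc q" using cyc_ex by blast
    then have "closed q" "set q \<subseteq> {..<m}" using walk_set by (auto simp: cyc_def closed_def)
    then show ?thesis using that by blast
  qed
  have first: "wp (If (WLess (WC 0) (WV 42)) (RSet 0 (RV 2) ;; BF ;; If (WLess (WC 0) (WV 7)) SKIP TIGHT) SKIP) ?S s"
  proof (cases "0 < wv s 42")
    case False
    have "?S (s\<lparr>clk := clk s + k\<rparr>)" if "k \<le> 30" for k
      using i al all[of s] False that by (auto simp: inp_def)
    from this[of 5] show ?thesis using False lt_IM by (auto simp add: wp_If wp_SKIP inp_def)
  next
    case True
    define s1 where "s1 = s\<lparr>rv := (rv s)(0 := rv s 2), clk := clk s + costB (WLess (WC 0) (WV 42)) + costR (RV 2) + 3\<rparr>"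
    have i1: "inp s1" using i by (simp add: inp_def s1_def)
    have "wp BF (wp (If (WLess (WC 0) (WV 7)) SKIP TIGHT) ?S) s1"
    proof (rule wp_BF[OF i1])
      show "rv s1 0 = rv s 2" by (simp add: s1_def)
      fix s2 :: st assume f2: "frame BF s1 s2" and n2: "wv s2 7 = (if \<exists>q. closed q \<and> wt (\<lambda>e. c e - rv s 2 * t e) q < 0 then 1 else 0)"
        and p2: "wv s2 7 = 0 \<Longrightarrow> \<forall>e<m. ra s2 2 (dst e) \<le> ra s2 2 (src e) + (c e - rv s 2 * t e)"
        and t2: "clk s2 \<le> clk s1 + 200 * (n * m + n + m + 1)"
      have n2: "wv s2 7 = (if lam < rv s 2 then 1 else 0)" using n2 unfolding neg_iff .
      have i2: "inp s2" by (rule inp_frame[OF i1 f2]) auto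
      have a2: "\<forall>e<m. 0 < wa s2 2 e" using f2 al by (auto simp: frame_def s1_def)
      show "wp (If (WLess (WC 0) (WV 7)) SKIP TIGHT) ?S s2"
      proof (cases "lam < rv s 2")
        case L: True
        have "?S (s2\<lparr>clk := clk s2 + k\<rparr>)" if "k \<le> 30" for k
          using i2 a2 all[of s2] L that t2 by (auto simp: inp_def s1_def)
        from this[of 5] show ?thesis using L n2 lt_IM by (auto simp add: wp_If wp_SKIP inp_def)
      next
        case L: False
        then have bl: "rv s 2 = lam" using b[OF True] by simp
        let ?s2 = "s2\<lparr>clk := clk s2 + costB (WLess (WC 0) (WV 7))\<rparr>"
        have p2: "\<forall>e<m. ra s2 2 (dst e) \<le> ra s2 2 (src e) + (c e - lam * t e)" using p2 n2 L bl by simp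
        let ?tight = "\<lambda>e. ra s2 2 (dst e) = ra s2 2 (src e) + (c e - lam * t e)"
        have "wp TIGHT (\<lambda>s'. ?S (s'\<lparr>clk := clk s' + 1\<rparr>)) ?s2"
        proof (rule wp_TIGHT)
          show "inp ?s2" using i2 by (simp add: inp_def)
          show "rv ?s2 0 = lam" using f2 bl by (auto simp: frame_def s1_def)
          show "\<forall>e<m. 0 < wa ?s2 2 e" using a2 by simp
          show "\<forall>e<m. ra ?s2 2 (dst e) \<le> ra ?s2 2 (src e) + (c e - lam * t e)" using p2 by simp
          fix s3 :: st assume a3: "\<forall>e<m. 0 < wa s3 2 e \<longleftrightarrow> ra ?s2 2 (dst e) = ra ?s2 2 (src e) + (c e - lam * t e)"
            and f3: "frame TIGHT ?s2 s3" and t3: "clk s3 \<le> clk ?s2 + 112 * m + 9"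
          have i3: "inp s3" by (rule inp_frame[OF i2 f3[unfolded frame_clk]]) auto
          have a3: "\<forall>e<m. 0 < wa s3 2 e \<longleftrightarrow> ?tight e" using a3 by simp
          have sq: "e < m" if "walk u q v" "e \<in> set q" for u q v e using walk_set that by blast
          have "wt c q = lam * wt t q" if q: "cyc q" "\<forall>e\<in>set q. 0 < wa s3 2 e" for q
          proof -
            obtain u where u: "walk u q u" using q by (auto simp: cyc_def closed_def)
            \<comment> \<open>Around a cycle of tight arcs the potentials cancel and leave weight
              zero at \<open>lam\<close>.\<close>
            have "ra s2 2 u = ra s2 2 u + wt (\<lambda>e. c e - lam * t e) q"
              by (rule walk_tight[OF u]) (use a3 q(2) sq[OF u] in blast)
            then show ?thesis by (simp add: wt_diff)
          qed
          moreover have "\<exists>q. closed q \<and> (\<forall>e\<in>set q. 0 < wa s3 2 e)"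
          proof -
            obtain q where q: "cyc q" "wt c q = lam * wt t q" using lam_attained by blast
            then obtain u where u: "walk u q u" "q \<noteq> []" by (auto simp: cyc_def closed_def)
            have "?tight e" if "e \<in> set q" for e
              by (rule potential_tight[where d = "ra s2 2" and w = "\<lambda>e. c e - lam * t e", OF _ u(1) _ that])
                (use p2 q(2) in \<open>auto simp: wt_diff\<close>)
            then show ?thesis using a3 sq[OF u(1)] q(1) by (intro exI[of _ q]) (auto simp: cyc_def)
          qed
          moreover have "clk s3 + 1 \<le> clk s + 330 * (n * m + n + m + 1)" using t3 t2 by (simp add: s1_def)
          ultimately show "?S (s3\<lparr>clk := clk s3 + 1\<rparr>)" using i3 by (simp add: inp_def)
        qed
        then show ?thesis using L n2 lt_IM by (simp add: wp_If)
      qed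
    qed
    then show ?thesis using True lt_IM by (simp add: wp_If wp_Seq_fun wp_RSet s1_def)
  qed
  show ?thesis unfolding FINAL_def wp_Seq
  proof (rule wp_conseq[OF first])
    fix s1 :: st assume S: "?S s1"
    show "wp MARK (wp EXTRACT R) s1"
    proof (rule wp_MARK[OF conjunct1[OF S] refl])
      fix s2 :: st assume f2: "frame MARK s1 s2" and mk: "mk_inv (\<lambda>e. 0 < wa s1 2 e) n 0 (wa s2 3) (wa s2 4)"
        and z: "wv s2 9 = 0 \<Longrightarrow> \<forall>q. closed q \<longrightarrow> \<not> (\<forall>e\<in>set q. 0 < wa s1 2 e)"
        and u: "\<And>u. wv s2 9 = Suc u \<Longrightarrow> u < n \<and> n \<le> wa s2 3 u"
        and t2: "clk s2 \<le> clk s1 + 200 * (n * m + n + m + 1)"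
      have i2: "inp s2" by (rule inp_frame[OF conjunct1[OF S] f2]) auto
      have "wv s2 9 \<noteq> 0" using z S by blast
      then obtain u' where u': "wv s2 9 = Suc u'" using not0_implies_Suc by blast
      show "wp EXTRACT R s2"
      proof (rule wp_EXTRACT[OF i2 mk u'])
        show "u' < n" "n \<le> wa s2 3 u'" using u[OF u'] by auto
        fix s3 :: st and q assume q: "cyc q" "\<forall>e\<in>set q. 0 < wa s1 2 e" and r: "map (wa s3 32) [0..<wv s3 0] = q"
          and t3: "clk s3 \<le> clk s2 + 100 * (n + 1)"
        have t1: "clk s1 \<le> clk s + 330 * (n * m + n + m + 1)" using S by blast
        show "R s3" by (rule post[OF q(1) _ r]) (use S q t1 t2 t3 in auto)
      qed
    qed
  qed
qed

definition main_time :: "nat \<Rightarrow> nat \<Rightarrow> nat \<Rightarrow> nat \<Rightarrow> nat" where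
  "main_time lv L h N = h * (RB lv (2 * (n * m)) + 500 * (n * m + n + 1) + 12) +
     L * (RB lv (2 * (N * N * N)) + 600 * (N * N * N + N * N + N + 1) + 12) + 1500 * (n * m + n + m + 1)"

text \<open>This is the deterministic core of the one-sided error: every sample leads to a cycle,
  and the sample affects optimality only through \<open>hits\<close>.\<close>

lemma wp_MAIN:
  assumes rd: "ready s" and sz: "sizes lv s" and M: "2 * (n * m) \<le> 2 ^ lv" "2 * (N * N * N) \<le> 2 ^ lv" "N < IM"
    and v: "wv s 2 = L" "L < W" "wv s 3 = h" "h < W" "wv s 4 = N" and z: "\<And>g. wa s 6 g = 0" and S: "\<And>i. i < N \<Longrightarrow> wa s 5 i < n"
    and inj: "inj_on (\<lambda>e. (src e, dst e)) {..<m}" and L: "n \<le> 2 ^ L"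
    and post: "\<And>s' q. cyc q \<Longrightarrow> map (wa s' 32) [0..<wv s' 0] = q \<Longrightarrow>
      (\<And>r. cyc r \<Longrightarrow> wt c r = lam * wt t r \<Longrightarrow> length r \<le> h \<or> hits (wa s 5 ` {..<N}) h r \<Longrightarrow> wt c q = lam * wt t q) \<Longrightarrow>
      clk s' \<le> clk s + main_time lv L h N \<Longrightarrow> R s'"
  shows "wp MAIN R s"
proof -
  have i: "inp s" using rd by (simp add: ready_def)
  obtain q0 where q0: "cyc q0" using cyc_ex by blast
  then obtain e0 where "e0 < m" using walk_set by (fastforce simp: cyc_def closed_def neq_Nil_conv)
  then have m0: "0 < m" by simp
  let ?s = "s\<lparr>clk := clk s + costB (WLess (WC 0) (WV 1))\<rparr>"
  let ?c = "If (WLess (WC 0) (WV 9)) (PHASE1 ;; PHASE2 ;; SELECT ;; FINAL) (WSet 0 (WC 0))"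
  have i0: "inp ?s" and rd0: "ready ?s" and sz0: "sizes lv ?s" using i rd sz by (simp_all add: inp_def ready_def sizes_def)
  have "wp ALLARCS (wp MARK (wp ?c R)) ?s"
  proof (rule wp_ALLARCS[OF i0])
    fix s1 :: st assume f1: "frame ALLARCS ?s s1" and t1: "clk s1 \<le> clk ?s + 32 * m + 9" and a1: "\<forall>e<m. 0 < wa s1 2 e"
    have i1: "inp s1" and rd1: "ready s1" by (rule inp_frame[OF i0 f1] ready_frame[OF rd0 f1]; auto)+
    have sz1: "sizes lv s1" by (rule sizes_frame[OF sz0 f1]) auto
    show "wp MARK (wp ?c R) s1"
    proof (rule wp_MARK[OF i1 refl])
      fix s2 :: st assume f2: "frame MARK s1 s2" and z2: "wv s2 9 = 0 \<Longrightarrow> \<forall>q. closed q \<longrightarrow> \<not> (\<forall>e\<in>set q. 0 < wa s1 2 e)"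
        and t2: "clk s2 \<le> clk s1 + 200 * (n * m + n + m + 1)"
      have "set q0 \<subseteq> {..<m}" "closed q0" using q0 walk_set by (auto simp: cyc_def closed_def)
      then have w9: "0 < wv s2 9" using z2 a1 by blast
      let ?s2 = "s2\<lparr>clk := clk s2 + costB (WLess (WC 0) (WV 9))\<rparr>"
      have rd2': "ready s2" by (rule ready_frame[OF rd1 f2]) auto
      then have rd2: "ready ?s2" by (simp add: ready_def inp_def)
      have sz2': "sizes lv s2" by (rule sizes_frame[OF sz1 f2]) auto
      then have sz2: "sizes lv ?s2" by (simp add: sizes_def)
      have v2: "wv ?s2 2 = L" "wv ?s2 3 = h" "wv ?s2 4 = N" "\<And>g. wa ?s2 6 g = 0" "wa ?s2 5 = wa s 5" "\<forall>e<m. 0 < wa ?s2 2 e"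
        using f1 f2 v z a1 by (auto simp: frame_def)
      have "wp PHASE1 (wp PHASE2 (wp SELECT (wp FINAL R))) ?s2"
      proof (rule wp_PHASE1[OF rd2 sz2 M(1) v2(4) v2(2) v(4) inj])
        fix s3 :: st assume rd3: "ready s3" and so3: "sound (tab s3)" and op3: "opt1 h (tab s3)" and f3: "frame PHASE1 ?s2 s3"
          and t3: "clk s3 \<le> clk ?s2 + h * (RB lv (2 * (n * m)) + 500 * (n * m + n + 1) + 12) + 112 * m + 18"
        have sz3: "sizes lv s3" by (rule sizes_frame[OF sz2 f3]) auto
        have v3: "wv s3 2 = L" "wv s3 4 = N" "wa s3 5 = wa s 5" "wa s3 2 = wa s2 2" using f3 v2 by (auto simp: frame_def)
        have S3: "\<And>i. i < N \<Longrightarrow> wa s3 5 i < n" using S v3 by simp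
        show "wp PHASE2 (wp SELECT (wp FINAL R)) s3"
        proof (rule wp_PHASE2[OF rd3 sz3 M(2,3) v3(2,1) v(2) S3 so3 op3])
          fix s4 :: st assume rd4: "ready s4" and so4: "sound (tab s4)" and op4: "opt1 h (tab s4)" "opt2 (wa s3 5 ` {..<N}) h L (tab s4)"
            and f4: "frame PHASE2 s3 s4"
            and t4: "clk s4 \<le> clk s3 + L * (RB lv (2 * (N * N * N)) + 600 * (N * N * N + N * N + N + 1) + 12) + 9"
          have v4: "wa s4 2 = wa s2 2" using f4 v3 by (auto simp: frame_def)
          have nn: "n * n \<le> IM" using sz by (simp add: sizes_def)
          show "wp SELECT (wp FINAL R) s4"
          proof (rule wp_SELECT[OF rd4 nn so4])
            fix s5 :: st assume b5: "0 < wv s5 42 \<Longrightarrow> lam \<le> rv s5 2"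
              and g5: "\<exists>u<n. below (tab s4) (u * n + u) 0 \<Longrightarrow> 0 < wv s5 42 \<and> rv s5 2 = lam"
              and f5: "frame SELECT s4 s5" and t5: "clk s5 \<le> clk s4 + 112 * n + 20"
            have i5: "inp s5" by (rule inp_frame[OF _ f5]) (use rd4 in \<open>auto simp: ready_def\<close>)
            have a5: "\<forall>e<m. 0 < wa s5 2 e" using f5 v4 v2(6) by (auto simp: frame_def)
            show "wp FINAL R s5"
            proof (rule wp_FINAL[OF i5 a5 b5])
              fix s6 :: st and q assume q: "cyc q" "0 < wv s5 42 \<Longrightarrow> rv s5 2 = lam \<Longrightarrow> wt c q = lam * wt t q"
                and r6: "map (wa s6 32) [0..<wv s6 0] = q" and t6: "clk s6 \<le> clk s5 + 700 * (n * m + n + m + 1)"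
              have "clk s6 \<le> clk s + main_time lv L h N"
                using t6 t5 t4 t3 t2 t1 unfolding main_time_def by simp
              moreover have "wt c q = lam * wt t q"
                if "cyc r" "wt c r = lam * wt t r" "length r \<le> h \<or> hits (wa s 5 ` {..<N}) h r" for r
              proof -
                have "wa s 5 ` {..<N} \<subseteq> {..<n}" using S by auto
                from g5[OF opt_diagonal[OF that(1,2) op4(1) op4(2)[unfolded v3(3)] this L that(3)]]
                show ?thesis using q(2) by simp
              qed
              ultimately show "R s6" using post[OF q(1) r6] by blast
            qed
          qed
        qed
      qed
      then show "wp ?c R s2" using w9 lt_IM by (simp add: wp_If wp_Seq_fun)
    qed
  qed
  then show ?thesis unfolding MAIN_def using m0 inpD[OF i] lt_IM by (simp add: wp_If wp_Seq_fun)
qed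

end

section \<open>The whole program\<close>

text \<open>Input arc \<open>e\<close> occupies the cells 2e and 2e + 1. Copying separates the four
  arrays and frees the input region for the output.\<close>

definition COPY :: cmd where
  "COPY = For 32 1
     (WSt 0 (WV 32) (WL 32 (WB Mul (WC 2) (WV 32))) ;;
      WSt 1 (WV 32) (WL 32 (WB Add (WB Mul (WC 2) (WV 32)) (WC 1))) ;;
      RSt 0 (WV 32) (RL 32 (WB Mul (WC 2) (WV 32))) ;;
      RSt 1 (WV 32) (RL 32 (WB Add (WB Mul (WC 2) (WV 32)) (WC 1))))"

definition LOOPL :: cmd where
  "LOOPL = While (WLess (WV 46) (WV 0)) (WSet 46 (WB Add (WV 46) (WV 46)) ;; WSet 2 (WB Add (WV 2) (WC 1)))"

definition LOOPH :: cmd where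
  "LOOPH = While (WLess (WB Mul (WB Mul (WB Mul (WB Mul (WV 3) (WV 3)) (WV 3)) (WV 3)) (WV 1)) (WV 47))
     (WSet 3 (WB Add (WV 3) (WC 1)))"

text \<open>Variable 15 is the number of sorting levels and variable 24 the number of pruning
  passes. Variable 45 is \<open>n - 1\<close>, as the bound of \<open>WRandom\<close> is
  inclusive.\<close>

definition PARAMS :: cmd where
  "PARAMS = (WSet 2 (WC 1) ;; WSet 46 (WC 2) ;; LOOPL ;;
     WSet 47 (WB Mul (WB Mul (WV 0) (WV 0)) (WB Mul (WB Mul (WB Mul (WV 2) (WV 2)) (WV 2)) (WV 2))) ;; WSet 3 (WC 1) ;; LOOPH ;;
     WSet 4 (WB Mul (WB Add (WB Div (WV 0) (WV 3)) (WC 1)) (WB Add (WV 2) (WC 1))) ;;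
     WSet 15 (WB Mul (WC 10) (WV 2)) ;; WSet 24 (WB Mul (WC 30) (WV 2)) ;; WSet 45 (WB Sub (WV 0) (WC 1)))"

definition PRE :: cmd where
  "PRE = (COPY ;; If (WLess (WC 0) (WV 1)) PARAMS SKIP)"

lemma mod_PRE [simp]: "modW PRE = {2, 3, 4, 15, 24, 32, 45, 46, 47}" "modR PRE = {}" "modWA PRE = {0, 1}" "modRA PRE = {0, 1}"
  "modW COPY = {32}" "modR COPY = {}" "modWA COPY = {0, 1}" "modRA COPY = {0, 1}"
  by (auto simp: PRE_def COPY_def PARAMS_def LOOPL_def LOOPH_def)

section \<open>Choice of the parameters\<close>

definition par_L :: "nat \<Rightarrow> nat" where
  "par_L n = (LEAST l. 1 \<le> l \<and> n \<le> 2 ^ l)"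

text \<open>The value L n^(1/2) / m^(1/4), rounded up. Stated with fourth powers it can be found by
  linear search, without extracting roots; the search takes about \<open>h\<close> steps.\<close>

definition par_h :: "nat \<Rightarrow> nat \<Rightarrow> nat" where
  "par_h n m = (LEAST h. 1 \<le> h \<and> n * n * (par_L n * par_L n * par_L n * par_L n) \<le> h * h * h * h * m)"

text \<open>\<open>n div h + 1\<close> draws miss a set of \<open>h\<close> vertices with
  probability at most 1/2; \<open>L + 1\<close> such batches bring this down to 1/(2n), small enough
  for a union bound over the windows of a cycle.\<close>

definition par_N :: "nat \<Rightarrow> nat \<Rightarrow> nat" where
  "par_N n m = (n div par_h n m + 1) * (par_L n + 1)"

lemma par_L: "1 \<le> par_L n" "n \<le> 2 ^ par_L n" "k < par_L n \<Longrightarrow> 1 \<le> k \<Longrightarrow> 2 ^ k < n"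
proof -
  have "1 \<le> Suc n \<and> n \<le> 2 ^ Suc n" using less_exp[of "Suc n"] by simp
  from LeastI[of "\<lambda>l. 1 \<le> l \<and> n \<le> 2 ^ l", OF this] show "1 \<le> par_L n" "n \<le> 2 ^ par_L n" by (auto simp: par_L_def)
  show "2 ^ k < n" if "k < par_L n" "1 \<le> k"
    using not_less_Least[of k "\<lambda>l. 1 \<le> l \<and> n \<le> 2 ^ l"] that unfolding par_L_def by auto
qed

lemma par_L_pow: "0 < n \<Longrightarrow> 2 ^ par_L n \<le> 2 * n"
proof -
  assume n: "0 < n"
  show ?thesis
  proof (cases "par_L n = 1")
    case False
    then have "par_L n - 1 < par_L n" "1 \<le> par_L n - 1" using par_L(1)[of n] by auto
    then have "2 ^ (par_L n - 1) < n" by (rule par_L(3))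
    moreover have "(2::nat) ^ par_L n = 2 * 2 ^ (par_L n - 1)" using par_L(1)[of n] by (cases "par_L n") auto
    ultimately show ?thesis by simp
  qed (use n in simp)
qed

text \<open>The value \<open>n * par_L n\<close> satisfies the defining inequality. This shows that
  the minimum is attained and bounds the numbers that occur in the search.\<close>

lemma par_h:
  assumes "0 < m" "0 < n"
  shows "1 \<le> par_h n m" "n * n * (par_L n * par_L n * par_L n * par_L n) \<le> par_h n m * par_h n m * par_h n m * par_h n m * m"
    "k < par_h n m \<Longrightarrow> 1 \<le> k \<Longrightarrow> k * k * k * k * m < n * n * (par_L n * par_L n * par_L n * par_L n)"
    "par_h n m \<le> n * par_L n"
proof -
  let ?P = "\<lambda>h. 1 \<le> h \<and> n * n * (par_L n * par_L n * par_L n * par_L n) \<le> h * h * h * h * m"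
  have "1 \<le> n * par_L n" using assms par_L(1)[of n] by simp
  moreover have "n * n * (par_L n * par_L n * par_L n * par_L n) * 1 \<le> (n * par_L n) * (n * par_L n) * (n * par_L n) * (n * par_L n) * m"
  proof (rule mult_le_mono)
    have "n * n * (par_L n * par_L n * par_L n * par_L n) * 1 \<le> n * n * (par_L n * par_L n * par_L n * par_L n) * (n * n)"
      using assms by (intro mult_le_mono2) simp
    then show "n * n * (par_L n * par_L n * par_L n * par_L n) \<le> (n * par_L n) * (n * par_L n) * (n * par_L n) * (n * par_L n)"
      by (simp add: ac_simps)
  qed (use assms in simp)
  ultimately have P: "?P (n * par_L n)" by simp
  from LeastI[of ?P, OF P] show "1 \<le> par_h n m" "n * n * (par_L n * par_L n * par_L n * par_L n) \<le> par_h n m * par_h n m * par_h n m * par_h n m * m"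
    by (auto simp: par_h_def)
  show "k * k * k * k * m < n * n * (par_L n * par_L n * par_L n * par_L n)" if "k < par_h n m" "1 \<le> k"
    using not_less_Least[of k ?P] that unfolding par_h_def by auto
  show "par_h n m \<le> n * par_L n" unfolding par_h_def by (rule Least_le) (rule P)
qed

context mach
begin

lemma wp_COPY:
  assumes off: "off = 2 * m" and v: "wv s 0 = n" "wv s 1 = m"
    and input: "\<And>e. e < m \<Longrightarrow> wa s 32 (2 * e) = src e \<and> wa s 32 (Suc (2 * e)) = dst e \<and> ra s 32 (2 * e) = c e \<and> ra s 32 (Suc (2 * e)) = t e"
    and post: "\<And>s'. inp s' \<Longrightarrow> frame COPY s s' \<Longrightarrow> clk s' \<le> clk s + 112 * m + 9 \<Longrightarrow> R s'"
  shows "wp COPY R s"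
proof -
  have "2 * m < W" using fits mIM off by linarith
  then have b: "2 * e < W" "Suc (2 * e) < W" "2 < W" "Suc 0 < W" if "e < m" for e using that by auto
  show ?thesis unfolding COPY_def
  proof (rule wp_For[where N = m and \<tau> = 100 and I = "\<lambda>k s'. \<forall>e<k. wa s' 0 e = src e \<and> wa s' 1 e = dst e \<and> ra s' 0 e = c e \<and> ra s' 1 e = t e"])
    let ?B = "WSt 0 (WV 32) (WL 32 (WB Mul (WC 2) (WV 32))) ;;
      WSt 1 (WV 32) (WL 32 (WB Add (WB Mul (WC 2) (WV 32)) (WC 1))) ;;
      RSt 0 (WV 32) (RL 32 (WB Mul (WC 2) (WV 32))) ;;
      RSt 1 (WV 32) (RL 32 (WB Add (WB Mul (WC 2) (WV 32)) (WC 1)))"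
    fix k and s' :: st assume k: "k < m" "wv s' 32 = k" and f: "frame (For 32 1 ?B) s s'"
      and I: "\<forall>e<k. wa s' 0 e = src e \<and> wa s' 1 e = dst e \<and> ra s' 0 e = c e \<and> ra s' 1 e = t e"
    have k_off: "2 * k < off" "Suc (2 * k) < off" using k off by auto
    have "wa s' 32 = wa s 32" "ra s' 32 = ra s 32" using f by (auto simp: frame_def)
    then show "wp ?B (\<lambda>s''. (\<forall>e<Suc k. wa s'' 0 e = src e \<and> wa s'' 1 e = dst e \<and> ra s'' 0 e = c e \<and> ra s'' 1 e = t e) \<and> clk s'' \<le> clk s' + 100) s'"
      using k I input[OF k(1)] b[OF k(1)] lt_IM k_off by (simp add: wp_simps less_Suc_eq)
  next
    fix s' :: st assume I: "\<forall>e<m. wa s' 0 e = src e \<and> wa s' 1 e = dst e \<and> ra s' 0 e = c e \<and> ra s' 1 e = t e"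
      and f: "frame (For 32 1 (WSt 0 (WV 32) (WL 32 (WB Mul (WC 2) (WV 32))) ;;
      WSt 1 (WV 32) (WL 32 (WB Add (WB Mul (WC 2) (WV 32)) (WC 1))) ;;
      RSt 0 (WV 32) (RL 32 (WB Mul (WC 2) (WV 32))) ;;
      RSt 1 (WV 32) (RL 32 (WB Add (WB Mul (WC 2) (WV 32)) (WC 1))))) s s'"
      and t: "clk s' \<le> clk s + m * (100 + 12) + 9"
    have "inp s'" using I f v by (auto simp: inp_def frame_def)
    then show "R s'" using post f t by (simp add: COPY_def mult.commute)
  qed (use v lt_IM in auto)
qed

definition LB :: nat where "LB = par_L n * par_L n * par_L n * par_L n"

lemma wp_PARAMS:
  assumes i: "inp s" and mn: "0 < m" "0 < n" and big: "n * n * LB < W" "n * par_L n < W" "\<And>h. h \<le> n * par_L n \<Longrightarrow> h * h * h * h * m < W"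
      "2 ^ par_L n < W" "par_N n m < W" "30 * par_L n < W"
    and post: "\<And>s'. wv s' 2 = par_L n \<Longrightarrow> wv s' 3 = par_h n m \<Longrightarrow> wv s' 4 = par_N n m \<Longrightarrow> wv s' 15 = 10 * par_L n \<Longrightarrow>
      wv s' 24 = 30 * par_L n \<Longrightarrow> wv s' 45 = n - 1 \<Longrightarrow> clk s' \<le> clk s + 30 * par_L n + 40 * par_h n m + 150 \<Longrightarrow> R s'"
  shows "wp PARAMS R s"
proof -
  let ?L = "par_L n" and ?h = "par_h n m"
  note ph = par_h[OF mn]
  have c: "2 < W" "1 < W" "10 < W" "30 < W" "0 < W" "n < W" using fits lt_IM(6) by linarith+
  define s1 where "s1 = s\<lparr>wv := ((wv s)(2 := 1, 46 := 2)), clk := clk s + costW (WC 1) + 2 + costW (WC 2) + 2\<rparr>"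
  let ?r3 = "WSet 4 (WB Mul (WB Add (WB Div (WV 0) (WV 3)) (WC 1)) (WB Add (WV 2) (WC 1))) ;;
     WSet 15 (WB Mul (WC 10) (WV 2)) ;; WSet 24 (WB Mul (WC 30) (WV 2)) ;; WSet 45 (WB Sub (WV 0) (WC 1))"
  let ?r2 = "WSet 47 (WB Mul (WB Mul (WV 0) (WV 0)) (WB Mul (WB Mul (WB Mul (WV 2) (WV 2)) (WV 2)) (WV 2))) ;; WSet 3 (WC 1) ;; LOOPH ;; ?r3"
  have "wp LOOPL (wp ?r2 R) s1"
    unfolding LOOPL_def
  proof (rule wp_WhileP[where N = "?L - 1" and I = "\<lambda>k s'. wv s' 2 = Suc k \<and> wv s' 46 = 2 ^ Suc k" and ph = "\<lambda>_ _. 0" and \<tau> = 14])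
    show "wv s1 2 = Suc 0 \<and> wv s1 46 = 2 ^ Suc 0" by (simp add: s1_def)
  next
    let ?B = "WSet 46 (WB Add (WV 46) (WV 46)) ;; WSet 2 (WB Add (WV 2) (WC 1))"
    fix k and s' :: st assume k: "k \<le> ?L - 1" and I: "wv s' 2 = Suc k \<and> wv s' 46 = 2 ^ Suc k" and f: "frame ?B s1 s'"
    have n0: "wv s' 0 = n" using f inpD(1)[OF i] by (auto simp: frame_def s1_def)
    have "2 ^ Suc k < n \<longleftrightarrow> k < ?L - 1"
    proof
      assume "k < ?L - 1"
      then show "2 ^ Suc k < n" by (intro par_L(3)) auto
    next
      assume a: "2 ^ Suc k < n"
      show "k < ?L - 1"
      proof (rule ccontr)
        assume "\<not> ?thesis"
        then have "?L \<le> Suc k" by simp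
        then have "(2::nat) ^ ?L \<le> 2 ^ Suc k" by (intro power_increasing) auto
        then show False using a par_L(2)[of n] by simp
      qed
    qed
    then show "okB s' (WLess (WV 46) (WV 0)) \<and> (evB s' (WLess (WV 46) (WV 0)) \<longleftrightarrow> k < ?L - 1)" using I n0 by simp
  next
    let ?B = "WSet 46 (WB Add (WV 46) (WV 46)) ;; WSet 2 (WB Add (WV 2) (WC 1))"
    fix k and s' :: st assume k: "k < ?L - 1" and I: "wv s' 2 = Suc k \<and> wv s' 46 = 2 ^ Suc k"
    have "(2::nat) ^ Suc (Suc k) \<le> 2 ^ ?L" using k by (intro power_increasing) auto
    then have "2 ^ Suc k + 2 ^ Suc k < W" using big(4) by simp
    moreover have "Suc (Suc k) < W" using k big(6) by linarith
    ultimately show "wp ?B (\<lambda>s''. (wv s'' 2 = Suc (Suc k) \<and> wv s'' 46 = 2 ^ Suc (Suc k)) \<and> clk s'' + 0 \<le> clk s' + 0 + 14) s'"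
      using I c by (simp add: wp_simps)
  next
    fix s2 :: st assume I2: "wv s2 2 = Suc (?L - 1) \<and> wv s2 46 = 2 ^ Suc (?L - 1)"
      and f2: "frame (WSet 46 (WB Add (WV 46) (WV 46)) ;; WSet 2 (WB Add (WV 2) (WC 1))) s1 s2"
      and t2: "clk s2 + 0 \<le> clk s1 + 0 + (?L - 1) * (14 + costB (WLess (WV 46) (WV 0)) + 1) + costB (WLess (WV 46) (WV 0)) + 1"
    have v2: "wv s2 2 = ?L" "wv s2 0 = n" "wv s2 1 = m" using I2 par_L(1)[of n] f2 inpD(1,2)[OF i] by (auto simp: frame_def s1_def)
    define s3 where "s3 = s2\<lparr>wv := (wv s2)(47 := n * n * LB, 3 := 1), clk := 22 + clk s2\<rparr>"
    have "wp LOOPH (wp ?r3 R) s3"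
      unfolding LOOPH_def
    proof (rule wp_WhileP[where N = "?h - 1" and I = "\<lambda>k s'. wv s' 3 = Suc k" and ph = "\<lambda>_ _. 0" and \<tau> = 6])
      show "wv s3 3 = Suc 0" by (simp add: s3_def)
    next
      fix k and s' :: st assume k: "k \<le> ?h - 1" and I: "wv s' 3 = Suc k" and f: "frame (WSet 3 (WB Add (WV 3) (WC 1))) s3 s'"
      have v': "wv s' 47 = n * n * LB" "wv s' 1 = m" using f v2 by (auto simp: frame_def s3_def)
      have kh: "Suc k \<le> n * ?L" using k ph(1,4) by linarith
      let ?k = "Suc k"
      \<comment> \<open>Every partial product is bounded by the full product, so no intermediate
        result of the guard overflows.\<close>
      have "?k * ?k * ?k * ?k * 1 \<le> ?k * ?k * ?k * ?k * m" using mn by (intro mult_le_mono2) simp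
      moreover have "?k * ?k * ?k * 1 \<le> ?k * ?k * ?k * ?k" by (intro mult_le_mono2) simp
      moreover have "?k * ?k * 1 \<le> ?k * ?k * ?k" by (intro mult_le_mono2) simp
      ultimately have ok: "?k * ?k < W" "?k * ?k * ?k < W" "?k * ?k * ?k * ?k < W" "?k * ?k * ?k * ?k * m < W"
        using big(3)[OF kh] by linarith+
      have "?k * ?k * ?k * ?k * m < n * n * LB \<longleftrightarrow> k < ?h - 1"
      proof
        assume "k < ?h - 1"
        then show "?k * ?k * ?k * ?k * m < n * n * LB" unfolding LB_def by (intro ph(3)) auto
      next
        assume a: "?k * ?k * ?k * ?k * m < n * n * LB"
        show "k < ?h - 1"
        proof (rule ccontr)
          assume "\<not> ?thesis"
          then have "?k = ?h" using k ph(1) by simp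
          then show False using a ph(2) unfolding LB_def by simp
        qed
      qed
      then show "okB s' (WLess (WB Mul (WB Mul (WB Mul (WB Mul (WV 3) (WV 3)) (WV 3)) (WV 3)) (WV 1)) (WV 47)) \<and>
          (evB s' (WLess (WB Mul (WB Mul (WB Mul (WB Mul (WV 3) (WV 3)) (WV 3)) (WV 3)) (WV 1)) (WV 47)) \<longleftrightarrow> k < ?h - 1)"
        using I v' ok by (simp only: okB.simps okW.simps evB.simps evW.simps nat_aop.simps) simp
    next
      fix k and s' :: st assume k: "k < ?h - 1" and I: "wv s' 3 = Suc k"
      have "Suc (Suc k) < W" using k ph(4) big(2) by linarith
      then show "wp (WSet 3 (WB Add (WV 3) (WC 1))) (\<lambda>s''. wv s'' 3 = Suc (Suc k) \<and> clk s'' + 0 \<le> clk s' + 0 + 6) s'"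
        using I c by (simp add: wp_simps)
    next
      fix s4 :: st assume I4: "wv s4 3 = Suc (?h - 1)" and f4: "frame (WSet 3 (WB Add (WV 3) (WC 1))) s3 s4"
        and t4: "clk s4 + 0 \<le> clk s3 + 0 + (?h - 1) * (6 + costB (WLess (WB Mul (WB Mul (WB Mul (WB Mul (WV 3) (WV 3)) (WV 3)) (WV 3)) (WV 1)) (WV 47)) + 1)
           + costB (WLess (WB Mul (WB Mul (WB Mul (WB Mul (WV 3) (WV 3)) (WV 3)) (WV 3)) (WV 1)) (WV 47)) + 1"
      have v4: "wv s4 3 = ?h" "wv s4 0 = n" "wv s4 2 = ?L" using I4 ph(1) f4 v2 by (auto simp: frame_def s3_def)
      have pN: "(n div ?h + 1) * (?L + 1) < W" using big(5) by (simp add: par_N_def)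
      have "(n div ?h + 1) * 1 \<le> (n div ?h + 1) * (?L + 1)" "1 * (?L + 1) \<le> (n div ?h + 1) * (?L + 1)"
        by (intro mult_le_mono; simp)+
      from this[THEN le_less_trans, OF pN] have pN': "n div ?h + 1 < W" "?L + 1 < W" by simp_all
      have tm: "clk s4 + 60 \<le> clk s + 30 * ?L + 40 * ?h + 150"
        using t4 t2 ph(1) par_L(1)[of n] by (simp add: s3_def s1_def)
      have fin: "R s5" if "wv s5 2 = ?L" "wv s5 3 = ?h" "wv s5 4 = (n div ?h + 1) * (?L + 1)" "wv s5 15 = 10 * ?L"
        "wv s5 24 = 30 * ?L" "wv s5 45 = n - 1" "clk s5 \<le> clk s4 + 60" for s5
        by (rule post) (use that tm in \<open>simp_all add: par_N_def\<close>)
      have "wp ?r3 (\<lambda>s5. wv s5 2 = ?L \<and> wv s5 3 = ?h \<and> wv s5 4 = (n div ?h + 1) * (?L + 1) \<and> wv s5 15 = 10 * ?L \<and>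
        wv s5 24 = 30 * ?L \<and> wv s5 45 = n - 1 \<and> clk s5 \<le> clk s4 + 60) s4"
        using v4 pN pN' big(6) c by (simp add: wp_simps)
      then show "wp ?r3 R s4" by (rule wp_conseq) (use fin in blast)
    qed simp_all
    moreover have "wp (WSet 47 (WB Mul (WB Mul (WV 0) (WV 0)) (WB Mul (WB Mul (WB Mul (WV 2) (WV 2)) (WV 2)) (WV 2))) ;; WSet 3 (WC 1))
      (\<lambda>s'. s' = s3) s2"
    proof -
      have "1 \<le> LB" using par_L(1)[of n] by (simp add: LB_def)
      then have "n * n * 1 \<le> n * n * LB" by (intro mult_le_mono2)
      moreover have "1 * LB \<le> n * n * LB" using mn by (intro mult_le_mono1) simp
      moreover have "?L * ?L * ?L * 1 \<le> LB" unfolding LB_def by (intro mult_le_mono2 par_L(1))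
      moreover have "?L * ?L * 1 \<le> ?L * ?L * ?L" by (intro mult_le_mono2 par_L(1))
      ultimately have "n * n < W" "?L * ?L < W" "?L * ?L * ?L < W" "LB < W" "n * n * LB < W" using big(1) by linarith+
      then show ?thesis using v2 c by (simp add: wp_simps LB_def s3_def)
    qed
    ultimately have "wp (WSet 47 (WB Mul (WB Mul (WV 0) (WV 0)) (WB Mul (WB Mul (WB Mul (WV 2) (WV 2)) (WV 2)) (WV 2))) ;; WSet 3 (WC 1))
      (wp LOOPH (wp ?r3 R)) s2" by (elim wp_conseq) simp
    then show "wp ?r2 R s2" unfolding wp_Seq_fun .
  qed simp_all
  then have "wp (WSet 2 (WC 1)) (wp (WSet 46 (WC 2)) (wp LOOPL (wp ?r2 R))) s" using c by (simp add: wp_WSet s1_def)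
  then show ?thesis unfolding PARAMS_def wp_Seq_fun .
qed

end

subsection \<open>Sampling\<close>

definition STORE :: cmd where
  "STORE = (WSt 5 (WV 43) (WV 44) ;; WSet 43 (WB Add (WV 43) (WC 1)))"

abbreviation more :: bexp where "more \<equiv> WLess (WV 43) (WV 4)"

text \<open>Written by hand because the structured language is deterministic. Relative to
  \<open>l\<close>, the guard is at 0 to 4, the exit jump at 5, the random draw at 6,
  \<open>STORE\<close> at 7 to 22 and the jump back at 23.\<close>

definition draw :: "nat \<Rightarrow> instr list" where
  "draw l = compB (l + 6) more @ [Jump (l + 24)] @ [WRandom (ur 44) (ur 45)] @ comp (l + 7) STORE @ [Jump l]"

lemma length_draw: "length (draw l) = 24"
  by (simp add: draw_def length_compB length_comp) (simp add: STORE_def)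

lemma draw_nth: "draw l ! 5 = Jump (l + 24)" "draw l ! 6 = WRandom (ur 44) (ur 45)" "draw l ! 23 = Jump l"
proof -
  have "length (comp (l + 7) STORE) = 16" by (simp add: length_comp) (simp add: STORE_def)
  moreover have "length (compB (l + 6) more) = 5" by (simp only: length_compB) simp
  ultimately show "draw l ! 5 = Jump (l + 24)" "draw l ! 6 = WRandom (ur 44) (ur 45)" "draw l ! 23 = Jump l"
    unfolding draw_def by (simp_all add: nth_append nth_Cons' del: compB.simps)
qed

lemma draw_code:
  assumes code: "codeat P l (draw l)"
  shows "codeat P l (compB (l + 6) more)" "codeat P (l + 7) (comp (l + 7) STORE)"
    "l + 5 < length P \<and> P ! (l + 5) = Jump (l + 24)" "l + 6 < length P \<and> P ! (l + 6) = WRandom (ur 44) (ur 45)"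
    "l + 23 < length P \<and> P ! (l + 23) = Jump l"
proof -
  show "codeat P l (compB (l + 6) more)" using code unfolding draw_def codeat_append by blast
  have "codeat P l ((compB (l + 6) more @ [Jump (l + 24)] @ [WRandom (ur 44) (ur 45)]) @ comp (l + 7) STORE @ [Jump l])"
    using code unfolding draw_def append_assoc .
  moreover have "length (compB (l + 6) more @ [Jump (l + 24)] @ [WRandom (ur 44) (ur 45)]) = 7"
    by (simp only: length_append length_compB) simp
  ultimately show "codeat P (l + 7) (comp (l + 7) STORE)" unfolding codeat_append[of P l] by (simp only: codeat_append)
  show "l + 5 < length P \<and> P ! (l + 5) = Jump (l + 24)" "l + 6 < length P \<and> P ! (l + 6) = WRandom (ur 44) (ur 45)"
    "l + 23 < length P \<and> P ! (l + 23) = Jump l"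
    using codeat_nth[OF code, of 5] codeat_nth[OF code, of 6] codeat_nth[OF code, of 23] unfolding length_draw draw_nth by simp_all
qed

definition drawn :: "st \<Rightarrow> nat \<Rightarrow> nat list \<Rightarrow> st \<Rightarrow> bool" where
  "drawn s i xs s' \<longleftrightarrow> (\<forall>j<length xs. wa s' 5 (i + j) = xs ! j) \<and> (\<forall>j<i. wa s' 5 j = wa s 5 j) \<and>
     (\<forall>a. a \<noteq> 5 \<longrightarrow> wa s' a = wa s a) \<and> ra s' = ra s \<and> (\<forall>v. v \<noteq> 43 \<longrightarrow> v \<noteq> 44 \<longrightarrow> wv s' v = wv s v)"

lemma drawn_Cons:
  assumes "drawn (s\<lparr>wv := f, wa := (wa s)(5 := (wa s 5)(i := x)), clk := z\<rparr>) (Suc i) xs s'"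
    "\<And>v. v \<noteq> 43 \<Longrightarrow> v \<noteq> 44 \<Longrightarrow> f v = wv s v"
  shows "drawn s i (x # xs) s'"
proof -
  have "wa s' 5 (i + j) = (x # xs) ! j" if "j < length (x # xs)" for j
    using assms(1) that by (cases j) (auto simp: drawn_def)
  then show ?thesis using assms unfolding drawn_def by simp
qed

context ram
begin

text \<open>An iteration takes 5 + 1 + 16 + 1 = 23 steps and the exit takes 6, whatever is drawn.
  Hence the distribution at that time is the image of a list of independent uniform draws under a
  function \<open>F\<close>.\<close>

lemma draw_run:
  assumes code: "codeat P l (draw l)" and n: "0 < n" and N: "N < IM"
  shows "\<lbrakk>rel s \<sigma>; pc \<sigma> = l; wv s 4 = N; wv s 43 = i; i \<le> N; wv s 45 = n - 1\<rbrakk> \<Longrightarrow>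
    \<exists>F. run W P ((N - i) * 23 + 6) \<sigma> = map_pmf F (replicate_pmf (N - i) (pmf_of_set {..n - 1})) \<and>
      (\<forall>xs. length xs = N - i \<longrightarrow> set xs \<subseteq> {..<n} \<longrightarrow> pc (F xs) = l + 24 \<and> (\<exists>s'. rel s' (F xs) \<and> drawn s i xs s'))"
proof (induction "N - i" arbitrary: i s \<sigma>)
  case 0
  then have iN: "i = N" by simp
  have cb: "codeat P (pc \<sigma>) (compB (l + 6) more)" and cj: "l + 5 < length P \<and> P ! (l + 5) = Jump (l + 24)"
    using draw_code(1,3)[OF code] 0 by (simp_all del: compB.simps)
  from reach_compB[OF cb _ 0(2)] obtain \<sigma>1 where 1: "reach W P 5 \<sigma> \<sigma>1" "pc \<sigma>1 = l + 5" "rel s \<sigma>1"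
    using 0 iN by auto
  have "reach W P 1 \<sigma>1 (\<sigma>1\<lparr>pc := l + 24\<rparr>)" by (rule reach_instr[where x = "Jump (l + 24)"]) (use cj 1 in auto)
  from reach_trans[OF 1(1) this] have "run W P 6 \<sigma> = return_pmf (\<sigma>1\<lparr>pc := l + 24\<rparr>)" by (simp add: reach_def)
  moreover have "drawn s i [] s" by (simp add: drawn_def)
  ultimately show ?case using rel_pc[OF 1(3)] iN
    by (intro exI[of _ "\<lambda>_. \<sigma>1\<lparr>pc := l + 24\<rparr>"]) auto
next
  case (Suc d)
  then have iN: "i < N" and d: "d = N - Suc i" by auto
  have cb: "codeat P (pc \<sigma>) (compB (l + 6) more)" using draw_code(1)[OF code] Suc.prems by (simp del: compB.simps)
  note cs = draw_code(2)[OF code] and cr = draw_code(4)[OF code] and cj = draw_code(5)[OF code]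
  from reach_compB[OF cb _ Suc.prems(1)] obtain \<sigma>1 where 1: "reach W P 5 \<sigma> \<sigma>1" "pc \<sigma>1 = l + 6" "rel s \<sigma>1"
    using Suc.prems iN by auto
  have r45: "wreg \<sigma>1 (ur 45) = n - 1" using rel_bounds(3)[OF 1(3), of 45] Suc.prems by simp
  have nW: "x < W" if "x \<le> n - 1" for x using rel_bounds(1)[OF 1(3), of "ur 45"] that r45 by linarith
  let ?p = "pmf_of_set {..n - 1}"
  define g where "g x = \<sigma>1\<lparr>wreg := (wreg \<sigma>1)(ur 44 := x), pc := l + 7\<rparr>" for x
  have "run W P 0 = return_pmf" by (rule ext) simp
  moreover have "step W P \<sigma>1 = map_pmf g ?p"
    using cr 1(2) r45 by (simp add: step_def halted_def g_def[abs_def] add.commute[of 7 l])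
  ultimately have rnd: "run W P 1 \<sigma>1 = map_pmf g ?p" by (simp add: bind_return_pmf')
  have step: "\<exists>\<sigma>' F. run W P 17 (g x) = return_pmf \<sigma>' \<and>
      run W P (d * 23 + 6) \<sigma>' = map_pmf F (replicate_pmf d ?p) \<and>
      (\<forall>xs. length xs = d \<longrightarrow> set xs \<subseteq> {..<n} \<longrightarrow> pc (F xs) = l + 24 \<and> (\<exists>s'. rel s' (F xs) \<and> drawn s i (x # xs) s'))"
    if x: "x \<le> n - 1" for x
  proof -
    define sx where "sx = s\<lparr>wv := (wv s)(44 := x), clk := 0\<rparr>"
    have rx: "rel sx (g x)" unfolding sx_def g_def using rel_WSet[OF 1(3) nW[OF x], where i = 44 and t = 0 and k = "l + 7"] .
    define sy where "sy = s\<lparr>wv := (wv s)(44 := x, 43 := Suc i), wa := (wa s)(5 := (wa s 5)(i := x)), clk := 16\<rparr>"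
    have b: "i < IM" "Suc i < W" "Suc 0 < W" using iN N fits by linarith+
    have "wp STORE (\<lambda>s'. s' = sy) sx"
      using b Suc.prems by (simp add: STORE_def wp_simps sx_def sy_def)
    then have "big STORE sx sy" by (simp add: wp_def)
    from comp_correct[OF this _ rx, of P] cs obtain k \<sigma>2 where 2: "clk sy = clk sx + k" "reach W P k (g x) \<sigma>2"
      "pc \<sigma>2 = pc (g x) + len STORE" "rel sy \<sigma>2" by (auto simp: g_def)
    \<comment> \<open>This is where the exactness of the clock is used.\<close>
    have k: "k = 16" using 2(1) by (simp add: sx_def sy_def)
    have p2: "pc \<sigma>2 = l + 23" using 2(3) by (simp add: g_def STORE_def)
    let ?\<sigma>' = "\<sigma>2\<lparr>pc := l\<rparr>"
    have "reach W P 1 \<sigma>2 ?\<sigma>'" by (rule reach_instr[where x = "Jump l"]) (use cj p2 in auto)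
    from reach_trans[OF 2(2) this] have r17: "run W P 17 (g x) = return_pmf ?\<sigma>'" by (simp add: reach_def k)
    have "rel sy ?\<sigma>'" using rel_pc[OF 2(4)] .
    from Suc.hyps(1)[OF d this] obtain F where F: "run W P (d * 23 + 6) ?\<sigma>' = map_pmf F (replicate_pmf d ?p)"
      "\<forall>xs. length xs = d \<longrightarrow> set xs \<subseteq> {..<n} \<longrightarrow> pc (F xs) = l + 24 \<and> (\<exists>s'. rel s' (F xs) \<and> drawn sy (Suc i) xs s')"
      using Suc.prems iN d by (auto simp: sy_def)
    have "drawn s i (x # xs) s'" if "drawn sy (Suc i) xs s'" for xs s'
      using that unfolding sy_def by (rule drawn_Cons) auto
    then show ?thesis using r17 F by blast
  qed
  then obtain S F where SF: "\<And>x. x \<le> n - 1 \<Longrightarrow> run W P 17 (g x) = return_pmf (S x) \<and>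
      run W P (d * 23 + 6) (S x) = map_pmf (F x) (replicate_pmf d ?p) \<and>
      (\<forall>xs. length xs = d \<longrightarrow> set xs \<subseteq> {..<n} \<longrightarrow> pc (F x xs) = l + 24 \<and> (\<exists>s'. rel s' (F x xs) \<and> drawn s i (x # xs) s'))"
    by metis
  have sp: "set_pmf ?p = {..n - 1}" by (rule set_pmf_of_set) auto
  have e: "N - i = Suc d" and e2: "Suc d * 23 + 6 = 5 + (1 + (17 + (d * 23 + 6)))" using Suc.hyps(2) by auto
  have "run W P (5 + (1 + (17 + (d * 23 + 6)))) \<sigma> = bind_pmf ?p (\<lambda>x. bind_pmf (run W P 17 (g x)) (run W P (d * 23 + 6)))"
    unfolding run_add[of W P 5] run_add[of W P 1] 1(1)[unfolded reach_def] bind_return_pmf rnd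
    by (simp only: bind_map_pmf run_add[of W P 17])
  also have "\<dots> = bind_pmf ?p (\<lambda>x. map_pmf (F x) (replicate_pmf d ?p))"
    by (rule bind_pmf_cong) (use SF sp in \<open>auto simp: bind_return_pmf\<close>)
  also have "\<dots> = map_pmf (\<lambda>xs. F (hd xs) (tl xs)) (replicate_pmf (Suc d) ?p)"
    by (simp add: map_bind_pmf map_pmf_def bind_assoc_pmf bind_return_pmf)
  finally have run: "run W P ((N - i) * 23 + 6) \<sigma> = map_pmf (\<lambda>xs. F (hd xs) (tl xs)) (replicate_pmf (N - i) ?p)"
    unfolding e e2 .
  show ?case
  proof (rule exI, rule conjI)
    show "run W P ((N - i) * 23 + 6) \<sigma> = map_pmf (\<lambda>xs. F (hd xs) (tl xs)) (replicate_pmf (N - i) ?p)" by (rule run)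
    show "\<forall>xs. length xs = N - i \<longrightarrow> set xs \<subseteq> {..<n} \<longrightarrow>
      pc (F (hd xs) (tl xs)) = l + 24 \<and> (\<exists>s'. rel s' (F (hd xs) (tl xs)) \<and> drawn s i xs s')"
    proof (intro allI impI)
      fix xs assume xs: "length xs = N - i" "set xs \<subseteq> {..<n}"
      then obtain y ys where y: "xs = y # ys" using iN by (cases xs) auto
      then have "y \<le> n - 1" "length ys = d" "set ys \<subseteq> {..<n}" using xs d by auto
      then show "pc (F (hd xs) (tl xs)) = l + 24 \<and> (\<exists>s'. rel s' (F (hd xs) (tl xs)) \<and> drawn s i xs s')"
        using SF[of y] y by auto
    qed
  qed
qed

text \<open>A halted machine idles, so runs of different lengths can be compared at a common later
  time.\<close>

lemma run_halted: "halted P \<sigma> \<Longrightarrow> run W P k \<sigma> = return_pmf \<sigma>"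
  by (induction k) (auto simp: step_def bind_return_pmf)

end

text \<open>The first instruction puts \<open>2 * m\<close> into register 2, the offset on which all
  array addresses are based.\<close>

definition PROG :: program where
  "PROG = [WOp Add 2 1 1] @ comp 1 PRE @ draw (1 + len PRE) @ comp (25 + len PRE) MAIN"

lemma length_PROG: "length PROG = 25 + len PRE + len MAIN"
  by (simp add: PROG_def length_comp length_draw)

lemma PROG_code: "codeat PROG 0 [WOp Add 2 1 1]" "codeat PROG 1 (comp 1 PRE)"
  "codeat PROG (1 + len PRE) (draw (1 + len PRE))" "codeat PROG (25 + len PRE) (comp (25 + len PRE) MAIN)"
proof -
  let ?a = "[WOp Add 2 1 1]" and ?b = "comp 1 PRE" and ?c = "draw (1 + len PRE)" and ?d = "comp (25 + len PRE) MAIN"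
  have l: "length ?a = 1" "length (?a @ ?b) = 1 + len PRE" "length (?a @ ?b @ ?c) = 25 + len PRE"
    by (simp_all add: length_comp length_draw)
  show "codeat PROG 0 ?a" using codeat_middle[of "[]" ?a] by (simp add: PROG_def)
  show "codeat PROG 1 ?b" using codeat_middle[of ?a ?b "?c @ ?d"] unfolding PROG_def l by simp
  show "codeat PROG (1 + len PRE) ?c" using codeat_middle[of "?a @ ?b" ?c ?d] unfolding PROG_def l by simp
  show "codeat PROG (25 + len PRE) ?d" using codeat_middle[of "?a @ ?b @ ?c" ?d "[]"] unfolding PROG_def l by simp
qed

context ram
begin

text \<open>Only \<open>MAIN\<close> has a running time that varies with the sample. Its runs are
  padded to \<open>T2\<close>, so that a single time \<open>T\<close> serves all random
  choices.\<close>

lemma run_PROG: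
  assumes first: "reach W PROG 1 \<sigma> \<sigma>0" "pc \<sigma>0 = 1" "rel s0 \<sigma>0" "clk s0 = 0"
    and pre: "wp PRE (\<lambda>s1. wv s1 4 = N \<and> wv s1 43 = 0 \<and> wv s1 45 = n - 1 \<and> clk s1 \<le> T1 \<and>
      (\<forall>xs s2. drawn s1 0 xs s2 \<longrightarrow> length xs = N \<longrightarrow> set xs \<subseteq> {..<n} \<longrightarrow> wp MAIN (\<lambda>s3. Q xs s3 \<and> clk s3 \<le> clk s2 + T2) s2)) s0"
    and n: "0 < n" "N < IM"
  shows "\<exists>T H. T \<le> T1 + 23 * N + T2 + 7 \<and> run W PROG T \<sigma> = map_pmf H (replicate_pmf N (pmf_of_set {..n - 1})) \<and>
    (\<forall>xs\<in>set_pmf (replicate_pmf N (pmf_of_set {..n - 1})). length xs = N \<and> halted PROG (H xs) \<and> (\<exists>s3. rel s3 (H xs) \<and> Q xs s3))"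
proof -
  let ?R = "replicate_pmf N (pmf_of_set {..n - 1})"
  obtain s1 where s1: "big PRE s0 s1" "wv s1 4 = N" "wv s1 43 = 0" "wv s1 45 = n - 1" "clk s1 \<le> T1"
    and mn: "\<And>xs s2. drawn s1 0 xs s2 \<Longrightarrow> length xs = N \<Longrightarrow> set xs \<subseteq> {..<n} \<Longrightarrow> wp MAIN (\<lambda>s3. Q xs s3 \<and> clk s3 \<le> clk s2 + T2) s2"
    using pre by (auto simp: wp_def)
  from comp_correct[OF s1(1) _ first(3), of PROG] PROG_code(2) first(2,4) obtain k1 \<sigma>1 where
    1: "clk s1 = k1" "reach W PROG k1 \<sigma>0 \<sigma>1" "pc \<sigma>1 = 1 + len PRE" "rel s1 \<sigma>1" by auto
  from draw_run[OF PROG_code(3) n 1(4,3) s1(2,3) _ s1(4)] obtain F where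
    F: "run W PROG (N * 23 + 6) \<sigma>1 = map_pmf F ?R"
      "\<forall>xs. length xs = N \<longrightarrow> set xs \<subseteq> {..<n} \<longrightarrow> pc (F xs) = 1 + len PRE + 24 \<and> (\<exists>s'. rel s' (F xs) \<and> drawn s1 0 xs s')"
    by auto
  have xs: "length xs = N \<and> set xs \<subseteq> {..<n}" if "xs \<in> set_pmf ?R" for xs
  proof -
    have "set_pmf (pmf_of_set {..n - 1}) = {..n - 1}" by (rule set_pmf_of_set) auto
    then show ?thesis using that n(1) unfolding set_replicate_pmf by (auto simp: lists_eq_set)
  qed
  have "\<exists>\<sigma>3. run W PROG T2 (F xs) = return_pmf \<sigma>3 \<and> halted PROG \<sigma>3 \<and> (\<exists>s3. rel s3 \<sigma>3 \<and> Q xs s3)" if hx: "xs \<in> set_pmf ?R" for xs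
  proof -
    obtain s2 where s2: "rel s2 (F xs)" "drawn s1 0 xs s2" "pc (F xs) = 25 + len PRE" using F(2) xs[OF hx] by auto
    from mn[OF s2(2)] xs[OF hx] obtain s3 where s3: "big MAIN s2 s3" "Q xs s3" "clk s3 \<le> clk s2 + T2" by (auto simp: wp_def)
    from comp_correct[OF s3(1) _ s2(1), of PROG] PROG_code(4) s2(3) obtain k \<sigma>3 where
      3: "clk s3 = clk s2 + k" "reach W PROG k (F xs) \<sigma>3" "pc \<sigma>3 = 25 + len PRE + len MAIN" "rel s3 \<sigma>3" by auto
    have h: "halted PROG \<sigma>3" using 3(3) by (simp add: halted_def length_PROG)
    have "run W PROG (k + (T2 - k)) (F xs) = return_pmf \<sigma>3"
      using 3(2) run_halted[OF h] unfolding run_add reach_def by (simp add: bind_return_pmf)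
    moreover have "k + (T2 - k) = T2" using 3(1) s3(3) by simp
    ultimately show ?thesis using h 3(4) s3(2) by auto
  qed
  then obtain H where H: "\<And>xs. xs \<in> set_pmf ?R \<Longrightarrow>
      run W PROG T2 (F xs) = return_pmf (H xs) \<and> halted PROG (H xs) \<and> (\<exists>s3. rel s3 (H xs) \<and> Q xs s3)" by metis
  have "run W PROG (1 + (k1 + ((N * 23 + 6) + T2))) \<sigma> = bind_pmf ?R (\<lambda>xs. run W PROG T2 (F xs))"
    unfolding run_add[of W PROG 1] run_add[of W PROG k1] run_add[of W PROG "N * 23 + 6"]
      first(1)[unfolded reach_def] 1(2)[unfolded reach_def] bind_return_pmf F(1) bind_map_pmf ..
  also have "\<dots> = bind_pmf ?R (\<lambda>xs. return_pmf (H xs))"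
    by (rule bind_pmf_cong) (use H in auto)
  also have "\<dots> = map_pmf H ?R" by (simp add: map_pmf_def)
  finally have "run W PROG (1 + (k1 + ((N * 23 + 6) + T2))) \<sigma> = map_pmf H ?R" .
  moreover have "1 + (k1 + ((N * 23 + 6) + T2)) \<le> T1 + 23 * N + T2 + 7" using s1(5) 1(1) by simp
  ultimately show ?thesis using H xs by blast
qed

end

section \<open>The probability of success\<close>

lemma prob_miss:
  assumes A: "A \<subseteq> {..<n}" and n: "0 < n"
  shows "measure_pmf.prob (replicate_pmf N (pmf_of_set {..n - 1})) {xs. set xs \<inter> A = {}} = (1 - real (card A) / real n) ^ N"
proof (induction N)
  case (Suc N)
  let ?p = "pmf_of_set {..n - 1}"
  have e: "replicate_pmf (Suc N) ?p = map_pmf (\<lambda>(x, xs). x # xs) (pair_pmf ?p (replicate_pmf N ?p))"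
    by (simp add: pair_pmf_def map_bind_pmf)
  have "(\<lambda>(x, xs). x # xs) -` {xs. set xs \<inter> A = {}} = (- A) \<times> {xs. set xs \<inter> A = {}}" by auto
  then have "measure_pmf.prob (replicate_pmf (Suc N) ?p) {xs. set xs \<inter> A = {}} =
      measure_pmf.prob ?p (- A) * measure_pmf.prob (replicate_pmf N ?p) {xs. set xs \<inter> A = {}}"
    unfolding e measure_map_pmf by (simp add: measure_pmf_prob_product)
  moreover have "measure_pmf.prob ?p (- A) = 1 - real (card A) / real n"
  proof -
    have "{..n - 1} \<inter> - A = {..<n} - A" "card {..n - 1} = n" using n by auto
    moreover have "card ({..<n} - A) = n - card A" "card A \<le> n"
      using A card_mono[of "{..<n}" A] finite_subset[OF A] by (auto simp: card_Diff_subset)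
    ultimately show ?thesis using n by (simp add: measure_pmf_of_set diff_divide_distrib of_nat_diff)
  qed
  ultimately show ?case using Suc.IH by simp
qed simp

text \<open>As \<open>n div h + 1\<close> exceeds n/h, one batch of draws misses with probability at
  most exp(-1), which is below 1/2. Then \<open>L + 1\<close> batches miss with probability at most
  \<open>1 / (2 * 2 ^ L)\<close>.\<close>

lemma miss_bound:
  assumes h: "0 < h" "h \<le> n" and L: "n \<le> 2 ^ L"
  shows "(1 - real h / real n) ^ ((n div h + 1) * (L + 1)) \<le> 1 / (2 * real n)"
proof -
  let ?x = "real h / real n" and ?a = "n div h + 1"
  have n: "0 < n" using h by simp
  have x: "0 \<le> 1 - ?x" using h n by (simp add: field_simps)
  have "n < h * ?a" using h(1) by (simp add: dividend_less_times_div)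
  then have "real n < real (h * ?a)" by (rule of_nat_less_iff[THEN iffD2])
  then have "real n < real h * real ?a" by (simp only: of_nat_mult)
  then have "1 \<le> real ?a * ?x" using n by (simp add: field_simps)
  have "(1 - ?x) ^ ?a \<le> exp (- ?x) ^ ?a" using x exp_ge_add_one_self[of "- ?x"] by (intro power_mono) auto
  also have "\<dots> = exp (- (real ?a * ?x))" by (simp only: exp_of_nat_mult[symmetric] mult_minus_right)
  also have "\<dots> \<le> exp (- 1)" using \<open>1 \<le> real ?a * ?x\<close> by simp
  also have "\<dots> \<le> 1 / 2"
    using exp_ge_add_one_self[of 1] by (simp add: exp_minus inverse_eq_divide le_divide_eq divide_le_eq)
  finally have "((1 - ?x) ^ ?a) ^ (L + 1) \<le> (1 / 2) ^ (L + 1)" using x by (intro power_mono) auto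
  also have "\<dots> = 1 / (2 * 2 ^ L)" by (simp add: power_divide)
  also have "\<dots> \<le> 1 / (2 * real n)"
  proof (intro divide_left_mono)
    have "real n \<le> real (2 ^ L)" using L by (rule of_nat_mono)
    then show "2 * real n \<le> 2 * 2 ^ L" by simp
  qed (use n in auto)
  finally show ?thesis by (simp only: power_mult)
qed

text \<open>Union bound over the at most \<open>n\<close> cyclic windows. The heads of a cycle are
  distinct, so a window contributes \<open>h\<close> different vertices and is missed with
  probability at most 1/(2n).\<close>

lemma (in arc_graph) prob_hits:
  assumes q: "cyc q" and h: "0 < h" "h < length q" and L: "n \<le> 2 ^ L"
  shows "1 / 2 \<le> measure_pmf.prob (replicate_pmf ((n div h + 1) * (L + 1)) (pmf_of_set {..n - 1})) {xs. \<forall>r<length q. \<exists>e\<in>set (take h (rotate r q)). dst e \<in> set xs}"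
    (is "_ \<le> measure_pmf.prob ?R ?G")
proof -
  obtain u where u: "walk u q u" "q \<noteq> []" "distinct (map dst q)" using q by (auto simp: cyc_def closed_def)
  have ln: "length q \<le> n" using distinct_length u by blast
  have n: "0 < n" using h ln by simp
  let ?A = "\<lambda>r. dst ` set (take h (rotate r q))"
  let ?M = "\<lambda>r. {xs. set xs \<inter> ?A r = {}}"
  have miss: "measure_pmf.prob ?R (?M r) \<le> 1 / (2 * real n)" for r
  proof -
    have s: "set (take h (rotate r q)) \<subseteq> set q" using set_take_subset[of h "rotate r q"] by simp
    then have A: "?A r \<subseteq> {..<n}" using walk_set[OF u(1)] dst by auto
    have d: "distinct (take h (rotate r q))" using u(3) by (simp add: distinct_map)
    have "inj_on dst (set (take h (rotate r q)))" using u(3) s by (auto simp: distinct_map intro: inj_on_subset)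
    then have "card (?A r) = card (set (take h (rotate r q)))" by (rule card_image)
    also have "\<dots> = h" using distinct_card[OF d] h by simp
    finally have "card (?A r) = h" .
    then show ?thesis unfolding prob_miss[OF A n] using h ln L by (simp only:) (intro miss_bound; simp)
  qed
  have "- ?G \<subseteq> (\<Union>r\<in>{..<length q}. ?M r)" by auto
  then have "measure_pmf.prob ?R (- ?G) \<le> measure_pmf.prob ?R (\<Union>r\<in>{..<length q}. ?M r)"
    by (intro measure_pmf.finite_measure_mono) auto
  also have "\<dots> \<le> (\<Sum>r<length q. measure_pmf.prob ?R (?M r))"
    by (intro measure_pmf.finite_measure_subadditive_finite) auto
  also have "\<dots> \<le> (\<Sum>r<length q. 1 / (2 * real n))" by (intro sum_mono miss)
  also have "\<dots> \<le> 1 / 2" using ln n by (simp add: field_simps)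
  finally have "measure_pmf.prob ?R (- ?G) \<le> 1 / 2" .
  moreover have "measure_pmf.prob ?R (- ?G) = 1 - measure_pmf.prob ?R ?G"
    using measure_pmf.prob_compl[of ?G ?R] by (simp add: Compl_eq_Diff_UNIV)
  ultimately show ?thesis by simp
qed

section \<open>The running time\<close>

context mrat
begin

text \<open>The 30 L passes cost at most 2200 Z each, which gives 66000; the amortised sorting gives
  5500; the remaining 500 absorb the constant 9.\<close>

lemma RB_bound:
  assumes L: "1 \<le> L" "real L \<le> Z" and Z: "real (n * m) \<le> Z" "real n \<le> Z" "real m \<le> Z" "1 \<le> Z" "real M \<le> Z"
  shows "real (RB (10 * L) M) \<le> 72000 * (real L * Z)"
proof -
  have L1: "1 \<le> real L" using L by simp
  have e: "real (RB (10 * L) M) = 30 * real L * ((10 * real L + 1) * 60 + 200 * (real (n * m) + real n + real m + 1) + 500 * real M + 220)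
      + 500 * (10 * real L + 1) * real M + 9"
    unfolding RB_def by simp
  have A: "30 * real L * ((10 * real L + 1) * 60 + 200 * (real (n * m) + real n + real m + 1) + 500 * real M + 220) \<le> 30 * real L * (2200 * Z)"
  proof (rule mult_left_mono)
    show "(10 * real L + 1) * 60 + 200 * (real (n * m) + real n + real m + 1) + 500 * real M + 220 \<le> 2200 * Z"
    proof -
      have "(10 * a + 1) * 60 + 200 * (b + d + e + 1) + 500 * f + 220 \<le> 2200 * z"
        if "a \<le> z" "b \<le> z" "d \<le> z" "e \<le> z" "f \<le> z" "1 \<le> z" for a b d e f z :: real
        using that by argo
      then show ?thesis using L(2) Z by blast
    qed
  qed simp
  have B: "500 * (10 * real L + 1) * real M \<le> 5500 * real L * Z"
  proof (rule mult_mono)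
    show "500 * (10 * real L + 1) \<le> 5500 * real L" using L1 by argo
  qed (use Z in auto)
  have C: "1 * 1 \<le> real L * Z" using L1 Z by (intro mult_mono) auto
  have sum: "x + y + 9 \<le> 72000 * z" if "x \<le> 66000 * z" "y \<le> 5500 * z" "1 \<le> z" for x y z :: real
    using that by argo
  have "30 * real L * (2200 * Z) = 66000 * (real L * Z)" "5500 * real L * Z = 5500 * (real L * Z)" "1 * 1 = (1 :: real)" by simp_all
  from sum[OF A[unfolded this] B[unfolded this] C[unfolded this]] show ?thesis unfolding e .
qed

end

text \<open>\<open>u\<close> and \<open>v\<close> are the ideal values of h / L and
  \<open>N\<close>. They satisfy u v = n and u n m = v^3 = X, which is the balance of the two
  phases, and \<open>u\<close> is at least 1 because m is at most n^2.\<close>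

lemma par_bounds:
  assumes n: "2 \<le> n" and m: "0 < m" "m \<le> n * n"
  defines "l \<equiv> log 2 (real n)" and "u \<equiv> real n powr (1/2) / real m powr (1/4)" and "v \<equiv> real n powr (1/2) * real m powr (1/4)"
    and "X \<equiv> real n powr (3/2) * real m powr (3/4)"
  shows "1 \<le> l" "1 \<le> u" "1 \<le> v" "v \<le> X" "u * real (n * m) = X" "v ^ 3 = X" "real (par_L n) \<le> 2 * l" "real (par_L n) \<le> 4 * v"
    "real (par_L n) \<le> 4 * real n" "real (par_h n m) \<le> 2 * u * real (par_L n)" "real (par_N n m) \<le> 10 * v"
proof -
  have n0: "0 < n" "0 < real n" "0 < real m" "1 \<le> real n" "1 \<le> real m" using n m by auto
  let ?L = "real (par_L n)"
  have L1: "1 \<le> ?L" using par_L(1)[of n] by simp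
  show l1: "1 \<le> l" using n unfolding l_def by (simp add: le_log_iff)
  have p14: "(real m powr (1/4)) ^ 4 = real m" "(real n powr (1/2)) ^ 4 = real n ^ 2" "(real n powr (1/2)) ^ 2 = real n"
    using n0 by (simp_all add: powr_power powr_numeral)
  have mp: "1 \<le> real m powr (1/4)" "1 \<le> real n powr (1/2)" using n0 by (simp_all add: ge_one_powr_ge_zero)
  have "real m \<le> real n ^ 2" using m(2) by (simp add: power2_eq_square flip: of_nat_mult)
  then have "(real m powr (1/4)) ^ 4 \<le> (real n powr (1/2)) ^ 4" unfolding p14 .
  then have mn: "real m powr (1/4) \<le> real n powr (1/2)" by (rule power_le_imp_le_base[where n = 3, simplified]) simp
  show u1: "1 \<le> u" unfolding u_def using mn mp n0 by (simp add: le_divide_eq)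
  have "1 * 1 \<le> real n powr (1/2) * real m powr (1/4)" using mp by (intro mult_mono) auto
  then show v1: "1 \<le> v" by (simp add: v_def)
  have v3: "v ^ 3 = X" unfolding v_def X_def power_mult_distrib using n0 by (simp add: powr_power)
  then show "v ^ 3 = X" .
  have "v * 1 \<le> v * (v * v)" using v1 by (intro mult_left_mono) (auto simp: mult_ge1_I)
  then show "v \<le> X" using v3 by (simp add: power3_eq_cube)
  have "u * real (n * m) = (real n powr (1/2) * real n powr 1) * (real m powr 1 / real m powr (1/4))"
    using n0 by (simp add: u_def)
  also have "\<dots> = X" unfolding X_def powr_add[symmetric] powr_diff[symmetric] by simp
  finally show "u * real (n * m) = X" .
  have "2 ^ par_L n \<le> 2 * real n" using of_nat_mono[OF par_L_pow[OF n0(1)], where 'a = real] by simp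
  then have "log 2 (2 ^ par_L n) \<le> log 2 (2 * real n)" by (subst log_le_cancel_iff) (use n0 in auto)
  then have "?L \<le> 1 + l" using n0 by (simp add: log_mult l_def log_nat_power)
  \<comment> \<open>Since n is at least 2, its logarithm is at least 1 and absorbs the rounding
    up.\<close>
  then show Ll: "?L \<le> 2 * l" using l1 by simp
  have nv: "real n powr (1/2) \<le> v" unfolding v_def using mp by (simp add: mult_le_cancel_left1)
  \<comment> \<open>Taking the logarithm of the square root bounds \<open>l\<close> by a multiple of
    n^(1/2), and therefore \<open>L\<close> by a multiple of \<open>v\<close>.\<close>
  have "l = 2 * log 2 (real n powr (1/2))" using n0 by (simp add: l_def log_powr)
  also have "log 2 (real n powr (1/2)) \<le> real n powr (1/2)"
  proof -
    let ?s = "real n powr (1/2)"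
    have "?s < 2 powr ?s"
    proof -
      have "Suc (nat \<lfloor>?s\<rfloor>) \<le> 2 ^ nat \<lfloor>?s\<rfloor>" by (rule Suc_leI) (rule less_exp)
      then have "real (Suc (nat \<lfloor>?s\<rfloor>)) \<le> real (2 ^ nat \<lfloor>?s\<rfloor>)" by (rule of_nat_mono)
      moreover have "?s < real (Suc (nat \<lfloor>?s\<rfloor>))" using mp(2) by linarith
      moreover have "real (2 ^ nat \<lfloor>?s\<rfloor>) = 2 powr real (nat \<lfloor>?s\<rfloor>)"
        unfolding of_nat_power of_nat_numeral by (rule powr_realpow[symmetric]) simp
      moreover have "real (nat \<lfloor>?s\<rfloor>) \<le> ?s" using mp(2) by linarith
      then have "(2::real) powr real (nat \<lfloor>?s\<rfloor>) \<le> 2 powr ?s" by (intro powr_mono) auto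
      ultimately show ?thesis by linarith
    qed
    then have "log 2 ?s \<le> log 2 (2 powr ?s)" using n0 by (subst log_le_cancel_iff) auto
    then show ?thesis by simp
  qed
  finally have ls: "l \<le> 2 * real n powr (1/2)" by simp
  then show Lv: "?L \<le> 4 * v" using Ll nv by linarith
  have "real n powr (1/2) \<le> real n powr 1" using n0 by (intro powr_mono) auto
  then show "?L \<le> 4 * real n" using Ll ls n0 by simp
  have u4: "u ^ 4 * real m = real n ^ 2" unfolding u_def power_divide p14 using n0 by simp
  have q: "(u * ?L) ^ 4 * real m = real n ^ 2 * ?L ^ 4" using u4 by (simp add: power_mult_distrib mult.commute mult.left_commute)
  note ph = par_h[OF m(1) n0(1)]
  let ?h = "real (par_h n m)"
  have uL: "1 \<le> u * ?L" using u1 L1 mult_mono[of 1 u 1 ?L] by simp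
  \<comment> \<open>Minimality of \<open>h\<close> at h - 1 gives (h - 1)^4 m < n^2 L^4 = (u L)^4
    m.\<close>
  have h_up: "?h \<le> 1 + u * ?L"
  proof (cases "par_h n m = 1")
    case False
    let ?k = "par_h n m - 1"
    have k: "1 \<le> ?k" "?k < par_h n m" using ph(1) False by auto
    have "real (?k * ?k * ?k * ?k * m) < real (n * n * (par_L n * par_L n * par_L n * par_L n))"
      using ph(3)[OF k(2,1)] by (rule of_nat_less_iff[THEN iffD2])
    then have "real ?k ^ 4 * real m < (u * ?L) ^ 4 * real m"
      unfolding q by (simp add: power4_eq_xxxx power2_eq_square mult.assoc)
    then have "real ?k ^ 4 < (u * ?L) ^ 4" using n0 by simp
    then have "real ?k < u * ?L" by (rule power_less_imp_less_base) (use uL in simp)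
    then show ?thesis using k by linarith
  qed (use uL in simp)
  then show "?h \<le> 2 * u * ?L" using uL by simp
  have "real (n * n * (par_L n * par_L n * par_L n * par_L n)) \<le> real (par_h n m * par_h n m * par_h n m * par_h n m * m)"
    using ph(2) by (rule of_nat_mono)
  then have "(u * ?L) ^ 4 * real m \<le> ?h ^ 4 * real m"
    unfolding q by (simp add: power4_eq_xxxx power2_eq_square mult.assoc)
  then have "(u * ?L) ^ 4 \<le> ?h ^ 4" using n0 by simp
  then have h_lo: "u * ?L \<le> ?h" by (rule power_le_imp_le_base[where n = 3, simplified]) simp
  have nuv: "real n = u * v" unfolding u_def v_def using n0 p14(3) by (simp add: power2_eq_square)
  have "real (n div par_h n m) \<le> real n / ?h" by (rule of_nat_div_le_of_nat)
  also have "\<dots> \<le> u * v / (u * ?L)" unfolding nuv using uL h_lo u1 v1 by (intro divide_left_mono) auto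
  also have "\<dots> = v / ?L" using u1 by simp
  finally have "real (n div par_h n m) + 1 \<le> v / ?L + 1" by simp
  \<comment> \<open>The factor \<open>L\<close> in \<open>h\<close> cancels against the
    \<open>L + 1\<close> batches of draws, so \<open>N\<close> is of order \<open>v\<close> without
    a logarithm.\<close>
  then have "real (par_N n m) \<le> (v / ?L + 1) * (2 * ?L)"
    unfolding par_N_def using L1 v1 by (simp only: of_nat_mult of_nat_add of_nat_1, intro mult_mono) auto
  also have "\<dots> = 2 * v + 2 * ?L" using L1 by (simp add: field_simps)
  finally show "real (par_N n m) \<le> 10 * v" using Lv by simp
qed

text \<open>The first phase costs a multiple of h L n m, at most 2 L^2 X, and the second one a
  multiple of L^2 N^3, at most 1000 L^2 X. Replacing \<open>L\<close> by twice the logarithm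
  contributes a factor 4, and 4 * (579200 + 146000000 + 6000) is less than 6 * 10^8.\<close>

lemma (in mrat) main_time_bound:
  assumes n: "2 \<le> n" and m: "0 < m" "m \<le> n * n"
  shows "real (main_time (10 * par_L n) (par_L n) (par_h n m) (par_N n m)) \<le>
    6 * 10 ^ 8 * (real n powr (3/2) * real m powr (3/4) * (log 2 (real n))\<^sup>2)"
proof -
  define l u v X where "l = log 2 (real n)" and "u = real n powr (1/2) / real m powr (1/4)" and
    "v = real n powr (1/2) * real m powr (1/4)" and "X = real n powr (3/2) * real m powr (3/4)"
  note pb = par_bounds[OF n m, folded l_def u_def v_def X_def]
  define p L h N where "p = real (n * m)" and "L = real (par_L n)" and "h = real (par_h n m)" and "N = real (par_N n m)"
  have nm: "1 \<le> n" "1 \<le> m" using n m by auto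
  have "n \<le> n * m" "m \<le> n * m" "1 \<le> n * m" using nm by auto
  from this(1,2)[THEN of_nat_mono[where 'a = real]] this(3)[THEN of_nat_mono[where 'a = real]]
  have p: "real n \<le> p" "real m \<le> p" "1 \<le> p" unfolding p_def by simp_all
  have L1: "1 \<le> L" "1 \<le> par_L n" using par_L(1)[of n] by (simp_all add: L_def)
  have X1: "1 \<le> X" "p \<le> X" "u \<le> X"
  proof -
    have "1 * p \<le> u * p" "u * 1 \<le> u * p" using pb(2) p by (intro mult_mono; simp)+
    then show "p \<le> X" "u \<le> X" using pb(5) by (simp_all add: p_def)
    then show "1 \<le> X" using p by linarith
  qed
  have Lp: "L \<le> 4 * p" using pb(9) p by (simp add: L_def)
  have LX: "L \<le> 4 * X" using pb(8,4) by (simp add: L_def)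
  have h0: "0 \<le> h" by (simp add: h_def)
  have hb: "h * (L * p) \<le> 2 * (L * L * X)"
  proof -
    have "h * (L * p) \<le> (2 * u * L) * (L * p)" using pb(10) L1 p by (intro mult_right_mono) (auto simp: h_def L_def)
    also have "\<dots> = 2 * (L * L * (u * p))" by simp
    finally show ?thesis using pb(5) by (simp add: p_def)
  qed
  have LLX: "X \<le> L * L * X" "L * X \<le> L * L * X" "1 \<le> L * L"
  proof -
    show 1: "1 \<le> L * L" using L1 mult_mono[of 1 L 1 L] by simp
    show "X \<le> L * L * X" using mult_right_mono[OF 1, of X] X1 by simp
    show "L * X \<le> L * L * X" using mult_right_mono[of L "L * L" X] X1 L1 by (simp add: mult_le_cancel_left1)
  qed
  have N3: "N * N * N \<le> 1000 * X"
  proof -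
    have "N ^ 3 \<le> (10 * v) ^ 3" using pb(11) by (intro power_mono) (auto simp: N_def)
    then show ?thesis using pb(6) by (simp add: power_mult_distrib power3_eq_cube)
  qed
  have N1: "1 \<le> N" using nm by (simp add: N_def par_N_def)
  have N2: "N * N \<le> N * N * N" "N \<le> N * N"
    using mult_left_mono[OF N1, of "N * N"] mult_left_mono[OF N1, of N] N1 by auto
  have r1: "real (RB (10 * par_L n) (2 * (n * m))) \<le> 72000 * (L * (4 * p))"
    unfolding L_def by (rule RB_bound) (use L1 Lp p in \<open>auto simp: L_def p_def\<close>)
  have "real (2 * (par_N n m * par_N n m * par_N n m)) \<le> 2000 * X" using N3 by (simp add: N_def)
  then have r2: "real (RB (10 * par_L n) (2 * (par_N n m * par_N n m * par_N n m))) \<le> 72000 * (L * (2000 * X))"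
    unfolding L_def by (intro RB_bound) (use L1 LX p X1 in \<open>auto simp: L_def p_def\<close>)
  have "72000 * (L * (4 * p)) = 288000 * (L * p)" "72000 * (L * (2000 * X)) = 144000000 * (L * X)" by simp_all
  note r1 = r1[unfolded this] and r2 = r2[unfolded this]
  have Lp1: "p \<le> L * p" using mult_right_mono[OF L1(1), of p] p by simp
  have LX1: "X \<le> L * X" using mult_right_mono[OF L1(1), of X] X1 by simp
  have "real (RB (10 * par_L n) (2 * (n * m))) + 500 * (p + real n + 1) + 12 \<le> 289600 * (L * p)"
  proof -
    have "a + 500 * (q + b + 1) + 12 \<le> 289600 * y" if "a \<le> 288000 * y" "b \<le> q" "1 \<le> q" "q \<le> y" for a b q y :: real
      using that by argo
    from this[OF r1 p(1,3) Lp1] show ?thesis .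
  qed
  from mult_left_mono[OF this h0]
  have A: "h * (real (RB (10 * par_L n) (2 * (n * m))) + 500 * (p + real n + 1) + 12) \<le> 579200 * (L * L * X)" using hb by linarith
  have "real (RB (10 * par_L n) (2 * (par_N n m * par_N n m * par_N n m))) + 600 * (N * N * N + N * N + N + 1) + 12 \<le> 146000000 * (L * X)"
  proof -
    have "a + 600 * (b3 + b2 + b + 1) + 12 \<le> 146000000 * y"
      if "a \<le> 144000000 * y" "b3 \<le> 1000 * x" "b2 \<le> b3" "b \<le> b2" "1 \<le> x" "x \<le> y" for a b b2 b3 x y :: real
      using that by argo
    from this[OF r2 N3 N2 X1(1) LX1] show ?thesis .
  qed
  from mult_left_mono[OF this, of L]
  have B: "L * (real (RB (10 * par_L n) (2 * (par_N n m * par_N n m * par_N n m))) + 600 * (N * N * N + N * N + N + 1) + 12) \<le> 146000000 * (L * L * X)"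
    using L1 by simp
  have C: "1500 * (p + real n + real m + 1) \<le> 6000 * (L * L * X)" using p X1 LLX(1) by argo
  have e: "real (main_time (10 * par_L n) (par_L n) (par_h n m) (par_N n m)) =
      h * (real (RB (10 * par_L n) (2 * (n * m))) + 500 * (p + real n + 1) + 12) +
      L * (real (RB (10 * par_L n) (2 * (par_N n m * par_N n m * par_N n m))) + 600 * (N * N * N + N * N + N + 1) + 12) +
      1500 * (p + real n + real m + 1)"
    unfolding main_time_def h_def L_def N_def p_def by simp
  have "L * L \<le> (2 * l) * (2 * l)" using pb(7) L1 by (intro mult_mono) (auto simp: L_def)
  from mult_right_mono[OF this, of X] X1 have "L * L * X \<le> 4 * (X * l\<^sup>2)" by (simp add: power2_eq_square mult.commute mult.left_commute)
  then have "real (main_time (10 * par_L n) (par_L n) (par_h n m) (par_N n m)) \<le> 6 * 10 ^ 8 * (X * l\<^sup>2)"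
  proof -
    have "a + b + d \<le> 600000000 * z" if "a \<le> 579200 * y" "b \<le> 146000000 * y" "d \<le> 6000 * y" "y \<le> 4 * z" "0 \<le> y" for a b d y z :: real
      using that by argo
    from this[OF A B C] LLX(1) X1 \<open>L * L * X \<le> 4 * (X * l\<^sup>2)\<close> show ?thesis unfolding e by simp
  qed
  then show ?thesis unfolding X_def l_def .
qed

lemma small_time_bound:
  assumes n: "2 \<le> n" and m: "0 < m" "m \<le> n * n"
  shows "real (1000 * (n * m + n + m + 1) + 40 * par_h n m + 30 * par_L n + 23 * par_N n m) \<le>
    10 ^ 5 * (real n powr (3/2) * real m powr (3/4) * (log 2 (real n))\<^sup>2)"
proof -
  define l u v X where "l = log 2 (real n)" and "u = real n powr (1/2) / real m powr (1/4)" and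
    "v = real n powr (1/2) * real m powr (1/4)" and "X = real n powr (3/2) * real m powr (3/4)"
  note pb = par_bounds[OF n m, folded l_def u_def v_def X_def]
  define p L where "p = real (n * m)" and "L = real (par_L n)"
  have nm: "1 \<le> n" "1 \<le> m" using n m by auto
  have "n \<le> n * m" "m \<le> n * m" "1 \<le> n * m" using nm by auto
  from this(1,2)[THEN of_nat_mono[where 'a = real]] this(3)[THEN of_nat_mono[where 'a = real]]
  have p: "real n \<le> p" "real m \<le> p" "1 \<le> p" unfolding p_def by simp_all
  have X1: "1 \<le> X" "p \<le> X" "u \<le> X"
  proof -
    have "1 * p \<le> u * p" "u * 1 \<le> u * p" using pb(2) p by (intro mult_mono; simp)+
    then show "p \<le> X" "u \<le> X" using pb(5) by (simp_all add: p_def)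
    then show "1 \<le> X" using p by linarith
  qed
  have lX: "X \<le> l * X" using mult_right_mono[OF pb(1), of X] X1 by simp
  have "l * X \<le> l * (l * X)" using mult_left_mono[OF lX, of l] pb(1) by simp
  then have lX2: "X \<le> X * l\<^sup>2" "l * X \<le> X * l\<^sup>2" using lX by (simp_all add: power2_eq_square mult.commute mult.left_commute)
  have "2 * u * L \<le> 2 * X * (2 * l)" using X1 pb(1,2,7) by (intro mult_mono) (auto simp: L_def)
  moreover have "2 * X * (2 * l) = 4 * (l * X)" by simp
  ultimately have h: "real (par_h n m) \<le> 4 * (l * X)" using pb(10) unfolding L_def by argo
  have "real (1000 * (n * m + n + m + 1) + 40 * par_h n m + 30 * par_L n + 23 * par_N n m) =
      1000 * (p + real n + real m + 1) + 40 * real (par_h n m) + 30 * real (par_L n) + 23 * real (par_N n m)"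
    by (simp add: p_def)
  also have "\<dots> \<le> 100000 * (X * l\<^sup>2)" using h lX2 X1 p pb(4,8,11) by argo
  also have "\<dots> = 10 ^ 5 * (X * l\<^sup>2)" by simp
  finally show ?thesis unfolding X_def l_def .
qed

section \<open>Overflow-free inputs and runs of the whole program\<close>

context mach
begin

text \<open>Collects the size conditions under which the parameter computation does not overflow and
  the tables, candidate lists and samples fit into their arrays.\<close>

definition large :: bool where
  "large \<longleftrightarrow> 2 ^ (10 * par_L n) < IM \<and> n * n \<le> IM \<and> 30 * par_L n < W \<and> n * n * LB < W \<and> n * par_L n < W \<and>
     (\<forall>h\<le>n * par_L n. h * h * h * h * m < W) \<and> 2 ^ par_L n < W \<and> par_N n m < IM"

definition start :: "config \<Rightarrow> bool" where
  "start \<sigma> \<longleftrightarrow> pc \<sigma> = 0 \<and> wreg \<sigma> = (\<lambda>_. 0)(0 := n, 1 := m) \<and> rreg \<sigma> = (\<lambda>_. 0) \<and>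
     wmem \<sigma> = (\<lambda>a. if a < 2 * m then (if even a then src (a div 2) else dst (a div 2)) else 0) \<and>
     rmem \<sigma> = (\<lambda>a. if a < 2 * m then (if even a then c (a div 2) else t (a div 2)) else 0)"

definition start_st :: "config \<Rightarrow> st" where
  "start_st \<sigma> = \<lparr>wv = (\<lambda>_. 0)(0 := n, 1 := m), rv = (\<lambda>_. 0), wa = (\<lambda>a i. if a = 32 then wmem \<sigma> i else 0),
     ra = (\<lambda>a i. if a = 32 then rmem \<sigma> i else 0), clk = 0\<rparr>"

lemma start_first:
  assumes off: "off = 2 * m" and st: "start \<sigma>"
  shows "\<exists>\<sigma>0. reach W PROG 1 \<sigma> \<sigma>0 \<and> pc \<sigma>0 = 1 \<and> rel (start_st \<sigma>) \<sigma>0"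
proof -
  let ?s = "\<sigma>\<lparr>wreg := (wreg \<sigma>)(2 := 2 * m), pc := 1\<rparr>"
  have mW: "2 * m < W" "0 < W" using fits off by linarith+
  have "PROG ! 0 = WOp Add 2 1 1" "0 < length PROG" by (simp_all add: PROG_def)
  then have "reach W PROG 1 \<sigma> ?s"
    using st mW by (intro reach_instr[where x = "WOp Add 2 1 1"]) (auto simp: start_def mult_2)
  moreover have "rel (start_st \<sigma>) ?s"
  proof -
    have b: "src (a div 2) < W" "dst (a div 2) < W" if "a < 2 * m" for a
    proof -
      have "a div 2 < m" using that by simp
      from src_IM[OF this] show "src (a div 2) < W" "dst (a div 2) < W" using IM_W by linarith+
    qed
    show ?thesis using st off lt_IM(6,7) mW b unfolding rel_def start_def start_st_def by auto
  qed
  ultimately show ?thesis by auto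
qed

lemma wp_PRE:
  assumes off: "off = 2 * m" and st: "start \<sigma>"
    and big: "0 < m \<Longrightarrow> 0 < n \<and> large"
    and post: "\<And>s'. inp s' \<Longrightarrow> frame PRE (start_st \<sigma>) s' \<Longrightarrow>
      (0 < m \<Longrightarrow> wv s' 2 = par_L n \<and> wv s' 3 = par_h n m \<and> wv s' 4 = par_N n m \<and> wv s' 15 = 10 * par_L n \<and>
        wv s' 24 = 30 * par_L n \<and> wv s' 45 = n - 1) \<Longrightarrow> (m = 0 \<Longrightarrow> wv s' 4 = 0 \<and> wv s' 45 = 0) \<Longrightarrow>
      clk s' \<le> 112 * m + 30 * par_L n + 40 * par_h n m + 170 \<Longrightarrow> R s'"
  shows "wp PRE R (start_st \<sigma>)"
proof -
  let ?s = "start_st \<sigma>" and ?c = "If (WLess (WC 0) (WV 1)) PARAMS SKIP"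
  let ?R = "\<lambda>s'. frame PRE ?s s' \<longrightarrow> R s'"
  have "wp COPY (wp ?c ?R) ?s"
  proof (rule wp_COPY[OF off])
    show "wv ?s 0 = n" "wv ?s 1 = m" by (simp_all add: start_st_def)
    show "wa ?s 32 (2 * e) = src e \<and> wa ?s 32 (Suc (2 * e)) = dst e \<and> ra ?s 32 (2 * e) = c e \<and> ra ?s 32 (Suc (2 * e)) = t e" if "e < m" for e
      using st that by (simp add: start_st_def start_def)
    fix s1 assume i1: "inp s1" and f1: "frame COPY ?s s1" and t1: "clk s1 \<le> clk ?s + 112 * m + 9"
    have t1: "clk s1 \<le> 112 * m + 9" using t1 by (simp add: start_st_def)
    have v1: "wv s1 4 = 0" "wv s1 45 = 0" using f1 by (auto simp: frame_def start_st_def)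
    show "wp ?c ?R s1"
    proof (cases "m = 0")
      case True
      have fin: "R s2" if "wv s2 = wv s1" "wa s2 = wa s1" "ra s2 = ra s1" "frame PRE ?s s2" "clk s2 \<le> clk s1 + 10" for s2
      proof -
        have "inp s2" using i1 that(1-3) unfolding inp_def by simp
        moreover have "clk s2 \<le> 112 * m + 30 * par_L n + 40 * par_h n m + 170" using that(5) t1 by linarith
        ultimately show ?thesis using True that(1,4) v1 by (intro post) simp_all
      qed
      then show ?thesis using True inpD(2)[OF i1] lt_IM by (simp add: wp_If wp_SKIP)
    next
      case False
      then have b: "0 < m" "0 < n" large using big by auto
      let ?s1 = "s1\<lparr>clk := clk s1 + costB (WLess (WC 0) (WV 1))\<rparr>"
      have i1': "inp ?s1" using i1 by (simp add: inp_def)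
      have "wp PARAMS (\<lambda>s2. wv s2 2 = par_L n \<and> wv s2 3 = par_h n m \<and> wv s2 4 = par_N n m \<and> wv s2 15 = 10 * par_L n \<and>
          wv s2 24 = 30 * par_L n \<and> wv s2 45 = n - 1 \<and> clk s2 \<le> clk ?s1 + 30 * par_L n + 40 * par_h n m + 150) ?s1"
      proof (rule wp_PARAMS[OF i1' b(1,2)])
        have "IM \<le> W" using IM_W by simp
        then show "n * n * LB < W" "n * par_L n < W" "2 ^ par_L n < W" "par_N n m < W" "30 * par_L n < W"
          "\<And>h. h \<le> n * par_L n \<Longrightarrow> h * h * h * h * m < W"
          using b(3) unfolding large_def by auto
      qed auto
      then have "wp PARAMS ?R ?s1"
      proof (rule wp_conseq)
        fix s2 assume v: "wv s2 2 = par_L n \<and> wv s2 3 = par_h n m \<and> wv s2 4 = par_N n m \<and> wv s2 15 = 10 * par_L n \<and>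
          wv s2 24 = 30 * par_L n \<and> wv s2 45 = n - 1 \<and> clk s2 \<le> clk ?s1 + 30 * par_L n + 40 * par_h n m + 150"
          and f2: "frame PARAMS ?s1 s2"
        have "inp s2" by (rule inp_frame[OF i1' f2]) (auto simp: PARAMS_def LOOPL_def LOOPH_def)
        then show "?R s2" using post[of s2] v t1 b(1) by auto
      qed
      then show ?thesis using b inpD(2)[OF i1] lt_IM by (simp add: wp_If)
    qed
  qed
  then have "wp PRE ?R ?s" unfolding PRE_def wp_Seq .
  then show ?thesis by (rule wp_conseq) auto
qed

lemma drawn_inp: "inp s1 \<Longrightarrow> drawn s1 0 xs s2 \<Longrightarrow> inp s2"
  unfolding inp_def drawn_def by simp

lemma run_acyclic:
  assumes off: "off = 2 * m" and st: "start \<sigma>" and big: "0 < m \<Longrightarrow> 0 < n \<and> large" and no: "\<And>q. \<not> cyc q"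
  shows "\<exists>T H (R :: nat list pmf). (0 < m \<longrightarrow> T \<le> 1000 * (n * m + n + m + 1) + 40 * par_h n m + 30 * par_L n + 23 * par_N n m) \<and>
    run W PROG T \<sigma> = map_pmf H R \<and> (\<forall>xs\<in>set_pmf R. halted PROG (H xs) \<and> wreg (H xs) 0 = 0)"
proof -
  obtain \<sigma>0 where 0: "reach W PROG 1 \<sigma> \<sigma>0" "pc \<sigma>0 = 1" "rel (start_st \<sigma>) \<sigma>0" using start_first[OF off st] by blast
  \<comment> \<open>For \<open>m = 0\<close> no parameters have been computed: variables 4 and 45
    are zero, nothing is drawn, and \<open>n' = 1\<close> describes the singleton range below
    variable 45.\<close>
  define N n' T1 T2 where "N = (if m = 0 then 0 else par_N n m)" and "n' = (if m = 0 then 1 else n)"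
    and "T1 = 112 * m + 30 * par_L n + 40 * par_h n m + 170" and "T2 = 300 * (n * m + n + m + 1)"
  have "wp PRE (\<lambda>s1. wv s1 4 = N \<and> wv s1 43 = 0 \<and> wv s1 45 = n' - 1 \<and> clk s1 \<le> T1 \<and>
      (\<forall>xs s2. drawn s1 0 xs s2 \<longrightarrow> length xs = N \<longrightarrow> set xs \<subseteq> {..<n'} \<longrightarrow>
        wp MAIN (\<lambda>s3. wv s3 0 = 0 \<and> clk s3 \<le> clk s2 + T2) s2)) (start_st \<sigma>)"
  proof (rule wp_PRE[OF off st big])
    fix s' assume i: "inp s'" and f: "frame PRE (start_st \<sigma>) s'" and 1: "0 < m \<Longrightarrow> wv s' 2 = par_L n \<and> wv s' 3 = par_h n m \<and> wv s' 4 = par_N n m \<and> wv s' 15 = 10 * par_L n \<and>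
        wv s' 24 = 30 * par_L n \<and> wv s' 45 = n - 1" and 2: "m = 0 \<Longrightarrow> wv s' 4 = 0 \<and> wv s' 45 = 0"
      and t: "clk s' \<le> 112 * m + 30 * par_L n + 40 * par_h n m + 170"
    have "wv s' 43 = 0" using f by (auto simp: frame_def start_st_def)
    moreover have "wp MAIN (\<lambda>s3. wv s3 0 = 0 \<and> clk s3 \<le> clk s2 + T2) s2" if "drawn s' 0 xs s2" for xs s2
      by (rule wp_acyclic[OF drawn_inp[OF i that] no]) (simp add: T2_def)
    ultimately show "wv s' 4 = N \<and> wv s' 43 = 0 \<and> wv s' 45 = n' - 1 \<and> clk s' \<le> T1 \<and>
      (\<forall>xs s2. drawn s' 0 xs s2 \<longrightarrow> length xs = N \<longrightarrow> set xs \<subseteq> {..<n'} \<longrightarrow>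
        wp MAIN (\<lambda>s3. wv s3 0 = 0 \<and> clk s3 \<le> clk s2 + T2) s2)"
      using 1 2 t by (auto simp: N_def n'_def T1_def)
  qed auto
  moreover have "0 < n'" "N < IM" using big nIM by (auto simp: n'_def N_def large_def)
  moreover have "clk (start_st \<sigma>) = 0" by (simp add: start_st_def)
  ultimately obtain T H where TH: "T \<le> T1 + 23 * N + T2 + 7" "run W PROG T \<sigma> = map_pmf H (replicate_pmf N (pmf_of_set {..n' - 1}))"
    "\<forall>xs\<in>set_pmf (replicate_pmf N (pmf_of_set {..n' - 1})). length xs = N \<and> halted PROG (H xs) \<and> (\<exists>s3. rel s3 (H xs) \<and> wv s3 0 = 0)"
    using run_PROG[OF 0, of N n' T1 "\<lambda>_ s3. wv s3 0 = 0" T2] by blast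
  have "wreg (H xs) 0 = 0" if "rel s3 (H xs)" "wv s3 0 = 0" for xs s3
    using rel_bounds(3)[OF that(1), of 0] that(2) by simp
  moreover have "T \<le> 1000 * (n * m + n + m + 1) + 40 * par_h n m + 30 * par_L n + 23 * par_N n m" if "0 < m"
    using TH(1) that by (simp add: T1_def T2_def N_def)
  ultimately show ?thesis using TH(2,3) by blast
qed

end

text \<open>\<open>N\<close> is at most 2^(2L + 1), so 2 N^3 is at most 2^(6L + 4), and
  \<open>L\<close> is at least 1. This is the origin of the 10 in the number
  \<open>10 * par_L n\<close> of sorting levels.\<close>

lemma par_N_pow: "2 * (par_N n m * par_N n m * par_N n m) \<le> 2 ^ (10 * par_L n)"
proof -
  let ?L = "par_L n"
  have "n div par_h n m \<le> 2 ^ ?L" using par_L(2)[of n] div_le_dividend[of n "par_h n m"] by linarith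
  then have "n div par_h n m + 1 \<le> 2 ^ (?L + 1)" by (simp add: Suc_leI) (metis add_mono_thms_linordered_semiring(1) mult_2 one_le_numeral one_le_power Suc_eq_plus1)
  moreover have "?L + 1 \<le> 2 ^ ?L" by (metis Suc_eq_plus1 Suc_leI less_exp)
  ultimately have "par_N n m \<le> 2 ^ (?L + 1) * 2 ^ ?L" unfolding par_N_def by (rule mult_le_mono)
  then have "par_N n m \<le> 2 ^ (?L + 1 + ?L)" by (simp only: power_add)
  moreover have "?L + 1 + ?L = 2 * ?L + 1" by simp
  ultimately have N: "par_N n m \<le> 2 ^ (2 * ?L + 1)" by (simp only:)
  have "par_N n m * par_N n m * par_N n m \<le> 2 ^ (2 * ?L + 1) * 2 ^ (2 * ?L + 1) * 2 ^ (2 * ?L + 1)" by (intro mult_le_mono N)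
  also have "\<dots> = 2 ^ (2 * ?L + 1 + (2 * ?L + 1) + (2 * ?L + 1))" by (simp only: power_add)
  finally have "2 * (par_N n m * par_N n m * par_N n m) \<le> 2 ^ Suc (2 * ?L + 1 + (2 * ?L + 1) + (2 * ?L + 1))"
    unfolding power_Suc by (rule mult_le_mono2)
  also have "\<dots> \<le> 2 ^ (10 * ?L)" using par_L(1)[of n] by (intro power_increasing) auto
  finally show ?thesis .
qed

lemma par_nm_pow: "m \<le> n * n \<Longrightarrow> 2 * (n * m) \<le> 2 ^ (10 * par_L n)"
proof -
  assume m: "m \<le> n * n"
  let ?L = "par_L n"
  have n: "n \<le> 2 ^ ?L" by (rule par_L(2))
  have "n * m \<le> n * (n * n)" using m by simp
  also have "\<dots> \<le> 2 ^ ?L * (2 ^ ?L * 2 ^ ?L)" by (intro mult_le_mono n)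
  also have "\<dots> = 2 ^ (?L + (?L + ?L))" by (simp only: power_add)
  finally have "2 * (n * m) \<le> 2 ^ Suc (?L + (?L + ?L))" unfolding power_Suc by (rule mult_le_mono2)
  also have "\<dots> \<le> 2 ^ (10 * ?L)" using par_L(1)[of n] by (intro power_increasing) auto
  finally show ?thesis .
qed

context mrat
begin

lemma run_cyclic:
  assumes off: "off = 2 * m" and st: "start \<sigma>" and mn: "0 < m" "0 < n" "m \<le> n * n" and lg: large
    and inj: "inj_on (\<lambda>e. (src e, dst e)) {..<m}"
  shows "\<exists>T H. T \<le> main_time (10 * par_L n) (par_L n) (par_h n m) (par_N n m) +
      (1000 * (n * m + n + m + 1) + 40 * par_h n m + 30 * par_L n + 23 * par_N n m) \<and>
    run W PROG T \<sigma> = map_pmf H (replicate_pmf (par_N n m) (pmf_of_set {..n - 1})) \<and>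
    (\<forall>xs\<in>set_pmf (replicate_pmf (par_N n m) (pmf_of_set {..n - 1})). halted PROG (H xs) \<and> cyc (result (H xs)) \<and>
      (\<forall>r. cyc r \<longrightarrow> wt c r = lam * wt t r \<longrightarrow> length r \<le> par_h n m \<or> hits (set xs) (par_h n m) r \<longrightarrow>
        wt c (result (H xs)) = lam * wt t (result (H xs))))"
proof -
  let ?L = "par_L n" and ?h = "par_h n m" and ?N = "par_N n m"
  obtain \<sigma>0 where 0: "reach W PROG 1 \<sigma> \<sigma>0" "pc \<sigma>0 = 1" "rel (start_st \<sigma>) \<sigma>0" using start_first[OF off st] by blast
  define T1 T2 where "T1 = 112 * m + 30 * ?L + 40 * ?h + 170" and "T2 = main_time (10 * ?L) ?L ?h ?N"
  define Q where "Q xs s3 \<longleftrightarrow> (\<exists>q. cyc q \<and> map (wa s3 32) [0..<wv s3 0] = q \<and>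
      (\<forall>r. cyc r \<longrightarrow> wt c r = lam * wt t r \<longrightarrow> length r \<le> ?h \<or> hits (set xs) ?h r \<longrightarrow> wt c q = lam * wt t q))" for xs and s3 :: st
  have IM: "IM \<le> W" using IM_W by simp
  have "wp PRE (\<lambda>s1. wv s1 4 = ?N \<and> wv s1 43 = 0 \<and> wv s1 45 = n - 1 \<and> clk s1 \<le> T1 \<and>
      (\<forall>xs s2. drawn s1 0 xs s2 \<longrightarrow> length xs = ?N \<longrightarrow> set xs \<subseteq> {..<n} \<longrightarrow>
        wp MAIN (\<lambda>s3. Q xs s3 \<and> clk s3 \<le> clk s2 + T2) s2)) (start_st \<sigma>)"
  proof (rule wp_PRE[OF off st])
    fix s1 assume i: "inp s1" and f: "frame PRE (start_st \<sigma>) s1" and 1: "0 < m \<Longrightarrow> wv s1 2 = ?L \<and> wv s1 3 = ?h \<and> wv s1 4 = ?N \<and> wv s1 15 = 10 * ?L \<and>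
        wv s1 24 = 30 * ?L \<and> wv s1 45 = n - 1" and t: "clk s1 \<le> 112 * m + 30 * ?L + 40 * ?h + 170"
    note v = 1[OF mn(1)]
    have z: "wv s1 43 = 0" "wa s1 8 = (\<lambda>_. 0)" "wa s1 13 = (\<lambda>_. 0)" "wa s1 6 = (\<lambda>_. 0)"
      using f by (auto simp: frame_def start_st_def)
    have "wp MAIN (\<lambda>s3. Q xs s3 \<and> clk s3 \<le> clk s2 + T2) s2"
      if d: "drawn s1 0 xs s2" and len: "length xs = ?N" and S: "set xs \<subseteq> {..<n}" for xs s2
    proof -
      have i2: "inp s2" by (rule drawn_inp[OF i d])
      have a: "wa s2 8 = (\<lambda>_. 0)" "wa s2 13 = (\<lambda>_. 0)" "wa s2 6 = (\<lambda>_. 0)" using d z by (auto simp: drawn_def)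
      have v2: "wv s2 2 = ?L" "wv s2 3 = ?h" "wv s2 4 = ?N" "wv s2 15 = 10 * ?L" "wv s2 24 = 30 * ?L"
        using d v by (auto simp: drawn_def)
      have rd: "ready s2" using i2 a by (simp add: ready_def)
      have sz: "sizes (10 * ?L) s2" using v2 lg par_L(1)[of n] by (simp add: sizes_def large_def)
      have s5: "wa s2 5 j = xs ! j" if "j < ?N" for j using d len that by (simp add: drawn_def)
      have im: "wa s2 5 ` {..<?N} = set xs"
      proof -
        have "wa s2 5 ` {..<?N} = (!) xs ` {..<?N}" using s5 by (intro image_cong) auto
        then show ?thesis using len by (auto simp: set_conv_nth)
      qed
      have hW: "?L < W" "?h < W" "?N < IM" using lg par_h(4)[OF mn(1,2)] unfolding large_def by auto
      show ?thesis
      proof (rule wp_MAIN[OF rd sz par_nm_pow[OF mn(3)] par_N_pow hW(3) v2(1) hW(1) v2(2) hW(2) v2(3) _ _ inj par_L(2)])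
        show "\<And>g. wa s2 6 g = 0" by (simp only: a(3))
        show "wa s2 5 j < n" if j: "j < ?N" for j
        proof -
          have "xs ! j \<in> set xs" using j by (simp add: len)
          then have "xs ! j \<in> {..<n}" by (rule subsetD[OF S])
          then show ?thesis by (simp only: s5[OF j] lessThan_iff)
        qed
        fix s3 :: st and q assume q: "cyc q" "map (wa s3 32) [0..<wv s3 0] = q"
          "\<And>r. cyc r \<Longrightarrow> wt c r = lam * wt t r \<Longrightarrow> length r \<le> ?h \<or> hits (wa s2 5 ` {..<?N}) ?h r \<Longrightarrow> wt c q = lam * wt t q"
          and t3: "clk s3 \<le> clk s2 + main_time (10 * ?L) ?L ?h ?N"
        show "Q xs s3 \<and> clk s3 \<le> clk s2 + T2" using q t3 unfolding Q_def T2_def im by blast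
      qed
    qed
    then show "wv s1 4 = ?N \<and> wv s1 43 = 0 \<and> wv s1 45 = n - 1 \<and> clk s1 \<le> T1 \<and>
      (\<forall>xs s2. drawn s1 0 xs s2 \<longrightarrow> length xs = ?N \<longrightarrow> set xs \<subseteq> {..<n} \<longrightarrow>
        wp MAIN (\<lambda>s3. Q xs s3 \<and> clk s3 \<le> clk s2 + T2) s2)"
      using v z t by (simp add: T1_def)
  qed (use mn lg in auto)
  moreover have "?N < IM" using lg by (simp add: large_def)
  moreover have "clk (start_st \<sigma>) = 0" by (simp add: start_st_def)
  ultimately obtain T H where TH: "T \<le> T1 + 23 * ?N + T2 + 7" "run W PROG T \<sigma> = map_pmf H (replicate_pmf ?N (pmf_of_set {..n - 1}))"
    "\<forall>xs\<in>set_pmf (replicate_pmf ?N (pmf_of_set {..n - 1})). length xs = ?N \<and> halted PROG (H xs) \<and> (\<exists>s3. rel s3 (H xs) \<and> Q xs s3)"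
    using run_PROG[OF 0 _ _ mn(2), of ?N T1 Q T2] by blast
  \<comment> \<open>The output has at most \<open>m\<close> entries and so lies entirely in the
    first \<open>off\<close> cells, where memory and array 32 agree.\<close>
  have res: "cyc (result (H xs)) \<and> (\<forall>r. cyc r \<longrightarrow> wt c r = lam * wt t r \<longrightarrow> length r \<le> ?h \<or> hits (set xs) ?h r \<longrightarrow>
        wt c (result (H xs)) = lam * wt t (result (H xs)))" if r: "rel s3 (H xs)" and Q: "Q xs s3" for xs s3
  proof -
    obtain q where q: "cyc q" "map (wa s3 32) [0..<wv s3 0] = q"
      "\<forall>r. cyc r \<longrightarrow> wt c r = lam * wt t r \<longrightarrow> length r \<le> ?h \<or> hits (set xs) ?h r \<longrightarrow> wt c q = lam * wt t q"
      using Q unfolding Q_def by blast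
    have "wv s3 0 = length q" unfolding q(2)[symmetric] by simp
    then have l: "wv s3 0 \<le> off" using cyc_length[OF q(1)] m_off by linarith
    have e: "\<forall>i<off. wmem (H xs) i = wa s3 32 i" using r unfolding rel_def by (elim conjE)
    have w: "wreg (H xs) 0 = wv s3 0" using rel_bounds(3)[OF r, of 0] by simp
    have "map (wmem (H xs)) [0..<wv s3 0] = map (wa s3 32) [0..<wv s3 0]"
    proof (rule map_cong[OF refl])
      fix i assume "i \<in> set [0..<wv s3 0]"
      then have "i < off" using l unfolding set_upt atLeastLessThan_iff by linarith
      then show "wmem (H xs) i = wa s3 32 i" using e by blast
    qed
    then have "result (H xs) = q" unfolding result_def w q(2) .
    then show ?thesis using q(1,3) by blast
  qed
  have "T \<le> T2 + (1000 * (n * m + n + m + 1) + 40 * ?h + 30 * ?L + 23 * ?N)"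
    using TH(1) by (simp add: T1_def)
  then show ?thesis using TH(2,3) res unfolding T2_def by blast
qed

end

section \<open>The main theorem\<close>

context
  fixes n m K W IM :: nat
  assumes K: "K = n + m + 2" and W: "W = K ^ 30" and IM: "IM = K ^ 20 + 1"
begin

lemma K_power_mono: "i \<le> j \<Longrightarrow> K ^ i \<le> K ^ j"
  by (rule power_increasing) (simp_all add: K)

lemma K_power_less: "i < 30 \<Longrightarrow> x \<le> K ^ i \<Longrightarrow> x < W"
  unfolding W by (erule le_less_trans) (rule power_strict_increasing, simp_all add: K)

text \<open>As \<open>K\<close> is at least 2, 1024 K^20 is at most K^30, which leaves room for the
  input and 32 arrays of K^20 + 1 cells.\<close>

lemma memory_fits: "2 * m + 32 * IM + 32 \<le> W" "n < IM" "m < IM"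
proof -
  have "2 ^ 10 \<le> K ^ 10" by (rule power_mono) (simp_all add: K)
  then have "1024 * K ^ 20 \<le> K ^ 10 * K ^ 20" by (intro mult_le_mono1) simp
  also have "\<dots> = W" unfolding W power_add[symmetric] by simp
  finally have 1: "1024 * K ^ 20 \<le> W" .
  have 2: "K \<le> K ^ 20" using K_power_mono[of 1 20] by simp
  have 3: "1 \<le> K ^ 20" using K by simp
  define p where "p = K ^ 20"
  note 4 = 1[folded p_def] 2[folded p_def] 3[folded p_def] K
  have "2 * m + 32 * (p + 1) + 32 = 2 * m + 32 * p + 64" by simp
  also have "\<dots> \<le> 2 * p + 32 * p + 64 * p" using 4(2-) by (intro add_mono) auto
  also have "\<dots> \<le> 1024 * p" by simp
  also note 4(1)
  finally show "2 * m + 32 * IM + 32 \<le> W" unfolding IM p_def[symmetric] .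
  show "n < IM" "m < IM" unfolding IM p_def[symmetric] using 4 by linarith+
qed

text \<open>Because \<open>L\<close> is a rounded logarithm, 2^L is at most 2n and hence at most
  K^2. So the 2^(10L) candidates allowed for are at most K^20 many, which dictates the array
  length.\<close>

lemma memory_large:
  assumes M: "mach W (2 * m) IM n m src dst" and n: "0 < n"
  shows "mach.large W IM n m"
proof -
  let ?L = "par_L n"
  note small = K_power_less
  have nm: "n \<le> K" "m \<le> K" "n + 1 \<le> K" using K by auto
  have "2 ^ ?L \<le> 2 * n" by (rule par_L_pow[OF n])
  also have "\<dots> \<le> K * K" using K by (intro mult_le_mono) auto
  finally have P: "2 ^ ?L \<le> K ^ 2" by (simp only: power2_eq_square)
  have L1: "?L + 1 \<le> K ^ 2" using less_exp[of ?L] P by linarith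
  then have L: "?L \<le> K ^ 2" by linarith
  have "(2::nat) ^ (10 * ?L) = (2 ^ ?L) ^ 10" by (simp only: power_mult[symmetric] mult.commute)
  also have "\<dots> \<le> (K ^ 2) ^ 10" by (rule power_mono[OF P]) simp
  also have "\<dots> = K ^ 20" by (simp only: power_mult[symmetric]) simp
  finally have 1: "2 ^ (10 * ?L) < IM" unfolding IM by linarith
  have "n * n \<le> K ^ 2" unfolding power2_eq_square by (intro mult_le_mono nm)
  also have "\<dots> \<le> K ^ 20" by (rule K_power_mono) simp
  finally have 2: "n * n \<le> IM" unfolding IM by linarith
  have "(2::nat) ^ 5 \<le> K ^ 5" by (rule power_mono) (simp_all add: K)
  then have "30 * ?L \<le> K ^ 5 * K ^ 2" by (intro mult_le_mono L) simp
  then have "30 * ?L \<le> K ^ (5 + 2)" by (simp only: power_add)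
  then have 3: "30 * ?L < W" by (rule small[rotated]) simp
  have "n * n * (?L * ?L * ?L * ?L) \<le> K ^ 1 * K ^ 1 * (K ^ 2 * K ^ 2 * K ^ 2 * K ^ 2)"
    by (intro mult_le_mono L) (simp_all add: nm)
  then have "n * n * (?L * ?L * ?L * ?L) \<le> K ^ (1 + 1 + (2 + 2 + 2 + 2))" by (simp only: power_add)
  then have 4: "n * n * (?L * ?L * ?L * ?L) < W" by (rule small[rotated]) simp
  have "n * ?L \<le> K ^ 1 * K ^ 2" by (intro mult_le_mono L) (simp add: nm)
  then have nL: "n * ?L \<le> K ^ (1 + 2)" by (simp only: power_add)
  then have 5: "n * ?L < W" by (rule small[rotated]) simp
  have 6: "h * h * h * h * m < W" if "h \<le> n * ?L" for h
  proof -
    have h: "h \<le> K ^ (1 + 2)" using that nL by (rule le_trans)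
    have "h * h * h * h * m \<le> K ^ (1 + 2) * K ^ (1 + 2) * K ^ (1 + 2) * K ^ (1 + 2) * K ^ 1"
      by (intro mult_le_mono h) (simp add: nm)
    then have "h * h * h * h * m \<le> K ^ (1 + 2 + (1 + 2) + (1 + 2) + (1 + 2) + 1)" by (simp only: power_add)
    then show ?thesis by (rule small[rotated]) simp
  qed
  have 7: "2 ^ ?L < W" by (rule small[OF _ P]) simp
  have "n div par_h n m + 1 \<le> K ^ 1" using div_le_dividend[of n "par_h n m"] nm(3) unfolding power_one_right by linarith
  then have "par_N n m \<le> K ^ 1 * K ^ 2" unfolding par_N_def by (intro mult_le_mono L1)
  also have "\<dots> = K ^ (1 + 2)" by (simp only: power_add)
  also have "\<dots> \<le> K ^ 20" by (rule K_power_mono) simp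
  finally have 8: "par_N n m < IM" unfolding IM by linarith
  show ?thesis unfolding mach.large_def[OF M] mach.LB_def[OF M] using 1 2 3 4 5 6 7 8 by blast
qed

end

section \<open>Numbered digraphs and their cycles\<close>

lemma awalk_verts_cas: "pre_digraph.cas G u p v \<Longrightarrow> pre_digraph.awalk_verts G u p = u # map (head G) p"
  by (induction p arbitrary: u) (auto simp: pre_digraph.cas.simps pre_digraph.awalk_verts.simps)

lemma numbered_digraph_arc_graph: "numbered_digraph n m G \<Longrightarrow> arc_graph n m (tail G) (head G)"
  using wf_digraph.tail_in_verts[of G] wf_digraph.head_in_verts[of G]
  by unfold_locales (auto simp: numbered_digraph_def nomulti_digraph_def)

text \<open>Behind the start vertex, the vertices of a walk are the heads of its arcs, so both
  notions demand distinct heads.\<close>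

lemma cycle_iff_cyc:
  assumes G: "numbered_digraph n m G"
  shows "pre_digraph.cycle G p \<longleftrightarrow> arc_graph.cyc m (tail G) (head G) p"
proof -
  interpret arc_graph n m "tail G" "head G" by (rule numbered_digraph_arc_graph[OF G])
  have GG: "verts G = {..<n}" "arcs G = {..<m}" using G by (simp_all add: numbered_digraph_def)
  have walk_iff_cas: "walk u p v \<longleftrightarrow> pre_digraph.cas G u p v \<and> set p \<subseteq> {..<m}" for u v p
    by (induction p arbitrary: u) (auto simp: pre_digraph.cas.simps)
  have "pre_digraph.awalk G u p u \<and> distinct (tl (pre_digraph.awalk_verts G u p)) \<and> p \<noteq> [] \<longleftrightarrow>
      walk u p u \<and> distinct (map (head G) p) \<and> p \<noteq> []" for u
    using walk_ends[of u p u] awalk_verts_cas[of G u p u]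
    unfolding pre_digraph.awalk_def GG walk_iff_cas by auto
  then show ?thesis unfolding pre_digraph.cycle_def cyc_def closed_def by blast
qed

lemma numbered_digraph_inj:
  assumes "numbered_digraph n m G" shows "inj_on (\<lambda>e. (tail G e, head G e)) {..<m}"
  using assms nomulti_digraph.no_multi_arcs[of G]
  by (auto simp: numbered_digraph_def arc_to_ends_def inj_on_def)

lemma numbered_digraph_size:
  assumes G: "numbered_digraph n m G" shows "m \<le> n * n"
proof -
  interpret arc_graph n m "tail G" "head G" by (rule numbered_digraph_arc_graph[OF G])
  have "card {..<m} \<le> card ({..<n} \<times> {..<n})"
    by (rule card_inj_on_le[OF numbered_digraph_inj[OF G]]) (use src dst in auto)
  then show ?thesis by simp
qed

text \<open>Fix one optimal cycle. Either it has at most \<open>h\<close> arcs and every sample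
  succeeds, or the sample hits all its windows with probability at least 1/2.\<close>

lemma (in mrat) run_cyclic_prob:
  assumes off: "off = 2 * m" and st: "start \<sigma>" and mn: "0 < m" "0 < n" "m \<le> n * n" and lg: large
    and inj: "inj_on (\<lambda>e. (src e, dst e)) {..<m}"
  shows "\<exists>T. T \<le> main_time (10 * par_L n) (par_L n) (par_h n m) (par_N n m) +
      (1000 * (n * m + n + m + 1) + 40 * par_h n m + 30 * par_L n + 23 * par_N n m) \<and>
    (\<forall>s\<in>set_pmf (run W PROG T \<sigma>). halted PROG s \<and> cyc (result s)) \<and>
    1 / 2 \<le> measure_pmf.prob (run W PROG T \<sigma>) {s. cyc (result s) \<and> wt c (result s) = lam * wt t (result s)}"
proof -
  let ?h = "par_h n m" and ?R = "replicate_pmf (par_N n m) (pmf_of_set {..n - 1})"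
  obtain T H where T: "T \<le> main_time (10 * par_L n) (par_L n) ?h (par_N n m) +
      (1000 * (n * m + n + m + 1) + 40 * ?h + 30 * par_L n + 23 * par_N n m)"
    and run: "run W PROG T \<sigma> = map_pmf H ?R"
    and H: "\<And>xs. xs \<in> set_pmf ?R \<Longrightarrow> halted PROG (H xs) \<and> cyc (result (H xs)) \<and>
      (\<forall>r. cyc r \<longrightarrow> wt c r = lam * wt t r \<longrightarrow> length r \<le> ?h \<or> hits (set xs) ?h r \<longrightarrow>
        wt c (result (H xs)) = lam * wt t (result (H xs)))"
    using run_cyclic[OF assms] by blast
  obtain q where q: "cyc q" "wt c q = lam * wt t q" using lam_attained by blast
  let ?X = "{s. cyc (result s) \<and> wt c (result s) = lam * wt t (result s)}"
  define A where "A = {xs. length q \<le> ?h \<or> hits (set xs) ?h q}"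
  have "1 / 2 \<le> measure_pmf.prob ?R A"
  proof (cases "length q \<le> ?h")
    case True
    then have "A = UNIV" by (simp add: A_def)
    then show ?thesis by simp
  next
    case False
    then have h: "?h < length q" by simp
    have "A = {xs. \<forall>r<length q. \<exists>e\<in>set (take ?h (rotate r q)). dst e \<in> set xs}"
      using False by (simp add: A_def hits_def)
    then show ?thesis using prob_hits[OF q(1) _ h par_L(2)] par_h(1)[OF mn(1,2)] by (simp add: par_N_def)
  qed
  also have "\<dots> \<le> measure_pmf.prob ?R (H -` ?X)"
  proof (rule measure_pmf.finite_measure_mono_AE)
    show "AE xs in measure_pmf ?R. xs \<in> A \<longrightarrow> xs \<in> H -` ?X"
      unfolding AE_measure_pmf_iff using H q by (auto simp: A_def)
  qed simp
  finally have "1 / 2 \<le> measure_pmf.prob (run W PROG T \<sigma>) ?X" unfolding run measure_map_pmf .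
  moreover have "\<forall>s\<in>set_pmf (run W PROG T \<sigma>). halted PROG s \<and> cyc (result s)"
    unfolding run set_map_pmf using H by blast
  ultimately show ?thesis using T by blast
qed

lemma solves_numbered_digraph:
  assumes G: "numbered_digraph n m G" and pos: "\<And>q. pre_digraph.cycle G q \<Longrightarrow> (\<Sum>e\<leftarrow>q. t e) > 0"
  shows "\<exists>T. solves_min_ratio_cycle_within ((n + m + 2) ^ 30) PROG T n m G c t \<and>
    (n \<ge> 2 \<and> m \<ge> 1 \<longrightarrow> real T \<le> 10 ^ 9 * (real n powr (3/2) * real m powr (3/4) * (log 2 (real n))\<^sup>2))"
proof -
  define K W IM where "K = n + m + 2" and "W = K ^ 30" and "IM = K ^ 20 + 1"
  note defs = this
  define X where "X = real n powr (3/2) * real m powr (3/4) * (log 2 (real n))\<^sup>2"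
  have X0: "0 \<le> X" by (simp add: X_def)
  let ?small = "1000 * (n * m + n + m + 1) + 40 * par_h n m + 30 * par_L n + 23 * par_N n m"
  have mnn: "m \<le> n * n" by (rule numbered_digraph_size[OF G])
  interpret arc_graph n m "tail G" "head G" by (rule numbered_digraph_arc_graph[OF G])
  have M: "mach W (2 * m) IM n m (tail G) (head G)"
    by unfold_locales (use memory_fits[OF defs] in auto)
  interpret M: mach W "2 * m" IM n m "tail G" "head G" c t by (rule M)
  have st: "M.start (initial n m G c t)" by (simp add: M.start_def initial_def)
  have big: "0 < n \<and> M.large" if "0 < m"
  proof -
    have "0 < n" using mnn that by (cases n) auto
    then show ?thesis using memory_large[OF defs M] by blast
  qed
  have small: "real ?small \<le> 10 ^ 5 * X" if "2 \<le> n" "1 \<le> m"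
    unfolding X_def by (rule small_time_bound) (use that mnn in auto)
  note cycle = cycle_iff_cyc[OF G]
  have "\<exists>T. solves_min_ratio_cycle_within W PROG T n m G c t \<and> (n \<ge> 2 \<and> m \<ge> 1 \<longrightarrow> real T \<le> 10 ^ 9 * X)"
  proof (cases "\<exists>q. cyc q")
    case False
    then have no: "\<not> cyc q" for q by blast
    obtain T H and R :: "nat list pmf" where T: "0 < m \<longrightarrow> T \<le> ?small" and run: "run W PROG T (initial n m G c t) = map_pmf H R"
      and H: "\<forall>xs\<in>set_pmf R. halted PROG (H xs) \<and> wreg (H xs) 0 = 0"
      using M.run_acyclic[OF refl st big no] by blast
    have "solves_min_ratio_cycle_within W PROG T n m G c t"
      using H no by (auto simp: solves_min_ratio_cycle_within_def run cycle result_def)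
    moreover have "real T \<le> 10 ^ 9 * X" if "2 \<le> n" "1 \<le> m"
    proof -
      have "T \<le> ?small" using T that by simp
      then have "real T \<le> real ?small" by (rule of_nat_mono)
      also have "\<dots> \<le> 10 ^ 5 * X" by (rule small[OF that])
      also have "\<dots> \<le> 10 ^ 9 * X" by (rule mult_right_mono[OF _ X0]) simp
      finally show ?thesis .
    qed
    ultimately show ?thesis by blast
  next
    case True
    then obtain q where "cyc q" by blast
    then have "q \<noteq> []" "set q \<subseteq> {..<m}" using walk_set unfolding cyc_def closed_def by blast+
    then have m0: "0 < m" by (cases q) auto
    interpret R: mrat W "2 * m" IM n m "tail G" "head G" c t
      by unfold_locales (use True pos cycle in \<open>auto simp: wt_def\<close>)
    obtain T where T: "T \<le> R.main_time (10 * par_L n) (par_L n) (par_h n m) (par_N n m) + ?small"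
      and H: "\<forall>s\<in>set_pmf (run W PROG T (initial n m G c t)). halted PROG s \<and> cyc (result s)"
      and prob: "1 / 2 \<le> measure_pmf.prob (run W PROG T (initial n m G c t))
        {s. cyc (result s) \<and> wt c (result s) = R.lam * wt t (result s)}"
      using R.run_cyclic_prob[OF refl st m0 _ mnn _ numbered_digraph_inj[OF G]] big[OF m0] by blast
    have "min_ratio_cycle G c t q" if q: "cyc q" "wt c q = R.lam * wt t q" for q
    proof -
      have "cycle_ratio c t q = R.lam"
        using q R.cyc_pos[OF q(1)] by (simp add: cycle_ratio_def wt_def)
      moreover have "R.lam \<le> cycle_ratio c t r" if "cyc r" for r
        using R.cyc_lam[OF that] R.cyc_pos[OF that] by (simp add: cycle_ratio_def wt_def pos_le_divide_eq)
      ultimately show ?thesis using q(1) by (simp add: min_ratio_cycle_def cycle)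
    qed
    then have "{s. cyc (result s) \<and> wt c (result s) = R.lam * wt t (result s)} \<subseteq> {s. min_ratio_cycle G c t (result s)}" by blast
    then have "1 / 2 \<le> measure_pmf.prob (run W PROG T (initial n m G c t)) {s. min_ratio_cycle G c t (result s)}"
      by (rule order_trans[OF prob measure_pmf.finite_measure_mono]) simp
    then have "solves_min_ratio_cycle_within W PROG T n m G c t"
      using H True by (simp add: solves_min_ratio_cycle_within_def cycle Let_def)
    moreover have "real T \<le> 10 ^ 9 * X" if nm: "2 \<le> n" "1 \<le> m"
    proof -
      have "real T \<le> real (R.main_time (10 * par_L n) (par_L n) (par_h n m) (par_N n m)) + real ?small"
        using T unfolding of_nat_add[symmetric] by (rule of_nat_mono)
      also have "\<dots> \<le> 6 * 10 ^ 8 * X + 10 ^ 5 * X"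
        unfolding X_def by (intro add_mono R.main_time_bound small[OF nm, unfolded X_def]) (use nm mnn in auto)
      also have "\<dots> = (6 * 10 ^ 8 + 10 ^ 5) * X" by (rule distrib_right[symmetric])
      also have "\<dots> \<le> 10 ^ 9 * X" by (rule mult_right_mono[OF _ X0]) simp
      finally show ?thesis .
    qed
    ultimately show ?thesis by blast
  qed
  then show ?thesis unfolding X_def W_def K_def .
qed

theorem theorem18:
  shows "\<exists>(P :: program) (k :: nat) (C :: real).
    \<forall>(n :: nat) (m :: nat) (G :: (nat, nat) pre_digraph) (c :: nat \<Rightarrow> real) (t :: nat \<Rightarrow> real).
      numbered_digraph n m G \<longrightarrow>
      (\<forall>q. pre_digraph.cycle G q \<longrightarrow> (\<Sum>e\<leftarrow>q. t e) > 0) \<longrightarrow>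
      (\<exists>T. solves_min_ratio_cycle_within ((n + m + 2) ^ k) P T n m G c t \<and>
           (n \<ge> 2 \<and> m \<ge> 1 \<longrightarrow>
              real T \<le> C * (real n powr (3/2) * real m powr (3/4) * (log 2 (real n))\<^sup>2)))"
  using solves_numbered_digraph by blast

end
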